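(* Let $N\ge1$, let $Q$ be a real symmetric positive definite $N\times N$ matrix, let $B\neq0$ be a real $N\times N$ matrix, and let $T>0$ and $M>0$. Assume that $s>\frac12$ and that $\omega\subset\mathbb{R}^N$ is a thick set. Let $\mathcal{A}$ and $(\mathcal{T}(t))_{t\ge0}$ be the fractional Ornstein-Uhlenbeck operator and semigroup on $L^2(\mathbb{R}^N)$ defined in the context. Then there exist positive constants $C$, $C_1$ and $\delta$ depending on $(s,T,\omega,M)$, with $C_1\delta<1$, such that for all $u_0\in D(\mathcal{A})$ with $\|u_0\|_{D(\mathcal{A})}\le M$, the solution $u(t)=\mathcal{T}(t)u_0$ satisfies $$\|u_0\|_{L^2(\mathbb{R}^N)}\le\frac{-C}{\log\left(C_1\|u\|_{H^1(0,T;L^2(\omega))}\right)}$$ whenever $\|u\|_{H^1(0,T;L^2(\omega))}\le\delta$. (If this norm is $0$, the right-hand side is understood as $0$.)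
   Context: Equation: $\partial_tu=-\mathrm{tr}^s(-Q\nabla^2u)+Bx\cdot\nabla u$ on $(0,T)\times\mathbb{R}^N$, $u|_{t=0}=u_0$, where $\mathrm{tr}^s(-Q\nabla^2\cdot)$ is the Fourier multiplier with symbol $\langle Q\xi,\xi\rangle^s$ and $Bx\cdot\nabla u=\sum_{i,j}b_{ij}x_j\partial_{x_i}u$. The operator $\mathcal{A}=-\mathrm{tr}^s(-Q\nabla^2\cdot)+Bx\cdot\nabla\cdot$ with domain $D(\mathcal{A})=\{u\in L^2(\mathbb{R}^N):\mathcal{A}u\in L^2(\mathbb{R}^N)\}$, endowed with the graph norm $\|u\|_{D(\mathcal{A})}=\|u\|_{L^2(\mathbb{R}^N)}+\|\mathcal{A}u\|_{L^2(\mathbb{R}^N)}$, generates a $C_0$-semigroup $(\mathcal{T}(t))_{t\ge0}$ on $L^2(\mathbb{R}^N)$ (Lebesgue measure), given with $\widehat g(\xi)=\int_{\mathbb{R}^N}g(x)e^{-\mathrm{i}x\cdot\xi}dx$ by $$\widehat{\mathcal{T}(t)u_0}(\xi)=e^{-\mathrm{tr}(B)t}\exp\left[-\int_0^t\left|Q^{\frac12}e^{-\tau B^\top}\xi\right|^{2s}d\tau\right]\widehat{u_0}\left(e^{-tB^\top}\xi\right).$$ Norm of the observation: $\|u\|_{H^1(0,T;L^2(\omega))}^2=\int_0^T\left(\|u(t)\|_{L^2(\omega)}^2+\|\partial_tu(t)\|_{L^2(\omega)}^2\right)dt$. Thick set: a measurable set $\omega\subset\mathbb{R}^N$ is thick if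 there exist $\lambda\in(0,1]$ and $a=(a_1,\dots,a_N)$ with all $a_i>0$ such that $|\omega\cap(x+\mathcal{R})|\ge\lambda\prod_{j=1}^Na_j$ for all $x\in\mathbb{R}^N$, where $\mathcal{R}=[0,a_1]\times\dots\times[0,a_N]$ and $|\cdot|$ is Lebesgue measure. Known fact (observability): for $s>\frac12$ and $\omega$ thick, for every $T>0$ there is $\kappa_{s,T}>0$ with $\|\mathcal{T}(T)u_0\|_{L^2(\mathbb{R}^N)}^2\le\kappa_{s,T}^2\int_0^T\|\mathcal{T}(t)u_0\|_{L^2(\omega)}^2dt$ for all $u_0\in L^2(\mathbb{R}^N)$. The matrices $Q,B$ and the dimension $N$ are fixed, so dependence of the constants on them is allowed and not displayed. *)

theory Defs
  imports "HOL-Analysis.Analysis"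
begin

section \<open>\<open>L\<^sup>2\<close> spaces\<close>

text \<open>Functions are complex valued and are not identified when they agree almost everywhere;
  every notion below that is applied to them only depends on their class.\<close>

definition L2 :: "(real^'n) set \<Rightarrow> (real^'n \<Rightarrow> complex) set" where
  "L2 S = {f. set_borel_measurable lebesgue S f \<and>
              set_integrable lebesgue S (\<lambda>x. (norm (f x))\<^sup>2)}"

definition L2_norm_on :: "(real^'n) set \<Rightarrow> (real^'n \<Rightarrow> complex) \<Rightarrow> real" where
  "L2_norm_on S f = sqrt (LINT x:S|lebesgue. (norm (f x))\<^sup>2)"

text \<open>The nonnegative integral takes the value infinity where the Bochner integral would
  default to 0, so the convergence cannot hold for want of integrability.\<close>

definition tendsto_L2 ::
  "(real^'n) set \<Rightarrow> ('a \<Rightarrow> real^'n \<Rightarrow> complex) \<Rightarrow> (real^'n \<Rightarrow> complex) \<Rightarrow> 'a filter \<Rightarrow> bool" where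
  "tendsto_L2 S f g F \<longleftrightarrow>
     ((\<lambda>a. \<integral>\<^sup>+x\<in>S. ennreal ((norm (f a x - g x))\<^sup>2) \<partial>lebesgue) \<longlongrightarrow> 0) F"

section \<open>Fourier transform\<close>

definition fourier :: "(real^'n \<Rightarrow> complex) \<Rightarrow> real^'n \<Rightarrow> complex" where
  "fourier g \<xi> = (LINT x|lebesgue. g x * exp (- (\<i> * complex_of_real (x \<bullet> \<xi>))))"

text \<open>The Plancherel extension: the \<open>L\<^sup>2\<close> limit of the transforms of the truncations of \<open>f\<close>
  to balls, which are integrable. It is determined up to a null set.\<close>

definition fourier_L2 :: "(real^'n \<Rightarrow> complex) \<Rightarrow> real^'n \<Rightarrow> complex" where
  "fourier_L2 f = (SOME g. g \<in> L2 UNIV \<and>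
     tendsto_L2 UNIV (\<lambda>R. fourier (\<lambda>x. indicator (cball 0 R) x * f x)) g at_top)"

section \<open>Test functions\<close>

definition partial_deriv :: "'n \<Rightarrow> (real^'n \<Rightarrow> complex) \<Rightarrow> real^'n \<Rightarrow> complex" where
  "partial_deriv i f x = frechet_derivative f (at x) (axis i 1)"

primrec C_k :: "nat \<Rightarrow> (real^'n \<Rightarrow> complex) \<Rightarrow> bool" where
  "C_k 0 f \<longleftrightarrow> continuous_on UNIV f"
| "C_k (Suc k) f \<longleftrightarrow> f differentiable_on UNIV \<and> (\<forall>i. C_k k (partial_deriv i f))"

definition test_functions :: "(real^'n \<Rightarrow> complex) set" where
  "test_functions = {\<phi>. (\<forall>k. C_k k \<phi>) \<and> compact (closure {x. \<phi> x \<noteq> 0})}"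

section \<open>Matrices\<close>

definition symmetric_posdef :: "real^'n^'n \<Rightarrow> bool" where
  "symmetric_posdef Q \<longleftrightarrow> transpose Q = Q \<and> (\<forall>x. x \<noteq> 0 \<longrightarrow> 0 < (Q *v x) \<bullet> x)"

text \<open>The positive semidefinite square root, which exists and is unique for \<open>Q\<close> symmetric
  positive semidefinite.\<close>

definition matrix_sqrt :: "real^'n^'n \<Rightarrow> real^'n^'n" where
  "matrix_sqrt Q = (SOME R. transpose R = R \<and> (\<forall>x. 0 \<le> (R *v x) \<bullet> x) \<and> R ** R = Q)"

text \<open>Square matrices over \<open>real^'n\<close> do not form a normed algebra type, so the generic
  \<open>exp\<close> is not available for them.\<close>

definition matrix_exp :: "real^'n^'n \<Rightarrow> real^'n^'n" where
  "matrix_exp A = (\<Sum>k. (1 / fact k) *\<^sub>R (((\<lambda>X. A ** X) ^^ k) (mat 1)))"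

section \<open>The fractional Ornstein-Uhlenbeck operator and semigroup\<close>

text \<open>The distribution \<open>tr\<^sup>s(-Q\<nabla>\<^sup>2)u\<close> for \<open>u\<close> in \<open>L\<^sup>2\<close>, applied to a test function: the inverse
  Fourier transform of \<open>\<langle>Q\<xi>,\<xi>\<rangle>\<^sup>s\<close> times the transform of \<open>u\<close>, moved to the test function by
  duality (pairings are bilinear, without conjugation).\<close>

definition frac_diffusion ::
  "real^'n^'n \<Rightarrow> real \<Rightarrow> (real^'n \<Rightarrow> complex) \<Rightarrow> (real^'n \<Rightarrow> complex) \<Rightarrow> complex" where
  "frac_diffusion Q s u \<phi> =
     (LINT \<xi>|lebesgue. complex_of_real (((Q *v \<xi>) \<bullet> \<xi>) powr s) * fourier_L2 u \<xi>
        * fourier \<phi> (- \<xi>)) / complex_of_real ((2 * pi) ^ CARD('n))"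

text \<open>The distribution \<open>\<Sum> b\<^sub>i\<^sub>j x\<^sub>j \<partial>\<^sub>i u\<close>, applied to a test function.\<close>

definition drift ::
  "real^'n^'n \<Rightarrow> (real^'n \<Rightarrow> complex) \<Rightarrow> (real^'n \<Rightarrow> complex) \<Rightarrow> complex" where
  "drift B u \<phi> = (\<Sum>i\<in>UNIV. \<Sum>j\<in>UNIV. complex_of_real (B $ i $ j) *
     (- (LINT x|lebesgue. u x * partial_deriv i (\<lambda>y. complex_of_real (y $ j) * \<phi> y) x)))"

definition is_OU_image ::
  "real^'n^'n \<Rightarrow> real^'n^'n \<Rightarrow> real \<Rightarrow> (real^'n \<Rightarrow> complex) \<Rightarrow> (real^'n \<Rightarrow> complex) \<Rightarrow> bool" where
  "is_OU_image Q B s u f \<longleftrightarrow> f \<in> L2 UNIV \<and>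
     (\<forall>\<phi>\<in>test_functions.
        (LINT x|lebesgue. f x * \<phi> x) = - frac_diffusion Q s u \<phi> + drift B u \<phi>)"

definition OU_domain ::
  "real^'n^'n \<Rightarrow> real^'n^'n \<Rightarrow> real \<Rightarrow> (real^'n \<Rightarrow> complex) set" where
  "OU_domain Q B s = {u \<in> L2 UNIV. \<exists>f. is_OU_image Q B s u f}"

definition OU_op ::
  "real^'n^'n \<Rightarrow> real^'n^'n \<Rightarrow> real \<Rightarrow> (real^'n \<Rightarrow> complex) \<Rightarrow> real^'n \<Rightarrow> complex" where
  "OU_op Q B s u = (SOME f. is_OU_image Q B s u f)"

definition OU_graph_norm ::
  "real^'n^'n \<Rightarrow> real^'n^'n \<Rightarrow> real \<Rightarrow> (real^'n \<Rightarrow> complex) \<Rightarrow> real" where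
  "OU_graph_norm Q B s u = L2_norm_on UNIV u + L2_norm_on UNIV (OU_op Q B s u)"

definition OU_semigroup ::
  "real^'n^'n \<Rightarrow> real^'n^'n \<Rightarrow> real \<Rightarrow> real \<Rightarrow> (real^'n \<Rightarrow> complex) \<Rightarrow> real^'n \<Rightarrow> complex" where
  "OU_semigroup Q B s t u0 = (SOME v. v \<in> L2 UNIV \<and>
     (AE \<xi> in lebesgue. fourier_L2 v \<xi> =
        complex_of_real (exp (- trace B * t) *
          exp (- (LBINT \<tau>:{0..t}.
             norm (matrix_sqrt Q *v (matrix_exp (- \<tau> *\<^sub>R transpose B) *v \<xi>)) powr (2 * s))))
        * fourier_L2 u0 (matrix_exp (- t *\<^sub>R transpose B) *v \<xi>)))"

section \<open>The observation\<close>

text \<open>The time derivative of \<open>u\<close> is taken as a limit of difference quotients in \<open>L\<^sup>2(S)\<close>. For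
  initial data in the domain the orbit is \<open>C\<^sup>1\<close> with values in \<open>L\<^sup>2\<close>, so that this is also its
  weak derivative.\<close>

definition L2_time_deriv ::
  "(real^'n) set \<Rightarrow> (real \<Rightarrow> real^'n \<Rightarrow> complex) \<Rightarrow> real \<Rightarrow> real^'n \<Rightarrow> complex" where
  "L2_time_deriv S u t = (SOME v. v \<in> L2 S \<and>
     tendsto_L2 S (\<lambda>h x. (u (t + h) x - u t x) / complex_of_real h) v (at 0))"

definition H1_norm ::
  "real \<Rightarrow> (real^'n) set \<Rightarrow> (real \<Rightarrow> real^'n \<Rightarrow> complex) \<Rightarrow> real" where
  "H1_norm T S u = sqrt (LBINT t:{0<..<T}.
     (L2_norm_on S (u t))\<^sup>2 + (L2_norm_on S (L2_time_deriv S u t))\<^sup>2)"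

definition thick :: "(real^'n) set \<Rightarrow> bool" where
  "thick \<omega> \<longleftrightarrow> \<omega> \<in> sets lebesgue \<and>
     (\<exists>c>0. c \<le> 1 \<and> (\<exists>a::real^'n. (\<forall>i. 0 < a $ i) \<and>
        (\<forall>x. c * (\<Prod>i\<in>UNIV. a $ i) \<le> measure lebesgue (\<omega> \<inter> (+) x ` cbox 0 a))))"

end

theory Submission
 imports Defs "HOL-Probability.Probability"
begin

text \<open>On the Fourier side the semigroup is transport by a linear flow together with damping by
 \<open>exp (- c t |\<xi>|\<^sup>2\<^sup>s)\<close>. Conjugating test functions by the flow turns the weak definition of \<open>\<A>\<close> into an
 integrated transport equation for almost every frequency, and an integrating factor turns that into
 Duhamel's formula. Hence the orbit of \<open>u0\<close> is continuously differentiable, and the part of \<open>u0\<close> at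
 frequencies above \<open>K\<close> is at most \<open>C M / K\<^sup>2\<^sup>s\<close>. The part below \<open>K\<close> is at most \<open>exp (C K\<^sup>2\<^sup>s)\<close> times
 \<open>u(t)\<close>, \<open>T/2 \<le> t \<le> T\<close>. Up to an error \<open>exp (- c (A K)\<^sup>2\<^sup>s)\<close>, \<open>u(t)\<close> has frequencies below \<open>A K\<close> only, and
 such functions are observed from a thick set at the cost \<open>exp (C A K)\<close>. As \<open>2 s > 1\<close>, a large \<open>A\<close> makes
 the error negligible. With \<open>X = K\<^sup>2\<^sup>s\<close> and \<open>h\<close> the norm of the observation this gives
 \<open>|u0| \<le> C / X + C exp (C' X) h\<close> for all \<open>X \<ge> 1\<close>, and \<open>X\<close> is chosen proportional to \<open>- log h\<close>.\<close>

section \<open>Square integrable functions\<close>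

text \<open>The graph norm bounds \<open>\<A> u0\<close> as a whole, not diffusion and drift
  separately, so the tail of \<open>u0\<close> in frequency cannot be read off from it. Duhamel's
  formula gives it: if \<open>g\<close> and \<open>k\<close> are the transforms of \<open>u0\<close>
  and \<open>\<A> u0\<close>, then \<open>g\<close> is \<open>evo T g\<close> minus the integral of
  \<open>evo r k\<close> over \<open>[0, T]\<close>. Above frequency \<open>K\<close> the integrand
  is damped by \<open>exp (- c r K powr (2 s))\<close>, and integration in \<open>r\<close> leaves
  the gain \<open>1 / K powr (2 s)\<close>. The formula must be drawn from a weak definition. As the
  symbol grows, the equation for transforms is between functions that are square integrable only
  after division by a polynomial weight, and test transforms have to separate these. The operator,
  the semigroup and the derivative are choices by \<open>SOME\<close>. All estimates are made for
  Borel functions under \<open>lborel\<close>, and uniqueness up to null sets identifies the choices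
  at the end. The observed norm is a Bochner integral, which is \<open>0\<close> when the integrand
  is not integrable; a lower bound for it requires that the integrand, time derivative included, be
  identified with a continuous function of time.\<close>

definition sqi_on :: "'a measure \<Rightarrow> ('a \<Rightarrow> complex) \<Rightarrow> bool" where
 "sqi_on M f \<longleftrightarrow> f \<in> borel_measurable M \<and> integrable M (\<lambda>x. (cmod (f x))^2)"

definition nrm_on :: "'a measure \<Rightarrow> ('a \<Rightarrow> complex) \<Rightarrow> real" where
 "nrm_on M f = sqrt (LINT x|M. (cmod (f x))^2)"

abbreviation "sqi f \<equiv> sqi_on lborel f"
abbreviation "nrm f \<equiv> nrm_on lborel f"
abbreviation "cx \<equiv> complex_of_real"

abbreviation nn_lborel :: "('a::euclidean_space \<Rightarrow> ennreal) \<Rightarrow> ennreal" (binder "NN " 10)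
 where "nn_lborel f \<equiv> nn_integral lborel f"

lemma sqi_measurable [measurable_dest]: "sqi_on M f \<Longrightarrow> f \<in> borel_measurable M"
 by (simp add: sqi_on_def)

lemma sqi_integrable: "sqi_on M f \<Longrightarrow> integrable M (\<lambda>x. (cmod (f x))^2)"
 by (simp add: sqi_on_def)

lemma nrm_nonneg [simp]: "0 \<le> nrm_on M f"
 by (simp add: nrm_on_def)

lemma nrm_square: "(nrm_on M f)^2 = (LINT x|M. (cmod (f x))^2)"
 by (simp add: nrm_on_def)

lemma nn_integral_sqi:
 assumes "sqi_on M f"
 shows "(\<integral>\<^sup>+x. ennreal ((cmod (f x))^2) \<partial>M) = ennreal ((nrm_on M f)^2)"
 unfolding nrm_square by (rule nn_integral_eq_integral) (use assms in \<open>auto simp: sqi_on_def\<close>)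

lemma sqi_iff_nn_integral:
 "sqi_on M f \<longleftrightarrow> f \<in> borel_measurable M \<and> (\<integral>\<^sup>+x. ennreal ((cmod (f x))^2) \<partial>M) < \<infinity>"
 unfolding sqi_on_def by (auto simp: integrable_iff_bounded)

lemma sqi_dominated:
 assumes "sqi_on M g" "f \<in> borel_measurable M" "AE x in M. cmod (f x) \<le> cmod (g x)"
 shows "sqi_on M f"
proof -
 have "integrable M (\<lambda>x. (cmod (f x))^2)"
  by (rule Bochner_Integration.integrable_bound[OF sqi_integrable[OF assms(1)]])
    (use assms in \<open>auto intro!: power_mono\<close>)
 then show ?thesis using assms by (simp add: sqi_on_def)
qed

lemma nrm_mono:
 assumes "sqi_on M g" "f \<in> borel_measurable M" "AE x in M. cmod (f x) \<le> cmod (g x)"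
 shows "nrm_on M f \<le> nrm_on M g"
 unfolding nrm_on_def using assms sqi_dominated[OF assms]
 by (intro real_sqrt_le_mono integral_mono_AE sqi_integrable) (auto intro!: power_mono)

lemma sqi_add:
 assumes "sqi_on M f" "sqi_on M g"
 shows "sqi_on M (\<lambda>x. f x + g x)"
proof -
 have "integrable M (\<lambda>x. 2 * (cmod (f x))^2 + 2 * (cmod (g x))^2)"
  using assms by (auto simp: sqi_on_def)
 then have "integrable M (\<lambda>x. (cmod (f x + g x))^2)"
 proof (rule Bochner_Integration.integrable_bound)
  show "(\<lambda>x. (cmod (f x + g x))^2) \<in> borel_measurable M"
   using assms by (auto simp: sqi_on_def)
  have "(cmod (f x + g x))^2 \<le> 2 * (cmod (f x))^2 + 2 * (cmod (g x))^2" for x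
  proof -
   have "(cmod (f x + g x))^2 \<le> (cmod (f x) + cmod (g x))^2"
    by (intro power_mono norm_triangle_ineq) auto
   also have "\<dots> \<le> 2 * (cmod (f x))^2 + 2 * (cmod (g x))^2"
    using sum_squares_bound[of "cmod (f x)" "cmod (g x)"] by (simp add: power2_sum)
   finally show ?thesis .
  qed
  from order_trans[OF this abs_ge_self]
  show "AE x in M. norm ((cmod (f x + g x))^2) \<le> norm (2 * (cmod (f x))^2 + 2 * (cmod (g x))^2)"
   by (intro AE_I2) (simp only: real_norm_def abs_power2)
 qed
 then show ?thesis using assms by (auto simp: sqi_on_def)
qed

lemma sqi_scale: "sqi_on M f \<Longrightarrow> sqi_on M (\<lambda>x. c * f x)"
 by (auto simp: sqi_on_def norm_mult power_mult_distrib)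

lemma sqi_uminus: "sqi_on M f \<Longrightarrow> sqi_on M (\<lambda>x. - f x)"
 using sqi_scale[of M f "-1"] by simp

lemma sqi_diff: "sqi_on M f \<Longrightarrow> sqi_on M g \<Longrightarrow> sqi_on M (\<lambda>x. f x - g x)"
 using sqi_add[of M f "\<lambda>x. - g x"] sqi_uminus[of M g] by simp

lemma sqi_zero [simp]: "sqi_on M (\<lambda>x. 0)"
 by (simp add: sqi_on_def)

lemma borel_measurable_cnj [measurable]:
 "f \<in> borel_measurable M \<Longrightarrow> (\<lambda>x. cnj (f x)) \<in> borel_measurable M"
 by (rule borel_measurable_continuous_on[where f = cnj, OF linear_continuous_on[OF bounded_linear_cnj]])

lemma sqi_cnj: "sqi_on M f \<Longrightarrow> sqi_on M (\<lambda>x. cnj (f x))"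
 by (auto simp: sqi_on_def)

lemma nrm_cnj [simp]: "nrm_on M (\<lambda>x. cnj (f x)) = nrm_on M f"
 by (simp add: nrm_on_def)

lemma nrm_scale: "nrm_on M (\<lambda>x. c * f x) = cmod c * nrm_on M f"
 by (simp add: nrm_on_def norm_mult power_mult_distrib real_sqrt_mult)

lemma nrm_uminus [simp]: "nrm_on M (\<lambda>x. - f x) = nrm_on M f"
 by (simp add: nrm_on_def)

lemma nrm_minus_commute: "nrm_on M (\<lambda>x. f x - g x) = nrm_on M (\<lambda>x. g x - f x)"
 by (simp add: nrm_on_def norm_minus_commute)

lemma sqi_indicator: "sqi_on M f \<Longrightarrow> A \<in> sets M \<Longrightarrow> sqi_on M (\<lambda>x. indicator A x * f x)"
 by (rule sqi_dominated[of M f]) (auto simp: indicator_def)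

lemma sqi_cong_AE:
 assumes "sqi_on M f" "g \<in> borel_measurable M" "AE x in M. f x = g x"
 shows "sqi_on M g"
 by (rule sqi_dominated[of M f]) (use assms in auto)

lemma nrm_cong_AE:
 assumes "f \<in> borel_measurable M" "g \<in> borel_measurable M" "AE x in M. f x = g x"
 shows "nrm_on M f = nrm_on M g"
 unfolding nrm_on_def using assms by (intro arg_cong[where f = sqrt] integral_cong_AE) auto

lemma integrable_mult_sqi:
 assumes "sqi_on M f" "sqi_on M g"
 shows "integrable M (\<lambda>x. f x * g x)"
proof -
 have "integrable M (\<lambda>x. (cmod (f x))^2 + (cmod (g x))^2)"
  using assms by (auto simp: sqi_on_def)
 then show ?thesis
 proof (rule Bochner_Integration.integrable_bound)
  show "(\<lambda>x. f x * g x) \<in> borel_measurable M"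
   using assms by (auto simp: sqi_on_def)
  have "cmod (f x) * cmod (g x) \<le> (cmod (f x))^2 + (cmod (g x))^2" for x
   using sum_squares_bound[of "cmod (f x)" "cmod (g x)"]
    mult_nonneg_nonneg[OF norm_ge_zero norm_ge_zero, of "f x" "g x"] by linarith
  from order_trans[OF this abs_ge_self]
  show "AE x in M. norm (f x * g x) \<le> norm ((cmod (f x))^2 + (cmod (g x))^2)"
   by (intro AE_I2) (simp only: real_norm_def norm_mult)
 qed
qed

lemma Cauchy_Schwarz_nrm:
 assumes "sqi_on M f" "sqi_on M g"
 shows "(LINT x|M. cmod (f x) * cmod (g x)) \<le> nrm_on M f * nrm_on M g"
proof -
 have int: "integrable M (\<lambda>x. cmod (f x) * cmod (g x))"
  using integrable_norm[OF integrable_mult_sqi[OF assms]] by (simp add: norm_mult)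
 have meas: "f \<in> borel_measurable M" "g \<in> borel_measurable M"
  using assms by (auto simp: sqi_on_def)
 have "(\<integral>\<^sup>+x. ennreal (cmod (f x)) * ennreal (cmod (g x)) \<partial>M)^2
   \<le> (\<integral>\<^sup>+x. (ennreal (cmod (f x)))^2 \<partial>M) * (\<integral>\<^sup>+x. (ennreal (cmod (g x)))^2 \<partial>M)"
  using meas by (intro Cauchy_Schwarz_nn_integral) auto
 also have "\<dots> = ennreal ((nrm_on M f * nrm_on M g)^2)"
  using assms by (simp add: ennreal_power nn_integral_sqi ennreal_mult power_mult_distrib)
 also have "(\<integral>\<^sup>+x. ennreal (cmod (f x)) * ennreal (cmod (g x)) \<partial>M)
   = ennreal (LINT x|M. cmod (f x) * cmod (g x))"
  using int by (subst nn_integral_eq_integral[symmetric]) (auto simp: ennreal_mult)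
 finally have "(LINT x|M. cmod (f x) * cmod (g x))^2 \<le> (nrm_on M f * nrm_on M g)^2"
  by (simp add: ennreal_power)
 then show ?thesis
  by (rule power2_le_imp_le) simp
qed

lemma norm_integral_mult_le:
 assumes "sqi_on M f" "sqi_on M g"
 shows "cmod (LINT x|M. f x * g x) \<le> nrm_on M f * nrm_on M g"
 using order_trans[OF integral_norm_bound Cauchy_Schwarz_nrm[OF assms, unfolded norm_mult[symmetric]]] .

lemma nrm_triangle:
 assumes "sqi_on M f" "sqi_on M g"
 shows "nrm_on M (\<lambda>x. f x + g x) \<le> nrm_on M f + nrm_on M g"
proof -
 have int: "integrable M (\<lambda>x. cmod (f x) * cmod (g x))"
  using integrable_norm[OF integrable_mult_sqi[OF assms]] by (simp add: norm_mult)
 have ints: "integrable M (\<lambda>x. (cmod (f x))^2)" "integrable M (\<lambda>x. (cmod (g x))^2)"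
  using assms by (auto simp: sqi_on_def)
 have "(LINT x|M. (cmod (f x + g x))^2)
   \<le> (LINT x|M. (cmod (f x))^2 + 2 * (cmod (f x) * cmod (g x)) + (cmod (g x))^2)"
 proof (rule integral_mono)
  show "integrable M (\<lambda>x. (cmod (f x + g x))^2)"
   using sqi_add[OF assms] by (simp add: sqi_on_def)
  show "integrable M (\<lambda>x. (cmod (f x))^2 + 2 * (cmod (f x) * cmod (g x)) + (cmod (g x))^2)"
   using int ints by auto
  show "(cmod (f x + g x))^2 \<le> (cmod (f x))^2 + 2 * (cmod (f x) * cmod (g x)) + (cmod (g x))^2" for x
   using power_mono[OF norm_triangle_ineq[of "f x" "g x"], of 2] by (simp add: power2_sum algebra_simps)
 qed
 also have "\<dots> = (nrm_on M f)^2 + 2 * (LINT x|M. cmod (f x) * cmod (g x)) + (nrm_on M g)^2"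
  using int ints by (simp add: nrm_square)
 also have "\<dots> \<le> (nrm_on M f)^2 + 2 * (nrm_on M f * nrm_on M g) + (nrm_on M g)^2"
  using Cauchy_Schwarz_nrm[OF assms] by simp
 also have "\<dots> = (nrm_on M f + nrm_on M g)^2"
  by (simp add: power2_sum algebra_simps)
 finally show ?thesis
  unfolding nrm_square[symmetric] by (rule power2_le_imp_le) simp
qed

lemma nrm_triangle_sub:
 assumes "sqi_on M f" "sqi_on M g"
 shows "nrm_on M f \<le> nrm_on M g + nrm_on M (\<lambda>x. f x - g x)"
 using nrm_triangle[OF assms(2) sqi_diff[OF assms]] by simp

lemma nrm_diff_triangle:
 assumes "sqi_on M f" "sqi_on M g" "sqi_on M h"
 shows "nrm_on M (\<lambda>x. f x - h x) \<le> nrm_on M (\<lambda>x. f x - g x) + nrm_on M (\<lambda>x. g x - h x)"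
 using nrm_triangle[OF sqi_diff[OF assms(1,2)] sqi_diff[OF assms(2,3)]] by simp

lemma nrm_abs_diff:
 assumes "sqi_on M f" "sqi_on M g"
 shows "\<bar>nrm_on M f - nrm_on M g\<bar> \<le> nrm_on M (\<lambda>x. f x - g x)"
 using nrm_triangle_sub[OF assms] nrm_triangle_sub[OF assms(2,1)] nrm_minus_commute[of M f g] by linarith

lemma nrm_eq_0:
 assumes "sqi_on M f"
 shows "nrm_on M f = 0 \<longleftrightarrow> (AE x in M. f x = 0)"
 using integral_nonneg_eq_0_iff_AE[OF sqi_integrable[OF assms]] by (simp add: nrm_on_def)

text \<open>Fatou's lemma for the squares. The limit is not assumed square integrable: this is part
  of what is obtained. The bound is asked for large indices only, as a Cauchy sequence provides
  it.\<close>

lemma nrm_le_liminf: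
 assumes sq: "\<And>k. sqi_on M (h k)" and g: "g \<in> borel_measurable M"
  and ae: "AE x in M. (\<lambda>k. h k x) \<longlonglongrightarrow> g x" and bd: "\<And>k. k \<ge> K \<Longrightarrow> nrm_on M (h k) \<le> e"
 shows "sqi_on M g" "nrm_on M g \<le> e"
proof -
 have e0: "0 \<le> e" using bd[of K] nrm_nonneg[of M "h K"] by linarith
 have meas [measurable]: "h k \<in> borel_measurable M" for k using sq[of k] by (simp add: sqi_on_def)
 note g [measurable]
 have "(\<integral>\<^sup>+x. ennreal ((cmod (g x))^2) \<partial>M) = (\<integral>\<^sup>+x. liminf (\<lambda>k. ennreal ((cmod (h k x))^2)) \<partial>M)"
 proof (rule nn_integral_cong_AE, use ae in eventually_elim)
  fix x assume "(\<lambda>k. h k x) \<longlonglongrightarrow> g x"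
  then have "(\<lambda>k. ennreal ((cmod (h k x))^2)) \<longlonglongrightarrow> ennreal ((cmod (g x))^2)"
   by (intro tendsto_intros tendsto_ennrealI)
  then show "ennreal ((cmod (g x))^2) = liminf (\<lambda>k. ennreal ((cmod (h k x))^2))"
   by (metis lim_imp_Liminf trivial_limit_sequentially)
 qed
 also have "\<dots> \<le> liminf (\<lambda>k. \<integral>\<^sup>+x. ennreal ((cmod (h k x))^2) \<partial>M)"
  by (intro nn_integral_liminf) auto
 also have "\<dots> \<le> ennreal (e^2)"
 proof -
  have "\<forall>\<^sub>F k in sequentially. (\<integral>\<^sup>+x. ennreal ((cmod (h k x))^2) \<partial>M) \<le> ennreal (e^2)"
   using eventually_ge_at_top[of K]
   by eventually_elim (auto simp: nn_integral_sqi[OF sq] intro!: ennreal_leI power_mono bd)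
  then show ?thesis
   by (intro Liminf_le) auto
 qed
 finally have *: "(\<integral>\<^sup>+x. ennreal ((cmod (g x))^2) \<partial>M) \<le> ennreal (e^2)" .
 show s: "sqi_on M g"
  unfolding sqi_iff_nn_integral using * g
  using le_less_trans[OF * ennreal_less_top] by simp
 show "nrm_on M g \<le> e"
  using * unfolding nn_integral_sqi[OF s] using e0 by (simp add: power2_le_iff_abs_le)
qed

text \<open>Riesz-Fischer. Along a fast subsequence the increments have norm at most
  \<open>(1/4)^k\<close>, so the integrals of \<open>4^k * |d k|^2\<close> are summable; almost
  everywhere this bounds \<open>|d k x|\<close> by a multiple of \<open>(1/2)^k\<close>, and the
  subsequence converges. \<open>nrm_le_liminf\<close> turns pointwise convergence into convergence
  in norm of the whole sequence.\<close>

lemma sqi_complete: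
 assumes sq: "\<And>n. sqi_on M (f n)"
  and cau: "\<And>e. e > 0 \<Longrightarrow> \<exists>N. \<forall>m\<ge>N. \<forall>n\<ge>N. nrm_on M (\<lambda>x. f m x - f n x) < e"
 obtains g where "sqi_on M g" "(\<lambda>n. nrm_on M (\<lambda>x. f n x - g x)) \<longlonglongrightarrow> 0"
proof -
 have meas [measurable]: "f k \<in> borel_measurable M" for k using sq[of k] by (simp add: sqi_on_def)
 obtain N where N: "\<And>e m n. e > 0 \<Longrightarrow> m \<ge> N e \<Longrightarrow> n \<ge> N e \<Longrightarrow> nrm_on M (\<lambda>x. f m x - f n x) < e"
  using cau by metis
 \<comment> \<open>The sum makes \<open>r\<close> monotone, so that \<open>r k\<close> and
   \<open>r (Suc k)\<close> both reach the threshold for \<open>(1/4)^k\<close>; the summand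
   \<open>k\<close> makes \<open>r\<close> tend to infinity.\<close>
 define r where "r k = (\<Sum>j\<le>k. N ((1/4)^j)) + k" for k :: nat
 have rk: "r k \<ge> N ((1/4)^k)" "r (Suc k) \<ge> r k" "r k \<ge> k" for k
  by (auto simp: r_def intro: trans_le_add1 member_le_sum)
 have rN: "r (Suc k) \<ge> N ((1/4)^k)" for k using rk(1,2) le_trans by blast
 define d where "d k x = f (r (Suc k)) x - f (r k) x" for k x
 have d_sq: "sqi_on M (d k)" for k unfolding d_def by (intro sqi_diff sq)
 have [measurable]: "d k \<in> borel_measurable M" for k using d_sq[of k] by (simp add: sqi_on_def)
 have d_nrm: "nrm_on M (d k) \<le> (1/4)^k" for k
 proof -
  have "nrm_on M (\<lambda>x. f (r (Suc k)) x - f (r k) x) < (1/4)^k"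
   by (rule N[OF _ rN[of k] rk(1)[of k]]) simp
  moreover have "d k = (\<lambda>x. f (r (Suc k)) x - f (r k) x)"
   by (rule ext) (rule d_def)
  ultimately show ?thesis by (metis less_imp_le)
 qed
 have "(\<integral>\<^sup>+x. (\<Sum>k. ennreal (4^k * (cmod (d k x))^2)) \<partial>M)
   = (\<Sum>k. \<integral>\<^sup>+x. ennreal (4^k * (cmod (d k x))^2) \<partial>M)"
  by (rule nn_integral_suminf) auto
 also have "\<dots> \<le> (\<Sum>k. ennreal ((1/4)^k))"
 proof (rule suminf_le)
  fix k
  have "(\<integral>\<^sup>+x. ennreal (4^k * (cmod (d k x))^2) \<partial>M) = ennreal (4^k) * ennreal ((nrm_on M (d k))^2)"
   by (simp add: ennreal_mult nn_integral_cmult nn_integral_sqi[OF d_sq])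
  also have "\<dots> = ennreal (4^k * (nrm_on M (d k))^2)"
   by (simp add: ennreal_mult)
  also have "\<dots> \<le> ennreal (4^k * ((1/4)^k)^2)"
   by (intro ennreal_leI mult_left_mono power_mono d_nrm) auto
  also have "4^k * ((1/4)^k)^2 = ((1/4)^k :: real)"
   by (simp add: power2_eq_square power_divide)
  finally show "(\<integral>\<^sup>+x. ennreal (4^k * (cmod (d k x))^2) \<partial>M) \<le> ennreal ((1/4)^k)" .
 qed auto
 also have "\<dots> < \<infinity>"
  by (subst suminf_ennreal2) (auto intro!: summable_geometric)
 finally have "(\<integral>\<^sup>+x. (\<Sum>k. ennreal (4^k * (cmod (d k x))^2)) \<partial>M) \<noteq> \<infinity>" by simp
 then have "AE x in M. (\<Sum>k. ennreal (4^k * (cmod (d k x))^2)) \<noteq> \<infinity>"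
  by (intro nn_integral_PInf_AE) auto
 then have conv: "AE x in M. convergent (\<lambda>k. f (r k) x)"
 proof eventually_elim
  case (elim x)
  define S where "S = enn2real (\<Sum>k. ennreal (4^k * (cmod (d k x))^2))"
  have bound: "cmod (d k x) \<le> sqrt S * (1/2)^k" for k
  proof -
   define a where "a k = 4^k * (cmod (d k x))^2" for k
   have a0: "0 \<le> a k" for k by (simp add: a_def)
   have fin: "(\<Sum>k. ennreal (a k)) < top"
    using elim unfolding a_def by (simp only: less_top infinity_ennreal_def)
   have "ennreal (a k) \<le> (\<Sum>k. ennreal (a k))"
    using sum_le_suminf[OF summableI, of "{k}" "\<lambda>k. ennreal (a k)"] by auto
   also have "\<dots> = ennreal S"
    unfolding S_def a_def[symmetric] by (rule ennreal_enn2real[OF fin, symmetric])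
   finally have "a k \<le> S"
    by (subst (asm) ennreal_le_iff) (simp_all add: S_def)
   then have "4^k * (cmod (d k x))^2 \<le> S"
    by (simp add: a_def)
   moreover have "(2^k)^2 = (4^k :: real)"
    by (simp add: power2_eq_square flip: power_mult_distrib)
   ultimately have "(2^k * cmod (d k x))^2 \<le> S"
    by (simp only: power_mult_distrib)
   then have "2^k * cmod (d k x) \<le> sqrt S"
    by (rule real_le_rsqrt)
   then show ?thesis by (simp add: field_simps power_divide)
  qed
  have "summable (\<lambda>k. d k x)"
   by (rule summable_comparison_test[where g = "\<lambda>k. sqrt S * (1/2)^k"])
     (auto intro!: exI[of _ 0] bound summable_mult summable_geometric)
  then have "convergent (\<lambda>n. (\<Sum>k<n. d k x) + f (r 0) x)"
   by (intro convergent_add convergent_const) (simp add: summable_iff_convergent)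
  moreover have "(\<Sum>k<n. d k x) + f (r 0) x = f (r n) x" for n
   by (simp add: d_def sum_lessThan_telescope[of "\<lambda>k. f (r k) x"])
  ultimately show ?case by simp
 qed
 define g where "g x = lim (\<lambda>k. f (r k) x)" for x
 have g [measurable]: "g \<in> borel_measurable M" unfolding g_def by measurable
 have lim: "AE x in M. (\<lambda>k. f (r k) x) \<longlonglongrightarrow> g x"
  using conv by eventually_elim (simp add: g_def convergent_LIMSEQ_iff)
 have main: "sqi_on M (\<lambda>x. f n x - g x) \<and> nrm_on M (\<lambda>x. f n x - g x) \<le> e" if "e > 0" "n \<ge> N e" for n e
 proof -
  have 1: "AE x in M. (\<lambda>k. f n x - f (r k) x) \<longlonglongrightarrow> f n x - g x"
   using lim by eventually_elim (auto intro!: tendsto_intros)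
  have 2: "nrm_on M (\<lambda>x. f n x - f (r k) x) \<le> e" if "k \<ge> N e" for k
   using N[OF \<open>e > 0\<close> \<open>n \<ge> N e\<close>, of "r k"] that rk(3)[of k] by auto
  show ?thesis
   using nrm_le_liminf[of M "\<lambda>k x. f n x - f (r k) x", OF sqi_diff[OF sq sq] _ 1 2] by auto
 qed
 have gs: "sqi_on M g"
  using sqi_diff[OF sq[of "N 1"] conjunct1[OF main[of 1 "N 1"]]] by simp
 have "(\<lambda>n. nrm_on M (\<lambda>x. f n x - g x)) \<longlonglongrightarrow> 0"
 proof (rule LIMSEQ_I)
  fix e :: real assume "e > 0"
  then show "\<exists>n0. \<forall>n\<ge>n0. norm (nrm_on M (\<lambda>x. f n x - g x) - 0) < e"
   using main[of "e/2"] by (intro exI[of _ "N (e/2)"]) force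
 qed
 with gs show ?thesis by (rule that)
qed

section \<open>Density of continuous functions of compact support\<close>

definition Cc :: "('a::euclidean_space \<Rightarrow> complex) \<Rightarrow> bool" where
 "Cc g \<longleftrightarrow> continuous_on UNIV g \<and> (\<exists>R. \<forall>x. R < norm x \<longrightarrow> g x = 0)"

lemma Cc_continuous: "Cc g \<Longrightarrow> continuous_on UNIV g"
 by (simp add: Cc_def)

lemma Cc_borel [measurable_dest]: "Cc g \<Longrightarrow> g \<in> borel_measurable borel"
 by (simp add: Cc_def borel_measurable_continuous_onI)

lemma Cc_bounded:
 assumes "Cc g"
 obtains B R where "0 < B" "0 < R" "\<And>x. cmod (g x) \<le> B * indicator (cball 0 R) x"
proof -
 obtain R where R: "\<And>x. R < norm x \<Longrightarrow> g x = 0" using assms by (auto simp: Cc_def)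
 have "compact (g ` cball 0 (max R 1))"
  using assms by (intro compact_continuous_image) (auto simp: Cc_def intro: continuous_on_subset)
 from compact_imp_bounded[OF this] obtain B where "\<forall>y\<in>g ` cball 0 (max R 1). cmod y \<le> B"
  unfolding bounded_iff by (elim exE)
 then have B: "cmod (g x) \<le> B" if "x \<in> cball 0 (max R 1)" for x using that by blast
 show ?thesis
 proof (rule that[of "max B 1" "max R 1"])
  show "cmod (g x) \<le> max B 1 * indicator (cball 0 (max R 1)) x" for x
  proof (cases "x \<in> cball 0 (max R 1)")
   case True then show ?thesis using B[OF True] by (auto simp: indicator_def)
  next
   case False then show ?thesis using R[of x] by (auto simp: indicator_def)
  qed
 qed auto
qed

lemma integrable_indicator_cball: "integrable lborel (indicator (cball (a::'a::euclidean_space) R) :: 'a \<Rightarrow> real)"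
 using emeasure_lborel_cball_finite[of a R] by (intro integrable_real_indicator) auto

lemma integrable_bounded_support:
 fixes g :: "'a::euclidean_space \<Rightarrow> 'b::{banach, second_countable_topology}"
 assumes "g \<in> borel_measurable borel" "\<And>x. norm (g x) \<le> B * indicator (cball 0 R) x"
 shows "integrable lborel g"
proof (rule Bochner_Integration.integrable_bound)
 show "integrable lborel (\<lambda>x::'a. B * indicator (cball 0 R) x :: real)"
  by (intro integrable_mult_right integrable_indicator_cball)
 show "AE x in lborel. norm (g x) \<le> norm (B * indicator (cball 0 R) x :: real)"
  using assms(2) by (intro AE_I2) (metis abs_ge_self order_trans real_norm_def)
qed (use assms in auto)

lemma Cc_integrable:
 assumes "Cc g" shows "integrable lborel g"
 by (rule Cc_bounded[OF assms]) (rule integrable_bounded_support, use assms in auto)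

lemma Cc_mult:
 assumes "Cc g" "continuous_on UNIV h"
 shows "Cc (\<lambda>x. h x * g x)"
proof -
 obtain R where "\<And>x. R < norm x \<Longrightarrow> g x = 0" using assms(1) by (auto simp: Cc_def)
 then have "\<forall>x. R < norm x \<longrightarrow> h x * g x = 0" by simp
 with assms show ?thesis unfolding Cc_def by (intro conjI continuous_on_mult) auto
qed

lemma Cc_square: "Cc g \<Longrightarrow> Cc (\<lambda>x. cx ((cmod (g x))^2))"
 unfolding Cc_def by (auto intro!: continuous_intros)

lemma Cc_sqi:
 assumes "Cc g" shows "sqi g"
proof -
 have "integrable lborel (\<lambda>x. Re (cx ((cmod (g x))^2)))"
  by (rule integrable_Re[OF Cc_integrable[OF Cc_square[OF assms]]])
 then show ?thesis using assms by (auto simp: sqi_on_def simp del: of_real_power)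
qed

lemma Cc_add: "Cc f \<Longrightarrow> Cc g \<Longrightarrow> Cc (\<lambda>x. f x + g x)"
proof -
 assume a: "Cc f" "Cc g"
 then obtain R S where "\<And>x. R < norm x \<Longrightarrow> f x = 0" "\<And>x. S < norm x \<Longrightarrow> g x = 0"
  by (auto simp: Cc_def)
 then have "\<forall>x. max R S < norm x \<longrightarrow> f x + g x = 0" by simp
 with a show ?thesis unfolding Cc_def by (blast intro: continuous_intros)
qed

definition cutoff :: "real \<Rightarrow> 'a::real_normed_vector \<Rightarrow> real" where
 "cutoff n x = max 0 (min 1 (n + 1 - norm x))"

lemma cutoff: "continuous_on UNIV (cutoff n)" "0 \<le> cutoff n x" "cutoff n x \<le> 1"
  "norm x \<le> n \<Longrightarrow> cutoff n x = 1" "n + 1 < norm x \<Longrightarrow> cutoff n x = 0"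
 by (auto simp: cutoff_def[abs_def] intro!: continuous_intros)

lemma Cc_cutoff:
 assumes "continuous_on UNIV g" shows "Cc (\<lambda>x. cx (cutoff n x) * g x)"
 unfolding Cc_def using assms cutoff(1) cutoff(5)
 by (auto intro!: continuous_intros exI[of _ "n + 1"])

text \<open>Regularity of Lebesgue measure encloses \<open>A\<close> between a closed
  \<open>T\<close> and an open \<open>U\<close> with \<open>U - T\<close> small, and a Urysohn
  function for this pair differs from the indicator of \<open>A\<close> on \<open>U - T\<close>
  only. It need not have compact support, hence the multiplication by \<open>cutoff\<close> and the
  passage to the limit.\<close>

lemma Cc_dense_indicator:
 fixes A :: "'a::euclidean_space set"
 assumes A: "A \<in> sets borel" "emeasure lborel A < \<infinity>" and e: "e > 0"
 shows "\<exists>g. Cc g \<and> (LBINT x. cmod (indicator A x *\<^sub>R c - g x)) < e"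
proof -
 define d where "d = e / (2 * (cmod c + 1))"
 have d: "d > 0" using e by (auto simp: d_def intro!: divide_pos_pos add_nonneg_pos)
 have Al: "A \<in> sets lebesgue" using A(1) by auto
 obtain U where U: "open U" "A \<subseteq> U" "emeasure lebesgue (U - A) < ennreal (d/2)"
  using sets_lebesgue_outer_open[OF Al half_gt_zero[OF d]] by metis
 obtain T where T: "closed T" "T \<subseteq> A" "emeasure lebesgue (A - T) < ennreal (d/2)"
  using sets_lebesgue_inner_closed[OF Al half_gt_zero[OF d]] by metis
 have [measurable]: "U \<in> sets borel" "T \<in> sets borel" "A \<in> sets borel" using U T A by auto
 have UA: "emeasure lborel (U - A) < ennreal (d/2)" and AT: "emeasure lborel (A - T) < ennreal (d/2)"
  using U(3) T(3) by auto
 have "emeasure lborel (U - T) \<le> emeasure lborel ((U - A) \<union> (A - T))"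
  by (rule emeasure_mono) auto
 also have "\<dots> \<le> emeasure lborel (U - A) + emeasure lborel (A - T)"
  by (rule emeasure_subadditive) auto
 also have "\<dots> < ennreal (d/2) + ennreal (d/2)" using UA AT by (rule add_strict_mono)
 also have "\<dots> = ennreal d" using d by (simp flip: ennreal_plus)
 finally have UT: "emeasure lborel (U - T) < ennreal d" .
 have "emeasure lborel U \<le> emeasure lborel (U - A) + emeasure lborel A"
 proof -
  have "U - A \<union> A = U" using U(2) by blast
  then show ?thesis using emeasure_subadditive[of "U - A" lborel A] by (simp del: Un_Diff_cancel2)
 qed
 also have "\<dots> < \<infinity>" using order_less_trans[OF UA ennreal_less_top] A(2) by simp
 finally have Ufin: "emeasure lborel U < \<infinity>" .
 obtain p :: "'a \<Rightarrow> real" where p: "continuous_on UNIV p" "\<And>x. p x \<in> closed_segment 1 0"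
   "\<And>x. x \<in> T \<Longrightarrow> p x = 1" "\<And>x. x \<in> - U \<Longrightarrow> p x = 0"
  using Urysohn_local[of UNIV T "- U" 1 "0::real"] T U by auto
 have [measurable]: "p \<in> borel_measurable borel" using p(1) by (rule borel_measurable_continuous_onI)
 have p01: "0 \<le> p x" "p x \<le> 1" for x using p(2)[of x] by (auto simp: closed_segment_eq_real_ivl)
 have [measurable]: "cutoff n \<in> borel_measurable borel" for n
  using cutoff(1) by (rule borel_measurable_continuous_onI)
 define h where "h n x = indicator A x *\<^sub>R c - cx (cutoff n x) * (of_real (p x) * c)" for n x
 have intU: "integrable lborel (\<lambda>x. indicator U x * cmod c :: real)"
  using Ufin by (intro integrable_mult_left integrable_real_indicator) auto
 have "(\<lambda>n. LBINT x. cmod (h (real n) x)) \<longlonglongrightarrow> (LBINT x. cmod (indicator A x *\<^sub>R c - of_real (p x) * c))"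
 proof (rule integral_dominated_convergence[where w = "\<lambda>x. indicator U x * cmod c"])
  show "AE x in lborel. (\<lambda>n. cmod (h (real n) x)) \<longlonglongrightarrow> cmod (indicator A x *\<^sub>R c - of_real (p x) * c)"
  proof (rule AE_I2)
   fix x :: 'a
   have "eventually (\<lambda>n. cutoff (real n) x = 1) sequentially"
    using eventually_ge_at_top[of "nat \<lceil>norm x\<rceil>"] by eventually_elim (rule cutoff(4), linarith)
   then have "eventually (\<lambda>n. cmod (indicator A x *\<^sub>R c - of_real (p x) * c) = cmod (h (real n) x)) sequentially"
    by eventually_elim (simp add: h_def)
   then show "(\<lambda>n. cmod (h (real n) x)) \<longlonglongrightarrow> cmod (indicator A x *\<^sub>R c - of_real (p x) * c)"
    by (rule tendsto_eventually[OF eventually_mono]) auto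
  qed
  show "AE x in lborel. norm (cmod (h (real i) x)) \<le> indicator U x * cmod c" for i
  proof (rule AE_I2)
   fix x
   have "h (real i) x = of_real (indicator A x - cutoff (real i) x * p x) * c"
    by (simp add: h_def scaleR_conv_of_real algebra_simps)
   moreover have "\<bar>indicator A x - cutoff (real i) x * p x\<bar> \<le> indicator U x"
   proof -
    have "0 \<le> cutoff (real i) x * p x" "cutoff (real i) x * p x \<le> 1"
     using cutoff(2,3)[of "real i" x] p01[of x] by (auto intro: mult_le_one)
    then show ?thesis using p(4)[of x] U(2) by (auto simp: indicator_def)
   qed
   ultimately show "norm (cmod (h (real i) x)) \<le> indicator U x * cmod c"
    by (simp only: norm_mult norm_of_real real_norm_def abs_norm_cancel abs_mult abs_abs)
      (auto intro: mult_right_mono)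
  qed
 qed (use intU in \<open>auto simp: h_def[abs_def]\<close>)
 moreover have "(LBINT x. cmod (indicator A x *\<^sub>R c - of_real (p x) * c)) < e"
 proof -
  have "(LBINT x. cmod (indicator A x *\<^sub>R c - of_real (p x) * c)) \<le> (LBINT x. indicator (U - T) x * cmod c)"
  proof (rule integral_mono')
   show "integrable lborel (\<lambda>x. indicator (U - T) x * cmod c :: real)"
    using UT by (intro integrable_mult_left integrable_real_indicator) (auto intro: order_less_trans)
   fix x
   have "cmod (indicator A x *\<^sub>R c - of_real (p x) * c) = \<bar>indicator A x - p x\<bar> * cmod c"
    by (simp add: scaleR_conv_of_real norm_mult flip: of_real_diff left_diff_distrib)
   also have "\<dots> \<le> indicator (U - T) x * cmod c"
    using p01[of x] p(3,4)[of x] U(2) T(2)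
    by (intro mult_right_mono) (auto simp: indicator_def)
   finally show "cmod (indicator A x *\<^sub>R c - of_real (p x) * c) \<le> indicator (U - T) x * cmod c" .
  qed auto
  also have "\<dots> = measure lborel (U - T) * cmod c" by simp
  also have "measure lborel (U - T) \<le> d"
   using UT d by (simp add: measure_def enn2real_leI less_imp_le)
  then have "measure lborel (U - T) * cmod c \<le> d * cmod c" by (rule mult_right_mono) simp
  also have "\<dots> \<le> d * (cmod c + 1)" using d by simp
  also have "\<dots> < e"
  proof -
   have "cmod c + 1 > 0" using norm_ge_zero[of c] by linarith
   from mult_pos_pos[OF e this] this show ?thesis using e by (simp add: d_def field_simps)
  qed
  finally show ?thesis .
 qed
 ultimately have "eventually (\<lambda>n. (LBINT x. cmod (h (real n) x)) < e) sequentially"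
  by (rule order_tendstoD(2))
 then obtain n :: nat where n: "(LBINT x. cmod (h (real n) x)) < e"
  by (auto simp: eventually_sequentially)
 have "Cc (\<lambda>x. cx (cutoff (real n) x) * (of_real (p x) * c))"
  by (intro Cc_cutoff continuous_intros p(1))
 with n show ?thesis unfolding h_def by blast
qed

text \<open>Induction over integrable functions: the property passes from indicators to sums and to
  dominated limits.\<close>

lemma Cc_dense_L1:
 fixes f :: "'a::euclidean_space \<Rightarrow> complex"
 assumes "integrable lborel f"
 shows "\<forall>e>0. \<exists>g. Cc g \<and> (LBINT x. cmod (f x - g x)) < e"
 using assms
proof (induction rule: integrable_induct)
 case (base A c)
 then show ?case using Cc_dense_indicator[of A] by auto
next
 case (add f g)
 show ?case
 proof (intro allI impI)
  fix e :: real assume "e > 0"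
  then have "e/2 > 0" by simp
  then obtain f' g' where *: "Cc f'" "(LBINT x. cmod (f x - f' x)) < e/2"
    "Cc g'" "(LBINT x. cmod (g x - g' x)) < e/2"
   using add.IH by blast
  have i: "integrable lborel (\<lambda>x. cmod (f x - f' x))" "integrable lborel (\<lambda>x. cmod (g x - g' x))"
   using add.hyps Cc_integrable[OF *(1)] Cc_integrable[OF *(3)] by auto
  have "(LBINT x. cmod (f x + g x - (f' x + g' x)))
    \<le> (LBINT x. cmod (f x - f' x) + cmod (g x - g' x))"
   by (rule integral_mono') (use i norm_diff_triangle_ineq in auto)
  also have "\<dots> < e" using * i by simp
  finally show "\<exists>h. Cc h \<and> (LBINT x. cmod (f x + g x - h x)) < e"
   using Cc_add[OF *(1,3)] by blast
 qed
next
 case (lim f s)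
 show ?case
 proof (intro allI impI)
  fix e :: real assume e: "e > 0"
  have [measurable]: "f \<in> borel_measurable borel" "s i \<in> borel_measurable borel" for i
   using lim.hyps(1)[of i] lim.hyps(4) by (auto dest: borel_measurable_integrable)
  have "(\<lambda>i. LBINT x. cmod (f x - s i x)) \<longlonglongrightarrow> (LINT x|(lborel::'a measure). 0)"
  proof (rule integral_dominated_convergence[where w = "\<lambda>x. 3 * cmod (f x)"])
   show "AE x in lborel. (\<lambda>i. cmod (f x - s i x)) \<longlonglongrightarrow> 0"
    using lim.hyps(2) by (intro AE_I2) (auto intro!: tendsto_eq_intros)
   show "AE x in lborel. norm (cmod (f x - s i x)) \<le> 3 * cmod (f x)" for i
   proof (rule AE_I2)
    fix x show "norm (cmod (f x - s i x)) \<le> 3 * cmod (f x)"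
     using norm_triangle_ineq4[of "f x" "s i x"] lim.hyps(3)[of x i] by auto
   qed
  qed (use lim.hyps in auto)
  then have "eventually (\<lambda>i. (LBINT x. cmod (f x - s i x)) < e/2) sequentially"
   using e by (intro order_tendstoD(2)[where y = 0]) auto
  then obtain i where i: "(LBINT x. cmod (f x - s i x)) < e/2"
   by (auto simp: eventually_sequentially)
  obtain g where g: "Cc g" "(LBINT x. cmod (s i x - g x)) < e/2"
   using lim.IH[of i] e by (meson half_gt_zero)
  have int: "integrable lborel (\<lambda>x. cmod (f x - s i x))" "integrable lborel (\<lambda>x. cmod (s i x - g x))"
   using lim.hyps(1,4) Cc_integrable[OF g(1)] by auto
  have "(LBINT x. cmod (f x - g x)) \<le> (LBINT x. cmod (f x - s i x) + cmod (s i x - g x))"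
  proof (rule integral_mono')
   show "cmod (f x - g x) \<le> cmod (f x - s i x) + cmod (s i x - g x)" for x
    using norm_triangle_ineq[of "f x - s i x" "s i x - g x"] by simp
  qed (use int in auto)
  also have "\<dots> < e" using int i g by simp
  finally show "\<exists>h. Cc h \<and> (LBINT x. cmod (f x - h x)) < e" using g by blast
 qed
qed

lemma tendsto_nrm_truncation:
 assumes f: "sqi_on M f" and A: "\<And>n. A n \<in> sets M" "\<And>x. \<forall>\<^sub>F n in sequentially. x \<in> A n"
 shows "(\<lambda>n. nrm_on M (\<lambda>x. f x - indicator (A n) x * f x)) \<longlonglongrightarrow> 0"
proof -
 have [measurable]: "f \<in> borel_measurable M" "\<And>n. A n \<in> sets M" using f A by auto
 have "(\<lambda>n. LINT x|M. (cmod (f x - indicator (A n) x * f x))^2) \<longlonglongrightarrow> (LINT x|M. 0)"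
 proof (rule integral_dominated_convergence[where w = "\<lambda>x. (cmod (f x))^2"])
  show "AE x in M. (\<lambda>n. (cmod (f x - indicator (A n) x * f x))^2) \<longlonglongrightarrow> 0"
  proof (rule AE_I2, rule tendsto_eventually)
   fix x show "\<forall>\<^sub>F n in sequentially. (cmod (f x - indicator (A n) x * f x))^2 = 0"
    using A(2)[of x] by eventually_elim simp
  qed
 qed (use f in \<open>auto simp: sqi_on_def indicator_def\<close>)
 then have "(\<lambda>n. sqrt (LINT x|M. (cmod (f x - indicator (A n) x * f x))^2)) \<longlonglongrightarrow> sqrt 0"
  by (intro tendsto_real_sqrt) simp
 then show ?thesis by (simp add: nrm_on_def)
qed

text \<open>Approximation in the mean is used after truncation of \<open>f\<close> in size and
  support. The approximant \<open>g\<close> is projected to the disc of radius \<open>n\<close>: the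
  projection is a contraction that fixes the values of \<open>h\<close>, so the distance to
  \<open>h\<close> does not grow, and since it is now at most \<open>2 n\<close> its square is at
  most \<open>2 n\<close> times \<open>|h - g|\<close>.\<close>

lemma Cc_dense:
 fixes f :: "'a::euclidean_space \<Rightarrow> complex"
 assumes f: "sqi f" and e: "e > 0"
 obtains g where "Cc g" "nrm (\<lambda>x. f x - g x) < e"
proof -
 have [measurable]: "f \<in> borel_measurable borel" using f by (auto simp: sqi_on_def)
 define A where "A n = {x. norm x \<le> real n \<and> cmod (f x) \<le> real n}" for n
 have A [measurable]: "A n \<in> sets borel" for n
  unfolding A_def by measurable
 have "\<forall>\<^sub>F n in sequentially. x \<in> A n" for x
 proof -
  obtain k :: nat where "max (norm x) (cmod (f x)) \<le> real k" using real_arch_simple by blast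
  then have "x \<in> A n" if "n \<ge> k" for n using that by (simp add: A_def)
  then show ?thesis by (auto simp: eventually_sequentially)
 qed
 then have "(\<lambda>n. nrm (\<lambda>x. f x - indicator (A n) x * f x)) \<longlonglongrightarrow> 0"
  by (intro tendsto_nrm_truncation f) auto
 then have "eventually (\<lambda>n. nrm (\<lambda>x. f x - indicator (A n) x * f x) < e/2) sequentially"
  using e by (intro order_tendstoD(2)) auto
 then obtain n where n: "nrm (\<lambda>x. f x - indicator (A n) x * f x) < e/2"
  by (auto simp: eventually_sequentially)
 define h where "h x = indicator (A n) x * f x" for x
 have [measurable]: "h \<in> borel_measurable borel" unfolding h_def by measurable
 have hn: "cmod (h x) \<le> real n * indicator (cball 0 (real n)) x" for x
  by (auto simp: h_def A_def indicator_def)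
 have hi: "integrable lborel h" by (rule integrable_bounded_support[OF _ hn]) simp
 have hs: "sqi h" unfolding h_def[abs_def] by (intro sqi_indicator f) simp
 \<comment> \<open>Chosen such that \<open>2 n d < (e/2)^2\<close> for every \<open>n\<close>, zero
   included.\<close>
 define d where "d = e^2 / (8 * (real n + 1))"
 have d: "d > 0" using e by (simp add: d_def)
 obtain g where g: "Cc g" "(LBINT x. cmod (h x - g x)) < d"
  using Cc_dense_L1[OF hi] d by blast
 let ?B = "cball (0::complex) (real n)"
 have B: "convex ?B" "closed ?B" "?B \<noteq> {}" by auto
 define k where "k x = closest_point ?B (g x)" for x
 have k: "Cc k"
 proof -
  have "continuous_on UNIV k"
   unfolding k_def by (rule continuous_on_compose2[OF continuous_on_closest_point[OF B, of UNIV] Cc_continuous[OF g(1)]]) auto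
  moreover have "closest_point ?B 0 = 0" by (rule closest_point_self) simp
  moreover obtain R where "\<And>x. R < norm x \<Longrightarrow> g x = 0" using g(1) by (auto simp: Cc_def)
  ultimately show ?thesis unfolding Cc_def k_def by (intro conjI exI[of _ R]) auto
 qed
 have le: "cmod (h x - k x) \<le> cmod (h x - g x)" for x
 proof -
  have "h x \<in> ?B" using hn[of x] by (cases "x \<in> cball 0 (real n)") (auto simp: indicator_def)
  then have "closest_point ?B (h x) = h x" by (rule closest_point_self)
  then show ?thesis using closest_point_lipschitz[OF B, of "h x" "g x"] by (simp add: k_def dist_norm)
 qed
 have bd: "cmod (h x - k x) \<le> 2 * real n" for x
 proof -
  have "k x \<in> ?B" unfolding k_def using B by (intro closest_point_in_set) auto
  moreover have "cmod (h x) \<le> real n" using hn[of x] by (cases "x \<in> cball 0 (real n)") (auto simp: indicator_def)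
  ultimately show ?thesis using norm_triangle_ineq4[of "h x" "k x"] by simp
 qed
 have ig: "integrable lborel (\<lambda>x. cmod (h x - g x))" using hi Cc_integrable[OF g(1)] by auto
 have "(LBINT x. (cmod (h x - k x))^2) \<le> (LBINT x. 2 * real n * cmod (h x - g x))"
 proof (rule integral_mono')
  show "(cmod (h x - k x))^2 \<le> 2 * real n * cmod (h x - g x)" for x
   unfolding power2_eq_square by (intro mult_mono bd le) auto
 qed (use ig in auto)
 also have "\<dots> = 2 * real n * (LBINT x. cmod (h x - g x))" by simp
 also have "\<dots> \<le> 2 * real n * d" using g(2) by (intro mult_left_mono) auto
 also have "\<dots> < (e/2)^2" using e by (simp add: d_def power2_eq_square field_simps)
 finally have "nrm (\<lambda>x. h x - k x) < e/2"
  unfolding nrm_on_def using e by (intro real_less_lsqrt) auto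
 moreover have "nrm (\<lambda>x. f x - k x) \<le> nrm (\<lambda>x. f x - h x) + nrm (\<lambda>x. h x - k x)"
  by (rule nrm_diff_triangle[OF f hs Cc_sqi[OF k]])
 ultimately have "nrm (\<lambda>x. f x - k x) < e" using n by (simp add: h_def)
 with k show ?thesis by (rule that)
qed

section \<open>Matrix exponential and square root\<close>

definition mpow :: "real^'n^'n \<Rightarrow> nat \<Rightarrow> real^'n^'n" where
 "mpow A k = ((\<lambda>X. A ** X) ^^ k) (mat 1)"

lemma mpow_0 [simp]: "mpow A 0 = mat 1" and mpow_Suc: "mpow A (Suc k) = A ** mpow A k"
 by (simp_all add: mpow_def)

lemma matrix_mul_scaleR_left: "(c *\<^sub>R A) ** (B :: real^'n^'n) = c *\<^sub>R (A ** B)"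
 and matrix_mul_scaleR_right: "A ** (c *\<^sub>R B :: real^'n^'n) = c *\<^sub>R (A ** B)"
 by (simp_all add: vec_eq_iff matrix_matrix_mult_def sum_distrib_left mult_ac)

lemma mpow_Suc2: "mpow A (Suc k) = mpow A k ** A"
proof (induction k)
 case (Suc k)
 have "mpow A (Suc (Suc k)) = A ** (mpow A k ** A)" by (simp only: mpow_Suc[of A "Suc k"] Suc)
 then show ?case by (simp add: matrix_mul_assoc mpow_Suc[of A k])
qed (simp add: mpow_Suc)

lemma mpow_scaleR: "mpow (t *\<^sub>R A) k = t ^ k *\<^sub>R mpow A k"
 by (induction k) (simp_all add: mpow_Suc matrix_mul_scaleR_left matrix_mul_scaleR_right)

text \<open>The entries of a power of \<open>A\<close> are bounded by the same power of this number:
  the factor \<open>CARD('n)\<close> pays for the sum in a matrix product, and \<open>+ 1\<close>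
  keeps it positive.\<close>

definition mbound :: "real^'n^'n \<Rightarrow> real" where
 "mbound A = real CARD('n) * (\<Sum>i\<in>UNIV. \<Sum>j\<in>UNIV. \<bar>A $ i $ j\<bar>) + 1"

lemma mbound_pos: "mbound A > 0"
 unfolding mbound_def by (intro add_nonneg_pos mult_nonneg_nonneg sum_nonneg) auto

lemma entry_le_sum: "\<bar>A $ i $ j\<bar> \<le> (\<Sum>i\<in>UNIV. \<Sum>j\<in>UNIV. \<bar>(A::real^'n^'m) $ i $ j\<bar>)"
proof -
 have "\<bar>A $ i $ j\<bar> \<le> (\<Sum>j\<in>UNIV. \<bar>A $ i $ j\<bar>)" by (rule member_le_sum) auto
 also have "\<dots> \<le> (\<Sum>i\<in>UNIV. \<Sum>j\<in>UNIV. \<bar>A $ i $ j\<bar>)"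
  by (rule member_le_sum[of i UNIV "\<lambda>i. \<Sum>j\<in>UNIV. \<bar>A $ i $ j\<bar>"]) (auto intro: sum_nonneg)
 finally show ?thesis .
qed

lemma mpow_entry_bound:
 fixes A :: "real^'n^'n"
 shows "\<bar>mpow A k $ i $ j\<bar> \<le> mbound A ^ k"
proof (induction k arbitrary: i j)
 case 0 then show ?case by (simp add: mat_def)
next
 case (Suc k)
 have "\<bar>mpow A (Suc k) $ i $ j\<bar> \<le> (\<Sum>l\<in>UNIV. \<bar>A $ i $ l\<bar> * \<bar>mpow A k $ l $ j\<bar>)"
  by (simp add: mpow_Suc matrix_matrix_mult_def order_trans[OF sum_abs] abs_mult)
 also have "\<dots> \<le> (\<Sum>l\<in>(UNIV::'n set). (\<Sum>i\<in>UNIV. \<Sum>j\<in>UNIV. \<bar>A $ i $ j\<bar>) * mbound A ^ k)"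
  by (intro sum_mono mult_mono Suc entry_le_sum) (auto intro: sum_nonneg)
 also have "\<dots> \<le> mbound A * mbound A ^ k"
  using mbound_pos[of A] by (simp add: mbound_def algebra_simps)
 finally show ?case by simp
qed

text \<open>Time is a separate argument, which turns each entry into a power series in
  \<open>t\<close>.\<close>

definition expm :: "real^'n^'n \<Rightarrow> real \<Rightarrow> real^'n^'n" where
 "expm A t = matrix_exp (t *\<^sub>R A)"

text \<open>Entrywise domination by a real exponential series gives convergence everywhere, so that
  termwise differentiation of power series applies to each entry.\<close>

lemma expm_entry_sums: "(\<lambda>k. mpow A k $ i $ j / fact k * t ^ k) sums (expm A t $ i $ j)"
 and summable_expm_entry: "summable (\<lambda>k. mpow A k $ i $ j / fact k * t ^ k)"
proof -
 have s: "summable (\<lambda>k. mpow A k $ i $ j / fact k * t ^ k)" for i j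
 proof (rule summable_comparison_test)
  have "summable (\<lambda>k. inverse (fact k) * (mbound A * \<bar>t\<bar>) ^ k)" by (rule summable_exp)
  then show "summable (\<lambda>k. (mbound A * \<bar>t\<bar>) ^ k / fact k)" by (simp add: field_simps)
  show "\<exists>N. \<forall>n\<ge>N. norm (mpow A n $ i $ j / fact n * t ^ n) \<le> (mbound A * \<bar>t\<bar>) ^ n / fact n"
   using mpow_entry_bound[of A _ i j]
   by (intro exI[of _ 0])
     (auto simp: abs_mult power_abs power_mult_distrib intro!: divide_right_mono mult_right_mono)
 qed
 then show "summable (\<lambda>k. mpow A k $ i $ j / fact k * t ^ k)" .
 have "(\<lambda>k. (1 / fact k) *\<^sub>R (t ^ k *\<^sub>R mpow A k)) sums (\<chi> i j. \<Sum>k. mpow A k $ i $ j / fact k * t ^ k)"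
  unfolding sums_def
 proof (intro vec_tendstoI)
  fix i j
  have "(\<lambda>n. \<Sum>k<n. mpow A k $ i $ j / fact k * t ^ k) \<longlonglongrightarrow> (\<Sum>k. mpow A k $ i $ j / fact k * t ^ k)"
   using summable_sums[OF s] by (simp add: sums_def)
  then show "(\<lambda>n. (\<Sum>k<n. (1 / fact k) *\<^sub>R (t ^ k *\<^sub>R mpow A k)) $ i $ j)
    \<longlonglongrightarrow> (\<chi> i j. \<Sum>k. mpow A k $ i $ j / fact k * t ^ k) $ i $ j"
   by (simp add: field_simps)
 qed
 then have "expm A t = (\<chi> i j. \<Sum>k. mpow A k $ i $ j / fact k * t ^ k)"
  unfolding expm_def matrix_exp_def mpow_def[symmetric] mpow_scaleR by (simp add: sums_iff)
 then show "(\<lambda>k. mpow A k $ i $ j / fact k * t ^ k) sums (expm A t $ i $ j)"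
  using summable_sums[OF s] by simp
qed

lemma DERIV_expm_entry: "((\<lambda>t. expm A t $ i $ j) has_real_derivative ((A ** expm A t) $ i $ j)) (at t)"
proof -
 let ?c = "\<lambda>k. mpow A k $ i $ j / fact k"
 have "((\<lambda>t. \<Sum>k. ?c k * t ^ k) has_real_derivative (\<Sum>k. diffs ?c k * t ^ k)) (at t)"
  by (rule termdiffs_strong_converges_everywhere) (rule summable_expm_entry)
 moreover have "(\<lambda>t. \<Sum>k. ?c k * t ^ k) = (\<lambda>t. expm A t $ i $ j)"
  using expm_entry_sums[of A i j] by (auto simp: sums_iff)
 moreover have "(\<lambda>k. diffs ?c k * t ^ k) sums ((A ** expm A t) $ i $ j)"
 proof -
  have "(\<lambda>k. \<Sum>l\<in>UNIV. A $ i $ l * (mpow A k $ l $ j / fact k * t ^ k)) sums (\<Sum>l\<in>UNIV. A $ i $ l * expm A t $ l $ j)"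
   by (intro sums_sum sums_mult expm_entry_sums)
  moreover have "(\<Sum>l\<in>UNIV. A $ i $ l * (mpow A k $ l $ j / fact k * t ^ k)) = diffs ?c k * t ^ k" for k
   by (simp add: diffs_def mpow_Suc matrix_matrix_mult_def sum_divide_distrib sum_distrib_right
     sum_distrib_left field_simps del: of_nat_Suc)
  ultimately show ?thesis by (simp add: matrix_matrix_mult_def)
 qed
 ultimately show ?thesis by (simp add: sums_iff)
qed

lemma expm_commute: "A ** expm A t = expm A t ** A"
proof -
 have "(A ** expm A t) $ i $ j = (expm A t ** A) $ i $ j" for i j
 proof -
  have "(\<lambda>k. \<Sum>l\<in>UNIV. A $ i $ l * (mpow A k $ l $ j / fact k * t ^ k)) sums (\<Sum>l\<in>UNIV. A $ i $ l * expm A t $ l $ j)"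
   by (intro sums_sum sums_mult expm_entry_sums)
  moreover have "(\<lambda>k. \<Sum>l\<in>UNIV. (mpow A k $ i $ l / fact k * t ^ k) * A $ l $ j) sums (\<Sum>l\<in>UNIV. expm A t $ i $ l * A $ l $ j)"
   by (intro sums_sum sums_mult2 expm_entry_sums)
  moreover have "(\<Sum>l\<in>UNIV. A $ i $ l * (mpow A k $ l $ j / fact k * t ^ k))
    = (\<Sum>l\<in>UNIV. (mpow A k $ i $ l / fact k * t ^ k) * A $ l $ j)" for k
  proof -
   have "(A ** mpow A k) $ i $ j = (mpow A k ** A) $ i $ j" by (metis mpow_Suc mpow_Suc2)
   then have "(\<Sum>l\<in>UNIV. A $ i $ l * mpow A k $ l $ j) * (t ^ k / fact k) = (\<Sum>l\<in>UNIV. mpow A k $ i $ l * A $ l $ j) * (t ^ k / fact k)"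
    by (simp add: matrix_matrix_mult_def)
   moreover have "(\<Sum>l\<in>UNIV. A $ i $ l * (mpow A k $ l $ j / fact k * t ^ k)) = (\<Sum>l\<in>UNIV. A $ i $ l * mpow A k $ l $ j) * (t ^ k / fact k)"
    by (simp add: sum_distrib_left sum_divide_distrib mult_ac)
   moreover have "(\<Sum>l\<in>UNIV. (mpow A k $ i $ l / fact k * t ^ k) * A $ l $ j) = (\<Sum>l\<in>UNIV. mpow A k $ i $ l * A $ l $ j) * (t ^ k / fact k)"
    by (simp add: sum_distrib_left sum_divide_distrib mult_ac)
   ultimately show ?thesis by simp
  qed
  ultimately show ?thesis by (simp add: matrix_matrix_mult_def sums_unique2)
 qed
 then show ?thesis by (simp add: vec_eq_iff)
qed

lemma expm_0 [simp]: "expm A 0 = mat 1"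
proof -
 have "expm A 0 $ i $ j = mat 1 $ i $ j" for i j
  using expm_entry_sums[of A i j 0] powser_sums_zero[of "\<lambda>k. mpow A k $ i $ j / fact k"]
  by (auto simp: sums_iff)
 then show ?thesis by (simp add: vec_eq_iff)
qed

lemma DERIV_matrix_mult_entry:
 assumes "\<And>i j. ((\<lambda>t. F t $ i $ j) has_real_derivative F' $ i $ j) (at t)"
  and "\<And>i j. ((\<lambda>t. G t $ i $ j) has_real_derivative G' $ i $ j) (at t)"
 shows "((\<lambda>t. (F t ** (G t :: real^'n^'n)) $ i $ j) has_real_derivative (F' ** G t + F t ** G') $ i $ j) (at t)"
 unfolding matrix_matrix_mult_def
 by (auto intro!: derivative_eq_intros assms simp: sum.distrib mult_ac add_ac)

text \<open>As \<open>A\<close> commutes with its exponential, the derivative in \<open>t\<close> of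
  the product vanishes, and at \<open>t = 0\<close> the product is \<open>expm A s\<close>. The
  inverse is the case \<open>s = 0\<close>, and the group law follows.\<close>

lemma expm_minus_add:
 fixes A :: "real^'n^'n"
 shows "expm A (- t) ** expm A (t + s) = expm A s"
proof -
 have "((\<lambda>t. (expm A (- t) ** expm A (t + s)) $ i $ j) has_real_derivative 0) (at t)" for i j t
 proof -
  have 1: "((\<lambda>t. expm A (- t) $ i $ j) has_real_derivative (- (A ** expm A (- t))) $ i $ j) (at t)" for i j
  proof -
   have "(uminus has_real_derivative - 1) (at t)" by (auto intro!: derivative_eq_intros)
   from DERIV_chain2[where f = "\<lambda>t. expm A t $ i $ j" and g = uminus and x = t, OF DERIV_expm_entry this]
   show ?thesis by simp
  qed
  have 2: "((\<lambda>t. expm A (t + s) $ i $ j) has_real_derivative (A ** expm A (t + s)) $ i $ j) (at t)" for i j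
  proof -
   have "((\<lambda>t. t + s) has_real_derivative 1) (at t)" by (auto intro!: derivative_eq_intros)
   from DERIV_chain2[where f = "\<lambda>t. expm A t $ i $ j" and g = "\<lambda>t. t + s" and x = t, OF DERIV_expm_entry this]
   show ?thesis by simp
  qed
  have "- (A ** expm A (- t)) ** expm A (t + s) + expm A (- t) ** (A ** expm A (t + s)) = 0"
  proof -
   have "expm A (- t) ** (A ** expm A (t + s)) = (A ** expm A (- t)) ** expm A (t + s)"
    by (simp only: expm_commute[of A "- t"] matrix_mul_assoc)
   moreover have "- X ** Y = - (X ** Y)" for X Y :: "real^'n^'n"
    by (simp add: matrix_matrix_mult_def vec_eq_iff sum_negf)
   ultimately show ?thesis by simp
  qed
  then show ?thesis using DERIV_matrix_mult_entry[OF 1 2, of i j] by simp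
 qed
 then have "(expm A (- t) ** expm A (t + s)) $ i $ j = (expm A (- 0) ** expm A (0 + s)) $ i $ j" for i j
  using DERIV_isconst_all[of "\<lambda>t. (expm A (- t) ** expm A (t + s)) $ i $ j" t 0] by blast
 then show ?thesis by (simp add: vec_eq_iff)
qed

lemma expm_minus: "expm A (- t) ** expm A t = mat 1"
 using expm_minus_add[of A t 0] by simp

lemma expm_add: "expm A (t + s) = expm A t ** expm A s"
proof -
 have "expm A t ** (expm A (- t) ** expm A (t + s)) = expm A t ** expm A s"
  by (simp only: expm_minus_add)
 then show ?thesis using expm_minus[of A "- t"] by (simp add: matrix_mul_assoc)
qed

lemma expm_vector_add: "expm A (t + s) *v x = expm A t *v (expm A s *v x)"
 by (simp add: expm_add matrix_vector_mul_assoc)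

lemma expm_vector_minus [simp]: "expm A (- t) *v (expm A t *v x) = x" "expm A t *v (expm A (- t) *v x) = x"
 using expm_vector_add[of A "- t" t x] expm_vector_add[of A t "- t" x] by simp_all

lemma DERIV_expm_vector:
 "((\<lambda>t. expm A t *v x) has_vector_derivative A *v (expm A t *v x)) (at t)"
proof -
 have "((\<lambda>t. (expm A t *v x) $ i) has_real_derivative (A *v (expm A t *v x)) $ i) (at t)" for i
  unfolding matrix_vector_mul_assoc unfolding matrix_vector_mult_def
  by (auto intro!: derivative_eq_intros DERIV_expm_entry simp: mult_ac)
 then have *: "((\<lambda>t. (expm A t *v x) $ i) has_derivative (\<lambda>h. h * (A *v (expm A t *v x)) $ i)) (at t)" for i
  by (simp add: has_field_derivative_def mult_commute_abs)
 show ?thesis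
  unfolding has_vector_derivative_def
  by (subst has_derivative_componentwise_within) (auto simp: Basis_vec_def inner_axis intro!: *)
qed

lemma continuous_on_expm_vector:
 assumes "continuous_on S f" "continuous_on S g"
 shows "continuous_on S (\<lambda>z. expm A (f z) *v g z)"
proof -
 have c: "continuous_on UNIV (\<lambda>t. expm A t $ i $ j)" for i j
  by (rule continuous_at_imp_continuous_on) (auto intro: DERIV_isCont[OF DERIV_expm_entry])
 have "continuous_on S (\<lambda>z. expm A (f z) $ i $ j)" for i j
  using continuous_on_compose2[OF c assms(1)] by auto
 moreover have "continuous_on S (\<lambda>z. g z $ j)" for j using assms(2) by (rule continuous_on_component)
 ultimately show ?thesis
  unfolding matrix_vector_mult_def
  by (intro continuous_on_vec_lambda continuous_on_sum continuous_on_mult)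
qed

lemma measurable_expm_vector [measurable]:
 fixes A :: "real^'n^'n"
 assumes [measurable]: "f \<in> borel_measurable M" "g \<in> borel_measurable M"
 shows "(\<lambda>z. expm A (f z) *v g z) \<in> borel_measurable M"
proof -
 have "continuous_on UNIV (\<lambda>z :: real \<times> (real^'n). expm A (fst z) *v snd z)"
  by (intro continuous_on_expm_vector continuous_intros)
 then have [measurable]: "(\<lambda>z :: real \<times> (real^'n). expm A (fst z) *v snd z) \<in> borel_measurable borel"
  by (rule borel_measurable_continuous_onI)
 have "(\<lambda>z. (f z, g z)) \<in> borel_measurable M" by (rule borel_measurable_Pair) fact+
 from measurable_compose[where g = "\<lambda>z. expm A (fst z) *v snd z", OF this] show ?thesis by simp
qed

lemma expm_vector_bound:
 fixes A :: "real^'n^'n"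
 obtains C where "C \<ge> 1" "\<And>t x. \<bar>t\<bar> \<le> T \<Longrightarrow> norm (expm A t *v x) \<le> C * norm x"
proof -
 let ?S = "{-T..T} \<times> sphere (0::real^'n) 1"
 have "compact ((\<lambda>z. expm A (fst z) *v snd z) ` ?S)"
  by (intro compact_continuous_image continuous_on_expm_vector continuous_intros compact_Times) auto
 from compact_imp_bounded[OF this] obtain B where "\<forall>y\<in>(\<lambda>z. expm A (fst z) *v snd z) ` ?S. norm y \<le> B"
  unfolding bounded_iff by (elim exE)
 then have B: "norm (expm A (fst z) *v snd z) \<le> B" if "z \<in> ?S" for z using that by blast
 show ?thesis
 proof (rule that[of "max 1 B"])
  fix t :: real and x :: "real^'n" assume t: "\<bar>t\<bar> \<le> T"
  show "norm (expm A t *v x) \<le> max 1 B * norm x"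
  proof (cases "x = 0")
   case False
   have "norm (expm A t *v x) = norm x * norm (expm A t *v (x /\<^sub>R norm x))"
    using False by (simp add: matrix_vector_mult_scaleR)
   also have "\<dots> \<le> norm x * B"
    using B[of "(t, x /\<^sub>R norm x)"] t False by (intro mult_left_mono) (auto simp: abs_le_iff)
   also have "\<dots> \<le> max 1 B * norm x" using mult_left_mono[of B "max 1 B" "norm x"] by (simp only: mult.commute) simp
   finally show ?thesis .
  qed simp
 qed simp
qed

text \<open>Leibniz expansion: a permutation other than the identity moves at least two indices, so
  whichever factor is differentiated, another off-diagonal entry of the identity remains and the
  term vanishes.\<close>

lemma DERIV_det_identity:
 fixes F :: "real \<Rightarrow> real^'n^'n"
 assumes F: "\<And>i j. ((\<lambda>t. F t $ i $ j) has_real_derivative A $ i $ j) (at 0)" and F0: "F 0 = mat 1"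
 shows "((\<lambda>t. det (F t)) has_real_derivative trace A) (at 0)"
proof -
 let ?P = "{p. p permutes (UNIV :: 'n set)}"
 let ?D = "\<lambda>p. of_int (sign p) * (\<Sum>i\<in>UNIV. A $ i $ p i * (\<Prod>j\<in>UNIV - {i}. F 0 $ j $ p j))"
 have "((\<lambda>t. det (F t)) has_real_derivative (\<Sum>p\<in>?P. ?D p)) (at 0)"
  unfolding det_def
  by (intro DERIV_sum DERIV_cmult has_field_derivative_prod F)
 moreover have "(\<Sum>p\<in>?P. ?D p) = (\<Sum>p\<in>{id}. ?D p)"
 proof (rule sum.mono_neutral_right)
  show "\<forall>p\<in>?P - {id}. ?D p = 0"
  proof
   fix p assume "p \<in> ?P - {id}"
   then have p: "p permutes UNIV" "p \<noteq> id" by auto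
   then obtain a where a: "p a \<noteq> a" by fastforce
   have pa: "p (p a) \<noteq> p a" using a p(1) by (metis permutes_inj injD)
   have z: "(\<Prod>j\<in>UNIV - {i}. F 0 $ j $ p j) = 0" for i
   proof -
    obtain b where "b \<noteq> i" "p b \<noteq> b" using a pa by metis
    then show ?thesis by (intro prod_zero) (auto simp: F0 mat_def intro!: bexI[of _ b])
   qed
   show "?D p = 0" by (simp only: z mult_zero_right sum.neutral_const)
  qed
 qed (auto simp: permutes_id)
 moreover have "(\<Sum>p\<in>{id}. ?D p) = trace A"
  by (simp add: F0 mat_def trace_def)
 ultimately show ?thesis by simp
qed

text \<open>Liouville's formula. The group law carries the derivative at the identity to any time,
  which makes \<open>det (expm A s) * exp (- (s * trace A))\<close> constant.\<close>

lemma det_expm: "det (expm A t) = exp (t * trace A)"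
proof -
 have 0: "((\<lambda>s. det (expm A s)) has_real_derivative trace A) (at 0)"
  by (rule DERIV_det_identity) (use DERIV_expm_entry[of A _ _ 0] in auto)
 have "((\<lambda>s. det (expm A s) * exp (- (s * trace A))) has_real_derivative 0) (at s)" for s
 proof -
  have "((\<lambda>r. det (expm A (r - s))) has_real_derivative trace A) (at s)"
  proof -
   have 1: "((\<lambda>r. r - s) has_real_derivative 1) (at s)" by (auto intro!: derivative_eq_intros)
   have "((\<lambda>s. det (expm A s)) has_real_derivative trace A) (at (s - s))" using 0 by simp
   from DERIV_chain2[where f = "\<lambda>s. det (expm A s)" and g = "\<lambda>r. r - s" and x = s, OF this 1]
   show ?thesis by simp
  qed
  from DERIV_cmult[OF this, of "det (expm A s)"]
  have "((\<lambda>r. det (expm A r)) has_real_derivative det (expm A s) * trace A) (at s)"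
   by (simp flip: det_mul expm_add)
  then show ?thesis by (auto intro!: derivative_eq_intros)
 qed
 then have "det (expm A t) * exp (- (t * trace A)) = det (expm A 0) * exp (- (0 * trace A))"
  using DERIV_isconst_all[of "\<lambda>s. det (expm A s) * exp (- (s * trace A))" t 0] by blast
 then show ?thesis by (simp add: exp_minus field_simps)
qed

section \<open>The square root of a positive definite matrix\<close>

lemma posdef_symmetric:
 assumes "symmetric_posdef Q" shows "(Q *v x) \<bullet> y = x \<bullet> (Q *v y)"
 using assms dot_lmul_matrix[of x Q y] transpose_matrix_vector[of Q x]
 by (simp add: symmetric_posdef_def)

text \<open>The minimum of the form over the compact unit sphere is positive, and homogeneity does
  the rest.\<close>

lemma posdef_lower_bound:
 fixes Q :: "real^'n^'n"
 assumes "symmetric_posdef Q"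
 obtains m where "m > 0" "\<And>x. m * (norm x)^2 \<le> (Q *v x) \<bullet> x"
proof -
 have ne: "sphere (0::real^'n) 1 \<noteq> {}"
  by (metis empty_iff mem_sphere_0 norm_axis_1)
 have "continuous_on (sphere 0 1) (\<lambda>x. (Q *v x) \<bullet> x)"
  by (intro continuous_intros linear_continuous_on matrix_vector_mul_bounded_linear)
 then obtain y where y: "y \<in> sphere 0 1" "\<And>x. x \<in> sphere 0 1 \<Longrightarrow> (Q *v y) \<bullet> y \<le> (Q *v x) \<bullet> x"
  using continuous_attains_inf[OF compact_sphere ne] by blast
 have "y \<noteq> 0" using y(1) by auto
 then have "0 < (Q *v y) \<bullet> y" using assms by (simp add: symmetric_posdef_def)
 moreover have "((Q *v y) \<bullet> y) * (norm x)^2 \<le> (Q *v x) \<bullet> x" for x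
 proof (cases "x = 0")
  case False
  have "(Q *v y) \<bullet> y \<le> (Q *v (x /\<^sub>R norm x)) \<bullet> (x /\<^sub>R norm x)" using False by (intro y(2)) simp
  also have "\<dots> = ((Q *v x) \<bullet> x) / (norm x)^2"
   by (simp add: matrix_vector_mult_scaleR power2_eq_square field_simps)
  finally show ?thesis using False by (simp add: field_simps)
 qed simp
 ultimately show ?thesis by (rule that)
qed

text \<open>With \<open>P = 1 - Q / c\<close> the root is \<open>sqrt c * (1 - Y)\<close> for a
  solution of \<open>2 Y = P + Y^2\<close>. The norm of \<open>P\<close> is at most
  \<open>\<rho> < 1\<close>, and \<open>Y \<mapsto> (P + Y^2) / 2\<close> is a contraction on the
  closed set of self-adjoint operators of norm at most \<open>\<rho>\<close>. That \<open>Y\<close>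
  has norm below \<open>1\<close> also makes the root positive.\<close>

lemma posdef_sqrt_exists:
 fixes Q :: "real^'n^'n"
 assumes Q: "symmetric_posdef Q"
 shows "\<exists>R. transpose R = R \<and> (\<forall>x. 0 \<le> (R *v x) \<bullet> x) \<and> R ** R = Q"
proof -
 obtain m where m: "m > 0" "\<And>x. m * (norm x)^2 \<le> (Q *v x) \<bullet> x" using posdef_lower_bound[OF Q] by blast
 define K where "K = onorm ((*v) Q)"
 have K: "norm (Q *v x) \<le> K * norm x" for x
  unfolding K_def by (rule onorm[OF matrix_vector_mul_bounded_linear])
 obtain e :: "real^'n" where e: "norm e = 1" by (metis norm_axis_1)
 have mK: "m \<le> K"
 proof -
  have "m \<le> (Q *v e) \<bullet> e" using m(2)[of e] e by simp
  also have "\<dots> \<le> norm (Q *v e) * norm e" by (rule norm_cauchy_schwarz)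
  also have "\<dots> \<le> K" using K[of e] e by simp
  finally show ?thesis .
 qed
 \<comment> \<open>With this \<open>c\<close> the bound
   \<open>|x|^2 - 2 m |x|^2 / c + K^2 |x|^2 / c^2\<close> for \<open>|P x|^2\<close> becomes
   \<open>(1 - (m/K)^2) |x|^2\<close>.\<close>
 define c where "c = K^2 / m"
 have c: "c > 0" using m mK by (simp add: c_def)
 define \<rho> where "\<rho> = sqrt (1 - (m/K)\<^sup>2)"
 have mK1: "m / K \<le> 1" "0 < m / K" using m mK by auto
 have sq1: "(m/K)^2 \<le> 1" "0 < (m/K)^2" using mK1 by (auto intro: power_le_one)
 have \<rho>: "0 \<le> \<rho>" "\<rho> < 1" using sq1 by (auto simp: \<rho>_def)
 define P where "P = Blinfun (\<lambda>x. x - (1/c) *\<^sub>R (Q *v x))"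
 have P: "blinfun_apply P x = x - (1/c) *\<^sub>R (Q *v x)" for x
  unfolding P_def
  by (subst bounded_linear_Blinfun_apply)
    (auto intro!: bounded_linear_sub bounded_linear_ident bounded_linear_scaleR_right
     bounded_linear_compose[OF bounded_linear_scaleR_right matrix_vector_mul_bounded_linear])
 have Pn: "norm P \<le> \<rho>"
 proof (rule norm_blinfun_bound[OF \<rho>(1)])
  fix x
  have "(norm (x - (1/c) *\<^sub>R (Q *v x)))^2 = (norm x)^2 - 2 / c * ((Q *v x) \<bullet> x) + (norm (Q *v x))^2 / c^2"
  proof -
   have "(norm (x - a))^2 = (norm x)^2 - 2 * (a \<bullet> x) + (norm a)^2" for a
    by (simp add: power2_norm_eq_inner inner_diff_left inner_diff_right inner_commute)
   then show ?thesis by (simp add: power_divide)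
  qed
  also have "\<dots> \<le> (norm x)^2 - 2 / c * (m * (norm x)^2) + (K * norm x)^2 / c^2"
   using m(2)[of x] power_mono[OF K[of x], of 2] c
   by (intro add_mono diff_mono mult_left_mono divide_right_mono) auto
  also have "\<dots> = (1 - (m/K)\<^sup>2) * (norm x)^2"
  proof -
   have "K > 0" using m mK by linarith
   then show ?thesis using m(1) by (simp add: c_def power2_eq_square field_simps)
  qed
  also have "\<dots> = (\<rho> * norm x)^2" using sq1 by (simp add: \<rho>_def power_mult_distrib)
  finally show "norm (blinfun_apply P x) \<le> \<rho> * norm x"
   unfolding P by (rule power2_le_imp_le) (use \<rho> in auto)
 qed
 define S where "S = {Y :: (real^'n) \<Rightarrow>\<^sub>L (real^'n). norm Y \<le> \<rho> \<and> (\<forall>x y. blinfun_apply Y x \<bullet> y = x \<bullet> blinfun_apply Y y)}"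
 define f where "f Y = (1/2) *\<^sub>R (P + (Y o\<^sub>L Y))" for Y :: "(real^'n) \<Rightarrow>\<^sub>L (real^'n)"
 have "closed S" unfolding S_def
  by (intro closed_Collect_conj closed_Collect_all closed_Collect_le closed_Collect_eq continuous_intros)
 then have "closed S" .
 moreover have "S \<noteq> {}" using \<rho> by (auto simp: S_def intro!: exI[of _ 0])
 moreover have "f ` S \<subseteq> S"
 proof
  fix Z assume "Z \<in> f ` S"
  then obtain Y where Y: "Y \<in> S" and Z: "Z = f Y" by blast
  have n: "norm Y \<le> \<rho>" and sym: "blinfun_apply Y x \<bullet> y = x \<bullet> blinfun_apply Y y" for x y
   using Y by (auto simp: S_def)
  have "norm Z \<le> (1/2) * (norm P + norm (Y o\<^sub>L Y))" unfolding Z f_def using norm_triangle_ineq[of P "Y o\<^sub>L Y"] by simp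
  also have "norm (Y o\<^sub>L Y) \<le> norm Y * norm Y" by (rule norm_blinfun_compose)
  also have "norm Y * norm Y \<le> \<rho> * 1" using n \<rho> by (intro mult_mono) auto
  finally have "norm Z \<le> \<rho>" using Pn by simp
  moreover have "blinfun_apply Z x \<bullet> y = x \<bullet> blinfun_apply Z y" for x y
   unfolding Z f_def
   by (simp add: blinfun.bilinear_simps P inner_simps posdef_symmetric[OF Q] sym)
  ultimately show "Z \<in> S" by (simp add: S_def)
 qed
 moreover have "\<forall>Y\<in>S. \<forall>Z\<in>S. dist (f Y) (f Z) \<le> \<rho> * dist Y Z"
 proof (intro ballI)
  fix Y Z assume YZ: "Y \<in> S" "Z \<in> S"
  have "f Y - f Z = (1/2) *\<^sub>R ((Y o\<^sub>L (Y - Z)) + ((Y - Z) o\<^sub>L Z))"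
   by (rule blinfun_eqI) (simp add: f_def blinfun.bilinear_simps algebra_simps)
  then have "norm (f Y - f Z) \<le> (1/2) * (norm (Y o\<^sub>L (Y - Z)) + norm ((Y - Z) o\<^sub>L Z))"
   using norm_triangle_ineq[of "Y o\<^sub>L (Y - Z)" "(Y - Z) o\<^sub>L Z"] by simp
  also have "\<dots> \<le> (1/2) * (norm Y * norm (Y - Z) + norm (Y - Z) * norm Z)"
   by (intro mult_left_mono add_mono norm_blinfun_compose) auto
  also have "\<dots> \<le> (1/2) * (\<rho> * norm (Y - Z) + norm (Y - Z) * \<rho>)"
   using YZ by (intro mult_left_mono add_mono mult_right_mono) (auto simp: S_def)
  finally show "dist (f Y) (f Z) \<le> \<rho> * dist Y Z" by (simp add: dist_norm algebra_simps)
 qed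
 ultimately obtain Y where Y: "Y \<in> S" "f Y = Y"
  using Banach_fix[OF complete_eq_closed[THEN iffD2], of S \<rho> f] \<rho> by blast
 have n: "norm Y \<le> \<rho>" and sym: "blinfun_apply Y x \<bullet> y = x \<bullet> blinfun_apply Y y" for x y
  using Y by (auto simp: S_def)
 have fix2: "blinfun_apply P x + blinfun_apply Y (blinfun_apply Y x) = 2 *\<^sub>R blinfun_apply Y x" for x
 proof -
  have "2 *\<^sub>R blinfun_apply (f Y) x = blinfun_apply P x + blinfun_apply Y (blinfun_apply Y x)"
   by (simp add: f_def blinfun.bilinear_simps)
  then show ?thesis using Y by simp
 qed
 define r where "r x = sqrt c *\<^sub>R (x - blinfun_apply Y x)" for x
 have lin: "linear r"
  unfolding r_def by (intro linearI) (simp_all add: blinfun.bilinear_simps algebra_simps)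
 have ap: "matrix r *v x = r x" for x using matrix_works[of r x] lin by (simp add: linear_matrix_vector_mul_eq)
 have "transpose (matrix r) = matrix r"
 proof -
  have "matrix r $ i $ j = matrix r $ j $ i" for i j
  proof -
   have "r (axis j 1) \<bullet> axis i 1 = axis j 1 \<bullet> r (axis i 1)"
    unfolding r_def by (simp add: inner_diff_left inner_diff_right sym)
   then show ?thesis by (simp add: matrix_def inner_axis inner_axis')
  qed
  then show ?thesis by (simp add: transpose_def vec_eq_iff)
 qed
 moreover have "0 \<le> (matrix r *v x) \<bullet> x" for x
 proof -
  have "blinfun_apply Y x \<bullet> x \<le> norm (blinfun_apply Y x) * norm x" by (rule norm_cauchy_schwarz)
  also have "\<dots> \<le> (norm Y * norm x) * norm x" by (intro mult_right_mono norm_blinfun) auto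
  also have "\<dots> \<le> (1 * norm x) * norm x" using n \<rho> by (intro mult_right_mono) auto
  also have "\<dots> = x \<bullet> x" by (simp add: power2_norm_eq_inner flip: power2_eq_square)
  finally show ?thesis unfolding ap r_def using c by (simp add: inner_diff_left)
 qed
 moreover have "matrix r ** matrix r = Q"
 proof -
  have "(matrix r ** matrix r) *v x = Q *v x" for x
  proof -
   have "(matrix r ** matrix r) *v x = r (r x)" by (simp add: ap flip: matrix_vector_mul_assoc)
   also have "\<dots> = c *\<^sub>R (x - 2 *\<^sub>R blinfun_apply Y x + blinfun_apply Y (blinfun_apply Y x))"
    unfolding r_def using c by (simp add: blinfun.bilinear_simps algebra_simps scaleR_2)
   also have "\<dots> = c *\<^sub>R (x - blinfun_apply P x)" 
   proof -
    have "x - 2 *\<^sub>R blinfun_apply Y x + blinfun_apply Y (blinfun_apply Y x) = x - blinfun_apply P x"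
     using fix2[of x] by (simp add: algebra_simps)
    then show ?thesis by simp
   qed
   also have "\<dots> = Q *v x" using c by (simp add: P)
   finally show ?thesis .
  qed
  then show ?thesis by (simp add: matrix_eq)
 qed
 ultimately show ?thesis by blast
qed

lemma matrix_sqrt_norm:
 assumes "symmetric_posdef Q"
 shows "(norm (matrix_sqrt Q *v x))^2 = (Q *v x) \<bullet> x"
proof -
 have R: "transpose (matrix_sqrt Q) = matrix_sqrt Q" "matrix_sqrt Q ** matrix_sqrt Q = Q"
  using someI_ex[OF posdef_sqrt_exists[OF assms]] by (auto simp: matrix_sqrt_def)
 have "(norm (matrix_sqrt Q *v x))^2 = (matrix_sqrt Q *v x) \<bullet> (matrix_sqrt Q *v x)"
  by (rule power2_norm_eq_inner)
 also have "\<dots> = (matrix_sqrt Q *v (matrix_sqrt Q *v x)) \<bullet> x"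
  using dot_lmul_matrix[of "matrix_sqrt Q *v x" "matrix_sqrt Q" x] R(1)
   transpose_matrix_vector[of "matrix_sqrt Q" "matrix_sqrt Q *v x"] by simp
 also have "\<dots> = (Q *v x) \<bullet> x" by (simp add: matrix_vector_mul_assoc R(2))
 finally show ?thesis .
qed

section \<open>Changes of variables\<close>

lemma borel_measurable_matrix_vector [measurable]:
 fixes A :: "real^'n^'m"
 assumes [measurable]: "f \<in> borel_measurable M"
 shows "(\<lambda>x. A *v f x) \<in> borel_measurable M"
proof -
 have "(*v) A \<in> borel_measurable borel"
  by (intro borel_measurable_continuous_onI linear_continuous_on matrix_vector_mul_bounded_linear)
 from measurable_compose[OF assms this] show ?thesis .
qed

text \<open>Both sides agree on boxes, whose preimages are images under the inverse matrix. The form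
  \<open>density (distr ...)\<close> is shared by all changes of variables below, so that a single
  lemma turns it into rules for integrals, null sets and norms.\<close>

lemma lborel_distr_matrix:
 fixes A :: "real^'n::{finite,wellorder}^'n::_"
 assumes "det A \<noteq> 0"
 shows "density (distr lborel borel ((*v) A)) (\<lambda>_. ennreal \<bar>det A\<bar>) = lborel"
proof (rule lborel_eqI[symmetric])
 fix l u :: "real^'n::_" assume le: "\<And>b. b \<in> Basis \<Longrightarrow> l \<bullet> b \<le> u \<bullet> b"
 obtain A' where A': "A' ** A = mat 1" "A ** A' = mat 1"
  using assms invertible_det_nz[of A] unfolding invertible_def by blast
 have inv: "A' *v (A *v x) = x" "A *v (A' *v x) = x" for x
  by (simp_all add: matrix_vector_mul_assoc A')
 have d: "det A' * det A = 1" using A'(1) by (metis det_I det_mul)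
 have pre: "(*v) A -` box l u = (*v) A' ` box l u"
  by (auto simp: image_iff inv) (metis inv(1))
 have img: "(*v) A' ` box l u \<in> lmeasurable"
    "measure lebesgue ((*v) A' ` box l u) = \<bar>det A'\<bar> * measure lebesgue (box l u)"
  using measurable_linear_image[OF matrix_vector_mul_linear, of "box l u" A']
   measure_linear_image[OF matrix_vector_mul_linear, of "box l u" A'] by auto
 have b: "(*v) A -` box l u \<in> sets borel"
  using measurable_sets[of "(*v) A" borel borel "box l u"] borel_measurable_matrix_vector[of "\<lambda>x. x" borel A] by simp
 have "emeasure lborel ((*v) A -` box l u) = ennreal (\<bar>det A'\<bar> * measure lebesgue (box l u))"
 proof -
  have "emeasure lebesgue ((*v) A' ` box l u) = ennreal (measure lebesgue ((*v) A' ` box l u))"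
   by (rule emeasure_eq_ennreal_measure[OF fmeasurableD2[OF img(1)]])
  moreover have "emeasure lebesgue ((*v) A' ` box l u) = emeasure lborel ((*v) A' ` box l u)"
   using b unfolding pre by simp
  ultimately show ?thesis unfolding pre by (simp only: img(2))
 qed
 moreover have "measure lebesgue (box l u) = (\<Prod>b\<in>Basis. (u - l) \<bullet> b)"
  using le by (simp add: measure_lborel_box_eq)
 ultimately show "emeasure (density (distr lborel borel ((*v) A)) (\<lambda>_. ennreal \<bar>det A\<bar>)) (box l u) = (\<Prod>b\<in>Basis. (u - l) \<bullet> b)"
  using d by (simp add: emeasure_density_const emeasure_distr ennreal_mult'[symmetric] mult.assoc[symmetric]
    abs_mult[symmetric] mult.commute)
qed simp


text \<open>The volume formula for linear images is only available for a well-ordered index type. An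
 arbitrary finite index type is therefore copied to a well-ordered one.\<close>

typedef 'a ordered_index = "UNIV :: 'a set" ..

instance ordered_index :: (finite) finite
proof
 have "(UNIV :: 'a ordered_index set) = range Abs_ordered_index"
  by (metis UNIV_eq_I Rep_ordered_index_inverse rangeI)
 then show "finite (UNIV :: 'a ordered_index set)" by (metis finite finite_imageI)
qed

text \<open>Any injection into the natural numbers serves to order the copy.\<close>

definition index_code :: "'a::finite \<Rightarrow> nat" where
 "index_code = (SOME f. inj f)"

lemma inj_index_code: "inj index_code"
 using finite_imp_inj_to_nat_seg[OF finite] unfolding index_code_def by (metis someI_ex)

instantiation ordered_index :: (finite) wellorder
begin

definition less_eq_ordered_index :: "('a::finite) ordered_index \<Rightarrow> 'a ordered_index \<Rightarrow> bool" where
 "less_eq_ordered_index x y \<longleftrightarrow> index_code (Rep_ordered_index x) \<le> index_code (Rep_ordered_index y)"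
definition less_ordered_index :: "('a::finite) ordered_index \<Rightarrow> 'a ordered_index \<Rightarrow> bool" where
 "less_ordered_index x y \<longleftrightarrow> index_code (Rep_ordered_index x) < index_code (Rep_ordered_index y)"

instance
proof
 fix P :: "('a::finite) ordered_index \<Rightarrow> bool" and a
 assume step: "\<And>x. (\<And>y. y < x \<Longrightarrow> P y) \<Longrightarrow> P x"
 show "P a"
  by (induction a rule: measure_induct_rule[where f = "\<lambda>x. index_code (Rep_ordered_index x)"])
    (rule step, simp add: less_ordered_index_def)
next
 fix x y :: "('a::finite) ordered_index"
 assume "x \<le> y" "y \<le> x"
 then have "index_code (Rep_ordered_index x) = index_code (Rep_ordered_index y)"
  by (simp add: less_eq_ordered_index_def)
 then show "x = y" by (metis inj_index_code injD Rep_ordered_index_inject)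
qed (auto simp: less_eq_ordered_index_def less_ordered_index_def)

end

lemma bij_Rep_ordered_index: "bij Rep_ordered_index"
 by (rule bijI) (metis injI Rep_ordered_index_inject, metis UNIV_I Abs_ordered_index_inverse surjI)

lemma sum_Rep_ordered_index: "(\<Sum>j\<in>UNIV. f (Rep_ordered_index j)) = (\<Sum>i\<in>UNIV. f i)"
 by (rule sum.reindex_bij_betw[OF bij_Rep_ordered_index])

definition mvec :: "real^'n::finite \<Rightarrow> real^('n::finite) ordered_index" where
 "mvec x = (\<chi> j. x $ Rep_ordered_index j)"

definition nvec :: "real^('n::finite) ordered_index \<Rightarrow> real^'n::finite" where
 "nvec y = (\<chi> i. y $ Abs_ordered_index i)"

definition mmat :: "real^('n::finite)^('n::finite) \<Rightarrow> real^('n::finite) ordered_index^('n::finite) ordered_index" where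
 "mmat A = (\<chi> i j. A $ Rep_ordered_index i $ Rep_ordered_index j)"

lemma nvec_mvec: "nvec (mvec x) = x"
 by (simp add: nvec_def mvec_def vec_eq_iff Abs_ordered_index_inverse)

lemma mmat_mult: "mmat (A ** B) = mmat A ** mmat B"
 by (simp add: mmat_def vec_eq_iff matrix_matrix_mult_def
   sum_Rep_ordered_index[of "\<lambda>k. A $ _ $ k * B $ k $ _"])

lemma mmat_mat: "mmat (mat 1) = mat 1"
 by (simp add: mmat_def vec_eq_iff mat_def Rep_ordered_index_inject)

lemma mmat_vector: "mmat A *v mvec x = mvec (A *v x)"
 by (simp add: mmat_def mvec_def vec_eq_iff matrix_vector_mult_def
   sum_Rep_ordered_index[of "\<lambda>k. A $ _ $ k * x $ k"])

lemma mmat_mpow: "mmat (mpow A k) = mpow (mmat A) k"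
 by (induction k) (simp_all add: mmat_mat mpow_Suc mmat_mult)

lemma mmat_expm: "mmat (expm A t) = expm (mmat A) t"
proof -
 have "mmat (expm A t) $ i $ j = expm (mmat A) t $ i $ j" for i j
  using expm_entry_sums[of A "Rep_ordered_index i" "Rep_ordered_index j" t]
   expm_entry_sums[of "mmat A" i j t]
  by (simp add: mmat_mpow[symmetric] sums_unique2) (simp add: mmat_def sums_unique2)
 then show ?thesis by (simp add: vec_eq_iff)
qed

lemma trace_mmat: "trace (mmat A) = trace A"
 by (simp add: mmat_def trace_def sum_Rep_ordered_index[of "\<lambda>i. A $ i $ i"])

lemma prod_Basis_vec: "(\<Prod>b\<in>Basis. (x::real^'n) \<bullet> b) = (\<Prod>i\<in>UNIV. x $ i)"
proof -
 have inj: "inj (\<lambda>i. axis i 1 :: real^'n)" by (auto simp: inj_on_def axis_eq_axis)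
 have B: "Basis = range (\<lambda>i. axis i 1 :: real^'n)" by (auto simp: Basis_vec_def)
 show ?thesis unfolding B prod.reindex[OF inj] by (simp add: inner_axis o_def)
qed

lemma mvec_measurable [measurable]: "mvec \<in> borel_measurable borel"
 and nvec_measurable [measurable]: "nvec \<in> borel_measurable borel"
 unfolding mvec_def[abs_def] nvec_def[abs_def]
 by (intro borel_measurable_continuous_onI continuous_intros)+

text \<open>Relabelling the coordinates maps boxes to boxes with the same side lengths.\<close>

lemma lborel_distr_mvec: "distr lborel borel mvec = (lborel :: (real^('n::finite) ordered_index) measure)"
proof (rule lborel_eqI[symmetric])
 fix l u :: "real^('n::finite) ordered_index" assume le: "\<And>b. b \<in> Basis \<Longrightarrow> l \<bullet> b \<le> u \<bullet> b"
 have le': "l $ i \<le> u $ i" for i using le[of "axis i 1"] by (auto simp: inner_axis Basis_vec_def)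
 have "mvec x \<in> box l u \<longleftrightarrow> x \<in> box (nvec l) (nvec u)" for x
 proof -
  have "(\<forall>j. P (Rep_ordered_index j) j) \<longleftrightarrow> (\<forall>i. P i (Abs_ordered_index i))" for P :: "'n \<Rightarrow> 'n ordered_index \<Rightarrow> bool"
   by (metis Abs_ordered_index_inverse Rep_ordered_index_inverse UNIV_I)
  from this[of "\<lambda>i j. l $ j < x $ i \<and> x $ i < u $ j"] show ?thesis
   by (simp add: mem_box_cart mvec_def nvec_def)
 qed
 then have "mvec -` box l u = box (nvec l) (nvec u)" by blast
 moreover have "nvec l \<bullet> b \<le> nvec u \<bullet> b" if "b \<in> Basis" for b
  using that le' by (auto simp: Basis_vec_def inner_axis nvec_def)
 ultimately have "emeasure (distr lborel borel mvec) (box l u) = (\<Prod>b\<in>Basis. (nvec u - nvec l) \<bullet> b)"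
  by (simp add: emeasure_distr emeasure_lborel_box)
 also have "(\<Prod>b\<in>Basis. (nvec u - nvec l) \<bullet> b) = (\<Prod>b\<in>Basis. (u - l) \<bullet> b)"
  unfolding prod_Basis_vec
  using prod.reindex_bij_betw[OF bij_Rep_ordered_index, of "\<lambda>i. (nvec u - nvec l) $ i"]
  by (simp add: nvec_def Rep_ordered_index_inverse)
 finally show "emeasure (distr lborel borel mvec) (box l u) = (\<Prod>b\<in>Basis. (u - l) \<bullet> b)" .
qed simp

text \<open>The volume formula holds for the copy \<open>mmat A\<close> over the ordered index type;
  \<open>mvec\<close> preserves Lebesgue measure and intertwines the two exponentials.\<close>

lemma lborel_distr_expm:
 fixes A :: "real^'n^'n"
 shows "density (distr lborel borel ((*v) (expm A t))) (\<lambda>_. ennreal (exp (t * trace A))) = lborel"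
proof (rule measure_eqI)
 fix S assume "S \<in> sets (density (distr lborel borel ((*v) (expm A t))) (\<lambda>_. ennreal (exp (t * trace A))))"
 then have [measurable]: "S \<in> sets borel" by simp
 let ?E = "expm (mmat A) t"
 let ?f = "\<lambda>y. indicator S (nvec y) :: ennreal"
 have [measurable]: "(*v) (expm A t) \<in> borel_measurable borel" "(*v) ?E \<in> borel_measurable borel"
  using borel_measurable_matrix_vector[of "\<lambda>x. x" borel] by simp_all
 have d: "\<bar>det ?E\<bar> = exp (t * trace A)" by (simp add: det_expm trace_mmat)
 have "emeasure lborel S = (NN x. ?f (mvec x))" by (simp add: nvec_mvec)
 also have "\<dots> = (NN y. ?f y)" by (simp add: nn_integral_distr flip: lborel_distr_mvec)
 also have "\<dots> = ennreal (exp (t * trace A)) * (NN y. ?f (?E *v y))"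
  by (subst lborel_distr_matrix[of ?E, symmetric])
    (simp_all add: det_expm d[symmetric] nn_integral_density nn_integral_distr nn_integral_cmult)
 also have "(NN y. ?f (?E *v y)) = (NN x. ?f (?E *v mvec x))"
  by (simp add: nn_integral_distr flip: lborel_distr_mvec)
 also have "\<dots> = (NN x. indicator S (expm A t *v x))"
  by (simp add: mmat_vector nvec_mvec flip: mmat_expm)
 also have "ennreal (exp (t * trace A)) * \<dots> = emeasure (density (distr lborel borel ((*v) (expm A t))) (\<lambda>_. ennreal (exp (t * trace A)))) S"
 proof -
  have "(NN x. indicator S (expm A t *v x)) = (NN x. indicator ((*v) (expm A t) -` S) x)"
   by (intro nn_integral_cong) (auto simp: indicator_def)
  also have "\<dots> = emeasure lborel ((*v) (expm A t) -` S)"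
   using measurable_sets[of "(*v) (expm A t)" borel borel S] by (intro nn_integral_indicator) simp
  finally show ?thesis by (simp add: emeasure_density_const emeasure_distr)
 qed
 finally show "emeasure (density (distr lborel borel ((*v) (expm A t))) (\<lambda>_. ennreal (exp (t * trace A)))) S = emeasure lborel S"
  by (rule sym)
qed simp

text \<open>One transfer for every map that changes volume by a constant factor: dilations,
  translations, reflections and the exponential flows are all instances.\<close>

lemma
 fixes T :: "'a::euclidean_space \<Rightarrow> 'a" and c :: real and g :: "'a \<Rightarrow> 'b::{banach, second_countable_topology}"
 assumes D: "density (distr lborel borel T) (\<lambda>_. ennreal c) = lborel"
  and T [measurable]: "T \<in> borel_measurable borel" and c: "c > 0"
 shows nn_integral_lborel_scaling: "f \<in> borel_measurable borel \<Longrightarrow> (NN x. f x) = ennreal c * (NN x. f (T x))"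
  and integral_lborel_scaling: "g \<in> borel_measurable borel \<Longrightarrow> (LBINT x. g x) = c *\<^sub>R (LBINT x. g (T x))"
  and integrable_lborel_scaling: "integrable lborel g \<Longrightarrow> integrable lborel (\<lambda>x. g (T x))"
  and AE_lborel_scaling: "AE x in lborel. P x \<Longrightarrow> AE x in lborel. P (T x)"
  and sqi_lborel_scaling: "sqi h \<Longrightarrow> sqi (\<lambda>x. h (T x))"
  and nrm_lborel_scaling: "sqi h \<Longrightarrow> (nrm h)^2 = c * (nrm (\<lambda>x. h (T x)))^2"
proof -
 have nn: "(NN x. f x) = ennreal c * (NN x. f (T x))" if [measurable]: "f \<in> borel_measurable borel" for f
  by (subst D[symmetric]) (simp add: nn_integral_density nn_integral_distr nn_integral_cmult)
 then show "f \<in> borel_measurable borel \<Longrightarrow> (NN x. f x) = ennreal c * (NN x. f (T x))" .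
 have int: "(LBINT x. g x) = c *\<^sub>R (LBINT x. g (T x))" if [measurable]: "g \<in> borel_measurable borel"
  for g :: "'a \<Rightarrow> 'c::{banach, second_countable_topology}"
  using c by (subst D[symmetric]) (simp add: integral_density integral_distr)
 then show "g \<in> borel_measurable borel \<Longrightarrow> (LBINT x. g x) = c *\<^sub>R (LBINT x. g (T x))" .
 have itg: "integrable lborel (\<lambda>x. g (T x))" if g: "integrable lborel g"
  for g :: "'a \<Rightarrow> 'c::{banach, second_countable_topology}"
 proof -
  have [measurable]: "g \<in> borel_measurable borel" using g by auto
  have "ennreal c * (NN x. norm (g (T x))) < \<infinity>"
   using g nn[of "\<lambda>x. norm (g x)"] by (simp add: integrable_iff_bounded)
  then show ?thesis using c unfolding integrable_iff_bounded by (auto simp: ennreal_mult_less_top)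
 qed
 then show "integrable lborel g \<Longrightarrow> integrable lborel (\<lambda>x. g (T x))" .
 show "AE x in lborel. P (T x)" if P: "AE x in lborel. P x"
 proof -
  obtain N where N: "N \<in> null_sets lborel" "{x. \<not> P x} \<subseteq> N"
   using P by (auto simp: eventually_ae_filter)
  then have [measurable]: "N \<in> sets borel" by auto
  have "ennreal c * (NN x. indicator N (T x)) = 0"
   using nn[of "indicator N"] N(1) by auto
  then have "(NN x. indicator N (T x)) = 0" using c by simp
  then have "AE x in lborel. T x \<notin> N"
   by (subst (asm) nn_integral_0_iff_AE) (auto simp: indicator_def)
  then show ?thesis using N(2) by (auto elim!: eventually_mono)
 qed
 show "sqi (\<lambda>x. h (T x))" if h: "sqi h"
  using h itg[OF sqi_integrable[OF h]] by (auto simp: sqi_on_def)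
 show "(nrm h)^2 = c * (nrm (\<lambda>x. h (T x)))^2" if h: "sqi h"
  unfolding nrm_square using h by (subst int) (auto simp: sqi_on_def)
qed

section \<open>Invariance under translations\<close>

lemma nn_integral_lborel_translation:
 fixes a :: "'a::euclidean_space"
 assumes [measurable]: "f \<in> borel_measurable borel"
 shows "(NN x. f (a + x)) = (NN x. f x)"
 by (subst lborel_distr_plus[of a, symmetric]) (simp add: nn_integral_distr)

lemma integral_lborel_translation:
 fixes a :: "'a::euclidean_space" and f :: "'a \<Rightarrow> 'b::{banach, second_countable_topology}"
 assumes [measurable]: "f \<in> borel_measurable borel"
 shows "(LBINT x. f (a + x)) = (LBINT x. f x)"
 by (subst (2) lborel_distr_plus[of a, symmetric]) (simp add: integral_distr)

lemma nrm_translation: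
 fixes a :: "'a::euclidean_space"
 assumes f: "sqi f"
 shows "sqi (\<lambda>x. f (a + x))" "nrm (\<lambda>x. f (a + x)) = nrm f"
proof -
 have [measurable]: "f \<in> borel_measurable borel" using f by (auto simp: sqi_on_def)
 show "sqi (\<lambda>x. f (a + x))"
  using f nn_integral_lborel_translation[of "\<lambda>x. ennreal ((cmod (f x))^2)" a]
  by (auto simp: sqi_iff_nn_integral)
 show "nrm (\<lambda>x. f (a + x)) = nrm f"
  using integral_lborel_translation[of "\<lambda>x. (cmod (f x))^2" a] by (simp add: nrm_on_def)
qed

section \<open>Gaussians\<close>

text \<open>Lebesgue measure on \<open>real^'n\<close> is the image of a product measure over
  \<open>Basis\<close>; the basis vectors are relabelled by components, and Fubini's theorem for
  finite products applies.\<close>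

lemma
 fixes f :: "'n::finite \<Rightarrow> real \<Rightarrow> 'b::{real_normed_field,banach,second_countable_topology}"
 assumes "\<And>i. integrable lborel (f i)"
 shows integrable_lborel_vec_prod: "integrable lborel (\<lambda>x::real^'n. \<Prod>i\<in>UNIV. f i (x $ i))"
  and integral_lborel_vec_prod: "(LBINT x. (\<Prod>i\<in>UNIV. f i ((x::real^'n) $ i))) = (\<Prod>i\<in>UNIV. (LBINT t. f i t))"
proof -
 interpret P: product_sigma_finite "\<lambda>b::real^'n. lborel :: real measure" ..
 define e where "e i = (axis i 1 :: real^'n)" for i
 have inj: "inj e" by (auto simp: inj_on_def e_def axis_eq_axis)
 have B: "Basis = range e" by (auto simp: Basis_vec_def e_def)
 define g where "g b = f (the_inv e b)" for b
 have ge: "g (e i) = f i" for i by (simp add: g_def the_inv_f_f[OF inj])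
 have [measurable]: "f i \<in> borel_measurable borel" for i using assms[of i] by auto
 have gint: "integrable lborel (g b)" if "b \<in> Basis" for b using that assms by (auto simp: B ge)
 have pr: "(\<Prod>i\<in>UNIV. f i (x $ i)) = (\<Prod>b\<in>Basis. g b (x \<bullet> b))" for x :: "real^'n"
  unfolding B by (simp add: prod.reindex[OF inj] ge) (simp add: e_def inner_axis)
 have comp: "(\<Sum>b\<in>Basis. h b *\<^sub>R b) \<bullet> b = h b" if "b \<in> Basis" for h and b :: "real^'n"
  using that by simp
 have [measurable]: "(\<lambda>x::real^'n. \<Prod>i\<in>UNIV. f i (x $ i)) \<in> borel_measurable borel"
  by measurable
 have *: "(\<lambda>h. \<Prod>i\<in>UNIV. f i ((\<Sum>b\<in>Basis. h b *\<^sub>R b) $ i)) = (\<lambda>h. \<Prod>b\<in>Basis. g b (h b))" for h :: "real^'n \<Rightarrow> real"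
  unfolding pr by (intro ext prod.cong refl arg_cong[where f = "g _"]) (rule comp)
 have "integrable (\<Pi>\<^sub>M b\<in>Basis. lborel) (\<lambda>h. \<Prod>i\<in>UNIV. f i ((\<Sum>b\<in>Basis. h b *\<^sub>R b) $ i))"
  unfolding * by (rule P.product_integrable_prod) (auto intro: gint)
 then show "integrable lborel (\<lambda>x::real^'n. \<Prod>i\<in>UNIV. f i (x $ i))"
  unfolding lborel_eq[where 'a = "real^'n"]
  by (subst integrable_distr_eq) (simp_all del: sum_component vector_scaleR_component)
 have "(LBINT x. (\<Prod>i\<in>UNIV. f i ((x::real^'n) $ i))) = (LINT h|(\<Pi>\<^sub>M b\<in>Basis. lborel). (\<Prod>b\<in>Basis. g b (h b)))"
  unfolding lborel_eq[where 'a = "real^'n"] by (subst integral_distr) (simp_all add: * del: sum_component vector_scaleR_component)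
 also have "\<dots> = (\<Prod>b\<in>Basis. (LBINT t. g b t))"
  by (rule P.product_integral_prod) (auto intro: gint)
 also have "\<dots> = (\<Prod>i\<in>UNIV. (LBINT t. f i t))"
  unfolding B by (simp add: prod.reindex[OF inj] ge)
 finally show "(LBINT x. (\<Prod>i\<in>UNIV. f i ((x::real^'n) $ i))) = (\<Prod>i\<in>UNIV. (LBINT t. f i t))" .
qed

definition gauss :: "real^'n \<Rightarrow> real" where
 "gauss x = (\<Prod>i\<in>UNIV. std_normal_density (x $ i))"

lemma gauss_nonneg [simp]: "0 \<le> gauss x"
 by (auto simp: gauss_def intro!: prod_nonneg)

lemma gauss_measurable [measurable]: "gauss \<in> borel_measurable borel"
 unfolding gauss_def[abs_def] by measurable

lemma gauss_integrable: "integrable lborel gauss"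
 unfolding gauss_def[abs_def] by (rule integrable_lborel_vec_prod) (rule integrable_normal_density, simp)

lemma gauss_integral: "(LBINT x. gauss x) = 1"
 unfolding gauss_def by (subst integral_lborel_vec_prod) (auto simp: integral_normal_density)

lemma norm_vec_square: "(norm (x::real^'n))^2 = (\<Sum>i\<in>UNIV. (x $ i)^2)"
 unfolding power2_norm_eq_inner inner_vec_def by (simp add: power2_eq_square)

lemma prod_exp_norm: "(\<Prod>i\<in>UNIV. exp (- (x $ i)\<^sup>2 / 2)) = exp (- (norm (x::real^'n))\<^sup>2 / 2)"
 by (simp add: norm_vec_square sum_negf sum_divide_distrib flip: exp_sum)

lemma gauss_eq: "gauss (x::real^'n) = (2 * pi) powr (- real CARD('n) / 2) * exp (- (norm x)\<^sup>2 / 2)"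
proof -
 have "gauss x = (\<Prod>i\<in>(UNIV::'n set). 1 / sqrt (2 * pi)) * (\<Prod>i\<in>UNIV. exp (- (x $ i)\<^sup>2 / 2))"
  by (simp only: gauss_def std_normal_density_def prod.distrib)
 also have "(\<Prod>i\<in>UNIV. exp (- (x $ i)\<^sup>2 / 2)) = exp (- (norm x)\<^sup>2 / 2)" by (rule prod_exp_norm)
 also have "(\<Prod>i\<in>(UNIV::'n set). 1 / sqrt (2 * pi)) = (2 * pi) powr (- real CARD('n) / 2)"
 proof -
  have "1 / sqrt (2 * pi) = (2 * pi) powr (- 1 / 2)"
   by (simp add: powr_minus_divide powr_half_sqrt)
  then have "(1 / sqrt (2 * pi)) ^ CARD('n) = ((2 * pi) powr (- 1 / 2)) powr real CARD('n)"
   by (simp add: powr_realpow)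
  then show ?thesis by (simp add: powr_powr)
 qed
 finally show ?thesis .
qed

lemma std_normal_fourier:
 "(LBINT x. cx (std_normal_density x) * exp (\<i> * cx (t * x))) = cx (exp (- t\<^sup>2 / 2))"
proof -
 have "cx (exp (- t\<^sup>2 / 2)) = (LINT x|std_normal_distribution. iexp (t * x))"
  using char_std_normal_distribution by (simp add: char_def fun_eq_iff)
 also have "\<dots> = (LBINT x. std_normal_density x *\<^sub>R iexp (t * x))"
  by (subst integral_density) auto
 finally show ?thesis by (simp add: scaleR_conv_of_real)
qed

lemma gauss_fourier:
 "(LBINT x. cx (gauss x) * exp (\<i> * cx (x \<bullet> z))) = cx (exp (- (norm (z::real^'n))\<^sup>2 / 2))"
proof -
 have "cx (gauss x) * exp (\<i> * cx (x \<bullet> z))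
   = (\<Prod>i\<in>UNIV. cx (std_normal_density (x $ i)) * exp (\<i> * cx (z $ i * x $ i)))" for x
  unfolding gauss_def
  by (simp add: inner_vec_def sum_distrib_left prod.distrib exp_sum mult.commute)
 then have "(LBINT x. cx (gauss x) * exp (\<i> * cx (x \<bullet> z)))
   = (\<Prod>i\<in>UNIV. (LBINT x. cx (std_normal_density x) * exp (\<i> * cx (z $ i * x))))"
  by (simp only:, intro integral_lborel_vec_prod)
    (rule Bochner_Integration.integrable_bound[OF integrable_normal_density[of 1 0]], auto simp: norm_mult)
 also have "\<dots> = (\<Prod>i\<in>UNIV. cx (exp (- (z $ i)\<^sup>2 / 2)))"
  by (simp only: std_normal_fourier)
 also have "\<dots> = cx (exp (- (norm z)\<^sup>2 / 2))"
  by (simp only: of_real_prod[symmetric] prod_exp_norm)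
 finally show ?thesis .
qed

section \<open>Plancherel's theorem\<close>

abbreviation ekern :: "real^'n \<Rightarrow> real^'n \<Rightarrow> complex" where
 "ekern x z \<equiv> exp (- (\<i> * cx (x \<bullet> z)))"

lemma norm_ekern [simp]: "cmod (ekern x z) = 1"
 by (simp add: norm_exp_eq_Re)

lemma fourier_lborel:
 assumes [measurable]: "g \<in> borel_measurable borel"
 shows "fourier g z = (LBINT x. g x * ekern x z)"
 unfolding fourier_def by (rule integral_completion) measurable

lemma fourier_measurable [measurable]:
 assumes [measurable]: "g \<in> borel_measurable borel"
 shows "fourier g \<in> borel_measurable borel"
proof -
 have "(\<lambda>z. LBINT x. g x * ekern x z) \<in> borel_measurable borel"
  by (rule lborel.borel_measurable_lebesgue_integral) measurable
 moreover have "fourier g = (\<lambda>z. LBINT x. g x * ekern x z)"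
  by (rule ext) (rule fourier_lborel[OF assms])
 ultimately show ?thesis by simp
qed

lemma integrable_ekern:
 assumes "integrable lborel g"
 shows "integrable lborel (\<lambda>x. g x * ekern x z)"
proof (rule Bochner_Integration.integrable_bound[OF assms])
 have [measurable]: "g \<in> borel_measurable borel" using assms by auto
 show "(\<lambda>x. g x * ekern x z) \<in> borel_measurable lborel" by measurable
qed (simp add: norm_mult)

lemma norm_fourier_le:
 assumes "integrable lborel g"
 shows "cmod (fourier g z) \<le> (LBINT x. cmod (g x))"
proof -
 have "g \<in> borel_measurable borel" using assms by auto
 then show ?thesis
  using integral_norm_bound[of lborel "\<lambda>x. g x * ekern x z"] by (simp add: fourier_lborel norm_mult)
qed

lemma fourier_continuous:
 assumes g: "integrable lborel g"
 shows "continuous_on UNIV (fourier g)"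
proof -
 have [measurable]: "g \<in> borel_measurable borel" using g by auto
 show ?thesis
  unfolding continuous_on_sequentially
 proof (intro allI ballI impI)
  fix X :: "nat \<Rightarrow> real^'a" and z assume "(\<forall>n. X n \<in> UNIV) \<and> X \<longlonglongrightarrow> z"
  then have X: "X \<longlonglongrightarrow> z" by simp
  have "(\<lambda>n. LBINT x. g x * ekern x (X n)) \<longlonglongrightarrow> (LBINT x. g x * ekern x z)"
  proof (rule integral_dominated_convergence[where w = "\<lambda>x. cmod (g x)"])
   show "AE x in lborel. (\<lambda>n. g x * ekern x (X n)) \<longlonglongrightarrow> g x * ekern x z"
    by (intro AE_I2 tendsto_intros X)
   show "AE x in lborel. norm (g x * ekern x (X i)) \<le> cmod (g x)" for i
    by (simp add: norm_mult)
  qed (use g in auto)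
  then show "(fourier g \<circ> X) \<longlonglongrightarrow> fourier g z" by (simp add: fourier_lborel o_def)
 qed
qed

lemma fourier_add:
 assumes "integrable lborel f" "integrable lborel g"
 shows "fourier (\<lambda>x. a * f x + b * g x) z = a * fourier f z + b * fourier g z"
proof -
 have [measurable]: "f \<in> borel_measurable borel" "g \<in> borel_measurable borel" using assms by auto
 have "(LBINT x. (a * f x + b * g x) * ekern x z) = (LBINT x. a * (f x * ekern x z) + b * (g x * ekern x z))"
  by (simp add: algebra_simps)
 also have "\<dots> = a * (LBINT x. f x * ekern x z) + b * (LBINT x. g x * ekern x z)"
  using integrable_ekern[OF assms(1), of z] integrable_ekern[OF assms(2), of z]
  by (subst Bochner_Integration.integral_add) auto
 finally show ?thesis by (simp add: fourier_lborel)
qed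

lemma fourier_diff:
 assumes "integrable lborel f" "integrable lborel g"
 shows "fourier (\<lambda>x. f x - g x) z = fourier f z - fourier g z"
 using fourier_add[OF assms, of 1 "-1"] by simp

lemma integrable_mult_pair:
 fixes f :: "'a::euclidean_space \<Rightarrow> complex" and g :: "'b::euclidean_space \<Rightarrow> complex"
 assumes f: "integrable lborel f" and g: "integrable lborel g"
  and [measurable]: "e \<in> borel_measurable (lborel \<Otimes>\<^sub>M lborel)" and e: "\<And>z. cmod (e z) \<le> 1"
 shows "integrable (lborel \<Otimes>\<^sub>M lborel) (\<lambda>(x, y). f x * g y * e (x, y))"
proof (rule lborel_pair.Fubini_integrable)
 have [measurable]: "f \<in> borel_measurable borel" "g \<in> borel_measurable borel" using f g by auto
 have g2: "integrable lborel (\<lambda>y. c * g y)" for c using g by auto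
 show "(\<lambda>(x, y). f x * g y * e (x, y)) \<in> borel_measurable (lborel \<Otimes>\<^sub>M lborel)" by measurable
 have bd: "norm (f x * g y * e (x, y)) \<le> norm (f x * g y)" for x y
  using mult_left_mono[OF e[of "(x, y)"], of "norm (f x * g y)"] by (simp add: norm_mult)
 have int: "integrable lborel (\<lambda>y. f x * g y * e (x, y))" for x
  by (rule Bochner_Integration.integrable_bound[OF g2[of "f x"]]) (use bd in auto)
 show "AE x in lborel. integrable lborel (\<lambda>y. case (x, y) of (x, y) \<Rightarrow> f x * g y * e (x, y))"
  using int by simp
 have "integrable lborel (\<lambda>x. norm (f x) * (LBINT y. norm (g y)))" using f by auto
 then show "integrable lborel (\<lambda>x. LBINT y. norm (case (x, y) of (x, y) \<Rightarrow> f x * g y * e (x, y)))"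
 proof (rule Bochner_Integration.integrable_bound)
  show "(\<lambda>x. LBINT y. norm (case (x, y) of (x, y) \<Rightarrow> f x * g y * e (x, y))) \<in> borel_measurable lborel"
   by (rule lborel.borel_measurable_lebesgue_integral) measurable
  have "(LBINT y. norm (f x * g y * e (x, y))) \<le> (LBINT y. norm (f x * g y))" for x
   by (rule integral_mono) (use int bd g2 in auto)
  then show "AE x in lborel. norm (LBINT y. norm (case (x, y) of (x, y) \<Rightarrow> f x * g y * e (x, y)))
    \<le> norm (norm (f x) * (LBINT y. norm (g y)))"
   by (simp add: norm_mult integral_nonneg_AE)
 qed
qed

text \<open>Fubini for the integrable function \<open>f x * g w * ekern x w\<close>, the kernel
  being symmetric.\<close>

lemma fourier_mult_L1:
 assumes f: "integrable lborel f" and g: "integrable lborel g"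
 shows "(LBINT w. fourier f w * g w) = (LBINT x. f x * fourier g x)"
proof -
 have [measurable]: "f \<in> borel_measurable borel" "g \<in> borel_measurable borel" using f g by auto
 have "integrable (lborel \<Otimes>\<^sub>M lborel) (\<lambda>(x, y). f x * g y * (\<lambda>z. ekern (fst z) (snd z)) (x, y))"
  by (rule integrable_mult_pair[OF f g]) auto
 then have "(LBINT w. LBINT x. f x * g w * ekern x w) = (LBINT x. LBINT w. f x * g w * ekern x w)"
  by (intro lborel_pair.Fubini_integral) (simp add: case_prod_beta')
 moreover have "(LBINT x. f x * g w * ekern x w) = fourier f w * g w" for w
 proof -
  have "(LBINT x. f x * g w * ekern x w) = (LBINT x. (f x * ekern x w) * g w)"
   by (simp add: mult_ac)
  then show ?thesis using integrable_ekern[OF f, of w] by (simp add: fourier_lborel)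
 qed
 moreover have "(LBINT w. f x * g w * ekern x w) = f x * fourier g x" for x
 proof -
  have "(LBINT w. f x * g w * ekern x w) = (LBINT w. f x * (g w * ekern w x))"
   by (simp add: mult_ac inner_commute)
  then show ?thesis using integrable_ekern[OF g, of x] by (simp add: fourier_lborel)
 qed
 ultimately show ?thesis by simp
qed

lemma lborel_distr_affine:
 fixes t :: "'a::euclidean_space"
 assumes "c > 0"
 shows "density (distr lborel borel (\<lambda>x. t + c *\<^sub>R x)) (\<lambda>_. ennreal (c ^ DIM('a))) = lborel"
 using lborel_affine[of c t] assms by simp

text \<open>A Gaussian convergence factor: integrable for \<open>e > 0\<close>, tending to
  \<open>1\<close> as \<open>e\<close> tends to \<open>0\<close>, with a rescaled
  \<open>gauss\<close> as its transform up to a constant.\<close>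

definition damp :: "real \<Rightarrow> real^'n \<Rightarrow> real" where
 "damp e z = exp (- (e^2 * (norm z)^2 / 2))"

lemma damp_measurable [measurable]: "damp e \<in> borel_measurable borel"
 unfolding damp_def[abs_def] by measurable

lemma damp_eq_gauss: "damp e (z :: real^'n) = (2 * pi) powr (real CARD('n) / 2) * gauss (e *\<^sub>R z)"
 by (simp add: gauss_eq damp_def power_mult_distrib powr_minus)

lemma damp_bounds: "0 < damp e z" "damp e z \<le> 1"
 by (auto simp: damp_def)

lemma damp_integrable:
 assumes "e > 0"
 shows "integrable lborel (damp e :: real^'n \<Rightarrow> real)"
proof -
 have "integrable lborel (\<lambda>z::real^'n. gauss (0 + e *\<^sub>R z))"
  by (rule integrable_lborel_scaling[OF lborel_distr_affine[OF assms]]) (use assms gauss_integrable in auto)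
 then show ?thesis by (simp add: damp_eq_gauss[abs_def])
qed

lemma damp_fourier:
 assumes e: "e > 0"
 shows "fourier (\<lambda>z. cx (damp e z) * exp (\<i> * cx (x \<bullet> z))) y
    = cx ((2 * pi) ^ CARD('n) * (1 / e) ^ CARD('n) * gauss ((1 / e) *\<^sub>R (y - x :: real^'n)))"
proof -
 let ?c = "(2 * pi) powr (real CARD('n) / 2)"
 have "fourier (\<lambda>z. cx (damp e z) * exp (\<i> * cx (x \<bullet> z))) y
   = (LBINT z. cx (damp e z) * exp (\<i> * cx (z \<bullet> (x - y))))"
  by (subst fourier_lborel)
    (auto intro!: Bochner_Integration.integral_cong simp: exp_add[symmetric] inner_diff_right inner_commute algebra_simps)
 also have "\<dots> = (1 / e) ^ CARD('n) *\<^sub>R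
   (LBINT z. cx (damp e (0 + (1/e) *\<^sub>R z)) * exp (\<i> * cx ((0 + (1/e) *\<^sub>R z) \<bullet> (x - y))))"
  using integral_lborel_scaling[OF lborel_distr_affine[of "1/e" "0::real^'n"],
    of "\<lambda>z. cx (damp e z) * exp (\<i> * cx (z \<bullet> (x - y)))"] e
  by simp
 also have "(LBINT z. cx (damp e (0 + (1/e) *\<^sub>R z)) * exp (\<i> * cx ((0 + (1/e) *\<^sub>R z) \<bullet> (x - y))))
   = ?c * (LBINT z. cx (gauss z) * exp (\<i> * cx (z \<bullet> ((1/e) *\<^sub>R (x - y)))))"
  using e by (simp add: damp_eq_gauss mult.assoc)
 also have "\<dots> = ?c * cx (exp (- (norm ((1/e) *\<^sub>R (x - y)))\<^sup>2 / 2))"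
  by (simp only: gauss_fourier)
 also have "exp (- (norm ((1/e) *\<^sub>R (x - y)))\<^sup>2 / 2) = ?c * gauss ((1/e) *\<^sub>R (y - x))"
  by (simp add: gauss_eq powr_minus norm_minus_commute)
 also have "(1 / e) ^ CARD('n) *\<^sub>R (cx ?c * cx (?c * gauss ((1/e) *\<^sub>R (y - x))))
   = cx ((?c * ?c) * (1 / e) ^ CARD('n) * gauss ((1/e) *\<^sub>R (y - x)))"
  by (simp add: scaleR_conv_of_real mult_ac)
 also have "?c * ?c = (2 * pi) ^ CARD('n)"
  by (simp add: powr_realpow flip: powr_add)
 finally show ?thesis .
qed

lemma fourier_square_damped:
 fixes f :: "real^'n \<Rightarrow> complex"
 assumes f: "integrable lborel f" and e: "e > 0"
 shows "cx (LBINT w. (cmod (fourier f w))^2 * damp e w)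
   = (2 * pi) ^ CARD('n) * (LBINT x. f x * cnj (LBINT z. f (x + e *\<^sub>R z) * cx (gauss z)))"
proof -
 have [measurable]: "f \<in> borel_measurable borel" using f by auto
 define g where "g w = cnj (fourier f w) * cx (damp e w)" for w
 have [measurable]: "g \<in> borel_measurable borel" unfolding g_def[abs_def] by measurable
 have g: "integrable lborel g"
 proof (rule Bochner_Integration.integrable_bound)
  show "integrable lborel (\<lambda>w::real^'n. (LBINT x. cmod (f x)) * damp e w)"
   using damp_integrable[OF e] by auto
  have "0 \<le> (LBINT x. cmod (f x))" by (rule integral_nonneg_AE) auto
  then show "AE w in lborel. norm (g w) \<le> norm ((LBINT x. cmod (f x)) * damp e w)"
   using norm_fourier_le[OF f] damp_bounds(1)
   by (auto simp: g_def norm_mult abs_mult less_imp_le intro!: mult_right_mono)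
 qed simp
 have fg: "fourier g x = (2 * pi) ^ CARD('n) * cnj (LBINT z. f (x + e *\<^sub>R z) * cx (gauss z))" for x
 proof -
  let ?h = "\<lambda>w. cx (damp e w) * exp (\<i> * cx (x \<bullet> w))"
  have h: "integrable lborel ?h"
   by (rule Bochner_Integration.integrable_bound[OF damp_integrable[OF e]])
     (auto simp: norm_mult norm_exp_eq_Re)
  have "g w * ekern w x = cnj (fourier f w * ?h w)" for w
   by (simp add: g_def exp_cnj inner_commute)
  then have "fourier g x = cnj (LBINT w. fourier f w * ?h w)"
   by (simp add: fourier_lborel del: complex_cnj_mult)
  also have "(LBINT w. fourier f w * ?h w) = (LBINT y. f y * fourier ?h y)"
   by (rule fourier_mult_L1[OF f h])
  also have "\<dots> = (LBINT y. f y * cx ((2 * pi) ^ CARD('n) * (1 / e) ^ CARD('n) * gauss ((1 / e) *\<^sub>R (y - x))))"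
   by (simp only: damp_fourier[OF e])
  also have "\<dots> = e ^ CARD('n) *\<^sub>R (LBINT z. f (x + e *\<^sub>R z) * cx ((2 * pi) ^ CARD('n) * (1 / e) ^ CARD('n) * gauss ((1 / e) *\<^sub>R ((x + e *\<^sub>R z) - x))))"
   using integral_lborel_scaling[OF lborel_distr_affine[of "e" x],
     of "\<lambda>y. f y * cx ((2 * pi) ^ CARD('n) * (1 / e) ^ CARD('n) * gauss ((1 / e) *\<^sub>R (y - x)))"] e
   by simp
  also have "\<dots> = (LBINT z. (2 * pi) ^ CARD('n) * (f (x + e *\<^sub>R z) * cx (gauss z)))"
  proof -
   have "(1 / e) *\<^sub>R ((x + e *\<^sub>R z) - x) = z" for z using e by simp
   moreover have "e ^ CARD('n) *\<^sub>R (a * cx ((2 * pi) ^ CARD('n) * (1 / e) ^ CARD('n) * b)) = (2 * pi) ^ CARD('n) * (a * cx b)" for a b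
    using e by (simp add: scaleR_conv_of_real power_divide)
   ultimately show ?thesis by (simp only: integral_scaleR_right[symmetric])
  qed
  also have "\<dots> = (2 * pi) ^ CARD('n) * (LBINT z. f (x + e *\<^sub>R z) * cx (gauss z))"
   by (subst integral_mult_right_zero[symmetric]) simp
  finally show ?thesis by simp
 qed
 have "cx (LBINT w. (cmod (fourier f w))^2 * damp e w) = (LBINT w. fourier f w * g w)"
  by (subst integral_complex_of_real[symmetric])
    (simp add: g_def mult.assoc[symmetric] complex_norm_square[symmetric] del: of_real_power)
 also have "\<dots> = (LBINT x. f x * fourier g x)" by (rule fourier_mult_L1[OF f g])
 also have "\<dots> = (LBINT x. f x * ((2 * pi) ^ CARD('n) * cnj (LBINT z. f (x + e *\<^sub>R z) * cx (gauss z))))"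
  by (simp only: fg)
 also have "(LBINT x. f x * ((2 * pi) ^ CARD('n) * cnj (LBINT z. f (x + e *\<^sub>R z) * cx (gauss z))))
  = (LBINT x. (2 * pi) ^ CARD('n) * (f x * cnj (LBINT z. f (x + e *\<^sub>R z) * cx (gauss z))))"
  by (simp add: mult_ac)
 also have "\<dots> = (2 * pi) ^ CARD('n) * (LBINT x. f x * cnj (LBINT z. f (x + e *\<^sub>R z) * cx (gauss z)))"
  by (rule integral_mult_right_zero)
 finally show ?thesis .
qed

lemma norm_integral_le_nn_integral:
 fixes f :: "'a \<Rightarrow> 'b::{banach, second_countable_topology}"
 shows "ennreal (norm (integral\<^sup>L M f)) \<le> (\<integral>\<^sup>+x. ennreal (norm (f x)) \<partial>M)"
 by (cases "integrable M f") (auto intro: integral_norm_bound_ennreal simp: not_integrable_integral_eq)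

lemma gauss_nn_integral: "(NN z. ennreal (gauss z)) = 1"
 using gauss_integrable gauss_integral by (subst nn_integral_eq_integral) auto

text \<open>Cauchy-Schwarz for \<open>f\<close> against its translates, whose norms equal that of
  \<open>f\<close>, averaged over the probability density \<open>gauss\<close>.\<close>

lemma fourier_square_damped_le:
 fixes f :: "real^'n \<Rightarrow> complex"
 assumes f: "integrable lborel f" "sqi f" and e: "e > 0"
 shows "(LBINT y. (cmod (fourier f y))^2 * damp e y) \<le> (2 * pi) ^ CARD('n) * (nrm f)^2"
proof -
 have [measurable]: "f \<in> borel_measurable borel" using f by auto
 let ?J = "LBINT x. f x * cnj (LBINT z. f (x + e *\<^sub>R z) * cx (gauss z))"
 have "ennreal (cmod ?J) \<le> (NN x. \<integral>\<^sup>+z. ennreal (gauss z) * ennreal (cmod (f x) * cmod (f (x + e *\<^sub>R z))) \<partial>lborel)"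
 proof (rule order_trans[OF norm_integral_le_nn_integral], rule nn_integral_mono)
  fix x
  have "ennreal (cmod (f x * cnj (LBINT z. f (x + e *\<^sub>R z) * cx (gauss z))))
    = ennreal (cmod (f x)) * ennreal (cmod (LBINT z. f (x + e *\<^sub>R z) * cx (gauss z)))"
   by (simp add: norm_mult ennreal_mult)
  also have "\<dots> \<le> ennreal (cmod (f x)) * (NN z. ennreal (cmod (f (x + e *\<^sub>R z) * cx (gauss z))))"
   by (intro mult_left_mono norm_integral_le_nn_integral) simp
  also have "\<dots> = (NN z. ennreal (gauss z) * ennreal (cmod (f x) * cmod (f (x + e *\<^sub>R z))))"
   by (subst nn_integral_cmult[symmetric]) (auto simp: norm_mult ennreal_mult mult_ac)
  finally show "ennreal (cmod (f x * cnj (LBINT z. f (x + e *\<^sub>R z) * cx (gauss z))))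
    \<le> (NN z. ennreal (gauss z) * ennreal (cmod (f x) * cmod (f (x + e *\<^sub>R z))))" .
 qed
 also have "\<dots> = (NN z. \<integral>\<^sup>+x. ennreal (gauss z) * ennreal (cmod (f x) * cmod (f (x + e *\<^sub>R z))) \<partial>lborel)"
  by (rule lborel_pair.Fubini') measurable
 also have "\<dots> \<le> (\<integral>\<^sup>+z. ennreal (gauss z) * ennreal ((nrm f)^2) \<partial>(lborel :: (real^'n) measure))"
 proof (rule nn_integral_mono)
  fix z
  have s: "sqi (\<lambda>x. f (e *\<^sub>R z + x))" and n: "nrm (\<lambda>x. f (e *\<^sub>R z + x)) = nrm f"
   using nrm_translation[OF f(2)] by auto
  have "(NN x. ennreal (cmod (f x) * cmod (f (x + e *\<^sub>R z)))) = ennreal (LBINT x. cmod (f x) * cmod (f (e *\<^sub>R z + x)))"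
   using integrable_norm[OF integrable_mult_sqi[OF f(2) s]]
   by (subst nn_integral_eq_integral[symmetric]) (auto simp: norm_mult add.commute)
  also have "\<dots> \<le> ennreal ((nrm f)^2)"
   using Cauchy_Schwarz_nrm[OF f(2) s] by (simp add: n power2_eq_square)
  finally show "(NN x. ennreal (gauss z) * ennreal (cmod (f x) * cmod (f (x + e *\<^sub>R z))))
    \<le> ennreal (gauss z) * ennreal ((nrm f)^2)"
   by (subst nn_integral_cmult) (auto intro: mult_left_mono)
 qed
 also have "\<dots> = ennreal ((nrm f)^2)"
  by (subst nn_integral_multc) (auto simp: gauss_nn_integral)
 finally have J: "cmod ?J \<le> (nrm f)^2" by simp
 have "(LBINT y. (cmod (fourier f y))^2 * damp e y) \<le> cmod (cx (LBINT y. (cmod (fourier f y))^2 * damp e y))"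
  by (simp add: abs_ge_self)
 also have "\<dots> = (2 * pi) ^ CARD('n) * cmod ?J"
  unfolding fourier_square_damped[OF f(1) e] by (simp add: norm_mult norm_power)
 also have "\<dots> \<le> (2 * pi) ^ CARD('n) * (nrm f)^2"
  using J by (intro mult_left_mono) auto
 finally show ?thesis .
qed

abbreviation eps :: "nat \<Rightarrow> real" where "eps k \<equiv> 1 / real (Suc k)"

lemma eps_tendsto: "eps \<longlonglongrightarrow> 0"
 using LIMSEQ_inverse_real_of_nat by (simp add: inverse_eq_divide)

lemma damp_tendsto: "(\<lambda>k. damp (eps k) z) \<longlonglongrightarrow> 1"
proof -
 have "(\<lambda>k. exp (- ((eps k)^2 * (norm z)^2 / 2))) \<longlonglongrightarrow> exp (- (0^2 * (norm z)^2 / 2))"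
  by (intro tendsto_intros eps_tendsto) auto
 then show ?thesis by (simp add: damp_def)
qed

text \<open>The damping is removed by Fatou's lemma. Only an inequality results, but it contains the
  square integrability of the transform, which the dominated convergence for the equality
  needs.\<close>

lemma fourier_Bessel:
 fixes f :: "real^'n \<Rightarrow> complex"
 assumes f: "integrable lborel f" "sqi f"
 shows "sqi (fourier f)" "nrm (fourier f) \<le> sqrt ((2 * pi) ^ CARD('n)) * nrm f"
proof -
 have [measurable]: "f \<in> borel_measurable borel" using f by auto
 define h where "h k z = fourier f z * cx (sqrt (damp (eps k) z))" for k z
 have [measurable]: "h k \<in> borel_measurable borel" for k unfolding h_def[abs_def] by measurable
 have h2: "(cmod (h k z))^2 = (cmod (fourier f z))^2 * damp (eps k) z" for k z
  using damp_bounds(1)[of "eps k" z] by (simp add: h_def norm_mult power_mult_distrib)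
 have sq: "sqi (h k)" for k
 proof -
  have "integrable lborel (\<lambda>z::real^'n. (LBINT x. cmod (f x))^2 * damp (eps k) z)"
   using damp_integrable[of "eps k"] by auto
  then have "integrable lborel (\<lambda>z. (cmod (h k z))^2)"
  proof (rule Bochner_Integration.integrable_bound)
   show "AE z in lborel. norm ((cmod (h k z))^2) \<le> norm ((LBINT x. cmod (f x))^2 * damp (eps k) z)"
    unfolding h2 using norm_fourier_le[OF f(1)] damp_bounds(1)[of "eps k"]
    by (auto simp: abs_mult less_imp_le intro!: mult_right_mono power_mono)
  qed simp
  then show ?thesis by (simp add: sqi_on_def)
 qed
 have bd: "nrm (h k) \<le> sqrt ((2 * pi) ^ CARD('n)) * nrm f" for k
  using fourier_square_damped_le[OF f, of "eps k"]
  by (simp add: nrm_on_def[of _ "h k"] h2 real_le_lsqrt power_mult_distrib)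
 have ae: "AE z in lborel. (\<lambda>k. h k z) \<longlonglongrightarrow> fourier f z"
 proof (rule AE_I2)
  fix z
  have "(\<lambda>k. fourier f z * cx (sqrt (damp (eps k) z))) \<longlonglongrightarrow> fourier f z * cx (sqrt 1)"
   by (intro tendsto_intros damp_tendsto)
  then show "(\<lambda>k. h k z) \<longlonglongrightarrow> fourier f z" by (simp add: h_def)
 qed
 show "sqi (fourier f)" "nrm (fourier f) \<le> sqrt ((2 * pi) ^ CARD('n)) * nrm f"
  using nrm_le_liminf[OF sq _ ae bd] by auto
qed

text \<open>For continuous \<open>f\<close> of compact support the Gaussian averages are bounded and
  converge pointwise to \<open>f\<close>, so both sides of \<open>fourier_square_damped\<close> pass
  to the limit.\<close>

lemma Plancherel_Cc:
 fixes f :: "real^'n \<Rightarrow> complex"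
 assumes f: "Cc f"
 shows "(nrm (fourier f))^2 = (2 * pi) ^ CARD('n) * (nrm f)^2"
proof -
 have [measurable]: "f \<in> borel_measurable borel" using f by auto
 have fi: "integrable lborel f" and fs: "sqi f" using f by (auto intro: Cc_integrable Cc_sqi)
 obtain B R where B: "0 < B" "0 < R" "\<And>x. cmod (f x) \<le> B * indicator (cball 0 R) x" using Cc_bounded[OF f] by blast
 have B': "cmod (f x) \<le> B" for x
  using B(1) order_trans[OF B(3)[of x], of B] by (auto simp: indicator_def)
 have "(\<lambda>k. LBINT y. (cmod (fourier f y))^2 * damp (eps k) y) \<longlonglongrightarrow> (LBINT y. (cmod (fourier f y))^2)"
 proof (rule integral_dominated_convergence[where w = "\<lambda>y. (cmod (fourier f y))^2"])
  show "AE y in lborel. (\<lambda>k. (cmod (fourier f y))^2 * damp (eps k) y) \<longlonglongrightarrow> (cmod (fourier f y))^2"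
   using tendsto_mult[OF tendsto_const damp_tendsto] by (intro AE_I2) fastforce
  show "AE y in lborel. norm ((cmod (fourier f y))^2 * damp (eps k) y) \<le> (cmod (fourier f y))^2" for k
   by (intro AE_I2) (simp add: abs_mult abs_of_pos[OF damp_bounds(1)] mult_left_le damp_bounds(2) del: of_nat_Suc)
  show "integrable lborel (\<lambda>y. (cmod (fourier f y))^2)"
   using fourier_Bessel(1)[OF fi fs] by (simp add: sqi_on_def)
 qed auto
 then have "(\<lambda>k. cx (LBINT y. (cmod (fourier f y))^2 * damp (eps k) y)) \<longlonglongrightarrow> cx ((nrm (fourier f))^2)"
  unfolding nrm_square by (rule tendsto_of_real)
 moreover have "(\<lambda>k. LBINT x. f x * cnj (LBINT z. f (x + eps k *\<^sub>R z) * cx (gauss z))) \<longlonglongrightarrow> (LBINT x. f x * cnj (f x))"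
 proof (rule integral_dominated_convergence[where w = "\<lambda>x. cmod (f x) * B"])
  show "AE x in lborel. (\<lambda>k. f x * cnj (LBINT z. f (x + eps k *\<^sub>R z) * cx (gauss z))) \<longlonglongrightarrow> f x * cnj (f x)"
  proof (rule AE_I2, intro tendsto_intros)
   fix x
   have "(\<lambda>k. LBINT z. f (x + eps k *\<^sub>R z) * cx (gauss z)) \<longlonglongrightarrow> (LINT z|(lborel :: (real^'n) measure). f x * cx (gauss z))"
   proof (rule integral_dominated_convergence[where w = "\<lambda>z. B * gauss z"])
    show "AE z in lborel. (\<lambda>k. f (x + eps k *\<^sub>R z) * cx (gauss z)) \<longlonglongrightarrow> f x * cx (gauss z)"
    proof (rule AE_I2, intro tendsto_intros)
     fix z :: "real^'n"
     have "(\<lambda>k. x + eps k *\<^sub>R z) \<longlonglongrightarrow> x + 0 *\<^sub>R z" by (intro tendsto_intros eps_tendsto)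
     then show "(\<lambda>k. f (x + eps k *\<^sub>R z)) \<longlonglongrightarrow> f x"
      using Cc_continuous[OF f] by (auto simp: continuous_on_eq_continuous_at intro: isCont_tendsto_compose)
    qed
    show "AE z in lborel. norm (f (x + eps k *\<^sub>R z) * cx (gauss z)) \<le> B * gauss z" for k
     using B' by (auto simp: norm_mult intro!: mult_right_mono)
   qed (use gauss_integrable in auto)
   also have "(LINT z|(lborel :: (real^'n) measure). f x * cx (gauss z)) = f x * cx (LINT z|(lborel :: (real^'n) measure). gauss z)"
    by (subst integral_mult_right_zero) (simp add: integral_complex_of_real)
   finally show "(\<lambda>k. LBINT z. f (x + eps k *\<^sub>R z) * cx (gauss z)) \<longlonglongrightarrow> f x"
    by (simp add: gauss_integral)
  qed
  show "AE x in lborel. norm (f x * cnj (LBINT z. f (x + eps k *\<^sub>R z) * cx (gauss z))) \<le> cmod (f x) * B" for k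
  proof (rule AE_I2)
   fix x
   have "ennreal (cmod (LBINT z. f (x + eps k *\<^sub>R z) * cx (gauss z))) \<le> (NN z. ennreal (cmod (f (x + eps k *\<^sub>R z) * cx (gauss z))))"
    by (rule norm_integral_le_nn_integral)
   also have "\<dots> \<le> (\<integral>\<^sup>+z. ennreal B * ennreal (gauss z) \<partial>(lborel :: (real^'n) measure))"
    using B' B(1) by (intro nn_integral_mono) (auto simp: norm_mult simp flip: ennreal_mult intro!: ennreal_leI mult_right_mono)
   also have "\<dots> = ennreal B" by (subst nn_integral_cmult) (auto simp: gauss_nn_integral)
   finally have "cmod (LBINT z. f (x + eps k *\<^sub>R z) * cx (gauss z)) \<le> B" using B(1) by simp
   then show "norm (f x * cnj (LBINT z. f (x + eps k *\<^sub>R z) * cx (gauss z))) \<le> cmod (f x) * B"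
    by (simp add: norm_mult mult_left_mono)
  qed
  show "(\<lambda>x. f x * cnj (LBINT z. f (x + eps k *\<^sub>R z) * cx (gauss z))) \<in> borel_measurable lborel" for k
   by measurable
 qed (use fi in auto)
 then have "(\<lambda>k. (2 * pi) ^ CARD('n) * (LBINT x. f x * cnj (LBINT z. f (x + eps k *\<^sub>R z) * cx (gauss z)))) \<longlonglongrightarrow> (2 * pi) ^ CARD('n) * (LBINT x. f x * cnj (f x))"
  by (intro tendsto_intros)
 moreover have "(LBINT x. f x * cnj (f x)) = cx ((nrm f)^2)"
  unfolding nrm_square by (subst integral_complex_of_real[symmetric]) (simp add: complex_norm_square del: of_real_power)
 ultimately have "cx ((nrm (fourier f))^2) = (2 * pi) ^ CARD('n) * cx ((nrm f)^2)"
  by (simp add: fourier_square_damped[OF fi] LIMSEQ_unique)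
 then show ?thesis
  by (metis (no_types, lifting) of_real_eq_iff of_real_mult of_real_numeral of_real_power)
qed

text \<open>By \<open>fourier_Bessel\<close> both sides are continuous in the norm, and the equality
  extends from the dense subset.\<close>

lemma Plancherel_L1:
 fixes f :: "real^'n \<Rightarrow> complex"
 assumes f: "integrable lborel f" "sqi f"
 shows "sqi (fourier f)" "nrm (fourier f) = sqrt ((2 * pi) ^ CARD('n)) * nrm f"
proof -
 let ?c = "sqrt ((2 * pi) ^ CARD('n))"
 have c: "?c > 0" by simp
 show sf: "sqi (fourier f)" by (rule fourier_Bessel[OF f])
 have "?c * nrm f \<le> nrm (fourier f) + e" if e: "e > 0" for e
 proof -
  obtain g where g: "Cc g" "nrm (\<lambda>x. f x - g x) < e / (2 * ?c)"
   using Cc_dense[OF f(2), of "e / (2 * ?c)"] e c by auto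
  have gi: "integrable lborel g" "sqi g" using g by (auto intro: Cc_integrable Cc_sqi)
  have d: "integrable lborel (\<lambda>x. g x - f x)" "sqi (\<lambda>x. g x - f x)"
   using f gi by (auto intro: sqi_diff)
  have sg: "sqi (fourier g)" by (rule fourier_Bessel[OF gi])
  have "?c * nrm g = sqrt ((nrm (fourier g))^2)"
   unfolding Plancherel_Cc[OF g(1)] by (simp add: real_sqrt_mult)
  then have "?c * nrm g = nrm (fourier g)" by simp
  also have "\<dots> \<le> nrm (fourier f) + nrm (\<lambda>z. fourier g z - fourier f z)"
   by (rule nrm_triangle_sub[OF sg sf])
  also have "nrm (\<lambda>z. fourier g z - fourier f z) \<le> ?c * nrm (\<lambda>x. g x - f x)"
  proof -
   have "fourier (\<lambda>x. g x - f x) = (\<lambda>z. fourier g z - fourier f z)"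
    by (rule ext) (rule fourier_diff[OF gi(1) f(1)])
   then show ?thesis using fourier_Bessel(2)[OF d] by simp
  qed
  finally have 1: "?c * nrm g \<le> nrm (fourier f) + ?c * nrm (\<lambda>x. f x - g x)"
   by (simp only: nrm_minus_commute[of lborel f g])
  have "?c * nrm f \<le> ?c * (nrm g + nrm (\<lambda>x. f x - g x))"
   using nrm_triangle_sub[OF f(2) gi(2)] c by (intro mult_left_mono) auto
  then have "?c * nrm f \<le> nrm (fourier f) + 2 * ?c * nrm (\<lambda>x. f x - g x)"
   using 1 by (simp add: algebra_simps)
  also have "2 * ?c * nrm (\<lambda>x. f x - g x) \<le> e" using g(2) c by (simp add: field_simps)
  finally show ?thesis by simp
 qed
 then have "?c * nrm f \<le> nrm (fourier f)" by (rule field_le_epsilon)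
 with fourier_Bessel(2)[OF f] show "nrm (fourier f) = ?c * nrm f" by simp
qed

section \<open>The Plancherel transform of square integrable functions\<close>

definition trunc :: "real \<Rightarrow> (real^'n \<Rightarrow> complex) \<Rightarrow> real^'n \<Rightarrow> complex" where
 "trunc R f x = indicator (cball 0 R) x * f x"

text \<open>A relation, since a transform is determined only up to a null set. The limit over
  \<open>R\<close> is the one that defines \<open>fourier_L2\<close>.\<close>

definition FT :: "(real^'n \<Rightarrow> complex) \<Rightarrow> (real^'n \<Rightarrow> complex) \<Rightarrow> bool" where
 "FT f g \<longleftrightarrow> sqi f \<and> sqi g \<and>
   ((\<lambda>R. nrm (\<lambda>z. fourier (trunc R f) z - g z)) \<longlongrightarrow> 0) at_top"

lemma FT_sqi: "FT f g \<Longrightarrow> sqi f" "FT f g \<Longrightarrow> sqi g"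
 by (simp_all add: FT_def)

lemma FT_measurable: "FT f g \<Longrightarrow> f \<in> borel_measurable borel" "FT f g \<Longrightarrow> g \<in> borel_measurable borel"
 using FT_sqi[of f g] by (auto simp: sqi_on_def)

lemma sqi_trunc: "sqi f \<Longrightarrow> sqi (trunc R f)"
 unfolding trunc_def[abs_def] by (rule sqi_indicator) auto

lemma integrable_trunc:
 assumes f: "sqi f"
 shows "integrable lborel (trunc R f)"
proof -
 have "sqi (\<lambda>x::real^'a. indicator (cball 0 R) x :: complex)"
 proof -
  have "(\<lambda>x::real^'a. (cmod (indicator (cball 0 R) x))^2) = indicator (cball 0 R)"
   by (auto simp: indicator_def)
  moreover have "(indicator (cball 0 R) :: real^'a \<Rightarrow> complex) \<in> borel_measurable lborel"
   by (rule borel_measurable_indicator) simp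
  ultimately show ?thesis using integrable_indicator_cball[of "0::real^'a" R] unfolding sqi_on_def by simp
 qed
 from integrable_mult_sqi[OF this f] show ?thesis by (simp add: trunc_def[abs_def])
qed

lemma nrm_trunc_tendsto:
 assumes f: "sqi f"
 shows "((\<lambda>R. nrm (\<lambda>x. trunc R f x - f x)) \<longlongrightarrow> 0) at_top"
proof (rule tendstoI)
 fix e :: real assume e: "e > 0"
 have [measurable]: "f \<in> borel_measurable borel" using f by (simp add: sqi_on_def)
 have "(\<lambda>n. nrm (\<lambda>x. f x - indicator (cball 0 (real n)) x * f x)) \<longlonglongrightarrow> 0"
 proof (rule tendsto_nrm_truncation[OF f])
  fix x :: "real^'a"
  obtain k :: nat where "norm x \<le> real k" using real_arch_simple by blast
  then have "x \<in> cball 0 (real n)" if "n \<ge> k" for n using that by simp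
  then show "\<forall>\<^sub>F n in sequentially. x \<in> cball 0 (real n)" by (auto simp: eventually_sequentially)
 qed simp
 from order_tendstoD(2)[OF this e] obtain n where n: "nrm (\<lambda>x. f x - trunc (real n) f x) < e"
  by (auto simp: eventually_sequentially trunc_def)
 have "nrm (\<lambda>x. trunc R f x - f x) < e" if "R \<ge> real n" for R
 proof (rule le_less_trans[OF nrm_mono n])
  show "sqi (\<lambda>x. f x - trunc (real n) f x)" by (intro sqi_diff f sqi_trunc)
  show "AE x in lborel. cmod (trunc R f x - f x) \<le> cmod (f x - trunc (real n) f x)"
   using that by (intro AE_I2) (auto simp: trunc_def indicator_def)
  show "(\<lambda>x. trunc R f x - f x) \<in> borel_measurable lborel"
   using sqi_diff[OF sqi_trunc[OF f] f] by (simp add: sqi_on_def)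
 qed
 then show "\<forall>\<^sub>F R in at_top. dist (nrm (\<lambda>x. trunc R f x - f x)) 0 < e"
  by (auto simp: eventually_at_top_linorder)
qed

lemma fourier_diff_nrm:
 fixes f g :: "real^'n \<Rightarrow> complex"
 assumes "integrable lborel f" "sqi f" "integrable lborel g" "sqi g"
 shows "nrm (\<lambda>z. fourier f z - fourier g z) = sqrt ((2 * pi) ^ CARD('n)) * nrm (\<lambda>x. f x - g x)"
proof -
 have "fourier (\<lambda>x. f x - g x) = (\<lambda>z. fourier f z - fourier g z)"
  by (rule ext) (rule fourier_diff[OF assms(1,3)])
 then show ?thesis using Plancherel_L1(2)[of "\<lambda>x. f x - g x"] assms by (auto intro: sqi_diff)
qed

text \<open>Any integrable approximants may stand in for the truncations: Plancherel, applied to the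
  difference of a truncation and an approximant, compares the two limits.\<close>

lemma FT_limitI:
 fixes f g :: "real^'n \<Rightarrow> complex"
 assumes f: "sqi f" and g: "sqi g"
  and h: "\<And>k. integrable lborel (h k)" "\<And>k. sqi (h k)"
  and lim: "(\<lambda>k. nrm (\<lambda>x. h k x - f x)) \<longlonglongrightarrow> 0" "(\<lambda>k. nrm (\<lambda>z. fourier (h k) z - g z)) \<longlonglongrightarrow> 0"
 shows "FT f g"
proof -
 let ?c = "sqrt ((2 * pi) ^ CARD('n))"
 have le: "nrm (\<lambda>z. fourier (trunc R f) z - g z) \<le> ?c * nrm (\<lambda>x. trunc R f x - f x)" for R
 proof -
  have t: "integrable lborel (trunc R f)" "sqi (trunc R f)" using f integrable_trunc sqi_trunc by auto
  have le: "nrm (\<lambda>z. fourier (trunc R f) z - g z)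
    \<le> ?c * (nrm (\<lambda>x. trunc R f x - f x) + nrm (\<lambda>x. h k x - f x)) + nrm (\<lambda>z. fourier (h k) z - g z)" for k
  proof -
   have "nrm (\<lambda>z. fourier (trunc R f) z - g z)
     \<le> nrm (\<lambda>z. fourier (trunc R f) z - fourier (h k) z) + nrm (\<lambda>z. fourier (h k) z - g z)"
    by (intro nrm_diff_triangle Plancherel_L1(1) t h g)
   also have "nrm (\<lambda>z. fourier (trunc R f) z - fourier (h k) z) = ?c * nrm (\<lambda>x. trunc R f x - h k x)"
    by (rule fourier_diff_nrm[OF t h])
   also have "nrm (\<lambda>x. trunc R f x - h k x) \<le> nrm (\<lambda>x. trunc R f x - f x) + nrm (\<lambda>x. f x - h k x)"
    by (intro nrm_diff_triangle t h f)
   finally show ?thesis by (simp add: nrm_minus_commute[of lborel f "h k"])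
  qed
  have "(\<lambda>k. ?c * (nrm (\<lambda>x. trunc R f x - f x) + nrm (\<lambda>x. h k x - f x)) + nrm (\<lambda>z. fourier (h k) z - g z))
    \<longlonglongrightarrow> ?c * (nrm (\<lambda>x. trunc R f x - f x) + 0) + 0"
   by (rule tendsto_add[OF tendsto_mult[OF tendsto_const tendsto_add[OF tendsto_const lim(1)]] lim(2)])
  from LIMSEQ_le_const[OF this exI[of _ 0]] le
  have "nrm (\<lambda>z. fourier (trunc R f) z - g z) \<le> ?c * (nrm (\<lambda>x. trunc R f x - f x) + 0) + 0"
   by blast
  then show ?thesis by simp
 qed
 have lim0: "((\<lambda>R. ?c * nrm (\<lambda>x. trunc R f x - f x)) \<longlongrightarrow> 0) at_top"
  using tendsto_mult[OF tendsto_const[of ?c] nrm_trunc_tendsto[OF f]] by (simp only: mult_zero_right)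
 have le': "norm (nrm (\<lambda>z. fourier (trunc R f) z - g z)) \<le> ?c * nrm (\<lambda>x. trunc R f x - f x)" for R
  using le[of R] by (simp only: real_norm_def abs_of_nonneg[OF nrm_nonneg])
 have "((\<lambda>R. nrm (\<lambda>z. fourier (trunc R f) z - g z)) \<longlongrightarrow> 0) at_top"
  by (rule Lim_null_comparison[OF always_eventually[OF allI[OF le']] lim0])
 then show ?thesis using f g by (simp add: FT_def)
qed

lemma FT_seq:
 assumes "FT f g"
 shows "(\<lambda>k. nrm (\<lambda>x. trunc (real k) f x - f x)) \<longlonglongrightarrow> 0"
  "(\<lambda>k. nrm (\<lambda>z. fourier (trunc (real k) f) z - g z)) \<longlonglongrightarrow> 0"
proof -
 have t: "((\<lambda>R. nrm (\<lambda>z. fourier (trunc R f) z - g z)) \<longlongrightarrow> 0) at_top"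
  using assms by (simp add: FT_def)
 show "(\<lambda>k. nrm (\<lambda>x. trunc (real k) f x - f x)) \<longlonglongrightarrow> 0"
  using filterlim_compose[OF nrm_trunc_tendsto[OF FT_sqi(1)[OF assms]] filterlim_real_sequentially] .
 show "(\<lambda>k. nrm (\<lambda>z. fourier (trunc (real k) f) z - g z)) \<longlonglongrightarrow> 0"
  using filterlim_compose[OF t filterlim_real_sequentially] .
qed

lemma FT_exists:
 fixes f :: "real^'n \<Rightarrow> complex"
 assumes f: "sqi f"
 shows "\<exists>g. FT f g"
proof -
 let ?c = "sqrt ((2 * pi) ^ CARD('n))"
 have c: "?c > 0" by simp
 define h where "h k = trunc (real k) f" for k :: nat
 have h: "integrable lborel (h k)" "sqi (h k)" for k unfolding h_def using f integrable_trunc sqi_trunc by auto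
 have lim: "(\<lambda>k. nrm (\<lambda>x. h k x - f x)) \<longlonglongrightarrow> 0"
  unfolding h_def using filterlim_compose[OF nrm_trunc_tendsto[OF f] filterlim_real_sequentially] .
 have "\<exists>N. \<forall>m\<ge>N. \<forall>n\<ge>N. nrm (\<lambda>z. fourier (h m) z - fourier (h n) z) < e" if e: "e > 0" for e
 proof -
  have "e / (2 * ?c) > 0" using e c by simp
  from order_tendstoD(2)[OF lim this] obtain N where N: "\<And>k. k \<ge> N \<Longrightarrow> nrm (\<lambda>x. h k x - f x) < e / (2 * ?c)"
   by (auto simp: eventually_sequentially)
  have "nrm (\<lambda>z. fourier (h m) z - fourier (h n) z) < e" if "m \<ge> N" "n \<ge> N" for m n
  proof -
   have "nrm (\<lambda>x. h m x - h n x) \<le> nrm (\<lambda>x. h m x - f x) + nrm (\<lambda>x. f x - h n x)"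
    by (intro nrm_diff_triangle h f)
   also have "\<dots> < e / (2 * ?c) + e / (2 * ?c)"
    using N[OF that(1)] N[OF that(2)] by (intro add_strict_mono) (simp_all only: nrm_minus_commute[of lborel f])
   also have "\<dots> = e / ?c" by simp
   finally show ?thesis using c unfolding fourier_diff_nrm[OF h h] by (simp add: pos_less_divide_eq mult.commute)
  qed
  then show ?thesis by blast
 qed
 then obtain g where "sqi g" "(\<lambda>n. nrm (\<lambda>z. fourier (h n) z - g z)) \<longlonglongrightarrow> 0"
  using sqi_complete[of lborel "\<lambda>n. fourier (h n)", OF Plancherel_L1(1)[OF h]] by blast
 then show ?thesis using FT_limitI[OF f _ h lim] by blast
qed

lemma tendsto_nrm:
 assumes "\<And>k. sqi_on M (h k)" "sqi_on M f" "(\<lambda>k. nrm_on M (\<lambda>x. h k x - f x)) \<longlonglongrightarrow> 0"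
 shows "(\<lambda>k. nrm_on M (h k)) \<longlonglongrightarrow> nrm_on M f"
proof -
 have "(\<lambda>k. nrm_on M (h k) - nrm_on M f) \<longlonglongrightarrow> 0"
  using nrm_abs_diff[OF assms(1,2)] by (intro Lim_null_comparison[OF always_eventually[OF allI] assms(3)]) simp
 then show ?thesis by (simp add: LIM_zero_iff)
qed

lemma Plancherel:
 fixes f g :: "real^'n \<Rightarrow> complex"
 assumes "FT f g"
 shows "nrm g = sqrt ((2 * pi) ^ CARD('n)) * nrm f"
proof -
 let ?h = "\<lambda>k. trunc (real k) f"
 note f = FT_sqi(1)[OF assms] and g = FT_sqi(2)[OF assms]
 have h: "integrable lborel (?h k)" "sqi (?h k)" for k using f integrable_trunc sqi_trunc by auto
 have "(\<lambda>k. nrm (fourier (?h k))) \<longlonglongrightarrow> nrm g"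
  by (rule tendsto_nrm[OF Plancherel_L1(1)[OF h] g FT_seq(2)[OF assms]])
 moreover have "(\<lambda>k. sqrt ((2 * pi) ^ CARD('n)) * nrm (?h k)) \<longlonglongrightarrow> sqrt ((2 * pi) ^ CARD('n)) * nrm f"
  by (intro tendsto_intros tendsto_nrm[OF h(2) f FT_seq(1)[OF assms]])
 ultimately show ?thesis unfolding Plancherel_L1(2)[OF h] by (rule LIMSEQ_unique)
qed

lemma Plancherel_square:
 fixes f g :: "real^'n \<Rightarrow> complex"
 assumes "FT f g"
 shows "(nrm g)^2 = (2 * pi) ^ CARD('n) * (nrm f)^2"
 unfolding Plancherel[OF assms] by (simp add: power_mult_distrib)

lemma FT_linear:
 fixes f g p q :: "real^'n \<Rightarrow> complex"
 assumes fg: "FT f g" and pq: "FT p q"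
 shows "FT (\<lambda>x. a * f x + b * p x) (\<lambda>y. a * g y + b * q y)"
proof -
 define h where "h k x = a * trunc (real k) f x + b * trunc (real k) p x" for k x
 note s = FT_sqi[OF fg] FT_sqi[OF pq]
 have i: "integrable lborel (trunc (real k) f)" "integrable lborel (trunc (real k) p)" for k
  using s integrable_trunc by auto
 have t: "sqi (trunc (real k) f)" "sqi (trunc (real k) p)" for k
  using s sqi_trunc by auto
 have F: "fourier (h k) y = a * fourier (trunc (real k) f) y + b * fourier (trunc (real k) p) y" for k y
  unfolding h_def[abs_def] by (rule fourier_add[OF i])
 have tri: "nrm (\<lambda>x. (a * u x + b * v x) - (a * u' x + b * v' x))
   \<le> cmod a * nrm (\<lambda>x. u x - u' x) + cmod b * nrm (\<lambda>x. v x - v' x)"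
  if "sqi u" "sqi v" "sqi u'" "sqi v'" for u v u' v' :: "real^'n \<Rightarrow> complex"
 proof -
  have "nrm (\<lambda>x. a * (u x - u' x) + b * (v x - v' x)) \<le> nrm (\<lambda>x. a * (u x - u' x)) + nrm (\<lambda>x. b * (v x - v' x))"
   by (intro nrm_triangle sqi_scale sqi_diff that)
  then show ?thesis unfolding nrm_scale by (simp add: algebra_simps)
 qed
 show ?thesis
 proof (rule FT_limitI[where h = h])
  show "integrable lborel (h k)" for k unfolding h_def[abs_def] using i by auto
  show "sqi (h k)" for k unfolding h_def[abs_def] by (intro sqi_add sqi_scale t)
  have z: "(\<lambda>k. cmod a * A k + cmod b * B k) \<longlonglongrightarrow> 0" if "A \<longlonglongrightarrow> 0" "B \<longlonglongrightarrow> 0" for A B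
   using tendsto_add[OF tendsto_mult[OF tendsto_const that(1)] tendsto_mult[OF tendsto_const that(2)], of "cmod a" "cmod b"] by simp
  show "(\<lambda>k. nrm (\<lambda>x. h k x - (a * f x + b * p x))) \<longlonglongrightarrow> 0"
   by (rule Lim_null_comparison[OF always_eventually[OF allI] z[OF FT_seq(1)[OF fg] FT_seq(1)[OF pq]]])
     (simp only: real_norm_def abs_of_nonneg[OF nrm_nonneg] h_def, rule tri[OF t s(1) s(3)])
  show "(\<lambda>k. nrm (\<lambda>y. fourier (h k) y - (a * g y + b * q y))) \<longlonglongrightarrow> 0"
   by (rule Lim_null_comparison[OF always_eventually[OF allI] z[OF FT_seq(2)[OF fg] FT_seq(2)[OF pq]]])
     (simp only: real_norm_def abs_of_nonneg[OF nrm_nonneg] F, rule tri[OF Plancherel_L1(1)[OF i(1) t(1)] Plancherel_L1(1)[OF i(2) t(2)] s(2) s(4)])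
 qed (intro sqi_add sqi_scale s)+
qed

lemma FT_diff: "FT f g \<Longrightarrow> FT p q \<Longrightarrow> FT (\<lambda>x. f x - p x) (\<lambda>z. g z - q z)"
 using FT_linear[of f g p q 1 "-1"] by simp

lemma FT_scale: "FT f g \<Longrightarrow> FT (\<lambda>x. a * f x) (\<lambda>z. a * g z)"
 using FT_linear[of f g f g a 0] by simp

lemma FT_unique:
 assumes "FT f g" "FT f g'"
 shows "AE z in lborel. g z = g' z"
proof -
 have "FT (\<lambda>x. f x - f x) (\<lambda>z. g z - g' z)" by (rule FT_diff[OF assms])
 from Plancherel[OF this] have "nrm (\<lambda>z. g z - g' z) = 0" by (simp add: nrm_on_def)
 then show ?thesis using nrm_eq_0[OF sqi_diff[OF FT_sqi(2)[OF assms(1)] FT_sqi(2)[OF assms(2)]]] by simp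
qed

lemma FT_cong:
 assumes fg: "FT f g" and "AE x in lborel. f x = f' x" "AE z in lborel. g z = g' z"
  and [measurable]: "f' \<in> borel_measurable borel" "g' \<in> borel_measurable borel"
 shows "FT f' g'"
proof -
 note [measurable] = FT_measurable[OF fg]
 have f': "sqi f'" and g': "sqi g'"
  using sqi_cong_AE[OF FT_sqi(1)[OF fg], of f'] sqi_cong_AE[OF FT_sqi(2)[OF fg], of g'] assms by auto
 have m [measurable]: "trunc R f \<in> borel_measurable borel" "trunc R f' \<in> borel_measurable borel" for R
  using sqi_trunc[OF f'] sqi_trunc[OF FT_sqi(1)[OF fg]] by (auto simp: sqi_on_def)
 have "fourier (trunc R f') z = fourier (trunc R f) z" for R z
 proof -
  have ae: "AE x in lborel. trunc R f' x * ekern x z = trunc R f x * ekern x z"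
   using assms(2) by eventually_elim (simp add: trunc_def)
  have "(LBINT x. trunc R f' x * ekern x z) = (LBINT x. trunc R f x * ekern x z)"
   by (rule integral_cong_AE[OF _ _ ae]) measurable
  then show ?thesis by (simp add: fourier_lborel m)
 qed
 moreover have "nrm (\<lambda>z. fourier (trunc R f) z - g' z) = nrm (\<lambda>z. fourier (trunc R f) z - g z)" for R
 proof -
  have ae: "AE z in lborel. fourier (trunc R f) z - g' z = fourier (trunc R f) z - g z"
   using assms(3) by eventually_elim simp
  show ?thesis by (rule nrm_cong_AE[OF _ _ ae]) measurable
 qed
 ultimately show ?thesis using fg f' g' by (simp add: FT_def)
qed

lemma FT_L1:
 assumes f: "integrable lborel f" "sqi f"
 shows "FT f (fourier f)"
 by (rule FT_limitI[where h = "\<lambda>k. f"]) (use f Plancherel_L1(1)[OF f] in \<open>auto simp: nrm_on_def\<close>)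

section \<open>Multiplication formula, inversion and Parseval's identity\<close>

lemma tendsto_integral_mult_sqi:
 assumes h: "\<And>k. sqi_on M (h k)" "sqi_on M f" "(\<lambda>k. nrm_on M (\<lambda>x. h k x - f x)) \<longlonglongrightarrow> 0"
  and l: "\<And>k. sqi_on M (l k)" "sqi_on M g" "(\<lambda>k. nrm_on M (\<lambda>x. l k x - g x)) \<longlonglongrightarrow> 0"
 shows "(\<lambda>k. LINT x|M. h k x * l k x) \<longlonglongrightarrow> (LINT x|M. f x * g x)"
proof -
 have "cmod ((LINT x|M. h k x * l k x) - (LINT x|M. f x * g x))
   \<le> nrm_on M (\<lambda>x. h k x - f x) * nrm_on M (l k) + nrm_on M f * nrm_on M (\<lambda>x. l k x - g x)" for k
 proof -
  have 1: "sqi_on M (\<lambda>x. h k x - f x)" "sqi_on M (\<lambda>x. l k x - g x)" by (auto intro: sqi_diff h l)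
  have "(LINT x|M. (h k x - f x) * l k x) = (LINT x|M. h k x * l k x) - (LINT x|M. f x * l k x)"
   unfolding left_diff_distrib by (intro Bochner_Integration.integral_diff integrable_mult_sqi h l)
  moreover have "(LINT x|M. f x * (l k x - g x)) = (LINT x|M. f x * l k x) - (LINT x|M. f x * g x)"
   unfolding right_diff_distrib by (intro Bochner_Integration.integral_diff integrable_mult_sqi h l)
  ultimately have "(LINT x|M. h k x * l k x) - (LINT x|M. f x * g x)
    = (LINT x|M. (h k x - f x) * l k x) + (LINT x|M. f x * (l k x - g x))"
   by simp
  also have "cmod \<dots> \<le> cmod (LINT x|M. (h k x - f x) * l k x) + cmod (LINT x|M. f x * (l k x - g x))"
   by (rule norm_triangle_ineq)
  also have "\<dots> \<le> nrm_on M (\<lambda>x. h k x - f x) * nrm_on M (l k) + nrm_on M f * nrm_on M (\<lambda>x. l k x - g x)"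
   by (intro add_mono norm_integral_mult_le 1 h l)
  finally show ?thesis .
 qed
 moreover have "(\<lambda>k. nrm_on M (\<lambda>x. h k x - f x) * nrm_on M (l k) + nrm_on M f * nrm_on M (\<lambda>x. l k x - g x)) \<longlonglongrightarrow> 0"
 proof -
  have "(\<lambda>k. nrm_on M (l k)) \<longlonglongrightarrow> nrm_on M g" by (rule tendsto_nrm) (fact l)+
  from tendsto_add[OF tendsto_mult[OF h(3) this] tendsto_mult[OF tendsto_const[of "nrm_on M f"] l(3)]]
  show ?thesis by simp
 qed
 ultimately have "(\<lambda>k. (LINT x|M. h k x * l k x) - (LINT x|M. f x * g x)) \<longlonglongrightarrow> 0"
  by (rule Lim_null_comparison[OF always_eventually[OF allI]])
 then show ?thesis by (simp add: LIM_zero_iff)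
qed

lemma FT_mult:
 assumes fg: "FT f g" and pq: "FT p q"
 shows "(LBINT x. g x * p x) = (LBINT x. f x * q x)"
proof -
 note s = FT_sqi[OF fg] FT_sqi[OF pq]
 have i: "integrable lborel (trunc (real k) f)" "integrable lborel (trunc (real k) p)" for k
  using s integrable_trunc by auto
 have t: "sqi (trunc (real k) f)" "sqi (trunc (real k) p)" for k
  using s sqi_trunc by auto
 have "(\<lambda>k. LBINT x. fourier (trunc (real k) f) x * trunc (real k) p x) \<longlonglongrightarrow> (LBINT x. g x * p x)"
  by (rule tendsto_integral_mult_sqi[OF Plancherel_L1(1)[OF i(1) t(1)] s(2) FT_seq(2)[OF fg] t(2) s(3) FT_seq(1)[OF pq]])
 moreover have "(\<lambda>k. LBINT x. trunc (real k) f x * fourier (trunc (real k) p) x) \<longlonglongrightarrow> (LBINT x. f x * q x)"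
  by (rule tendsto_integral_mult_sqi[OF t(1) s(1) FT_seq(1)[OF fg] Plancherel_L1(1)[OF i(2) t(2)] s(4) FT_seq(2)[OF pq]])
 ultimately show ?thesis unfolding fourier_mult_L1[OF i] by (rule LIMSEQ_unique)
qed

text \<open>Inversion in a form without reflection: the transform \<open>q\<close> of
  \<open>cnj (g x)\<close> is a multiple of \<open>cnj (f x)\<close>. In the expansion of the
  squared norm of the difference the cross term is given by \<open>FT_mult\<close> and the squares
  by Plancherel, and the sum is \<open>0\<close>.\<close>

lemma FT_cnj:
 fixes f g :: "real^'n \<Rightarrow> complex"
 assumes fg: "FT f g"
 shows "FT (\<lambda>x. cnj (g x)) (\<lambda>x. (2 * pi) ^ CARD('n) * cnj (f x))"
proof -
 let ?C = "(2 * pi) ^ CARD('n)"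
 note s = FT_sqi[OF fg]
 obtain q where q: "FT (\<lambda>x. cnj (g x)) q" using FT_exists[OF sqi_cnj[OF s(2)]] by blast
 note sq = FT_sqi(2)[OF q]
 have nq: "(nrm q)^2 = ?C^2 * (nrm f)^2"
  using Plancherel_square[OF q] Plancherel_square[OF fg] by (simp add: power2_eq_square)
 have "(LBINT x. q x * f x) = (LBINT x. cnj (g x) * g x)"
  by (rule FT_mult[OF q fg])
 also have "\<dots> = cx ((nrm g)^2)"
  unfolding nrm_square by (subst integral_complex_of_real[symmetric]) (simp add: complex_norm_square mult.commute del: of_real_power)
 finally have ip: "(LBINT x. Re (q x * f x)) = ?C * (nrm f)^2"
  using integral_Re[OF integrable_mult_sqi[OF sq s(1)]] Plancherel_square[OF fg]
  by (simp only: Re_complex_of_real)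
 have "(nrm (\<lambda>x. q x - ?C * cnj (f x)))^2 = (LBINT x. (cmod (q x))^2 - 2 * ?C * Re (q x * f x) + ?C^2 * (cmod (f x))^2)"
 proof -
  have "(cmod (a - cx c * cnj b))^2 = (cmod a)^2 - 2 * c * Re (a * b) + c^2 * (cmod b)^2" for a b c
   unfolding cmod_power2 by (simp add: power2_eq_square algebra_simps)
  from this[of _ ?C] show ?thesis unfolding nrm_square by simp
 qed
 also have "\<dots> = (nrm q)^2 - 2 * ?C * (LBINT x. Re (q x * f x)) + ?C^2 * (nrm f)^2"
 proof -
  have "(LBINT x. a x - c * b x + e * d x) = (LBINT x. a x) - c * (LBINT x. b x) + e * (LBINT x. d x)"
   if "integrable lborel a" "integrable lborel b" "integrable lborel d" for a b d :: "real^'n \<Rightarrow> real" and c e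
   using that by simp
  from this[OF sqi_integrable[OF sq] integrable_Re[OF integrable_mult_sqi[OF sq s(1)]] sqi_integrable[OF s(1)]]
  show ?thesis unfolding nrm_square .
 qed
 also have "\<dots> = 0" unfolding nq ip by (simp add: power2_eq_square)
 finally have "nrm (\<lambda>x. q x - ?C * cnj (f x)) = 0" by simp
 then have "AE x in lborel. q x = ?C * cnj (f x)"
  using nrm_eq_0[OF sqi_diff[OF sq sqi_scale[OF sqi_cnj[OF s(1)]]]] by simp
 then show ?thesis
  using FT_measurable[OF fg] FT_measurable[OF q] by (intro FT_cong[OF q]) auto
qed

lemma FT_surj:
 fixes g :: "real^'n \<Rightarrow> complex"
 assumes g: "sqi g"
 shows "\<exists>f. FT f g"
proof -
 obtain q where q: "FT (\<lambda>x. cnj (g x)) q" using FT_exists[OF sqi_cnj[OF g]] by blast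
 from FT_scale[OF FT_cnj[OF q], of "1 / (2 * pi) ^ CARD('n)"] show ?thesis by auto
qed

text \<open>Inversion for the conjugate of \<open>h\<close> and the multiplication formula for the
  conjugate of \<open>p\<close>. Conjugating a transform reflects its argument, which matches the
  bilinear pairing of \<open>frac_diffusion\<close>.\<close>

lemma Parseval:
 fixes u h :: "real^'n \<Rightarrow> complex"
 assumes uh: "FT u h" and p: "integrable lborel p" "sqi p"
 shows "(2 * pi) ^ CARD('n) * (LBINT x. u x * p x) = (LBINT z. h z * fourier p (- z))"
proof -
 have c: "integrable lborel (\<lambda>x. cnj (p x))" "sqi (\<lambda>x. cnj (p x))" using p by (auto intro: sqi_cnj)
 have [measurable]: "p \<in> borel_measurable borel" using p by auto
 have fc: "fourier (\<lambda>x. cnj (p x)) z = cnj (fourier p (- z))" for z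
 proof -
  have e: "cnj (p x) * ekern x z = cnj (p x * ekern x (- z))" for x by (simp add: exp_cnj)
  have "fourier (\<lambda>x. cnj (p x)) z = (LBINT x. cnj (p x) * ekern x z)"
   by (rule fourier_lborel) measurable
  also have "\<dots> = cnj (LBINT x. p x * ekern x (- z))"
   by (simp only: e Bochner_Integration.integral_cnj)
  also have "(LBINT x. p x * ekern x (- z)) = fourier p (- z)"
   by (rule fourier_lborel[symmetric]) measurable
  finally show ?thesis .
 qed
 have "(LBINT x. ((2 * pi) ^ CARD('n) * cnj (u x)) * cnj (p x)) = (LBINT x. cnj (h x) * fourier (\<lambda>x. cnj (p x)) x)"
  by (rule FT_mult[OF FT_cnj[OF uh] FT_L1[OF c]])
 also have "\<dots> = cnj (LBINT z. h z * fourier p (- z))"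
  by (simp add: fc flip: complex_cnj_mult)
 also have "(LBINT x. ((2 * pi) ^ CARD('n) * cnj (u x)) * cnj (p x)) = cnj ((2 * pi) ^ CARD('n) * (LBINT x. u x * p x))"
  by (subst integral_mult_right_zero[symmetric]) (simp add: mult.assoc flip: Bochner_Integration.integral_cnj)
 finally show ?thesis by (metis complex_cnj_cnj)
qed

section \<open>A Remez inequality\<close>

text \<open>The denominators of Lagrange interpolation at equally spaced nodes.\<close>

lemma prod_dist_index: "a \<le> j \<Longrightarrow> (\<Prod>b\<in>{..j} - {a}. \<bar>real a - real b\<bar>) = fact a * fact (j - a)"
proof -
 assume aj: "a \<le> j"
 have 1: "(\<Prod>b<a. \<bar>real a - real b\<bar>) = fact a" for a
 proof (induction a)
  case (Suc a)
  have "(\<Prod>b<Suc a. \<bar>real (Suc a) - real b\<bar>) = real (Suc a) * (\<Prod>b<a. \<bar>real (Suc a) - real (Suc b)\<bar>)"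
   by (subst prod.lessThan_Suc_shift) simp
  with Suc show ?case by simp
 qed simp
 have 2: "(\<Prod>b\<in>{a<..a + d}. \<bar>real a - real b\<bar>) = fact d" for d
 proof (induction d)
  case (Suc d)
  have "{a<..a + Suc d} = insert (a + Suc d) {a<..a + d}" by auto
  with Suc show ?case by simp
 qed simp
 have e: "{..j} - {a} = {..<a} \<union> {a<..a + (j - a)}" using aj by auto
 have "(\<Prod>b\<in>{..j} - {a}. \<bar>real a - real b\<bar>) = (\<Prod>b<a. \<bar>real a - real b\<bar>) * (\<Prod>b\<in>{a<..a + (j - a)}. \<bar>real a - real b\<bar>)"
  unfolding e by (rule prod.union_disjoint) auto
 then show ?thesis by (simp only: 1 2)
qed

lemma Lagrange_at_zero:
 fixes x :: "nat \<Rightarrow> real" and c :: "nat \<Rightarrow> complex" and j :: nat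
 assumes inj: "inj_on x {..j}"
 defines "p \<equiv> \<lambda>r. \<Sum>m\<le>j. of_real r ^ m * c m"
 shows "c 0 = (\<Sum>a\<le>j. p (x a) * of_real (\<Prod>b\<in>{..j} - {a}. (0 - x b) / (x a - x b)))"
proof -
 define l where "l a = (\<Prod>b\<in>{..j} - {a}. smult (of_real (1 / (x a - x b))) [:- cx (x b), 1:])" for a
 define P where "P = (\<Sum>m\<le>j. monom (c m) m)"
 define L where "L = (\<Sum>a\<le>j. smult (p (x a)) (l a))"
 have polyP: "poly P z = (\<Sum>m\<le>j. z ^ m * c m)" for z
  by (simp add: P_def poly_sum poly_monom mult.commute)
 have polyl: "poly (l a) (of_real r) = of_real (\<Prod>b\<in>{..j} - {a}. (r - x b) / (x a - x b))" for a r
  by (simp add: l_def poly_prod of_real_prod diff_divide_distrib)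
 have degP: "degree P \<le> j"
  unfolding P_def by (intro degree_sum_le) (auto intro: order_trans[OF degree_monom_le])
 have degl: "degree (l a) \<le> j" if "a \<le> j" for a
 proof -
  have "degree (l a) \<le> sum (degree \<circ> (\<lambda>b. smult (of_real (1 / (x a - x b))) [:- cx (x b), 1:])) ({..j} - {a})"
   unfolding l_def by (rule degree_prod_sum_le) simp
  also have "\<dots> \<le> (\<Sum>b\<in>{..j} - {a}. 1)"
   by (intro sum_mono) (auto intro: order_trans[OF degree_smult_le])
  also have "\<dots> = j" using that by simp
  finally show ?thesis .
 qed
 have degL: "degree L \<le> j"
  unfolding L_def by (intro degree_sum_le) (auto intro: order_trans[OF degree_smult_le] degl)
 have "P = L"
 proof (rule poly_eqI_degree[where A = "(\<lambda>a. cx (x a)) ` {..j}"])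
  have "inj_on (\<lambda>a. cx (x a)) {..j}" using inj by (auto simp: inj_on_def)
  then have card: "card ((\<lambda>a. cx (x a)) ` {..j}) = Suc j" by (simp add: card_image)
  then show "degree P < card ((\<lambda>a. cx (x a)) ` {..j})" "degree L < card ((\<lambda>a. cx (x a)) ` {..j})"
   using degP degL by auto
  fix z assume "z \<in> (\<lambda>a. cx (x a)) ` {..j}"
  then obtain a where a: "a \<le> j" "z = of_real (x a)" by auto
  have "poly (l a') z = (if a' = a then 1 else 0)" if "a' \<le> j" for a'
  proof (cases "a' = a")
   case True
   have "(\<Prod>b\<in>{..j} - {a}. (x a - x b) / (x a - x b)) = 1"
    by (intro prod.neutral ballI) (use inj a in \<open>auto simp: inj_on_def\<close>)
   with True show ?thesis unfolding a polyl by simp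
  next
   case False
   have "(\<Prod>b\<in>{..j} - {a'}. (x a - x b) / (x a' - x b)) = 0"
    using a False by (intro prod_zero) auto
   with False show ?thesis unfolding a polyl by simp
  qed
  then have "poly L z = (\<Sum>a'\<le>j. p (x a') * (if a' = a then 1 else 0))"
   unfolding L_def by (simp add: poly_sum)
  also have "\<dots> = p (x a)" using a by (simp add: if_distrib sum.If_cases cong: if_cong)
  finally show "poly P z = poly L z" unfolding polyP a p_def by simp
 qed
 then have "poly P 0 = poly L (of_real 0)" by simp
 moreover have "poly P 0 = c 0" 
 proof -
  have "(\<Sum>m\<le>j. 0 ^ m * c m) = (\<Sum>m\<le>j. if m = 0 then c 0 else 0)" by (intro sum.cong) auto
  then show ?thesis unfolding polyP by simp
 qed
 moreover have "poly L (of_real 0) = (\<Sum>a\<le>j. p (x a) * of_real (\<Prod>b\<in>{..j} - {a}. (0 - x b) / (x a - x b)))"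
  unfolding L_def by (simp add: poly_sum polyl del: of_real_0)
 ultimately show ?thesis by simp
qed

text \<open>The distribution function \<open>F\<close> of \<open>S\<close> is 1-Lipschitz, so points
  are at least as far apart as their values of \<open>F\<close>. Of the \<open>2 (j + 1)\<close>
  layers of height \<open>d\<close> every second one supplies a node by \<open>G\<close>, and the
  layers between them keep the nodes apart.\<close>

lemma separated_points:
 fixes S :: "real set"
 assumes S [measurable]: "S \<in> sets borel" and S01: "S \<subseteq> {0..1}" and c: "0 < c" "c \<le> measure lborel S"
  and G: "\<And>T. T \<in> sets borel \<Longrightarrow> T \<subseteq> S \<Longrightarrow> measure lborel T = c / (2 * real (Suc j)) \<Longrightarrow> \<exists>r\<in>T. Q r"
 shows "\<exists>x. \<forall>a\<le>j. x a \<in> S \<and> Q (x a) \<and> (\<forall>b\<le>j. \<bar>real a - real b\<bar> * (c / (2 * real (Suc j))) \<le> \<bar>x a - x b\<bar>)"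
proof -
 define d where "d = c / (2 * real (Suc j))"
 have d: "d > 0" using c by (simp add: d_def)
 define F where "F r = measure lborel (S \<inter> {..r})" for r
 have fin: "T \<in> sets borel \<Longrightarrow> T \<subseteq> S \<Longrightarrow> T \<in> fmeasurable lborel" for T
  by (rule fmeasurableI2[of "{0..1}"]) (use S01 in \<open>auto simp: fmeasurable_def\<close>)
 have add: "F s = F r + measure lborel (S \<inter> {r<..s})" if "r \<le> s" for r s
 proof -
  have "S \<inter> {..s} = (S \<inter> {..r}) \<union> (S \<inter> {r<..s})" using that by auto
  moreover have "measure lborel ((S \<inter> {..r}) \<union> (S \<inter> {r<..s})) = measure lborel (S \<inter> {..r}) + measure lborel (S \<inter> {r<..s})"
  proof -
   have e: "(S \<inter> {..r}) \<inter> (S \<inter> {r<..s}) = {}" by auto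
   have "measure lborel ((S \<inter> {..r}) \<union> (S \<inter> {r<..s})) = measure lborel (S \<inter> {..r}) + measure lborel (S \<inter> {r<..s}) - measure lborel ((S \<inter> {..r}) \<inter> (S \<inter> {r<..s}))"
    by (intro measure_Un3 fin) auto
   then show "measure lborel ((S \<inter> {..r}) \<union> (S \<inter> {r<..s})) = measure lborel (S \<inter> {..r}) + measure lborel (S \<inter> {r<..s})"
    unfolding e by simp
  qed
  ultimately show ?thesis unfolding F_def by simp
 qed
 have mono: "r \<le> s \<Longrightarrow> F r \<le> F s" for r s using add[of r s] by simp
 have lip: "F s - F r \<le> s - r" if "r \<le> s" for r s
 proof -
  have "measure lborel (S \<inter> {r<..s}) \<le> measure lborel {r<..s}"
   by (rule measure_mono_fmeasurable) (use that in \<open>auto simp: fmeasurable_def emeasure_lborel_Ioc\<close>)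
  then show ?thesis using add[OF that] that by simp
 qed
 have lip': "\<bar>F s - F r\<bar> \<le> \<bar>s - r\<bar>" for r s
  using lip[of r s] lip[of s r] mono[of r s] mono[of s r] by (cases "r \<le> s") auto
 have cont: "continuous_on {0..1} F"
  unfolding continuous_on_iff dist_real_def using lip' by (meson le_less_trans)
 have F0: "F 0 = 0"
 proof -
  have "measure lborel (S \<inter> {..0}) \<le> measure lborel {0..0::real}"
   by (rule measure_mono_fmeasurable) (use S01 in \<open>auto simp: fmeasurable_def\<close>)
  then show ?thesis by (simp add: F_def measure_le_0_iff)
 qed
 have F1: "F 1 = measure lborel S"
 proof -
  have "S \<inter> {..1} = S" using S01 by auto
  then show ?thesis by (simp add: F_def)
 qed
 have ex: "\<exists>x. x \<in> S \<and> Q x \<and> 2 * real a * d \<le> F x \<and> F x \<le> (2 * real a + 1) * d" if a: "a \<le> j" for a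
 proof -
  have le: "(2 * real a + 1) * d \<le> F 1"
  proof -
   have "(2 * real a + 1) * d \<le> (2 * real (Suc j)) * d" using a d by (intro mult_right_mono) auto
   also have "\<dots> = c" by (simp add: d_def)
   finally show ?thesis using c F1 by simp
  qed
  have "2 * real a * d \<le> (2 * real a + 1) * d" using d by (intro mult_right_mono) auto
  with le have "2 * real a * d \<le> F 1" by linarith
  then obtain \<alpha> where \<alpha>: "0 \<le> \<alpha>" "\<alpha> \<le> 1" "F \<alpha> = 2 * real a * d"
   using IVT'[of F 0 "2 * real a * d" 1] cont F0 d by auto
  obtain \<beta> where \<beta>: "0 \<le> \<beta>" "\<beta> \<le> 1" "F \<beta> = (2 * real a + 1) * d"
   using IVT'[of F 0 "(2 * real a + 1) * d" 1] cont F0 d le by auto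
  have ab: "F \<beta> = F \<alpha> + d" unfolding \<alpha> \<beta> by (simp add: algebra_simps)
  then have "\<alpha> \<le> \<beta>" using mono[of \<beta> \<alpha>] d by (cases "\<alpha> \<le> \<beta>") auto
  then have "measure lborel (S \<inter> {\<alpha><..\<beta>}) = d" using add[of \<alpha> \<beta>] ab by simp
  with G[of "S \<inter> {\<alpha><..\<beta>}"] obtain x where "x \<in> S \<inter> {\<alpha><..\<beta>}" "Q x" by (auto simp: d_def)
  then show ?thesis using mono[of \<alpha> x] mono[of x \<beta>] \<alpha>(3) \<beta>(3) by auto
 qed
 then obtain x where x: "\<And>a. a \<le> j \<Longrightarrow> x a \<in> S \<and> Q (x a) \<and> 2 * real a * d \<le> F (x a) \<and> F (x a) \<le> (2 * real a + 1) * d"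
  by metis
 have sep: "\<bar>real a - real b\<bar> * d \<le> \<bar>x a - x b\<bar>" if ab: "a \<le> j" "b \<le> j" "a < b" for a b
 proof -
  have "(real b - real a) * d \<le> (2 * real b - (2 * real a + 1)) * d"
   using ab d by (intro mult_right_mono) auto
  also have "\<dots> \<le> F (x b) - F (x a)" using x[OF ab(1)] x[OF ab(2)] by (simp add: algebra_simps)
  also have "\<dots> \<le> \<bar>x b - x a\<bar>" using lip'[of "x b" "x a"] by linarith
  finally show ?thesis using ab by (simp add: abs_minus_commute)
 qed
 have "\<bar>real a - real b\<bar> * d \<le> \<bar>x a - x b\<bar>" if "a \<le> j" "b \<le> j" for a b
  using sep[of a b] sep[of b a] that by (cases a b rule: linorder_cases) (auto simp: abs_minus_commute)
 then show ?thesis using x unfolding d_def[symmetric] by blast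
qed

lemma power_le_exp_fact: "real n ^ j \<le> fact j * exp (real n)"
proof -
 have "real n ^ j /\<^sub>R fact j \<le> exp (real n)"
  unfolding exp_def using sum_le_suminf[of "\<lambda>k. real n ^ k /\<^sub>R fact k" "{j}"] summable_exp_generic[of "real n"] by auto
 then show ?thesis by (simp add: field_simps)
qed

text \<open>Lagrange interpolation at \<open>j + 1\<close> separated points of \<open>S\<close> where the polynomial is not larger
 than its mean square over \<open>S\<close> suggests.\<close>

lemma Remez_L2:
 fixes c :: "nat \<Rightarrow> complex" and S :: "real set" and j :: nat
 defines "p \<equiv> \<lambda>r. \<Sum>m\<le>j. of_real r ^ m * c m"
 assumes S [measurable]: "S \<in> sets borel" and S01: "S \<subseteq> {0..1}" and k: "0 < k" "k \<le> 1" "k \<le> measure lborel S"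
 shows "ennreal ((cmod (c 0))^2) \<le> ennreal ((4 * exp 2 / k) ^ (2 * Suc j)) * (NN r. indicator S r * ennreal ((cmod (p r))^2))"
proof -
 define N where "N = real (Suc j)"
 define d where "d = k / (2 * N)"
 have N: "N \<ge> 1" by (simp add: N_def)
 have d: "d > 0" using k N by (simp add: d_def)
 have contp: "continuous_on UNIV p" unfolding p_def by (intro continuous_intros)
 have [measurable]: "p \<in> borel_measurable borel" using contp by (rule borel_measurable_continuous_onI)
 define I where "I = (LBINT r. indicator S r * (cmod (p r))^2)"
 have "compact (p ` {0..1})" by (intro compact_continuous_image continuous_on_subset[OF contp]) auto
 from compact_imp_bounded[OF this] obtain B where "\<forall>y\<in>p ` {0..1}. cmod y \<le> B" unfolding bounded_iff by (elim exE)
 then have B: "cmod (p r) \<le> B" if "r \<in> {0..1}" for r using that by blast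
 have Sfin: "emeasure lborel S < \<infinity>"
  using emeasure_mono[OF S01, of lborel] by (auto intro: le_less_trans)
 have int: "integrable lborel (\<lambda>r. indicator S r * (cmod (p r))^2)"
 proof (rule Bochner_Integration.integrable_bound)
  show "integrable lborel (\<lambda>r. indicator S r * B^2 :: real)"
   using Sfin by (intro integrable_mult_left integrable_real_indicator) auto
  show "AE r in lborel. norm (indicator S r * (cmod (p r))^2) \<le> norm (indicator S r * B^2 :: real)"
   using B S01 by (intro AE_I2) (auto simp: indicator_def abs_mult intro!: power_mono)
 qed measurable
 have nnI: "(NN r. indicator S r * ennreal ((cmod (p r))^2)) = ennreal I"
  unfolding I_def by (subst nn_integral_eq_integral[symmetric, OF int]) (auto simp: indicator_def ennreal_mult' intro!: nn_integral_cong)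
 have I0: "I \<ge> 0" unfolding I_def by (rule integral_nonneg_AE) auto
 \<comment> \<open>The slack \<open>\<delta>\<close> makes the averaging strict: if
   \<open>|p|^2\<close> exceeded \<open>(I + \<delta>) / d\<close> on a subset of \<open>S\<close>
   of measure \<open>d\<close>, its integral would exceed \<open>I\<close>.\<close>
 have main: "(cmod (c 0))^2 \<le> (4 * exp 2 / k) ^ (2 * Suc j) * (I + \<delta>)" if \<delta>: "\<delta> > 0" for \<delta>
 proof -
  have "\<exists>x. \<forall>a\<le>j. x a \<in> S \<and> (cmod (p (x a)))^2 \<le> (I + \<delta>) / d \<and> (\<forall>b\<le>j. \<bar>real a - real b\<bar> * (k / (2 * real (Suc j))) \<le> \<bar>x a - x b\<bar>)"
  proof (rule separated_points[OF S S01 k(1,3)])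
   fix T assume T [measurable]: "T \<in> sets borel" and TS: "T \<subseteq> S" and mT: "measure lborel T = k / (2 * real (Suc j))"
   show "\<exists>r\<in>T. (cmod (p r))^2 \<le> (I + \<delta>) / d"
   proof (rule ccontr)
    assume "\<not> ?thesis"
    then have less: "\<And>r. r \<in> T \<Longrightarrow> (I + \<delta>) / d < (cmod (p r))^2" by auto
    have Tfin: "emeasure lborel T < \<infinity>" using emeasure_mono[OF TS, of lborel] Sfin by (auto intro: le_less_trans)
    have "(LBINT r. indicator T r * ((I + \<delta>) / d)) \<le> (LBINT r. indicator S r * (cmod (p r))^2)"
    proof (rule integral_mono[OF _ int])
     show "integrable lborel (\<lambda>r. indicator T r * ((I + \<delta>) / d))"
      using Tfin by (intro integrable_mult_left integrable_real_indicator) auto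
     show "indicator T r * ((I + \<delta>) / d) \<le> indicator S r * (cmod (p r))^2" for r
      using less[of r] TS by (auto simp: indicator_def less_imp_le)
    qed
    then have "d * ((I + \<delta>) / d) \<le> I" using mT by (simp add: d_def N_def I_def)
    then show False using d \<delta> by simp
   qed
  qed
  then obtain x where x: "\<And>a. a \<le> j \<Longrightarrow> (cmod (p (x a)))^2 \<le> (I + \<delta>) / d" "\<And>a. a \<le> j \<Longrightarrow> x a \<in> S"
    "\<And>a b. a \<le> j \<Longrightarrow> b \<le> j \<Longrightarrow> \<bar>real a - real b\<bar> * d \<le> \<bar>x a - x b\<bar>"
   unfolding d_def N_def by blast
  define K where "K = sqrt ((I + \<delta>) / d)"
  have K0: "K \<ge> 0" unfolding K_def using I0 \<delta> d by simp
  have pK: "cmod (p (x a)) \<le> K" if "a \<le> j" for a unfolding K_def using x(1)[OF that] by (rule real_le_rsqrt)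
  have inj: "inj_on x {..j}"
  proof (rule inj_onI)
   fix a b assume ab: "a \<in> {..j}" "b \<in> {..j}" "x a = x b"
   then have "\<bar>real a - real b\<bar> * d \<le> 0" using x(3)[of a b] by simp
   then show "a = b" using d by (simp add: mult_le_0_iff)
  qed
  have l: "\<bar>\<Prod>b\<in>{..j} - {a}. (0 - x b) / (x a - x b)\<bar> \<le> 1 / (d ^ j * (fact a * fact (j - a)))" if a: "a \<le> j" for a
  proof -
   have "\<bar>\<Prod>b\<in>{..j} - {a}. (0 - x b) / (x a - x b)\<bar> = (\<Prod>b\<in>{..j} - {a}. \<bar>x b\<bar> / \<bar>x a - x b\<bar>)"
    by (simp add: abs_prod)
   also have "\<dots> \<le> (\<Prod>b\<in>{..j} - {a}. 1 / (\<bar>real a - real b\<bar> * d))"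
   proof (intro prod_mono conjI)
    fix b assume b: "b \<in> {..j} - {a}"
    have "\<bar>x b\<bar> \<le> 1" using x(2)[of b] b S01 by auto
    moreover have "\<bar>real a - real b\<bar> * d > 0" using b d by auto
    ultimately show "\<bar>x b\<bar> / \<bar>x a - x b\<bar> \<le> 1 / (\<bar>real a - real b\<bar> * d)"
     using x(3)[of a b] a b by (intro frac_le) auto
   qed simp
   also have "\<dots> = 1 / (\<Prod>b\<in>{..j} - {a}. \<bar>real a - real b\<bar> * d)" by (simp add: prod_dividef)
   also have "(\<Prod>b\<in>{..j} - {a}. \<bar>real a - real b\<bar> * d) = d ^ j * (fact a * fact (j - a))"
    using a by (simp add: prod.distrib prod_dist_index)
   finally show ?thesis .
  qed
  have "cmod (c 0) \<le> (\<Sum>a\<le>j. cmod (p (x a) * of_real (\<Prod>b\<in>{..j} - {a}. (0 - x b) / (x a - x b))))"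
   unfolding p_def by (subst Lagrange_at_zero[OF inj, of c]) (rule norm_sum)
  also have "\<dots> \<le> (\<Sum>a\<le>j. K * (1 / (d ^ j * (fact a * fact (j - a)))))"
   unfolding norm_mult norm_of_real using l pK K0 by (intro sum_mono mult_mono) auto
  also have "\<dots> = (\<Sum>a\<le>j. K / (d ^ j * fact j) * real (j choose a))"
   by (intro sum.cong refl) (simp add: binomial_fact)
  also have "\<dots> = K / (d ^ j * fact j) * 2 ^ j"
   unfolding sum_distrib_left[symmetric] using choose_row_sum[of j] by (metis of_nat_numeral of_nat_power of_nat_sum)
  finally have c0: "cmod (c 0) \<le> K / (d ^ j * fact j) * 2 ^ j" .
  \<comment> \<open>The spacing \<open>d\<close> is of order \<open>1 / N\<close>, which costs
    \<open>N ^ j\<close>; the factorials in the Lagrange denominators compensate this up to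
    \<open>exp N\<close>, so the constant is only geometric in \<open>j\<close>.\<close>
  have "2 ^ j / (d ^ j * fact j) \<le> (4 / k) ^ j * exp N"
  proof -
   have "2 ^ j / (d ^ j * fact j) = (4 / k) ^ j * (N ^ j / fact j)"
   proof -
    have "2 / d = (4 / k) * N" by (simp add: d_def)
    moreover have "2 ^ j / (d ^ j * fact j) = (2 / d) ^ j / fact j" by (simp add: power_divide)
    ultimately show ?thesis by (simp only: power_mult_distrib times_divide_eq_right)
   qed
   also have "N ^ j / fact j \<le> exp N" using power_le_exp_fact[of "Suc j" j] by (simp add: N_def field_simps)
   finally show ?thesis using k by (simp add: mult_left_mono)
  qed
  then have "cmod (c 0) \<le> K * ((4 / k) ^ j * exp N)"
   using c0 K0 mult_left_mono[of "2 ^ j / (d ^ j * fact j)" "(4 / k) ^ j * exp N" K] by simp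
  then have "(cmod (c 0))^2 \<le> (K * ((4 / k) ^ j * exp N))^2" by (intro power_mono) auto
  also have "\<dots> = K^2 * ((4 / k) ^ (2 * j) * exp (2 * N))"
   by (simp add: power_mult_distrib exp_double power_even_eq)
  also have "K^2 = (I + \<delta>) * (2 * N / k)" using I0 \<delta> k N by (simp add: K_def d_def)
  also have "(I + \<delta>) * (2 * N / k) * ((4 / k) ^ (2 * j) * exp (2 * N)) = (I + \<delta>) * ((2 * N / k) * ((4 / k) ^ (2 * j) * exp (2 * N)))"
   by (simp only: mult.assoc)
  also have "\<dots> \<le> (I + \<delta>) * ((exp (2 * N) * (4 / k)^2) * ((4 / k) ^ (2 * j) * exp (2 * N)))"
  proof (intro mult_left_mono mult_right_mono)
   have "2 * N \<le> exp (2 * N)" using exp_ge_add_one_self[of "2 * N"] by linarith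
   moreover have "1 / k \<le> (4 / k)^2" using k by (simp add: power2_eq_square field_simps)
   ultimately have "(2 * N) * (1 / k) \<le> exp (2 * N) * (4 / k)^2" using k by (intro mult_mono) auto
   then show "2 * N / k \<le> exp (2 * N) * (4 / k)^2" by simp
  qed (use I0 \<delta> k in auto)
  also have "(exp (2 * N) * (4 / k)^2) * ((4 / k) ^ (2 * j) * exp (2 * N)) = (4 * exp 2 / k) ^ (2 * Suc j)"
  proof -
   have "exp (2 * N) = exp 2 ^ Suc j" unfolding N_def by (metis exp_of_nat2_mult mult.commute)
   then have e: "exp (2 * N) * exp (2 * N) = exp 2 ^ (2 * Suc j)" by (simp only: mult_2 power_add)
   have "(exp (2 * N) * (4 / k)^2) * ((4 / k) ^ (2 * j) * exp (2 * N)) = (exp (2 * N) * exp (2 * N)) * ((4 / k)^2 * (4 / k) ^ (2 * j))"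
    by (simp only: mult_ac)
   also have "(4 / k)^2 * (4 / k) ^ (2 * j) = (4 / k) ^ (2 * Suc j)"
    by (simp flip: power_add)
   finally show ?thesis unfolding e by (simp add: power_mult_distrib[symmetric] mult_ac)
  qed
  finally show ?thesis by (simp only: mult.commute)
 qed
 define L where "L = (4 * exp 2 / k) ^ (2 * Suc j)"
 have L: "L > 0" unfolding L_def using k by (intro zero_less_power) auto
 have "(cmod (c 0))^2 \<le> L * I"
 proof (rule field_le_epsilon)
  fix e :: real assume e: "e > 0"
  from main[of "e / L", folded L_def] e L show "(cmod (c 0))^2 \<le> L * I + e" by (simp add: distrib_left)
 qed
 then show ?thesis unfolding nnI L_def[symmetric] using L I0
  by (subst ennreal_mult[symmetric]) (auto intro: ennreal_leI)
qed

section \<open>Test functions\<close>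

lemma partial_deriv_eq: "(f has_derivative f') (at x) \<Longrightarrow> partial_deriv i f x = f' (axis i 1)"
 unfolding partial_deriv_def by (metis frechet_derivative_at)

lemma C_k_SucI:
 assumes "\<And>x. (f has_derivative f' x) (at x)" "\<And>i. C_k k (\<lambda>x. f' x (axis i 1))"
 shows "C_k (Suc k) f"
proof -
 have "partial_deriv i f = (\<lambda>x. f' x (axis i 1))" for i
  using partial_deriv_eq[OF assms(1)] by blast
 moreover have "f differentiable_on UNIV"
  using assms(1) by (auto simp: differentiable_on_def differentiable_def)
 ultimately show ?thesis using assms(2) by simp
qed

lemma C_k_has_derivative:
 assumes "C_k (Suc k) f" shows "(f has_derivative frechet_derivative f (at x)) (at x)"
 using assms by (simp add: differentiable_on_def frechet_derivative_works)

lemma C_k_partial: "C_k (Suc k) f \<Longrightarrow> C_k k (partial_deriv i f)"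
 by simp

lemma C_k_SucD: "C_k (Suc k) f \<Longrightarrow> C_k k f"
proof (induction k arbitrary: f)
 case 0
 then show ?case by (simp add: differentiable_imp_continuous_on)
next
 case (Suc k)
 then show ?case by simp
qed

lemma C_k_continuous: "C_k k f \<Longrightarrow> continuous_on UNIV f"
proof (induction k arbitrary: f)
 case (Suc k) then show ?case using C_k_SucD by blast
qed simp

lemma C_k_const: "C_k k (\<lambda>x. c)"
proof (induction k arbitrary: c)
 case (Suc k)
 show ?case by (rule C_k_SucI[where f' = "\<lambda>x h. 0"]) (auto intro: Suc)
qed simp

lemma C_k_add: "C_k k f \<Longrightarrow> C_k k g \<Longrightarrow> C_k k (\<lambda>x. f x + g x)"
proof (induction k arbitrary: f g)
 case (Suc k)
 show ?case
 proof (rule C_k_SucI)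
  show "((\<lambda>x. f x + g x) has_derivative (\<lambda>h. frechet_derivative f (at x) h + frechet_derivative g (at x) h)) (at x)" for x
   by (intro has_derivative_add C_k_has_derivative[OF Suc.prems(1)] C_k_has_derivative[OF Suc.prems(2)])
  show "C_k k (\<lambda>x. frechet_derivative f (at x) (axis i 1) + frechet_derivative g (at x) (axis i 1))" for i
   using Suc.IH[OF C_k_partial[OF Suc.prems(1)] C_k_partial[OF Suc.prems(2)], of i i]
   by (simp add: partial_deriv_def)
 qed
qed (auto intro: continuous_intros)

lemma C_k_mult: "C_k k f \<Longrightarrow> C_k k g \<Longrightarrow> C_k k (\<lambda>x. f x * g x)"
proof (induction k arbitrary: f g)
 case (Suc k)
 show ?case
 proof (rule C_k_SucI)
  show "((\<lambda>x. f x * g x) has_derivative (\<lambda>h. f x * frechet_derivative g (at x) h + frechet_derivative f (at x) h * g x)) (at x)" for x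
   by (intro has_derivative_mult C_k_has_derivative[OF Suc.prems(1)] C_k_has_derivative[OF Suc.prems(2)])
  show "C_k k (\<lambda>x. f x * frechet_derivative g (at x) (axis i 1) + frechet_derivative f (at x) (axis i 1) * g x)" for i
   using C_k_add[OF Suc.IH[OF C_k_SucD[OF Suc.prems(1)] C_k_partial[OF Suc.prems(2), of i]]
     Suc.IH[OF C_k_partial[OF Suc.prems(1), of i] C_k_SucD[OF Suc.prems(2)]]]
   by (simp add: partial_deriv_def)
 qed
qed (auto intro: continuous_intros)

lemma C_k_sum: "finite S \<Longrightarrow> (\<And>j. j \<in> S \<Longrightarrow> C_k k (f j)) \<Longrightarrow> C_k k (\<lambda>x. \<Sum>j\<in>S. f j x)"
 by (induction S rule: finite_induct) (auto intro: C_k_const C_k_add)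

lemma linear_expand_axis:
 fixes L :: "real^'n \<Rightarrow> complex"
 assumes "linear L"
 shows "L v = (\<Sum>j\<in>UNIV. cx (v $ j) * L (axis j 1))"
proof -
 have "v = (\<Sum>j\<in>UNIV. (v $ j) *\<^sub>R axis j 1)"
  using basis_expansion[of v] by (simp add: scalar_mult_eq_scaleR)
 then have "L v = L (\<Sum>j\<in>UNIV. (v $ j) *\<^sub>R axis j 1)" by simp
 also have "\<dots> = (\<Sum>j\<in>UNIV. (v $ j) *\<^sub>R L (axis j 1))"
  by (simp add: linear_sum[OF assms] linear_scale[OF assms])
 finally show ?thesis by (simp add: scaleR_conv_of_real)
qed

lemma C_k_linear: "C_k k f \<Longrightarrow> C_k k (\<lambda>x. f ((A::real^'n^'n) *v x))"
proof (induction k arbitrary: f)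
 case 0
 have "continuous_on UNIV ((*v) A)" by (intro linear_continuous_on matrix_vector_mul_bounded_linear)
 with 0 show ?case using continuous_on_compose2[of UNIV f UNIV "(*v) A"] by auto
next
 case (Suc k)
 show ?case
 proof (rule C_k_SucI)
  show "((\<lambda>x. f (A *v x)) has_derivative (\<lambda>h. frechet_derivative f (at (A *v x)) (A *v h))) (at x)" for x
   using diff_chain_at[OF bounded_linear_imp_has_derivative[OF matrix_vector_mul_bounded_linear, of A] C_k_has_derivative[OF Suc.prems]]
   by (simp add: o_def)
  have "frechet_derivative f (at (A *v x)) (A *v axis i 1) = (\<Sum>j\<in>UNIV. cx (A $ j $ i) * partial_deriv j f (A *v x))" for x i
   using linear_expand_axis[OF has_derivative_linear[OF C_k_has_derivative[OF Suc.prems, of "A *v x"]], of "A *v axis i 1"]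
   by (simp add: partial_deriv_def matrix_vector_mult_basis column_def)
  moreover have "C_k k (\<lambda>x. \<Sum>j\<in>UNIV. cx (A $ j $ i) * partial_deriv j f (A *v x))" for i
   by (intro C_k_sum C_k_mult C_k_const Suc.IH C_k_partial Suc.prems) auto
  ultimately show "C_k k (\<lambda>x. frechet_derivative f (at (A *v x)) (A *v axis i 1))" for i by simp
 qed
qed

lemma ekern_has_derivative:
 "((\<lambda>x. ekern x y) has_derivative (\<lambda>h. (- \<i> * cx (h \<bullet> y)) * ekern x y)) (at x)"
proof -
 have 1: "((\<lambda>x. - (\<i> * cx (x \<bullet> y))) has_derivative (\<lambda>h. - (\<i> * cx (h \<bullet> y)))) (at x)"
  by (intro bounded_linear_imp_has_derivative bounded_linear_minus bounded_linear_compose[OF bounded_linear_mult_right]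
    bounded_linear_compose[OF bounded_linear_of_real] bounded_linear_inner_left)
 have "(exp has_derivative (\<lambda>h. exp z * h)) (at z)" for z :: complex
  using DERIV_exp[of z] unfolding has_field_derivative_def .
 from has_derivative_compose[OF 1 this] show ?thesis by (simp add: mult_ac)
qed

lemma C_k_ekern: "C_k k (\<lambda>x. ekern x y)"
proof (induction k)
 case 0 then show ?case by (auto intro!: continuous_intros)
next
 case (Suc k)
 show ?case
 proof (rule C_k_SucI)
  show "((\<lambda>x. ekern x y) has_derivative (\<lambda>h. (- \<i> * cx (h \<bullet> y)) * ekern x y)) (at x)" for x
   by (rule ekern_has_derivative)
  show "C_k k (\<lambda>x. (- \<i> * cx (axis i 1 \<bullet> y)) * ekern x y)" for i
   by (intro C_k_mult C_k_const Suc)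
 qed
qed

lemma C_k_component: "C_k k (\<lambda>x. cx (x $ j))"
proof (cases k)
 case 0 then show ?thesis by (auto intro!: continuous_intros)
next
 case (Suc m)
 have "((\<lambda>x. cx (x $ j)) has_derivative (\<lambda>h. cx (h $ j))) (at x)" for x :: "real^'a"
  by (intro bounded_linear_imp_has_derivative bounded_linear_compose[OF bounded_linear_of_real bounded_linear_vec_nth])
 then show ?thesis unfolding Suc by (rule C_k_SucI) (rule C_k_const)
qed

section \<open>A smooth function of compact support\<close>

definition flat :: "real poly \<Rightarrow> real \<Rightarrow> real" where
 "flat p t = (if t > 0 then poly p (1 / t) * exp (- 1 / t) else 0)"

lemma power_le_fact_exp:
 assumes "s \<ge> (0::real)" shows "s ^ n \<le> fact n * exp s"
proof -
 have "s ^ n /\<^sub>R fact n \<le> exp s"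
  unfolding exp_def using sum_le_suminf[of "\<lambda>n. s ^ n /\<^sub>R fact n" "{n}"] summable_exp_generic[of s] assms by auto
 then show ?thesis by (simp add: field_simps)
qed

text \<open>Every power of \<open>1 / t\<close> is beaten by \<open>exp (1 / t)\<close>. The order
  \<open>t^2\<close> is what makes the derivative at \<open>0\<close> exist and vanish.\<close>

lemma flat_bound: "\<exists>C. \<forall>t. \<bar>flat p t\<bar> \<le> C * t^2"
proof -
 define C where "C = (\<Sum>i\<le>degree p. \<bar>coeff p i\<bar> * fact (i + 2))"
 have C0: "C \<ge> 0" unfolding C_def by (intro sum_nonneg) auto
 have "\<bar>flat p t\<bar> \<le> C * t^2" for t
 proof (cases "t > 0")
  case True
  define s where "s = 1 / t"
  have s: "s > 0" using True by (simp add: s_def)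
  have "\<bar>poly p s\<bar> * s^2 \<le> (\<Sum>i\<le>degree p. \<bar>coeff p i\<bar> * (s ^ i * s^2))"
  proof -
   have "\<bar>poly p s\<bar> \<le> (\<Sum>i\<le>degree p. \<bar>coeff p i\<bar> * s ^ i)"
    unfolding poly_altdef using s by (intro order_trans[OF sum_abs] sum_mono) (simp add: abs_mult)
   then have "\<bar>poly p s\<bar> * s^2 \<le> (\<Sum>i\<le>degree p. \<bar>coeff p i\<bar> * s ^ i) * s^2"
    by (rule mult_right_mono) simp
   then show ?thesis by (simp only: sum_distrib_right mult.assoc)
  qed
  also have "\<dots> \<le> (\<Sum>i\<le>degree p. \<bar>coeff p i\<bar> * (fact (i + 2) * exp s))"
   using s by (intro sum_mono mult_left_mono) (auto simp only: power_add[symmetric] abs_ge_zero intro: power_le_fact_exp less_imp_le)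
  also have "\<dots> = C * exp s" by (simp only: C_def sum_distrib_right mult.assoc)
  finally have "\<bar>poly p s\<bar> * s^2 * exp (- s) \<le> C" by (simp add: exp_minus field_simps)
  then have "\<bar>poly p s\<bar> * exp (- s) \<le> C * (1 / s)^2" using s by (simp add: field_simps)
  then show ?thesis using True by (simp add: flat_def s_def abs_mult)
 qed (use C0 in \<open>simp add: flat_def\<close>)
 then show ?thesis by blast
qed

text \<open>The family \<open>flat p\<close> is closed under differentiation: in the variable
  \<open>x = 1 / t\<close> the polynomial \<open>p\<close> becomes \<open>x^2 (p - p')\<close>.
  Smoothness is then an induction with \<open>p\<close> arbitrary, without a formula for higher
  derivatives.\<close>

lemma flat_DERIV: "(flat p has_real_derivative flat ([:0, 0, 1:] * (p - pderiv p)) t) (at t)"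
proof -
 consider "t > 0" | "t < 0" | "t = 0" by linarith
 then show ?thesis
 proof cases
  case 1
  have "((\<lambda>t. poly p (1 / t) * exp (- 1 / t)) has_real_derivative
    flat ([:0, 0, 1:] * (p - pderiv p)) t) (at t)"
   using 1 by (auto intro!: derivative_eq_intros poly_DERIV DERIV_chain2[OF poly_DERIV] simp: flat_def power2_eq_square field_simps)
  then show ?thesis
   by (rule has_field_derivative_transform_within_open[of _ _ _ "{0<..}"]) (use 1 in \<open>auto simp: flat_def\<close>)
 next
  case 2
  have "((\<lambda>t. 0) has_real_derivative flat ([:0, 0, 1:] * (p - pderiv p)) t) (at t)"
   using 2 by (simp add: flat_def)
  then show ?thesis
   by (rule has_field_derivative_transform_within_open[of _ _ _ "{..<0}"]) (use 2 in \<open>auto simp: flat_def\<close>)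
 next
  case 3
  obtain C where C: "\<And>t. \<bar>flat p t\<bar> \<le> C * t^2" using flat_bound by blast
  have "((\<lambda>h. (flat p (0 + h) - flat p 0) / h) \<longlongrightarrow> 0) (at 0)"
  proof (rule Lim_null_comparison)
   show "\<forall>\<^sub>F h in at 0. norm ((flat p (0 + h) - flat p 0) / h) \<le> C * \<bar>h\<bar>"
   proof (rule eventuallyI)
    fix h :: real
    show "norm ((flat p (0 + h) - flat p 0) / h) \<le> C * \<bar>h\<bar>"
    proof (cases "h = 0")
     case False
     have "\<bar>flat p h\<bar> / \<bar>h\<bar> \<le> C * h^2 / \<bar>h\<bar>" by (intro divide_right_mono C) auto
     also have "\<dots> = C * \<bar>h\<bar>" using False by (simp add: power2_eq_square field_simps abs_if)
     finally show ?thesis by (simp add: flat_def[of p 0] abs_divide)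
    qed simp
   qed
   show "((\<lambda>h. C * \<bar>h\<bar>) \<longlongrightarrow> 0) (at 0)" by (auto intro!: tendsto_eq_intros)
  qed
  then show ?thesis using 3 by (simp add: DERIV_def flat_def)
 qed
qed

lemma C_k_flat: "C_k k (\<lambda>x::real^'n. cx (flat p (1 - x \<bullet> x)))"
proof (induction k arbitrary: p)
 case 0
 have "continuous_on UNIV (flat p)"
  by (intro continuous_at_imp_continuous_on ballI DERIV_isCont[OF flat_DERIV])
 then show ?case
  by (auto intro!: continuous_intros continuous_on_compose2[of UNIV "flat p"])
next
 case (Suc k)
 let ?q = "[:0, 0, 1:] * (p - pderiv p)"
 show ?case
 proof (rule C_k_SucI)
  fix x :: "real^'n"
  have 1: "((\<lambda>x. 1 - x \<bullet> x) has_derivative (\<lambda>h. - (2 * (x \<bullet> h)))) (at x)"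
   by (auto intro!: derivative_eq_intros simp: inner_commute)
  have 2: "(flat p has_derivative (\<lambda>h. flat ?q (1 - x \<bullet> x) * h)) (at (1 - x \<bullet> x))"
   using flat_DERIV[of p "1 - x \<bullet> x"] by (simp add: has_field_derivative_def)
  show "((\<lambda>x. cx (flat p (1 - x \<bullet> x))) has_derivative
    (\<lambda>h. cx (flat ?q (1 - x \<bullet> x) * (- (2 * (x \<bullet> h)))))) (at x)"
   using has_derivative_of_real[OF diff_chain_at[OF 1 2]] by (simp add: o_def)
 next
  fix i
  have "C_k k (\<lambda>x::real^'n. cx (flat ?q (1 - x \<bullet> x)) * (cx (- 2) * cx (x $ i)))"
   by (intro C_k_mult Suc C_k_const C_k_component)
  then show "C_k k (\<lambda>x::real^'n. cx (flat ?q (1 - x \<bullet> x) * (- (2 * (x \<bullet> axis i 1)))))"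
   by (simp add: inner_axis)
 qed
qed

section \<open>Closure properties of test functions\<close>

lemma test_functions_iff:
 "p \<in> test_functions \<longleftrightarrow> (\<forall>k. C_k k p) \<and> (\<exists>R. \<forall>x. R < norm x \<longrightarrow> p x = 0)"
proof -
 have "compact (closure {x. p x \<noteq> 0}) \<longleftrightarrow> (\<exists>R. \<forall>x. R < norm x \<longrightarrow> p x = 0)"
  by (auto simp: compact_closure bounded_iff not_le) (meson not_less)+
 then show ?thesis by (simp add: test_functions_def)
qed

lemma test_Cc: "p \<in> test_functions \<Longrightarrow> Cc p"
 unfolding test_functions_iff Cc_def using C_k_continuous by blast

lemma test_C_k: "p \<in> test_functions \<Longrightarrow> C_k k p"
 unfolding test_functions_iff by blast

lemma test_partial:
 assumes "p \<in> test_functions" shows "partial_deriv i p \<in> test_functions"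
proof -
 obtain R where R: "\<And>x. R < norm x \<Longrightarrow> p x = 0" using assms by (auto simp: test_functions_iff)
 have "partial_deriv i p x = 0" if x: "R < norm x" for x
 proof -
  have "open {x::real^'a. R < norm x}" by (intro open_Collect_less continuous_intros)
  from has_derivative_transform_within_open[OF has_derivative_const[of "0::complex" "at x"] this, of p] x R
  have "(p has_derivative (\<lambda>h. 0)) (at x)" by auto
  then show ?thesis by (rule partial_deriv_eq)
 qed
 moreover have "C_k k (partial_deriv i p)" for k
  by (rule C_k_partial[OF test_C_k[OF assms]])
 ultimately show ?thesis unfolding test_functions_iff by blast
qed

lemma test_mult:
 assumes "p \<in> test_functions" "\<And>k. C_k k f" shows "(\<lambda>x. f x * p x) \<in> test_functions"
 using assms unfolding test_functions_iff by (auto intro: C_k_mult)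

lemma test_linear:
 fixes A A' :: "real^'n^'n"
 assumes p: "p \<in> test_functions" and A: "A' ** A = mat 1"
 shows "(\<lambda>x. p (A *v x)) \<in> test_functions"
proof -
 obtain R where R: "\<And>x. R < norm x \<Longrightarrow> p x = 0" using p by (auto simp: test_functions_iff)
 have K: "norm x \<le> onorm ((*v) A') * norm (A *v x)" for x
  using onorm[OF matrix_vector_mul_bounded_linear, of A' "A *v x"] by (simp add: matrix_vector_mul_assoc A)
 have "p (A *v x) = 0" if "onorm ((*v) A') * max R 0 < norm x" for x
 proof (rule R, rule ccontr)
  assume "\<not> R < norm (A *v x)"
  then have "onorm ((*v) A') * norm (A *v x) \<le> onorm ((*v) A') * max R 0"
   by (intro mult_left_mono onorm_pos_le matrix_vector_mul_bounded_linear) auto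
  with K[of x] that show False by linarith
 qed
 then show ?thesis using p unfolding test_functions_iff by (blast intro: C_k_linear)
qed

definition bump :: "real^'n \<Rightarrow> complex" where
 "bump x = cx (flat 1 (1 - x \<bullet> x))"

lemma bump_test: "bump \<in> test_functions"
proof -
 have "bump x = 0" if "1 < norm x" for x :: "real^'a"
  using one_less_power[OF that, of 2] by (simp add: bump_def flat_def power2_norm_eq_inner[symmetric])
 then show ?thesis unfolding test_functions_iff bump_def[abs_def] using C_k_flat by blast
qed

lemma bump_0: "bump 0 \<noteq> 0"
 by (simp add: bump_def flat_def)

section \<open>Decay of the Fourier transform of a test function\<close>

lemma integrable_pair_dominated:
 fixes F :: "'a::euclidean_space \<times> 'b::euclidean_space \<Rightarrow> complex" and a b :: "_ \<Rightarrow> real"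
 assumes a: "integrable lborel a" and b: "integrable lborel b"
  and F: "F \<in> borel_measurable (lborel \<Otimes>\<^sub>M lborel)" "\<And>x y. cmod (F (x, y)) \<le> a x * b y"
 shows "integrable (lborel \<Otimes>\<^sub>M lborel) F"
proof (rule Bochner_Integration.integrable_bound)
 show "integrable (lborel \<Otimes>\<^sub>M lborel) (\<lambda>(x, y). cx (a x) * cx (b y) * (\<lambda>z. 1) (x, y))"
  by (rule integrable_mult_pair) (use a b in auto)
 show "AE z in lborel \<Otimes>\<^sub>M lborel. norm (F z) \<le> norm (case z of (x, y) \<Rightarrow> cx (a x) * cx (b y) * 1)"
  using F(2) by (intro AE_I2) (auto simp: norm_mult split: prod.splits intro: order_trans[OF _ abs_ge_self] simp flip: abs_mult)
qed fact

lemma integrable_lborel_translation: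
 fixes a :: "'a::euclidean_space" and g :: "'a \<Rightarrow> 'b::{banach, second_countable_topology}"
 assumes "integrable lborel g" shows "integrable lborel (\<lambda>x. g (a + x))"
proof -
 have "integrable lborel (\<lambda>x. g (a + 1 *\<^sub>R x))"
  by (rule integrable_lborel_scaling[OF lborel_distr_affine]) (use assms in auto)
 then show ?thesis by simp
qed

text \<open>The mean of the translates of \<open>partial_deriv i q\<close> by \<open>t\<close> times
  the unit vector, \<open>t\<close> in \<open>[0, 1]\<close>, is the difference of \<open>q\<close>
  and a translate of it, whose integrals agree. By translation invariance the mean has the same
  integral as \<open>partial_deriv i q\<close>.\<close>

lemma integral_partial_deriv:
 fixes q :: "real^'n \<Rightarrow> complex"
 assumes q: "C_k 1 q" "Cc q" "Cc (partial_deriv i q)"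
 shows "(LBINT x. partial_deriv i q x) = 0"
proof -
 let ?d = "partial_deriv i q"
 have [measurable]: "q \<in> borel_measurable borel" "?d \<in> borel_measurable borel" using q by auto
 obtain B R where B: "0 < B" "0 < R" "\<And>x. cmod (?d x) \<le> B * indicator (cball 0 R) x" using Cc_bounded[OF q(3)] by blast
 have line: "((\<lambda>t. q (t *\<^sub>R axis i 1 + x)) has_vector_derivative ?d (t *\<^sub>R axis i 1 + x)) (at t within S)" for t x S
 proof -
  have 1: "((\<lambda>t::real. t *\<^sub>R axis i 1 + x) has_derivative (\<lambda>h. h *\<^sub>R axis i 1)) (at t within S)"
   by (auto intro!: derivative_eq_intros)
  have D: "(q has_derivative frechet_derivative q (at (t *\<^sub>R axis i 1 + x))) (at (t *\<^sub>R axis i 1 + x))"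
   using C_k_has_derivative[of 0 q] q(1) by simp
  have "((\<lambda>t. q (t *\<^sub>R axis i 1 + x)) has_derivative (\<lambda>h. frechet_derivative q (at (t *\<^sub>R axis i 1 + x)) (h *\<^sub>R axis i 1))) (at t within S)"
   using has_derivative_compose[OF 1 D] .
  then show ?thesis
   by (simp add: has_vector_derivative_def partial_deriv_def linear_scale[OF has_derivative_linear[OF D]])
 qed
 have FTC: "(LBINT t. indicator {0..1} t *\<^sub>R ?d (t *\<^sub>R axis i 1 + x)) = q (1 *\<^sub>R axis i 1 + x) - q (0 *\<^sub>R axis i 1 + x)" for x
  by (rule integral_FTC_Icc[OF _ line])
    (auto intro!: continuous_intros continuous_on_compose2[OF Cc_continuous[OF q(3)]])
 have "(LBINT x. LBINT t. indicator {0..1} t *\<^sub>R ?d (t *\<^sub>R axis i 1 + x))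
   = (LBINT t. LBINT x. indicator {0..1} t *\<^sub>R ?d (t *\<^sub>R axis i 1 + x))"
 proof (rule lborel_pair.Fubini_integral, rule integrable_pair_dominated)
  show "integrable lborel (\<lambda>t::real. B * indicator {0..1} t :: real)"
   by (intro integrable_mult_right integrable_real_indicator) auto
  show "integrable lborel (indicator (cball (0::real^'n) (R + 1)) :: _ \<Rightarrow> real)" by (rule integrable_indicator_cball)
  show "case_prod (\<lambda>t x. indicator {0..1} t *\<^sub>R ?d (t *\<^sub>R axis i 1 + x)) \<in> borel_measurable (lborel \<Otimes>\<^sub>M lborel)"
   by measurable
  fix t :: real and x :: "real^'n"
  show "cmod (case (t, x) of (t, x) \<Rightarrow> indicator {0..1} t *\<^sub>R ?d (t *\<^sub>R axis i 1 + x)) \<le> B * indicator {0..1} t * indicator (cball 0 (R + 1)) x"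
  proof (cases "t \<in> {0..1} \<and> norm (t *\<^sub>R axis i 1 + x) \<le> R")
   case True
   have "norm x \<le> norm (t *\<^sub>R axis i 1 + x) + norm (t *\<^sub>R (axis i 1 :: real^'n))"
    using norm_triangle_ineq4[of "t *\<^sub>R axis i 1 + x" "t *\<^sub>R axis i 1"] by simp
   also have "\<dots> \<le> R + 1" using True by (intro add_mono) auto
   finally show ?thesis using True B(3)[of "t *\<^sub>R axis i 1 + x"] by (simp add: indicator_def)
  next
   case False
   then show ?thesis using B(3)[of "t *\<^sub>R axis i 1 + x"] B(1) by (auto simp: indicator_def)
  qed
 qed
 also have "(\<lambda>t. LBINT x. indicator {0..1} t *\<^sub>R ?d (t *\<^sub>R axis i 1 + x)) = (\<lambda>t::real. indicator {0..1} t *\<^sub>R (LBINT x. ?d x))"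
  by (intro ext) (simp add: integral_lborel_translation)
 also have "(LBINT t. indicator {0..1::real} t *\<^sub>R (LBINT x. ?d x)) = (LBINT x. ?d x)"
  by simp
 also have "(LBINT x. LBINT t. indicator {0..1} t *\<^sub>R ?d (t *\<^sub>R axis i 1 + x)) = (LBINT x. q (axis i 1 + x)) - (LBINT x. q x)"
  unfolding FTC using Cc_integrable[OF q(2)] integrable_lborel_translation[OF Cc_integrable[OF q(2)], of "axis i 1"]
  by (subst Bochner_Integration.integral_diff[symmetric]) auto
 also have "\<dots> = 0" by (simp add: integral_lborel_translation)
 finally show ?thesis by simp
qed

text \<open>The partial derivative of \<open>ekern x z * p x\<close> integrates to
  \<open>0\<close>.\<close>

lemma fourier_partial_deriv:
 fixes p :: "real^'n \<Rightarrow> complex"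
 assumes p: "p \<in> test_functions"
 shows "fourier (partial_deriv i p) z = \<i> * cx (z $ i) * fourier p z"
proof -
 let ?q = "\<lambda>x. ekern x z * p x"
 have d: "partial_deriv i ?q x = ekern x z * partial_deriv i p x + (- \<i> * cx (z $ i)) * ekern x z * p x" for x
 proof -
  have "((\<lambda>x. ekern x z) has_derivative (\<lambda>h. (- \<i> * cx (h \<bullet> z)) * ekern x z)) (at x)"
   by (rule ekern_has_derivative)
  from partial_deriv_eq[OF has_derivative_mult[OF this C_k_has_derivative[OF test_C_k[OF p, of "Suc 0"]]], of i]
  show ?thesis by (simp add: partial_deriv_def inner_axis inner_commute)
 qed
 have t: "?q \<in> test_functions" by (rule test_mult[OF p C_k_ekern])
 have "0 = (LBINT x. partial_deriv i ?q x)"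
  using integral_partial_deriv[OF test_C_k[OF t] test_Cc[OF t] test_Cc[OF test_partial[OF t]]] by simp
 also have "\<dots> = (LBINT x. partial_deriv i p x * ekern x z + (- \<i> * cx (z $ i)) * (p x * ekern x z))"
  unfolding d by (simp add: mult_ac)
 also have "\<dots> = (LBINT x. partial_deriv i p x * ekern x z) + (- \<i> * cx (z $ i)) * (LBINT x. p x * ekern x z)"
  using integrable_ekern[OF Cc_integrable[OF test_Cc[OF test_partial[OF p]]]] integrable_ekern[OF Cc_integrable[OF test_Cc[OF p]]]
  by (subst Bochner_Integration.integral_add) auto
 finally show ?thesis
  using test_Cc[OF p] test_Cc[OF test_partial[OF p, of i]] by (simp add: fourier_lborel Cc_borel)
qed

lemma norm_le_sum_components: "norm (x::real^'n) \<le> (\<Sum>i\<in>UNIV. \<bar>x $ i\<bar>)"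
 using norm_le_l1[of x] by (simp add: Basis_vec_def norm_le_l1_cart)

text \<open>Repeated differentiation bounds the transform times \<open>|z $ i| ^ p\<close> for each
  coordinate, and the largest coordinate controls \<open>norm z\<close> up to the dimension.\<close>

lemma fourier_decay:
 fixes q :: "real^'n \<Rightarrow> complex"
 assumes "q \<in> test_functions"
 obtains C where "C > 0" "\<And>z. cmod (fourier q z) * (1 + norm z) ^ p \<le> C"
proof -
 have comp: "\<exists>C. \<forall>z. \<bar>z $ i\<bar> ^ p * cmod (fourier q z) \<le> C" if "q \<in> test_functions" for q :: "real^'n \<Rightarrow> complex" and i p
  using that
 proof (induction p arbitrary: q)
  case 0
  then show ?case using norm_fourier_le[OF Cc_integrable[OF test_Cc[OF 0]]] by auto
 next
  case (Suc p)
  from Suc.IH[OF test_partial[OF Suc.prems, of i]] show ?case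
   by (simp add: fourier_partial_deriv[OF Suc.prems] norm_mult mult_ac)
 qed
 obtain c where c: "\<And>i z. \<bar>z $ i\<bar> ^ p * cmod (fourier q z) \<le> c i" 
  using choice[of "\<lambda>i C. \<forall>z. \<bar>z $ i\<bar> ^ p * cmod (fourier q z) \<le> C"] comp[OF assms] by blast
 obtain c0 where c0: "\<And>z. cmod (fourier q z) \<le> c0"
  using norm_fourier_le[OF Cc_integrable[OF test_Cc[OF assms]]] by blast
 define N where "N = real CARD('n)"
 define C where "C = 2 ^ p * (c0 + N ^ p * (\<Sum>i\<in>UNIV. c i)) + 1"
 have ci: "c i \<ge> 0" for i using c[where i = i and z = 0] order_trans[of 0] by (meson mult_nonneg_nonneg norm_ge_zero zero_le_power abs_ge_zero)
 have c00: "c0 \<ge> 0" using c0[of 0] norm_ge_zero order_trans by blast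
 have "cmod (fourier q z) * (1 + norm z) ^ p \<le> C" for z
 proof -
  have mx: "(1 + norm z) ^ p \<le> 2 ^ p * (1 + norm z ^ p)"
  proof -
   have "1 + norm z \<le> 2 * max 1 (norm z)" by auto
   then have "(1 + norm z) ^ p \<le> (2 * max 1 (norm z)) ^ p" by (intro power_mono) auto
   also have "\<dots> \<le> 2 ^ p * (1 + norm z ^ p)" by (auto simp: power_mult_distrib max_def)
   finally show ?thesis .
  qed
  define m where "m = Max (range (\<lambda>i. \<bar>z $ i\<bar>))"
  have "m \<in> range (\<lambda>i. \<bar>z $ i\<bar>)" unfolding m_def by (rule Max_in) auto
  then obtain j where j: "m = \<bar>z $ j\<bar>" by blast
  have "\<bar>z $ i\<bar> \<le> m" for i unfolding m_def by (intro Max_ge) auto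
  then have "norm z \<le> N * m"
   using order_trans[OF norm_le_sum_components sum_bounded_above[of UNIV "\<lambda>i. \<bar>z $ i\<bar>" m]] by (simp add: N_def)
  then have "norm z ^ p \<le> N ^ p * \<bar>z $ j\<bar> ^ p"
   using power_mono[of "norm z" "N * m" p] by (simp add: power_mult_distrib j)
  then have "norm z ^ p * cmod (fourier q z) \<le> N ^ p * (\<bar>z $ j\<bar> ^ p * cmod (fourier q z))"
   using mult_right_mono[OF _ norm_ge_zero] by (metis mult.assoc)
  also have "\<dots> \<le> N ^ p * (\<Sum>i\<in>UNIV. c i)"
   using member_le_sum[of j UNIV c] ci by (intro mult_left_mono order_trans[OF c]) (auto simp: N_def)
  finally have 1: "norm z ^ p * cmod (fourier q z) \<le> N ^ p * (\<Sum>i\<in>UNIV. c i)" .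
  have "cmod (fourier q z) * (1 + norm z) ^ p \<le> cmod (fourier q z) * (2 ^ p * (1 + norm z ^ p))"
   using mx by (rule mult_left_mono) simp
  also have "\<dots> = 2 ^ p * (cmod (fourier q z) + norm z ^ p * cmod (fourier q z))" by (simp add: algebra_simps)
  also have "\<dots> \<le> 2 ^ p * (c0 + N ^ p * (\<Sum>i\<in>UNIV. c i))"
   using 1 c0 by (intro mult_left_mono add_mono) auto
  finally show ?thesis by (simp add: C_def)
 qed
 moreover have "C > 0" unfolding C_def using c00 ci
  by (intro add_nonneg_pos mult_nonneg_nonneg add_nonneg_nonneg sum_nonneg) (auto simp: N_def)
 ultimately show ?thesis using that by blast
qed

text \<open>Comparison with the product of the one-dimensional \<open>1 / (1 + (z $ i)^2)\<close>,
  which explains the exponent \<open>2 * CARD('n)\<close>.\<close>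

lemma weight_integrable:
 assumes "p \<ge> 2 * CARD('n)"
 shows "integrable lborel (\<lambda>z::real^'n. 1 / (1 + norm z) ^ p)"
proof (rule Bochner_Integration.integrable_bound)
 have "integrable lborel (\<lambda>x::real. inverse (1 + x^2))"
  using integrable_inverse_1_plus_square by (simp add: set_integrable_def)
 then show "integrable lborel (\<lambda>z::real^'n. \<Prod>i\<in>UNIV. inverse (1 + (z $ i)^2))"
  by (rule integrable_lborel_vec_prod)
 have "1 / (1 + norm z) ^ p \<le> (\<Prod>i\<in>UNIV. inverse (1 + (z $ i)^2))" for z :: "real^'n"
 proof -
  have "(\<Prod>i\<in>UNIV. 1 + (z $ i)^2) \<le> (\<Prod>i\<in>(UNIV::'n set). (1 + norm z)^2)"
  proof (intro prod_mono conjI)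
   fix i
   have "(z $ i)^2 \<le> (norm z)^2" using component_le_norm_cart[of z i] by (metis abs_le_square_iff abs_norm_cancel)
   then show "1 + (z $ i)^2 \<le> (1 + norm z)^2" by (simp add: power2_sum add_increasing2)
  qed simp
  also have "\<dots> = (1 + norm z) ^ (2 * CARD('n))" by (simp add: power_mult)
  also have "\<dots> \<le> (1 + norm z) ^ p" using assms by (intro power_increasing) auto
  finally have *: "(\<Prod>i\<in>UNIV. 1 + (z $ i)^2) \<le> (1 + norm z) ^ p" .
  moreover have "(\<Prod>i\<in>UNIV. 1 + (z $ i)^2) > 0" by (intro prod_pos) (auto intro: add_pos_nonneg)
  ultimately have "inverse ((1 + norm z) ^ p) \<le> inverse (\<Prod>i\<in>UNIV. 1 + (z $ i)^2)" by (rule le_imp_inverse_le)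
  also have "\<dots> = (\<Prod>i\<in>UNIV. inverse (1 + (z $ i)^2))" by (simp add: prod_inversef[symmetric] o_def)
  finally show ?thesis by (simp only: inverse_eq_divide)
 qed
 then show "AE z in lborel. norm (1 / (1 + norm z) ^ p) \<le> norm (\<Prod>i\<in>UNIV. inverse (1 + ((z::real^'n) $ i)^2))"
  by (intro AE_I2) (auto intro: order_trans[OF _ abs_ge_self])
qed simp

lemma weight_sqi:
 assumes "p \<ge> 2 * CARD('n)"
 shows "sqi (\<lambda>z::real^'n. cx (1 / (1 + norm z) ^ p))"
proof -
 have "integrable lborel (\<lambda>z::real^'n. 1 / (1 + norm z) ^ (p + p))"
  by (rule weight_integrable) (use assms in simp)
 moreover have "(cmod (cx (1 / (1 + norm z) ^ p)))^2 = 1 / (1 + norm z) ^ (p + p)" for z :: "real^'n"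
  by (simp only: norm_of_real) (simp add: power2_eq_square power_add)
 ultimately show ?thesis unfolding sqi_on_def by simp
qed

section \<open>The spectral inequality on thick sets\<close>

lemma lborel_distr_reflect: "density (distr lborel borel (\<lambda>x::'a::euclidean_space. - x)) (\<lambda>_. ennreal 1) = lborel"
 using lborel_affine[of "-1" "0::'a"] by simp

lemma
 fixes h :: "'a::euclidean_space \<Rightarrow> complex"
 assumes h: "sqi h"
 shows sqi_reflect: "sqi (\<lambda>x. h (- x))" and nrm_reflect: "nrm (\<lambda>x. h (- x)) = nrm h"
proof -
 show "sqi (\<lambda>x. h (- x))"
  by (rule sqi_lborel_scaling[OF lborel_distr_reflect]) (use h in auto)
 have "(nrm h)^2 = 1 * (nrm (\<lambda>x. h (- x)))^2"
  by (rule nrm_lborel_scaling[OF lborel_distr_reflect]) (use h in auto)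
 then show "nrm (\<lambda>x. h (- x)) = nrm h" by simp
qed

lemma emeasure_cbox_zero:
 fixes a :: "real^'n"
 assumes "\<And>i. 0 \<le> a $ i"
 shows "emeasure lborel (cbox 0 a) = ennreal (\<Prod>i\<in>UNIV. a $ i)"
proof -
 have "0 \<bullet> b \<le> a \<bullet> b" if "b \<in> Basis" for b using that assms by (auto simp: Basis_vec_def inner_axis)
 then show ?thesis by (subst emeasure_lborel_cbox) (auto simp: prod_Basis_vec)
qed

text \<open>Absorbs half of the left-hand side in \<open>ennreal\<close>, where terms cannot be
  moved freely across an inequality.\<close>

lemma ennreal_cancel_half:
 assumes "ennreal (2 * m) \<le> X + ennreal m" "0 \<le> m" shows "ennreal m \<le> X"
proof (cases X)
 case (real x)
 then show ?thesis using assms by (simp flip: ennreal_plus)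
qed simp

text \<open>For \<open>r\<close> close to \<open>1\<close> the box shrunk by \<open>r\<close> loses
  only a shell of volume at most \<open>l / 2\<close> times that of the box, so half of the measure
  granted by thickness is still seen at the points \<open>x + r v\<close>. Averaging over
  \<open>v\<close> for each such \<open>r\<close> and exchanging the integrals gives the statement
  on segments.\<close>

lemma thick_segments:
 fixes W :: "(real^'n) set" and a x :: "real^'n" and l :: real
 assumes W [measurable]: "W \<in> sets borel" and a: "\<And>i. 0 < a $ i" and l: "0 < l" "l \<le> 1"
  and thick: "ennreal (l * (\<Prod>i\<in>UNIV. a $ i)) \<le> (NN y. indicator (cbox 0 a) y * indicator W (x + y))"
 shows "ennreal (l^2 / (4 * real CARD('n)) * (\<Prod>i\<in>UNIV. a $ i))
   \<le> (NN v. indicator (cbox 0 a) v * (\<integral>\<^sup>+r. indicator {0..1} r * indicator W (x + r *\<^sub>R v) \<partial>(lborel::real measure)))"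
proof -
 define V where "V = (\<Prod>i\<in>UNIV. a $ i)"
 define N where "N = real CARD('n)"
 \<comment> \<open>By Bernoulli's inequality \<open>1 - r ^ CARD('n) \<le> l / 2\<close> for
   \<open>r0 \<le> r \<le> 1\<close>. The length \<open>l / (2 * N)\<close> of
   \<open>[r0, 1]\<close> times the density \<open>l / 2\<close> is the constant of the
   statement.\<close>
 define r0 where "r0 = 1 - l / (2 * N)"
 have N: "N \<ge> 1" by (simp add: N_def Suc_leI)
 have V: "V > 0" unfolding V_def using a by (intro prod_pos) auto
 have "l / (2 * N) \<le> 1 / 2" using l N by (simp add: divide_simps)
 then have r0: "1 / 2 \<le> r0" "r0 \<le> 1" using l N by (auto simp: r0_def)
 have inner: "ennreal (l / 2 * V) \<le> (NN v. indicator (cbox 0 a) v * indicator W (x + r *\<^sub>R v))" (is "_ \<le> ?X")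
  if r: "r0 \<le> r" "r \<le> 1" for r
 proof -
  have rp: "r > 0" using r r0 by linarith
  have "1 + real CARD('n) * (r - 1) \<le> (1 + (r - 1)) ^ CARD('n)"
   by (rule Bernoulli_inequality) (use rp in simp)
  moreover have "N * (1 - r) \<le> N * (l / (2 * N))" using r N by (intro mult_left_mono) (auto simp: r0_def)
  ultimately have rN: "1 - r ^ CARD('n) \<le> l / 2" using N by (simp add: N_def algebra_simps)
  have sub: "cbox 0 (r *\<^sub>R a) \<subseteq> cbox 0 a"
  proof
   fix y assume y: "y \<in> cbox 0 (r *\<^sub>R a)"
   have "r * a $ i \<le> 1 * a $ i" for i using a[of i] r by (intro mult_right_mono) auto
   with y show "y \<in> cbox 0 a" by (auto simp: mem_box_cart intro: order_trans)
  qed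
  have ebig: "emeasure lborel (cbox 0 a) = ennreal V" unfolding V_def using a by (intro emeasure_cbox_zero) (auto intro: less_imp_le)
  have esml: "emeasure lborel (cbox 0 (r *\<^sub>R a)) = ennreal (r ^ CARD('n) * V)"
   unfolding V_def using a rp by (subst emeasure_cbox_zero) (auto intro: less_imp_le simp: prod.distrib)
  have "emeasure lborel (cbox 0 a - cbox 0 (r *\<^sub>R a)) = ennreal V - ennreal (r ^ CARD('n) * V)"
   by (subst emeasure_Diff) (auto simp: ebig esml sub)
  also have "\<dots> = ennreal (V - r ^ CARD('n) * V)" using V rp by (simp add: ennreal_minus)
  also have "V - r ^ CARD('n) * V = (1 - r ^ CARD('n)) * V" by (simp add: algebra_simps)
  finally have diff: "emeasure lborel (cbox 0 a - cbox 0 (r *\<^sub>R a)) \<le> ennreal (l / 2 * V)"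
   using rN V by (auto intro!: ennreal_leI mult_right_mono)
  have scale: "(NN y. indicator (cbox 0 (r *\<^sub>R a)) y * indicator W (x + y)) \<le> ?X"
  proof -
   have mem: "0 + r *\<^sub>R v \<in> cbox 0 (r *\<^sub>R a) \<longleftrightarrow> v \<in> cbox 0 a" for v
    using rp by (auto simp: mem_box_cart zero_le_mult_iff)
   have "(NN y. indicator (cbox 0 (r *\<^sub>R a)) y * indicator W (x + y))
     = ennreal (r ^ DIM(real^'n)) * (NN v. indicator (cbox 0 (r *\<^sub>R a)) (0 + r *\<^sub>R v) * indicator W (x + (0 + r *\<^sub>R v)))"
    by (rule nn_integral_lborel_scaling[OF lborel_distr_affine[OF rp]]) (use rp in auto)
   also have "(\<lambda>v. indicator (cbox 0 (r *\<^sub>R a)) (0 + r *\<^sub>R v) * indicator W (x + (0 + r *\<^sub>R v))) = (\<lambda>v. indicator (cbox 0 a) v * indicator W (x + r *\<^sub>R v) :: ennreal)"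
    using mem by (simp add: fun_eq_iff indicator_def)
   also have "ennreal (r ^ DIM(real^'n)) * ?X \<le> 1 * ?X"
    using rp r by (intro mult_right_mono) (auto simp: power_le_one)
   finally show ?thesis by simp
  qed
  have "ennreal (2 * (l / 2 * V)) \<le> (NN y. indicator (cbox 0 a) y * indicator W (x + y))"
   using thick by (simp add: V_def)
  also have "\<dots> \<le> (NN y. indicator (cbox 0 (r *\<^sub>R a)) y * indicator W (x + y) + indicator (cbox 0 a - cbox 0 (r *\<^sub>R a)) y)"
   by (intro nn_integral_mono) (simp add: indicator_def)
  also have "\<dots> = (NN y. indicator (cbox 0 (r *\<^sub>R a)) y * indicator W (x + y)) + emeasure lborel (cbox 0 a - cbox 0 (r *\<^sub>R a))"
   by (subst nn_integral_add) auto
  also have "\<dots> \<le> ?X + ennreal (l / 2 * V)"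
   by (intro add_mono scale diff)
  finally show ?thesis by (rule ennreal_cancel_half) (use l V in simp)
 qed
 have "ennreal (l^2 / (4 * N) * V) = (NN r. indicator {r0..1} r * ennreal (l / 2 * V))"
  using r0 l V N by (subst nn_integral_multc) (auto simp: ennreal_mult[symmetric] r0_def power2_eq_square field_simps)
 also have "\<dots> \<le> (NN r. indicator {0..1} r * (NN v. indicator (cbox 0 a) v * indicator W (x + r *\<^sub>R v)))"
  using inner r0 by (intro nn_integral_mono) (auto simp: indicator_def)
 also have "\<dots> = (NN r. \<integral>\<^sup>+v. indicator (cbox 0 a) v * (indicator {0..1} r * indicator W (x + r *\<^sub>R v)) \<partial>lborel)"
  by (intro nn_integral_cong, subst nn_integral_cmult[symmetric]) (auto simp: mult_ac)
 also have "\<dots> = (NN v. \<integral>\<^sup>+r. indicator (cbox 0 a) v * (indicator {0..1} r * indicator W (x + r *\<^sub>R v)) \<partial>lborel)"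
  by (rule lborel_pair.Fubini'[symmetric]) measurable
 also have "\<dots> = (NN v. indicator (cbox 0 a) v * (NN r. indicator {0..1} r * indicator W (x + r *\<^sub>R v)))"
  by (intro nn_integral_cong nn_integral_cmult) measurable
 finally show ?thesis unfolding V_def N_def .
qed

text \<open>\<open>fourier g (- x)\<close> is, up to a constant, the function with transform
  \<open>g\<close>. These are the coefficients of its expansion in \<open>r\<close> along
  \<open>x + r v\<close>; for \<open>m = 0\<close> the value at \<open>x\<close> results.\<close>

definition taylor_coeff :: "(real^'n \<Rightarrow> complex) \<Rightarrow> nat \<Rightarrow> real^'n \<Rightarrow> real^'n \<Rightarrow> complex" where
 "taylor_coeff g m x v = (LBINT z. g z * ekern z (- x) * ((\<i> * cx (v \<bullet> z)) ^ m / fact m))"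

definition taylor_rem :: "(real^'n \<Rightarrow> complex) \<Rightarrow> nat \<Rightarrow> real \<Rightarrow> real^'n \<Rightarrow> real^'n \<Rightarrow> complex" where
 "taylor_rem g j r v x = fourier g (- (x + r *\<^sub>R v)) - (\<Sum>m\<le>j. of_real r ^ m * taylor_coeff g m x v)"

definition exp_rem :: "nat \<Rightarrow> real \<Rightarrow> complex" where
 "exp_rem j \<theta> = iexp \<theta> - (\<Sum>m\<le>j. (\<i> * cx \<theta>) ^ m / fact m)"

lemma exp_rem_measurable [measurable]: "exp_rem j \<in> borel_measurable borel"
 unfolding exp_rem_def[abs_def] by measurable

lemma norm_exp_rem: "cmod (exp_rem j \<theta>) \<le> \<bar>\<theta>\<bar> ^ Suc j / fact (Suc j)"
 unfolding exp_rem_def by (rule iexp_approx1)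

text \<open>Square integrability on a bounded set implies integrability, and a multiplier that is
  bounded on the band preserves it.\<close>

lemma integrable_band_limited_mult:
 fixes g h :: "real^'n \<Rightarrow> complex"
 assumes g: "sqi g" "\<And>z. k < norm z \<Longrightarrow> g z = 0"
  and h: "h \<in> borel_measurable borel" "\<And>z. norm z \<le> k \<Longrightarrow> cmod (h z) \<le> B"
 shows "integrable lborel (\<lambda>z. g z * h z)"
proof -
 have [measurable]: "g \<in> borel_measurable borel" using g by (simp add: sqi_on_def)
 note h(1) [measurable]
 have "trunc k g = g" using g(2) by (auto simp: trunc_def fun_eq_iff indicator_def not_le)
 then have gi: "integrable lborel g" using integrable_trunc[OF g(1), of k] by simp
 show ?thesis
 proof (rule Bochner_Integration.integrable_bound)
  show "integrable lborel (\<lambda>z. B * cmod (g z))" using gi by auto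
  have "cmod (g z * h z) \<le> B * cmod (g z)" for z
   using g(2)[of z] h(2)[of z] mult_left_mono[of "cmod (h z)" B "cmod (g z)"]
   by (cases "norm z \<le> k") (auto simp: norm_mult mult.commute)
  then show "AE z in lborel. norm (g z * h z) \<le> norm (B * cmod (g z))"
   by (intro AE_I2) (auto intro: order_trans[OF _ abs_ge_self])
 qed measurable
qed

lemma taylor_coeff_measurable [measurable]:
 assumes [measurable]: "g \<in> borel_measurable borel" "f1 \<in> borel_measurable M" "f2 \<in> borel_measurable M"
 shows "(\<lambda>z. taylor_coeff g m (f1 z) (f2 z)) \<in> borel_measurable M"
 unfolding taylor_coeff_def by (rule lborel.borel_measurable_lebesgue_integral) measurable

lemma taylor_rem_measurable [measurable]:
 assumes [measurable]: "g \<in> borel_measurable borel" "f0 \<in> borel_measurable M" "f1 \<in> borel_measurable M" "f2 \<in> borel_measurable M"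
 shows "(\<lambda>z. taylor_rem g j (f0 z) (f1 z) (f2 z)) \<in> borel_measurable M"
 unfolding taylor_rem_def by measurable

lemma integral_add_sum:
 fixes a :: "'a \<Rightarrow> complex"
 assumes "integrable M a" "\<And>m. integrable M (b m)"
 shows "(LINT x|M. a x + (\<Sum>m\<le>(j::nat). c m * b m x)) = (LINT x|M. a x) + (\<Sum>m\<le>j. c m * (LINT x|M. b m x))"
 using assms by (simp add: Bochner_Integration.integral_sum)

text \<open>For fixed \<open>r\<close> and \<open>v\<close> the Taylor remainder is again a
  transform, of \<open>g\<close> times the multiplier \<open>exp_rem\<close>, which is bounded on
  the band. Plancherel thus gives its mean square over all \<open>x\<close>.\<close>

lemma taylor_rem_fourier:
 fixes g :: "real^'n \<Rightarrow> complex"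
 assumes g: "sqi g" "\<And>z. k < norm z \<Longrightarrow> g z = 0"
 shows "taylor_rem g j r v x = fourier (\<lambda>z. g z * exp_rem j (r * (v \<bullet> z))) (- x)"
proof -
 have [measurable]: "g \<in> borel_measurable borel" using g by (simp add: sqi_on_def)
 have vk: "\<bar>v \<bullet> z\<bar> \<le> norm v * k" if "norm z \<le> k" for z
  using Cauchy_Schwarz_ineq2[of v z] mult_left_mono[OF that, of "norm v"] by auto
 have i1: "integrable lborel (\<lambda>z. g z * (ekern z (- x) * ((\<i> * cx (v \<bullet> z)) ^ m / fact m)))" for m
 proof (rule integrable_band_limited_mult[OF g])
  show "cmod (ekern z (- x) * ((\<i> * cx (v \<bullet> z)) ^ m / fact m)) \<le> (norm v * k) ^ m / fact m" if "norm z \<le> k" for z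
   using vk[OF that] by (auto simp: norm_mult norm_divide norm_power norm_ekern intro!: divide_right_mono power_mono)
 qed measurable
 have i2: "integrable lborel (\<lambda>z. g z * (exp_rem j (r * (v \<bullet> z)) * ekern z (- x)))"
 proof (rule integrable_band_limited_mult[OF g])
  show "cmod (exp_rem j (r * (v \<bullet> z)) * ekern z (- x)) \<le> (\<bar>r\<bar> * (norm v * k)) ^ Suc j / fact (Suc j)" if "norm z \<le> k" for z
   using order_trans[OF norm_exp_rem[of j "r * (v \<bullet> z)"], of "(\<bar>r\<bar> * (norm v * k)) ^ Suc j / fact (Suc j)"] vk[OF that]
   by (simp add: norm_mult divide_right_mono power_mono abs_mult mult_left_mono mult_mono del: power_Suc fact_Suc)
 qed measurable
 have "fourier g (- (x + r *\<^sub>R v)) = (LBINT z. g z * ekern z (- (x + r *\<^sub>R v)))"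
  by (rule fourier_lborel) measurable
 also have "\<dots> = (LBINT z. g z * (exp_rem j (r * (v \<bullet> z)) * ekern z (- x))
   + (\<Sum>m\<le>j. of_real r ^ m * (g z * (ekern z (- x) * ((\<i> * cx (v \<bullet> z)) ^ m / fact m)))))"
 proof (rule Bochner_Integration.integral_cong[OF refl])
  fix z
  have "ekern z (- (x + r *\<^sub>R v)) = ekern z (- x) * iexp (r * (v \<bullet> z))"
   by (simp add: exp_add[symmetric] inner_add_right inner_commute algebra_simps)
  also have "iexp (r * (v \<bullet> z)) = exp_rem j (r * (v \<bullet> z)) + (\<Sum>m\<le>j. of_real r ^ m * ((\<i> * cx (v \<bullet> z)) ^ m / fact m))"
   by (simp add: exp_rem_def power_mult_distrib mult_ac)
  finally show "g z * ekern z (- (x + r *\<^sub>R v)) = g z * (exp_rem j (r * (v \<bullet> z)) * ekern z (- x))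
   + (\<Sum>m\<le>j. of_real r ^ m * (g z * (ekern z (- x) * ((\<i> * cx (v \<bullet> z)) ^ m / fact m))))"
   by (simp add: distrib_left sum_distrib_left mult_ac)
 qed
 also have "\<dots> = (LBINT z. g z * (exp_rem j (r * (v \<bullet> z)) * ekern z (- x)))
   + (\<Sum>m\<le>j. of_real r ^ m * (LBINT z. g z * (ekern z (- x) * ((\<i> * cx (v \<bullet> z)) ^ m / fact m))))"
  by (rule integral_add_sum[OF i2 i1])
 also have "(LBINT z. g z * (exp_rem j (r * (v \<bullet> z)) * ekern z (- x))) = fourier (\<lambda>z. g z * exp_rem j (r * (v \<bullet> z))) (- x)"
  by (subst fourier_lborel) (measurable, simp add: mult.assoc)
 finally show ?thesis by (simp add: taylor_rem_def taylor_coeff_def mult.assoc)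
qed

text \<open>On the band \<open>norm z \<le> k\<close> the multiplier \<open>exp_rem\<close> is at
  most \<open>(A * k) ^ Suc j / fact (Suc j)\<close>: the remainder is small in mean square relative
  to the function itself, without pointwise estimates of derivatives.\<close>

lemma nrm_taylor_rem:
 fixes g :: "real^'n \<Rightarrow> complex"
 assumes g: "sqi g" "\<And>z. k < norm z \<Longrightarrow> g z = 0" and r: "0 \<le> r" "r \<le> 1" and v: "norm v \<le> A" and k: "0 \<le> k"
 shows "(NN x. ennreal ((cmod (taylor_rem g j r v x))^2))
   \<le> ennreal (((A * k) ^ Suc j / fact (Suc j))^2 * (nrm (fourier g))^2)"
proof -
 have [measurable]: "g \<in> borel_measurable borel" using g by (simp add: sqi_on_def)
 define E where "E = (A * k) ^ Suc j / fact (Suc j)"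
 have A: "A \<ge> 0" using v norm_ge_zero order_trans by blast
 have E: "E \<ge> 0" unfolding E_def using A k by simp
 define G where "G z = g z * exp_rem j (r * (v \<bullet> z))" for z
 have [measurable]: "G \<in> borel_measurable borel" unfolding G_def[abs_def] by measurable
 have er: "cmod (exp_rem j (r * (v \<bullet> z))) \<le> E" if "norm z \<le> k" for z
 proof -
  have "\<bar>r * (v \<bullet> z)\<bar> \<le> 1 * (norm v * norm z)"
   unfolding abs_mult using r Cauchy_Schwarz_ineq2[of v z] by (intro mult_mono) auto
  also have "\<dots> \<le> A * k" using v that A by (simp add: mult_mono)
  finally have "\<bar>r * (v \<bullet> z)\<bar> ^ Suc j / fact (Suc j) \<le> E"
   unfolding E_def by (intro divide_right_mono power_mono) auto
  then show ?thesis using norm_exp_rem order_trans by blast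
 qed
 have GE: "cmod (G z) \<le> cmod (cx E * g z)" for z
  using g(2)[of z] er[of z] E mult_left_mono[of "cmod (exp_rem j (r * (v \<bullet> z)))" E "cmod (g z)"]
  by (cases "norm z \<le> k") (auto simp: G_def norm_mult mult.commute)
 have sG: "sqi G" by (rule sqi_dominated[OF sqi_scale[OF g(1), of "of_real E"]]) (use GE in auto)
 have iG: "integrable lborel G"
  unfolding G_def[abs_def] by (rule integrable_band_limited_mult[OF g]) (use er in auto)
 have gi: "integrable lborel g" using integrable_band_limited_mult[OF g, where h = "\<lambda>z. 1" and B = 1] by simp
 have "(NN x. ennreal ((cmod (taylor_rem g j r v x))^2)) = (NN x. ennreal ((cmod (fourier G (- x)))^2))"
  by (simp add: taylor_rem_fourier[OF g] G_def[abs_def])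
 also have "\<dots> = ennreal ((nrm (fourier G))^2)"
  using nn_integral_sqi[OF sqi_reflect[OF Plancherel_L1(1)[OF iG sG]]] nrm_reflect[OF Plancherel_L1(1)[OF iG sG]] by simp
 also have "\<dots> \<le> ennreal (E^2 * (nrm (fourier g))^2)"
 proof (rule ennreal_leI)
  have "nrm G \<le> E * nrm g"
   using nrm_mono[OF sqi_scale[OF g(1), of "of_real E"], of G] GE E by (simp add: nrm_scale)
  then have "nrm (fourier G) \<le> E * nrm (fourier g)"
   unfolding Plancherel_L1(2)[OF iG sG] Plancherel_L1(2)[OF gi g(1)]
   using mult_left_mono[of "nrm G" "E * nrm g" "sqrt ((2 * pi) ^ CARD('n))"] by (simp add: mult_ac)
  then show "(nrm (fourier G))^2 \<le> E^2 * (nrm (fourier g))^2"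
   using power_mono[of "nrm (fourier G)" "E * nrm (fourier g)" 2] by (simp add: power_mult_distrib)
 qed
 finally show ?thesis unfolding E_def .
qed

lemma norm_le_cbox:
 fixes v a :: "real^'n" assumes "v \<in> cbox 0 a" shows "norm v \<le> norm a"
 unfolding norm_vec_def using assms by (intro L2_set_mono) (auto simp: mem_box_cart intro: order_trans[OF _ abs_ge_self])

text \<open>The segments from \<open>x\<close> to \<open>x + v\<close>, \<open>v\<close> in the box, spend on average a fixed fraction of their
 length in a thick set. On such a segment the band-limited function is a polynomial up to a small
 remainder, and its value at \<open>x\<close> is controlled by the Remez inequality. Averaging over \<open>v\<close> and \<open>x\<close>
 together, the remainders are bounded by Plancherel's theorem without any localisation.\<close>

lemma spectral_core:
 fixes W :: "(real^'n) set" and a :: "real^'n" and l k :: real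
 assumes W [measurable]: "W \<in> sets borel" and a: "\<And>i. 0 < a $ i" and l: "0 < l" "l \<le> 1"
  and thick: "\<And>x. ennreal (l * (\<Prod>i\<in>UNIV. a $ i)) \<le> (NN y. indicator (cbox 0 a) y * indicator W (x + y))"
  and g: "sqi g" "\<And>w. k < norm w \<Longrightarrow> g w = 0" and k: "0 \<le> k"
 defines "c \<equiv> l^2 / (8 * real CARD('n))"
 shows "c * (nrm (fourier g))^2 \<le> 2 * (4 * exp 2 / c) ^ (2 * Suc j) *
   ((nrm (\<lambda>x. indicator W x * fourier g (- x)))^2 + ((norm a * k) ^ Suc j / fact (Suc j))^2 * (nrm (fourier g))^2)"
proof -
 have [measurable]: "g \<in> borel_measurable borel" using g by (simp add: sqi_on_def)
 define V where "V = (\<Prod>i\<in>UNIV. a $ i)"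
 define \<Lambda> where "\<Lambda> = (4 * exp 2 / c) ^ (2 * Suc j)"
 define E where "E = ((norm a * k) ^ Suc j / fact (Suc j))^2"
 define F where "F x = fourier g (- x)" for x
 have [measurable]: "F \<in> borel_measurable borel" unfolding F_def[abs_def] by measurable
 have V: "V > 0" unfolding V_def using a by (intro prod_pos) auto
 have N: "real CARD('n) \<ge> 1" by (simp add: Suc_leI)
 have c: "0 < c" "c \<le> 1"
 proof -
  show "0 < c" using l N by (simp add: c_def)
  have "l^2 \<le> 1" using l by (simp add: power_le_one)
  then have "l^2 \<le> 8 * real CARD('n)" using N by linarith
  then show "c \<le> 1" unfolding c_def by (simp add: divide_le_eq)
 qed
 have \<Lambda>: "\<Lambda> > 0" unfolding \<Lambda>_def using c by (intro zero_less_power) auto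
 have gi: "integrable lborel g" using integrable_band_limited_mult[OF g, where h = "\<lambda>w. 1" and B = 1] by simp
 have sF: "sqi F" and nF: "nrm F = nrm (fourier g)"
  unfolding F_def[abs_def] using sqi_reflect nrm_reflect Plancherel_L1(1)[OF gi g(1)] by auto
 \<comment> \<open>From \<open>|p - q|^2 \<le> 2 |p|^2 + 2 |q|^2\<close>: the Taylor polynomial on a
   segment is the function minus the remainder, and the remainder is integrated over the whole
   segment, not only over the part in \<open>W\<close>.\<close>
 define H where "H x v r = indicator {0..1} r * (ennreal 2 * (indicator W (x + r *\<^sub>R v) * ennreal ((cmod (F (x + r *\<^sub>R v)))^2))
   + ennreal 2 * ennreal ((cmod (taylor_rem g j r v x))^2))" for x v :: "real^'n" and r :: real
 have Hm [measurable]: "(\<lambda>z. H (f1 z) (f2 z) (f3 z)) \<in> borel_measurable M"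
  if [measurable]: "f1 \<in> borel_measurable M" "f2 \<in> borel_measurable M" "f3 \<in> borel_measurable M" for f1 f2 f3 and M :: "'z measure"
  unfolding H_def by measurable
 \<comment> \<open>Segments that spend less than \<open>c\<close> in \<open>W\<close> get no Remez
   estimate and contribute the trivial bound \<open>c |F x|^2\<close>. As the mean over
   \<open>v\<close> of the time spent in \<open>W\<close> is at least \<open>2 c\<close>, this
   contribution is absorbed in \<open>pt\<close>.\<close>
 have seg: "ennreal ((cmod (F x))^2) * (NN r. indicator {0..1} r * indicator W (x + r *\<^sub>R v))
   \<le> ennreal (c * (cmod (F x))^2) + ennreal \<Lambda> * (NN r. H x v r)" for x v
 proof -
  define S where "S = {r \<in> {0..1}. x + r *\<^sub>R v \<in> W}"
  have S [measurable]: "S \<in> sets borel" unfolding S_def by measurable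
  have S01: "S \<subseteq> {0..1}" by (auto simp: S_def)
  have ind: "indicator {0..1} r * indicator W (x + r *\<^sub>R v) = (indicator S r :: ennreal)" for r
   by (auto simp: S_def indicator_def)
  have eS: "emeasure lborel S \<le> 1" using emeasure_mono[OF S01, of lborel] by simp
  have psi: "(NN r. indicator {0..1} r * indicator W (x + r *\<^sub>R v)) = emeasure lborel S"
   unfolding ind by simp
  show ?thesis
  proof (cases "c \<le> measure lborel S")
   case False
   have "emeasure lborel S = ennreal (measure lborel S)"
    using eS by (intro emeasure_eq_ennreal_measure) (auto simp: top_unique)
   then have "emeasure lborel S \<le> ennreal c" using False by (auto intro: ennreal_leI)
   then have "ennreal ((cmod (F x))^2) * emeasure lborel S \<le> ennreal ((cmod (F x))^2) * ennreal c" by (intro mult_left_mono) auto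
   also have "\<dots> = ennreal (c * (cmod (F x))^2)" using c by (simp add: ennreal_mult mult.commute)
   finally show ?thesis unfolding psi by (rule order_trans) simp
  next
   case True
   \<comment> \<open>The Remez inequality bounds the value at the endpoint \<open>r = 0\<close>,
     which is \<open>F x\<close> for every direction \<open>v\<close>.\<close>
   have c0: "taylor_coeff g 0 x v = F x" by (simp add: taylor_coeff_def F_def fourier_lborel)
   have "ennreal ((cmod (F x))^2) * emeasure lborel S \<le> ennreal ((cmod (F x))^2) * 1" using eS by (intro mult_left_mono) auto
   also have "\<dots> = ennreal ((cmod (taylor_coeff g 0 x v))^2)" by (simp add: c0)
   also have "\<dots> \<le> ennreal \<Lambda> * (NN r. indicator S r * ennreal ((cmod (\<Sum>m\<le>j. of_real r ^ m * taylor_coeff g m x v))^2))"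
    unfolding \<Lambda>_def by (rule Remez_L2[OF S S01 c True])
   also have "\<dots> \<le> ennreal \<Lambda> * (NN r. H x v r)"
   proof (intro mult_left_mono nn_integral_mono)
    fix r :: real
    have "(\<Sum>m\<le>j. of_real r ^ m * taylor_coeff g m x v) = F (x + r *\<^sub>R v) - taylor_rem g j r v x"
     by (simp add: taylor_rem_def F_def)
    moreover have "(cmod (p - q))^2 \<le> 2 * (cmod p)^2 + 2 * (cmod q)^2" for p q :: complex
    proof -
     have "(cmod (p - q))^2 \<le> (cmod p + cmod q)^2" by (intro power_mono norm_triangle_ineq4) auto
     also have "\<dots> \<le> 2 * (cmod p)^2 + 2 * (cmod q)^2"
      using sum_squares_bound[of "cmod p" "cmod q"] by (simp add: power2_sum)
     finally show ?thesis .
    qed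
    ultimately have "ennreal ((cmod (\<Sum>m\<le>j. of_real r ^ m * taylor_coeff g m x v))^2)
      \<le> ennreal (2 * (cmod (F (x + r *\<^sub>R v)))^2 + 2 * (cmod (taylor_rem g j r v x))^2)"
     by (intro ennreal_leI) simp
    also have "\<dots> = ennreal 2 * ennreal ((cmod (F (x + r *\<^sub>R v)))^2) + ennreal 2 * ennreal ((cmod (taylor_rem g j r v x))^2)"
     by (subst ennreal_plus) (simp_all add: ennreal_mult)
    finally show "indicator S r * ennreal ((cmod (\<Sum>m\<le>j. of_real r ^ m * taylor_coeff g m x v))^2) \<le> H x v r"
     by (auto simp: H_def S_def indicator_def)
   qed simp
   finally show ?thesis unfolding psi by (rule order_trans) simp
  qed
 qed
 have pt: "ennreal (c * V) * ennreal ((cmod (F x))^2) \<le> ennreal \<Lambda> * (NN v. indicator (cbox 0 a) v * (NN r. H x v r))" for x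
 proof -
  have "ennreal (2 * (c * V * (cmod (F x))^2)) = ennreal ((cmod (F x))^2) * ennreal (l^2 / (4 * real CARD('n)) * V)"
   using V by (subst ennreal_mult[symmetric]) (auto simp: c_def)
  also have "\<dots> \<le> ennreal ((cmod (F x))^2) * (NN v. indicator (cbox 0 a) v * (NN r. indicator {0..1} r * indicator W (x + r *\<^sub>R v)))"
   unfolding V_def by (intro mult_left_mono thick_segments W a l thick) auto
  also have "\<dots> = (NN v. indicator (cbox 0 a) v * (ennreal ((cmod (F x))^2) * (NN r. indicator {0..1} r * indicator W (x + r *\<^sub>R v))))"
   by (subst nn_integral_cmult[symmetric]) (auto simp: mult_ac)
  also have "\<dots> \<le> (NN v. indicator (cbox 0 a) v * (ennreal (c * (cmod (F x))^2) + ennreal \<Lambda> * (NN r. H x v r)))"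
   by (intro nn_integral_mono mult_left_mono seg) auto
  also have "\<dots> = (NN v. ennreal (c * (cmod (F x))^2) * indicator (cbox 0 a) v + ennreal \<Lambda> * (indicator (cbox 0 a) v * (NN r. H x v r)))"
   by (simp add: distrib_left mult_ac)
  also have "\<dots> = ennreal (c * (cmod (F x))^2) * emeasure lborel (cbox 0 a) + ennreal \<Lambda> * (NN v. indicator (cbox 0 a) v * (NN r. H x v r))"
   by (subst nn_integral_add) (auto simp: nn_integral_cmult)
  also have "ennreal (c * (cmod (F x))^2) * emeasure lborel (cbox 0 a) = ennreal (c * V * (cmod (F x))^2)"
   using a V c by (subst emeasure_cbox_zero) (auto simp: V_def[symmetric] ennreal_mult[symmetric] mult_ac intro: less_imp_le)
  finally have "ennreal (2 * (c * V * (cmod (F x))^2)) \<le> ennreal \<Lambda> * (NN v. indicator (cbox 0 a) v * (NN r. H x v r)) + ennreal (c * V * (cmod (F x))^2)"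
   by (simp add: add.commute)
  from ennreal_cancel_half[OF this] show ?thesis using V c by (simp add: ennreal_mult)
 qed
 \<comment> \<open>With \<open>v\<close> and \<open>r\<close> fixed, \<open>x + r v\<close> runs
   over the whole space together with \<open>x\<close>, so translation invariance makes the observed
   term independent of \<open>v\<close> and \<open>r\<close>.\<close>
 have Hx: "(NN x. H x v r) \<le> indicator {0..1} r * ennreal (2 * ((nrm (\<lambda>x. indicator W x * F x))^2 + E * (nrm F)^2))"
  if v: "v \<in> cbox 0 a" for v r
 proof (cases "r \<in> {0..1}")
  case True
  have "(NN x. H x v r) = ennreal 2 * (NN x. indicator W (r *\<^sub>R v + x) * ennreal ((cmod (F (r *\<^sub>R v + x)))^2))
    + ennreal 2 * (NN x. ennreal ((cmod (taylor_rem g j r v x))^2))"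
   using True unfolding H_def by (simp add: nn_integral_add nn_integral_cmult add.commute[of _ "r *\<^sub>R v"])
  also have "(NN x. indicator W (r *\<^sub>R v + x) * ennreal ((cmod (F (r *\<^sub>R v + x)))^2)) = (NN x. indicator W x * ennreal ((cmod (F x))^2))"
   by (rule nn_integral_lborel_translation[of "\<lambda>x. indicator W x * ennreal ((cmod (F x))^2)"]) measurable
  also have "\<dots> = (NN x. ennreal ((cmod (indicator W x * F x))^2))"
   by (intro nn_integral_cong) (auto simp: indicator_def)
  also have "\<dots> = ennreal ((nrm (\<lambda>x. indicator W x * F x))^2)"
   by (rule nn_integral_sqi[OF sqi_indicator[OF sF]]) simp
  also have "ennreal 2 * \<dots> + ennreal 2 * (NN x. ennreal ((cmod (taylor_rem g j r v x))^2))
    \<le> ennreal 2 * ennreal ((nrm (\<lambda>x. indicator W x * F x))^2) + ennreal 2 * ennreal (E * (nrm F)^2)"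
   unfolding E_def nF using True
   by (intro add_mono mult_left_mono nrm_taylor_rem[OF g] norm_le_cbox[OF v] k) auto
  also have "\<dots> = ennreal (2 * ((nrm (\<lambda>x. indicator W x * F x))^2 + E * (nrm F)^2))"
   by (subst (1 2) ennreal_mult[symmetric]) (auto simp: E_def distrib_left simp flip: ennreal_plus)
  finally show ?thesis using True by simp
 qed (simp add: H_def)
 have "(NN x. \<integral>\<^sup>+v. indicator (cbox 0 a) v * (NN r. H x v r) \<partial>lborel)
   = (NN v. \<integral>\<^sup>+x. indicator (cbox 0 a) v * (NN r. H x v r) \<partial>lborel)"
  by (rule lborel_pair.Fubini') measurable
 also have "\<dots> = (NN v. indicator (cbox 0 a) v * (NN x. \<integral>\<^sup>+r. H x v r \<partial>lborel))"
  by (intro nn_integral_cong nn_integral_cmult) measurable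
 also have "\<dots> = (NN v. indicator (cbox 0 a) v * (NN r. \<integral>\<^sup>+x. H x v r \<partial>lborel))"
  by (intro nn_integral_cong arg_cong2[where f = "(*)"] refl lborel_pair.Fubini') measurable
 also have "\<dots> \<le> (NN v. indicator (cbox 0 a) v * ennreal (2 * ((nrm (\<lambda>x. indicator W x * F x))^2 + E * (nrm F)^2)))"
 proof (rule nn_integral_mono)
  fix v :: "real^'n"
  show "indicator (cbox 0 a) v * (NN r. \<integral>\<^sup>+x. H x v r \<partial>lborel) \<le> indicator (cbox 0 a) v * ennreal (2 * ((nrm (\<lambda>x. indicator W x * F x))^2 + E * (nrm F)^2))"
  proof (cases "v \<in> cbox 0 a")
   case True
   have "(NN r. \<integral>\<^sup>+x. H x v r \<partial>lborel) \<le> (\<integral>\<^sup>+r. indicator {0..1} r * ennreal (2 * ((nrm (\<lambda>x. indicator W x * F x))^2 + E * (nrm F)^2)) \<partial>(lborel::real measure))"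
    by (intro nn_integral_mono Hx True)
   also have "\<dots> = ennreal (2 * ((nrm (\<lambda>x. indicator W x * F x))^2 + E * (nrm F)^2))"
    by (subst nn_integral_multc) auto
   finally show ?thesis using True by simp
  qed simp
 qed
 also have "\<dots> = ennreal V * ennreal (2 * ((nrm (\<lambda>x. indicator W x * F x))^2 + E * (nrm F)^2))"
  using a by (subst nn_integral_multc) (auto simp: emeasure_cbox_zero V_def less_imp_le)
 finally have bound: "(NN x. \<integral>\<^sup>+v. indicator (cbox 0 a) v * (NN r. H x v r) \<partial>lborel)
   \<le> ennreal V * ennreal (2 * ((nrm (\<lambda>x. indicator W x * F x))^2 + E * (nrm F)^2))" .
 have "ennreal (c * V) * ennreal ((nrm F)^2) = (NN x. ennreal (c * V) * ennreal ((cmod (F x))^2))"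
  by (subst nn_integral_cmult) (auto simp: nn_integral_sqi[OF sF])
 also have "\<dots> \<le> (NN x. ennreal \<Lambda> * (NN v. indicator (cbox 0 a) v * (NN r. H x v r)))"
  by (intro nn_integral_mono pt)
 also have "\<dots> = ennreal \<Lambda> * (NN x. \<integral>\<^sup>+v. indicator (cbox 0 a) v * (NN r. H x v r) \<partial>lborel)"
  by (rule nn_integral_cmult) measurable
 also have "\<dots> \<le> ennreal \<Lambda> * (ennreal V * ennreal (2 * ((nrm (\<lambda>x. indicator W x * F x))^2 + E * (nrm F)^2)))"
  by (intro mult_left_mono bound) simp
 finally have "ennreal (c * V) * ennreal ((nrm F)^2) \<le> ennreal \<Lambda> * (ennreal V * ennreal (2 * ((nrm (\<lambda>x. indicator W x * F x))^2 + E * (nrm F)^2)))" .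
 moreover define R where "R = 2 * ((nrm (\<lambda>x. indicator W x * F x))^2 + E * (nrm F)^2)"
 ultimately have le: "ennreal (c * V) * ennreal ((nrm F)^2) \<le> ennreal \<Lambda> * (ennreal V * ennreal R)" by simp
 have R0: "R \<ge> 0" unfolding R_def E_def by simp
 have "ennreal (c * V * (nrm F)^2) \<le> ennreal (\<Lambda> * (V * R))"
  using le c V \<Lambda> R0 by (simp add: ennreal_mult)
 then have "c * V * (nrm F)^2 \<le> \<Lambda> * (V * R)"
  using \<Lambda> V R0 by (subst (asm) ennreal_le_iff) auto
 then have "c * V * (nrm F)^2 \<le> \<Lambda> * (V * (2 * ((nrm (\<lambda>x. indicator W x * F x))^2 + E * (nrm F)^2)))"
  by (simp only: R_def)
 then have "V * (c * (nrm F)^2) \<le> V * (2 * \<Lambda> * ((nrm (\<lambda>x. indicator W x * F x))^2 + E * (nrm F)^2))"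
  by (simp only: mult_ac)
 then have "c * (nrm F)^2 \<le> 2 * \<Lambda> * ((nrm (\<lambda>x. indicator W x * F x))^2 + E * (nrm F)^2)"
  by (simp only: mult_le_cancel_left_pos[OF V])
 then show ?thesis unfolding \<Lambda>_def E_def nF F_def .
qed

text \<open>The degree is taken proportional to \<open>k\<close>, up to a constant. Then the Remez
  constant \<open>L ^ (2 * n)\<close> is at most a constant times an exponential in
  \<open>k\<close>, and its product with the squared remainder is at most \<open>c / 4\<close>, so
  that this term is absorbed on the left.\<close>

theorem spectral_inequality:
 fixes W :: "(real^'n) set" and a :: "real^'n" and l :: real
 assumes W: "W \<in> sets borel" and a: "\<And>i. 0 < a $ i" and l: "0 < l" "l \<le> 1"
  and thick: "\<And>x. ennreal (l * (\<Prod>i\<in>UNIV. a $ i)) \<le> (NN y. indicator (cbox 0 a) y * indicator W (x + y))"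
 obtains C where "C > 0"
  "\<And>k g. 0 \<le> k \<Longrightarrow> sqi g \<Longrightarrow> (\<And>z. k < norm z \<Longrightarrow> g z = 0) \<Longrightarrow>
   (nrm (fourier g))^2 \<le> C * exp (C * k) * (nrm (\<lambda>x. indicator W x * fourier g (- x)))^2"
proof -
 define c where "c = l^2 / (8 * real CARD('n))"
 define L where "L = 4 * exp 2 / c"
 \<comment> \<open>\<open>D\<close> gives \<open>L |a| k \<le> n exp (- 2)\<close>, hence
   \<open>(L |a| k) ^ n / fact n \<le> exp (- n)\<close> by
   \<open>n ^ n \<le> fact n * exp n\<close>. The term \<open>ln (4 / c)\<close> in
   \<open>D2\<close> makes \<open>exp (- n)\<close> at most \<open>c / 4\<close>, and its
   \<open>2\<close> covers the ceiling and the successor.\<close>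
 define D where "D = exp 2 * L * norm a"
 define D2 where "D2 = ln (4 / c) + 2"
 define C where "C = 4 / c * exp (2 * ln L * D2) + 2 * ln L * D"
 have N: "real CARD('n) \<ge> 1" by (simp add: Suc_leI)
 have c: "0 < c" "c \<le> 1"
 proof -
  show "0 < c" using l N by (simp add: c_def)
  have "l^2 \<le> 1" using l by (simp add: power_le_one)
  then have "l^2 \<le> 8 * real CARD('n)" using N by linarith
  then show "c \<le> 1" unfolding c_def by (simp add: divide_le_eq)
 qed
 have L: "L > 1"
 proof -
  have "c < 4 * exp 2" using c exp_ge_add_one_self[of 2] by linarith
  then show ?thesis using c by (simp add: L_def less_divide_eq)
 qed
 have lnL: "ln L > 0" using L by simp
 have ln4: "ln (4 / c) \<ge> 0" using c by (intro ln_ge_zero) (simp add: le_divide_eq)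
 have D: "D \<ge> 0" unfolding D_def using L by simp
 have "4 / c * exp (2 * ln L * D2) > 0" using c by simp
 then have C: "C > 0" "4 / c * exp (2 * ln L * D2) \<le> C" "2 * ln L * D \<le> C"
  using mult_nonneg_nonneg[of "2 * ln L" D] lnL D unfolding C_def by linarith+
 have "(nrm (fourier g))^2 \<le> C * exp (C * k) * (nrm (\<lambda>x. indicator W x * fourier g (- x)))^2"
  if k: "0 \<le> k" and g: "sqi g" "\<And>z. k < norm z \<Longrightarrow> g z = 0" for k g
 proof -
  define Y where "Y = (nrm (fourier g))^2"
  define X where "X = (nrm (\<lambda>x. indicator W x * fourier g (- x)))^2"
  have XY: "X \<ge> 0" "Y \<ge> 0" by (auto simp: X_def Y_def)
  define j where "j = nat \<lceil>D * k + ln (4 / c)\<rceil>"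
  define n where "n = Suc j"
  have Dk: "D * k \<ge> 0" using D k by simp
  have n1: "D * k + ln (4 / c) \<le> real n" unfolding n_def j_def by linarith
  have n2: "real n \<le> D * k + D2" unfolding n_def j_def D2_def using Dk ln4 by linarith
  have n0: "real n > 0" by (simp add: n_def)
  define Q where "Q = (L * (norm a * k)) ^ n / fact n"
  have Q0: "Q \<ge> 0" unfolding Q_def using L k by simp
  have "Q \<le> exp (- real n)"
  proof -
   have "(L * (norm a * k)) \<le> real n * exp (- 2)"
   proof -
    have "exp 2 * (L * (norm a * k)) \<le> real n" using n1 ln4 by (simp add: D_def mult_ac)
    then show ?thesis by (simp add: exp_minus field_simps)
   qed
   then have "(L * (norm a * k)) ^ n \<le> (real n * exp (- 2)) ^ n"
    using L k by (intro power_mono) auto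
   also have "\<dots> = real n ^ n * exp (- 2 * real n)"
    by (simp add: power_mult_distrib exp_of_nat_mult[symmetric] mult.commute)
   also have "\<dots> \<le> (fact n * exp (real n)) * exp (- 2 * real n)"
    by (intro mult_right_mono power_le_exp_fact) auto
   also have "\<dots> = fact n * exp (- real n)" by (simp add: mult.assoc exp_add[symmetric])
   finally show ?thesis unfolding Q_def by (simp add: divide_le_eq mult.commute)
  qed
  then have "Q^2 \<le> (exp (- real n))^2" using Q0 by (intro power_mono) auto
  also have "\<dots> \<le> exp (- real n) * 1" unfolding power2_eq_square by (intro mult_left_mono) auto
  also have "exp (- real n) \<le> exp (- ln (4 / c))" using n1 Dk by simp
  also have "\<dots> = c / 4" using c by (simp add: exp_minus)
  finally have Q2: "Q^2 \<le> c / 4" by simp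
  have LQ: "L ^ (2 * n) * ((norm a * k) ^ n / fact n)^2 = Q^2"
   by (simp add: Q_def power_mult_distrib power_divide power_even_eq)
  have "c * Y \<le> 2 * L ^ (2 * n) * (X + ((norm a * k) ^ n / fact n)^2 * Y)"
   using spectral_core[OF W a l thick g k, of j] unfolding Y_def X_def n_def L_def c_def by simp
  also have "\<dots> = 2 * L ^ (2 * n) * X + 2 * (L ^ (2 * n) * ((norm a * k) ^ n / fact n)^2) * Y"
   by (simp add: algebra_simps)
  also have "\<dots> \<le> 2 * L ^ (2 * n) * X + 2 * (c / 4) * Y"
   unfolding LQ using Q2 XY by (intro add_mono mult_right_mono) auto
  finally have "Y \<le> 4 / c * L ^ (2 * n) * X" using c by (simp add: field_simps)
  also have "L ^ (2 * n) = exp (2 * ln L * real n)"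
  proof -
   have "exp (real (2 * n) * ln L) = L ^ (2 * n)" using L by (simp only: exp_of_nat_mult exp_ln)
   moreover have "2 * ln L * real n = real (2 * n) * ln L" by simp
   ultimately show ?thesis by (simp only:)
  qed
  also have "4 / c * exp (2 * ln L * real n) * X \<le> 4 / c * exp (2 * ln L * (D * k + D2)) * X"
   using c lnL n2 XY by (intro mult_right_mono mult_left_mono) auto
  also have "4 / c * exp (2 * ln L * (D * k + D2)) = (4 / c * exp (2 * ln L * D2)) * exp ((2 * ln L * D) * k)"
   by (simp add: algebra_simps exp_add)
  also have "\<dots> * X \<le> C * exp (C * k) * X"
   using C k XY by (intro mult_right_mono mult_mono) (auto intro: mult_right_mono)
  finally show ?thesis unfolding X_def Y_def .
 qed
 with C(1) show ?thesis by (rule that)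
qed

section \<open>Transforms of test functions determine a tempered function\<close>

lemma peetre: "1 + norm (x::'a::real_normed_vector) \<le> (1 + norm (x + y)) * (1 + norm y)"
proof -
 have "norm x \<le> norm (x + y) + norm y" using norm_triangle_ineq4[of "x + y" y] by simp
 moreover have "0 \<le> norm (x + y) * norm y" by simp
 moreover have "(1 + norm (x + y)) * (1 + norm y) = 1 + norm (x + y) + norm y + norm (x + y) * norm y"
  by (simp add: algebra_simps)
 ultimately show ?thesis by linarith
qed

lemma integrable_sqi_weight:
 fixes w :: "real^'n \<Rightarrow> complex"
 assumes "sqi w"
 shows "integrable lborel (\<lambda>z. cmod (w z) / (1 + norm z) ^ (2 * CARD('n)))"
proof -
 have "cmod (w z * cx (1 / (1 + norm z) ^ (2 * CARD('n)))) = cmod (w z) / (1 + norm z) ^ (2 * CARD('n))" for z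
  by (simp only: norm_mult norm_of_real) simp
 with integrable_norm[OF integrable_mult_sqi[OF assms weight_sqi[OF order_refl]]] show ?thesis by simp
qed

lemma continuous_AE_zero:
 fixes h :: "'a::euclidean_space \<Rightarrow> complex"
 assumes "AE x in lborel. h x = 0" "continuous_on UNIV h"
 shows "h x = 0"
proof -
 have [measurable]: "h \<in> borel_measurable borel" using assms(2) by (rule borel_measurable_continuous_onI)
 have "open {x. h x \<noteq> 0}" using assms(2) by (intro open_Collect_neq continuous_intros)
 moreover have "{x. h x \<noteq> 0} \<in> null_sets lborel"
  using assms(1) by (subst (asm) AE_iff_null) auto
 then have "negligible {x. h x \<noteq> 0}"
  unfolding negligible_iff_null_sets by (rule null_sets_completionI)
 ultimately have "{x. h x \<noteq> 0} = {}" using open_not_negligible by blast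
 then show ?thesis by blast
qed

text \<open>Inversion at the origin: the integral is \<open>(2 * pi) ^ CARD('a) * bump 0\<close>.
  Inversion holds almost everywhere, and continuity of both sides carries it to the point
  \<open>0\<close>.\<close>

lemma bump_transform_integral: "(LBINT z. fourier bump z) \<noteq> 0"
proof -
 let ?b = "bump :: real^'a \<Rightarrow> complex"
 have b: "integrable lborel ?b" "sqi ?b" "continuous_on UNIV ?b"
  using test_Cc[OF bump_test] by (auto intro: Cc_integrable Cc_sqi Cc_continuous)
 obtain C where C: "C > 0" "\<And>y. cmod (fourier ?b y) * (1 + norm y) ^ (2 * CARD('a)) \<le> C"
  using fourier_decay[OF bump_test] by metis
 have [measurable]: "?b \<in> borel_measurable borel" using b by auto
 have F: "integrable lborel (fourier ?b)"
 proof (rule Bochner_Integration.integrable_bound)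
  show "integrable lborel (\<lambda>y::real^'a. C * (1 / (1 + norm y) ^ (2 * CARD('a))))"
   by (intro integrable_mult_right weight_integrable) simp
  have "cmod (fourier ?b y) \<le> C * (1 / (1 + norm y) ^ (2 * CARD('a)))" for y
  proof -
   have "(1 + norm y) ^ (2 * CARD('a)) > 0" by (intro zero_less_power) (auto intro: add_pos_nonneg)
   then show ?thesis using C(2)[of y] by (simp add: field_simps)
  qed
  then show "AE y in lborel. norm (fourier ?b y) \<le> norm (C * (1 / (1 + norm y) ^ (2 * CARD('a))))"
   using C(1) by (intro AE_I2) (simp only: real_norm_def abs_mult abs_of_pos, simp)
 qed simp
 have Fs: "sqi (fourier ?b)" by (rule Plancherel_L1[OF b(1,2)])
 let ?F = "\<lambda>y. cnj (fourier ?b y)"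
 have F': "integrable lborel ?F" "sqi ?F" using F Fs by (auto intro: sqi_cnj)
 have "AE x in lborel. fourier ?F x = (2 * pi) ^ CARD('a) * cnj (?b x)"
  by (rule FT_unique[OF FT_L1[OF F'] FT_cnj[OF FT_L1[OF b(1,2)]]])
 then have "AE x in lborel. fourier ?F x - (2 * pi) ^ CARD('a) * cnj (?b x) = 0" by simp
 moreover have "continuous_on UNIV (\<lambda>x. fourier ?F x - (2 * pi) ^ CARD('a) * cnj (?b x))"
  by (intro continuous_intros fourier_continuous F' b(3))
 ultimately have *: "fourier ?F 0 - (2 * pi) ^ CARD('a) * cnj (?b 0) = 0" by (rule continuous_AE_zero)
 have "fourier ?F 0 = (LBINT z. cnj (fourier ?b z))"
  by (subst fourier_lborel) (auto intro: borel_measurable_cnj)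
 also have "\<dots> = cnj (LBINT z. fourier ?b z)" by (rule Bochner_Integration.integral_cnj)
 finally have "cnj (LBINT z. fourier ?b z) = (2 * pi) ^ CARD('a) * cnj (?b 0)" using * by simp
 then show ?thesis using bump_0[where 'a = 'a] by auto
qed

lemma bump_dilated_test:
 fixes w :: "real^'n"
 assumes "d > 0" shows "(\<lambda>x. ekern x w * bump (d *\<^sub>R x)) \<in> test_functions"
proof -
 have e: "mat c *v x = c *\<^sub>R x" for c and x :: "real^'n"
  by (simp add: mat_def matrix_vector_mult_def vec_eq_iff if_distrib[of "\<lambda>y. y * _"] cong: if_cong)
 have "mat (1 / d) ** mat d = (mat 1 :: real^'n^'n)"
  using assms by (intro matrix_eq[THEN iffD2]) (simp add: e flip: matrix_vector_mul_assoc)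
 from test_linear[OF bump_test this] have "(\<lambda>x. bump (d *\<^sub>R x)) \<in> (test_functions :: (real^'n \<Rightarrow> complex) set)" by (simp add: e)
 from test_mult[OF this C_k_ekern] show ?thesis .
qed

text \<open>Modulation by \<open>w\<close> and dilation turn the transform into a kernel that
  concentrates at \<open>w\<close> as \<open>e\<close> tends to \<open>0\<close>: test transforms
  contain approximate identities at every frequency.\<close>

lemma fourier_bump_dilated:
 fixes w :: "real^'n"
 assumes e: "e > 0"
 shows "fourier (\<lambda>x. ekern x w * bump (e *\<^sub>R x)) (- z) = (1 / e) ^ CARD('n) *\<^sub>R fourier bump ((1 / e) *\<^sub>R (w - z))"
proof -
 have [measurable]: "(bump :: real^'n \<Rightarrow> complex) \<in> borel_measurable borel" by (rule Cc_borel[OF test_Cc[OF bump_test]])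
 have "fourier (\<lambda>x. ekern x w * bump (e *\<^sub>R x)) (- z) = (LBINT x. ekern x w * bump (e *\<^sub>R x) * ekern x (- z))"
  by (rule fourier_lborel) measurable
 also have "\<dots> = (LBINT x. bump (e *\<^sub>R x) * ekern x (w - z))"
  by (intro Bochner_Integration.integral_cong refl) (simp add: exp_add[symmetric] exp_diff inner_diff_right algebra_simps)
 also have "\<dots> = (1 / e) ^ CARD('n) *\<^sub>R (LBINT y. bump (e *\<^sub>R (0 + (1/e) *\<^sub>R y)) * ekern (0 + (1/e) *\<^sub>R y) (w - z))"
  using integral_lborel_scaling[OF lborel_distr_affine[of "1/e" "0::real^'n"], of "\<lambda>x. bump (e *\<^sub>R x) * ekern x (w - z)"] e
  by simp
 also have "(LBINT y. bump (e *\<^sub>R (0 + (1/e) *\<^sub>R y)) * ekern (0 + (1/e) *\<^sub>R y) (w - z)) = fourier bump ((1 / e) *\<^sub>R (w - z))"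
  using e by (subst fourier_lborel) simp_all
 finally show ?thesis .
qed

text \<open>The weighted function \<open>q\<close> is orthogonal to the kernels of
  \<open>fourier_bump_dilated\<close>. Averaged over their centre against a continuous function of
  compact support, these kernels converge to a nonzero multiple of that function. So
  \<open>q\<close> is orthogonal to all such functions, and by density \<open>w\<close> vanishes.
  Polynomial weights and Peetre's inequality supply the dominating functions.\<close>

lemma test_transforms_total:
 fixes w :: "real^'n \<Rightarrow> complex"
 assumes w: "sqi w"
  and zero: "\<And>\<phi>. \<phi> \<in> test_functions \<Longrightarrow> (LBINT \<xi>. cx ((1 + norm \<xi>) ^ p) * w \<xi> * fourier \<phi> (- \<xi>)) = 0"
 shows "AE \<xi> in lborel. w \<xi> = 0"
proof -
 have [measurable]: "w \<in> borel_measurable borel" using w by (simp add: sqi_on_def)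
 define N where "N = CARD('n)"
 \<comment> \<open>The part \<open>p\<close> of the exponent undoes the weight in \<open>q\<close>,
   and \<open>2 * N\<close> makes the square integrable \<open>w\<close> integrable.\<close>
 define P where "P = p + 2 * N"
 define q where "q \<xi> = cx ((1 + norm \<xi>) ^ p) * w \<xi>" for \<xi>
 define b where "b z = fourier bump z" for z :: "real^'n"
 have [measurable]: "q \<in> borel_measurable borel" unfolding q_def[abs_def] by measurable
 have "(bump :: real^'n \<Rightarrow> complex) \<in> borel_measurable borel" by (rule Cc_borel[OF test_Cc[OF bump_test]])
 then have [measurable]: "b \<in> borel_measurable borel" unfolding b_def[abs_def] by (rule fourier_measurable)
 have pos: "0 < (1 + norm \<xi>) ^ m" for \<xi> :: "real^'n" and m by (intro zero_less_power) (auto intro: add_pos_nonneg)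
 obtain C where C: "C > 0" "\<And>z. cmod (b z) * (1 + norm z) ^ (P + 2 * N) \<le> C"
  unfolding b_def using fourier_decay[OF bump_test] by metis
 have bP: "cmod (b z) * (1 + norm z) ^ P \<le> C * (1 / (1 + norm z) ^ (2 * N))" for z
 proof -
  have "cmod (b z) * (1 + norm z) ^ P * (1 + norm z) ^ (2 * N) \<le> C" using C(2)[of z] by (simp only: power_add mult.assoc)
  then show ?thesis by (simp only: mult_1_right times_divide_eq_right pos_le_divide_eq[OF pos])
 qed
 have bP': "cmod (b z) \<le> C / (1 + norm z) ^ P" for z
 proof -
  have "1 \<le> (1 + norm z) ^ (2 * N)" by (intro one_le_power) simp
  then have "1 / (1 + norm z) ^ (2 * N) \<le> 1" by (simp only: pos_divide_le_eq[OF pos])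
  then have "C * (1 / (1 + norm z) ^ (2 * N)) \<le> C * 1" using C(1) by (intro mult_left_mono) auto
  with bP[of z] show ?thesis unfolding pos_le_divide_eq[OF pos] by linarith
 qed
 have bi: "integrable lborel (\<lambda>z. cmod (b z) * (1 + norm z) ^ P)"
 proof (rule Bochner_Integration.integrable_bound)
  show "integrable lborel (\<lambda>z::real^'n. C * (1 / (1 + norm z) ^ (2 * N)))"
   by (intro integrable_mult_right weight_integrable) (simp add: N_def)
  show "AE z in lborel. norm (cmod (b z) * (1 + norm z) ^ P) \<le> norm (C * (1 / (1 + norm z) ^ (2 * N)))"
  proof (rule AE_I2)
   fix z :: "real^'n"
   have "0 \<le> cmod (b z) * (1 + norm z) ^ P" by (intro mult_nonneg_nonneg) auto
   with bP[of z] show "norm (cmod (b z) * (1 + norm z) ^ P) \<le> norm (C * (1 / (1 + norm z) ^ (2 * N)))"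
    unfolding real_norm_def using abs_ge_self[of "C * (1 / (1 + norm z) ^ (2 * N))"] by linarith
  qed
 qed measurable
 have qP: "cmod (q \<xi>) / (1 + norm \<xi>) ^ P = cmod (w \<xi>) / (1 + norm \<xi>) ^ (2 * N)" for \<xi>
 proof -
  have "cmod (q \<xi>) = (1 + norm \<xi>) ^ p * cmod (w \<xi>)"
   unfolding q_def norm_mult norm_of_real using pos[of \<xi> p] by (simp only: abs_of_pos)
  then show ?thesis unfolding P_def power_add using pos[of \<xi> p] by (simp only: mult_divide_mult_cancel_left[OF less_imp_neq[THEN not_sym]])
 qed
 have wi: "integrable lborel (\<lambda>\<xi>. cmod (q \<xi>) / (1 + norm \<xi>) ^ P)"
  unfolding qP N_def by (rule integrable_sqi_weight[OF w])
 have q0: "(LBINT \<xi>. q \<xi> * b (real (Suc m) *\<^sub>R (\<zeta> - \<xi>))) = 0" for m \<zeta>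
 proof -
  have "(LBINT \<xi>. cx (real (Suc m) ^ CARD('n)) * (q \<xi> * b (real (Suc m) *\<^sub>R (\<zeta> - \<xi>)))) = 0"
   using zero[OF bump_dilated_test[of "1 / real (Suc m)" \<zeta>]] fourier_bump_dilated[of "1 / real (Suc m)" \<zeta>]
   by (simp add: q_def b_def scaleR_conv_of_real mult_ac del: of_nat_Suc)
  moreover have "cx (real (Suc m) ^ CARD('n)) \<noteq> 0" by (simp del: of_nat_Suc)
  ultimately show ?thesis unfolding integral_mult_right_zero mult_eq_0_iff by blast
 qed
 have qPhi: "(LBINT \<xi>. q \<xi> * \<Phi> \<xi>) = 0" if \<Phi>: "Cc \<Phi>" for \<Phi>
 proof -
  have [measurable]: "\<Phi> \<in> borel_measurable borel" using \<Phi> by auto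
  obtain B R where B: "0 < B" "0 < R" "\<And>x. cmod (\<Phi> x) \<le> B * indicator (cball 0 R) x" using Cc_bounded[OF \<Phi>] by blast
  define B' where "B' = B * (1 + R) ^ P"
  have B': "cmod (\<Phi> x) \<le> B' / (1 + norm x) ^ P" for x
  proof (cases "norm x \<le> R")
   case True
   have "(1 + norm x) ^ P \<le> (1 + R) ^ P" using True by (intro power_mono) auto
   then have "B * (1 + norm x) ^ P \<le> B'" unfolding B'_def using B(1) by (intro mult_left_mono) auto
   then have "B \<le> B' / (1 + norm x) ^ P" using pos[of x P] by (simp add: field_simps)
   then show ?thesis using B(3)[of x] True by (simp add: indicator_def)
  next
   case False then show ?thesis using B(3)[of x] B pos[of x P] by (auto simp: indicator_def B'_def)
  qed
  \<comment> \<open>\<open>\<Phi>\<close> smoothed by the kernel of width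
    \<open>1 / real (Suc m)\<close>, written in the variable scaled to that width.\<close>
  define T where "T m \<xi> = (LBINT z. \<Phi> (\<xi> + (1 / real (Suc m)) *\<^sub>R z) * b z)" for m \<xi>
  have Tm: "T m \<in> borel_measurable borel" for m
  proof -
   have "(\<lambda>\<xi>. LBINT z. \<Phi> (\<xi> + (1 / real (Suc m)) *\<^sub>R z) * b z) \<in> borel_measurable borel"
    by (rule lborel.borel_measurable_lebesgue_integral) measurable
   then show ?thesis by (simp add: T_def[abs_def])
  qed
  have bd: "cmod (\<Phi> (\<xi> + (1 / real (Suc m)) *\<^sub>R z) * b z) \<le> B' / (1 + norm \<xi>) ^ P * (cmod (b z) * (1 + norm z) ^ P)" for m \<xi> z
  proof -
   let ?y = "(1 / real (Suc m)) *\<^sub>R z"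
   have "1 + norm \<xi> \<le> (1 + norm (\<xi> + ?y)) * (1 + norm ?y)" by (rule peetre)
   also have "\<dots> \<le> (1 + norm (\<xi> + ?y)) * (1 + norm z)"
   proof (intro mult_left_mono add_left_mono)
    have "norm z * 1 \<le> norm z * real (Suc m)" by (intro mult_left_mono) auto
    then show "norm ?y \<le> norm z" by (simp add: field_simps)
   qed auto
   finally have "(1 + norm \<xi>) ^ P \<le> ((1 + norm (\<xi> + ?y)) * (1 + norm z)) ^ P" by (intro power_mono) auto
   then have "(1 + norm \<xi>) ^ P \<le> (1 + norm (\<xi> + ?y)) ^ P * (1 + norm z) ^ P" by (simp add: power_mult_distrib)
   then have "1 / (1 + norm (\<xi> + ?y)) ^ P \<le> (1 + norm z) ^ P / (1 + norm \<xi>) ^ P"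
    using pos[of \<xi> P] pos[of "\<xi> + ?y" P] by (simp add: field_simps)
   then have "B' * (1 / (1 + norm (\<xi> + ?y)) ^ P) \<le> B' * ((1 + norm z) ^ P / (1 + norm \<xi>) ^ P)"
    using B by (intro mult_left_mono) (auto simp: B'_def)
   then have "cmod (\<Phi> (\<xi> + ?y)) \<le> B' * ((1 + norm z) ^ P / (1 + norm \<xi>) ^ P)" using B'[of "\<xi> + ?y"] by simp
   from mult_right_mono[OF this, of "cmod (b z)"] show ?thesis by (simp add: norm_mult mult_ac)
  qed
  define I0 where "I0 = (LBINT z. cmod (b z) * (1 + norm z) ^ P)"
  have bT: "cmod (T m \<xi>) \<le> B' * I0 / (1 + norm \<xi>) ^ P" for m \<xi>
  proof -
   have "cmod (T m \<xi>) \<le> (LBINT z. cmod (\<Phi> (\<xi> + (1 / real (Suc m)) *\<^sub>R z) * b z))"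
    unfolding T_def by (rule integral_norm_bound)
   also have "\<dots> \<le> (LBINT z. B' / (1 + norm \<xi>) ^ P * (cmod (b z) * (1 + norm z) ^ P))"
   proof (rule integral_mono')
    show "0 \<le> B' / (1 + norm \<xi>) ^ P * (cmod (b z) * (1 + norm z) ^ P)" for z
     using order_trans[OF norm_ge_zero bd] .
   qed (use bi bd in auto)
   finally show ?thesis by (simp add: I0_def)
  qed
  have Tz: "(LBINT \<xi>. q \<xi> * T m \<xi>) = 0" for m
  proof -
   define k where "k = real (Suc m)"
   have k: "k \<ge> 1" by (simp add: k_def)
   \<comment> \<open>For the dominating function Peetre's inequality trades decay in
     \<open>k *\<^sub>R (\<zeta> - \<xi>)\<close> for decay in \<open>\<xi>\<close> and growth in
     \<open>\<zeta>\<close>; the growth is harmless on the support of \<open>\<Phi>\<close>.\<close>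
   have "(LBINT \<zeta>. LBINT \<xi>. \<Phi> \<zeta> * (q \<xi> * b (k *\<^sub>R (\<zeta> - \<xi>)))) = (LBINT \<xi>. LBINT \<zeta>. \<Phi> \<zeta> * (q \<xi> * b (k *\<^sub>R (\<zeta> - \<xi>))))"
   proof (rule lborel_pair.Fubini_integral[symmetric], rule integrable_pair_dominated)
    show "integrable lborel (\<lambda>\<zeta>. cmod (\<Phi> \<zeta>) * (1 + norm \<zeta>) ^ P * C)"
    proof -
     have "Cc (\<lambda>\<zeta>. cx ((1 + norm \<zeta>) ^ P) * \<Phi> \<zeta>)"
      by (intro Cc_mult[OF \<Phi>] continuous_intros)
     from integrable_norm[OF Cc_integrable[OF this]] show ?thesis
      unfolding norm_mult norm_of_real using pos by (simp add: abs_of_pos mult.commute)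
    qed
    show "integrable lborel (\<lambda>\<xi>. cmod (q \<xi>) / (1 + norm \<xi>) ^ P)" by (rule wi)
    show "case_prod (\<lambda>\<zeta> \<xi>. \<Phi> \<zeta> * (q \<xi> * b (k *\<^sub>R (\<zeta> - \<xi>)))) \<in> borel_measurable (lborel \<Otimes>\<^sub>M lborel)" by measurable
    fix \<zeta> \<xi> :: "real^'n"
    have "1 + norm \<xi> \<le> (1 + norm (\<xi> + - \<zeta>)) * (1 + norm (- \<zeta>))"
     using peetre[of \<xi> "- \<zeta>"] by simp
    also have "\<dots> \<le> (1 + norm (k *\<^sub>R (\<zeta> - \<xi>))) * (1 + norm \<zeta>)"
    proof -
     have "norm (\<xi> - \<zeta>) \<le> k * norm (\<zeta> - \<xi>)" using k mult_right_mono[of 1 k "norm (\<zeta> - \<xi>)"] by (simp add: norm_minus_commute)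
     then show ?thesis using k by (intro mult_mono) auto
    qed
    finally have "(1 + norm \<xi>) ^ P \<le> (1 + norm (k *\<^sub>R (\<zeta> - \<xi>))) ^ P * (1 + norm \<zeta>) ^ P"
     using power_mono[of "1 + norm \<xi>" "(1 + norm (k *\<^sub>R (\<zeta> - \<xi>))) * (1 + norm \<zeta>)" P] by (simp add: power_mult_distrib)
    then have "1 / (1 + norm (k *\<^sub>R (\<zeta> - \<xi>))) ^ P \<le> (1 + norm \<zeta>) ^ P / (1 + norm \<xi>) ^ P"
     using pos[of \<xi> P] pos[of "k *\<^sub>R (\<zeta> - \<xi>)" P] by (simp add: field_simps)
    then have "C * (1 / (1 + norm (k *\<^sub>R (\<zeta> - \<xi>))) ^ P) \<le> C * ((1 + norm \<zeta>) ^ P / (1 + norm \<xi>) ^ P)"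
     using C by (intro mult_left_mono) auto
    then have "cmod (b (k *\<^sub>R (\<zeta> - \<xi>))) \<le> C * ((1 + norm \<zeta>) ^ P / (1 + norm \<xi>) ^ P)"
     using bP'[of "k *\<^sub>R (\<zeta> - \<xi>)"] by simp
    from mult_left_mono[OF this, of "cmod (\<Phi> \<zeta>) * cmod (q \<xi>)"]
    show "cmod (case (\<zeta>, \<xi>) of (\<zeta>, \<xi>) \<Rightarrow> \<Phi> \<zeta> * (q \<xi> * b (k *\<^sub>R (\<zeta> - \<xi>)))) \<le> cmod (\<Phi> \<zeta>) * (1 + norm \<zeta>) ^ P * C * (cmod (q \<xi>) / (1 + norm \<xi>) ^ P)"
     by (simp add: norm_mult mult_ac)
   qed
   moreover have "(LBINT \<xi>. \<Phi> \<zeta> * (q \<xi> * b (k *\<^sub>R (\<zeta> - \<xi>)))) = 0" for \<zeta>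
    by (subst integral_mult_right_zero) (simp only: k_def q0 mult_zero_right)
   moreover have "(LBINT \<zeta>. \<Phi> \<zeta> * (q \<xi> * b (k *\<^sub>R (\<zeta> - \<xi>)))) = cx ((1 / k) ^ CARD('n)) * (q \<xi> * T m \<xi>)" for \<xi>
   proof -
    have "(LBINT \<zeta>. \<Phi> \<zeta> * (q \<xi> * b (k *\<^sub>R (\<zeta> - \<xi>))))
      = (1 / k) ^ DIM(real^'n) *\<^sub>R (LBINT z. \<Phi> (\<xi> + (1/k) *\<^sub>R z) * (q \<xi> * b (k *\<^sub>R ((\<xi> + (1/k) *\<^sub>R z) - \<xi>))))"
     by (rule integral_lborel_scaling[OF lborel_distr_affine]) (use k in auto)
    also have "(LBINT z. \<Phi> (\<xi> + (1/k) *\<^sub>R z) * (q \<xi> * b (k *\<^sub>R ((\<xi> + (1/k) *\<^sub>R z) - \<xi>)))) = (LBINT z. q \<xi> * (\<Phi> (\<xi> + (1/k) *\<^sub>R z) * b z))"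
     using k by (intro Bochner_Integration.integral_cong refl) (simp add: mult_ac)
    also have "\<dots> = q \<xi> * T m \<xi>" unfolding T_def k_def by (rule integral_mult_right_zero)
    finally show ?thesis by (simp add: scaleR_conv_of_real)
   qed
   ultimately have "(LINT \<zeta>|(lborel :: (real^'n) measure). 0) = (LBINT \<xi>. cx ((1 / k) ^ CARD('n)) * (q \<xi> * T m \<xi>))" by (simp only:)
   then have "cx ((1 / k) ^ CARD('n)) * (LBINT \<xi>. q \<xi> * T m \<xi>) = 0" by (simp only: integral_mult_right_zero Bochner_Integration.integral_zero)
   moreover have "cx ((1 / k) ^ CARD('n)) \<noteq> 0" using k by simp
   ultimately show ?thesis by (metis mult_eq_0_iff)
  qed
  define c where "c = (LBINT z. b z)"
  have c0: "c \<noteq> 0" unfolding c_def b_def by (rule bump_transform_integral)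
  have bint: "integrable lborel b"
   by (rule Bochner_Integration.integrable_bound[OF bi])
     (auto intro!: AE_I2 mult_right_le_one_le simp: abs_mult mult_le_cancel_left1 one_le_power)
  have lim: "(\<lambda>m. LBINT \<xi>. q \<xi> * T m \<xi>) \<longlonglongrightarrow> (LBINT \<xi>. q \<xi> * (\<Phi> \<xi> * c))"
  proof (rule integral_dominated_convergence[where w = "\<lambda>\<xi>. B' * I0 * (cmod (q \<xi>) / (1 + norm \<xi>) ^ P)"])
   show "AE \<xi> in lborel. (\<lambda>m. q \<xi> * T m \<xi>) \<longlonglongrightarrow> q \<xi> * (\<Phi> \<xi> * c)"
   proof (rule AE_I2, rule tendsto_mult[OF tendsto_const])
    fix \<xi>
    have "(\<lambda>m. LBINT z. \<Phi> (\<xi> + (1 / real (Suc m)) *\<^sub>R z) * b z) \<longlonglongrightarrow> (LBINT z. \<Phi> \<xi> * b z)"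
    proof (rule integral_dominated_convergence[where w = "\<lambda>z. B' / (1 + norm \<xi>) ^ P * (cmod (b z) * (1 + norm z) ^ P)"])
     show "AE z in lborel. (\<lambda>m. \<Phi> (\<xi> + (1 / real (Suc m)) *\<^sub>R z) * b z) \<longlonglongrightarrow> \<Phi> \<xi> * b z"
     proof (rule AE_I2, rule tendsto_mult[OF _ tendsto_const])
      fix z
      have "(\<lambda>m. \<xi> + (1 / real (Suc m)) *\<^sub>R z) \<longlonglongrightarrow> \<xi> + 0 *\<^sub>R z"
       by (intro tendsto_add tendsto_scaleR tendsto_const eps_tendsto)
      then show "(\<lambda>m. \<Phi> (\<xi> + (1 / real (Suc m)) *\<^sub>R z)) \<longlonglongrightarrow> \<Phi> \<xi>"
       using Cc_continuous[OF \<Phi>] by (auto simp: continuous_on_eq_continuous_at intro: isCont_tendsto_compose)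
     qed
     show "AE z in lborel. norm (\<Phi> (\<xi> + (1 / real (Suc m)) *\<^sub>R z) * b z) \<le> B' / (1 + norm \<xi>) ^ P * (cmod (b z) * (1 + norm z) ^ P)" for m
      using bd by (intro AE_I2)
    qed (use bi in auto)
    then show "(\<lambda>m. T m \<xi>) \<longlonglongrightarrow> \<Phi> \<xi> * c" unfolding T_def c_def by (simp only: integral_mult_right_zero)
   qed
   show "AE \<xi> in lborel. norm (q \<xi> * T m \<xi>) \<le> B' * I0 * (cmod (q \<xi>) / (1 + norm \<xi>) ^ P)" for m
    using mult_left_mono[OF bT, of "cmod (q _)"] by (intro AE_I2) (simp add: norm_mult mult_ac)
   show "integrable lborel (\<lambda>\<xi>. B' * I0 * (cmod (q \<xi>) / (1 + norm \<xi>) ^ P))" using wi by (rule integrable_mult_right)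
  qed (use Tm in auto)
  have "(LBINT \<xi>. q \<xi> * (\<Phi> \<xi> * c)) = 0"
   using lim unfolding Tz by (simp add: LIMSEQ_const_iff)
  then have "(LBINT \<xi>. c * (q \<xi> * \<Phi> \<xi>)) = 0" by (simp only: mult_ac)
  then show ?thesis using c0 by (subst (asm) integral_mult_right_zero) simp
 qed
 \<comment> \<open>\<open>\<Psi>\<close> approximates the conjugate of \<open>w\<close>. Divided by
   the weight it is still continuous with compact support, hence orthogonal to \<open>q\<close>, so
   that \<open>\<Psi>\<close> itself is orthogonal to \<open>w\<close>.\<close>
 have "nrm w \<le> e" if e: "e > 0" for e
 proof -
  obtain \<Psi> where \<Psi>: "Cc \<Psi>" "nrm (\<lambda>\<xi>. cnj (w \<xi>) - \<Psi> \<xi>) < e" using Cc_dense[OF sqi_cnj[OF w] e] by blast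
  have "continuous_on UNIV (\<lambda>\<xi>::real^'n. cx (1 / (1 + norm \<xi>) ^ p))"
  proof (intro continuous_intros ballI)
   show "(1 + norm \<xi>) ^ p \<noteq> 0" for \<xi> :: "real^'n" using pos[of \<xi> p] by linarith
  qed
  from qPhi[OF Cc_mult[OF \<Psi>(1) this]]
  have "(LBINT \<xi>. q \<xi> * (cx (1 / (1 + norm \<xi>) ^ p) * \<Psi> \<xi>)) = 0" .
  moreover have "q \<xi> * (cx (1 / (1 + norm \<xi>) ^ p) * \<Psi> \<xi>) = w \<xi> * \<Psi> \<xi>" for \<xi>
  proof -
   have "cx ((1 + norm \<xi>) ^ p) * cx (1 / (1 + norm \<xi>) ^ p) = 1"
    using pos[of \<xi> p] by (simp only: of_real_mult[symmetric] times_divide_eq_right mult_1_right divide_self[OF less_imp_neq[THEN not_sym]] of_real_1)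
   then show ?thesis unfolding q_def by (metis mult.assoc mult.commute mult_1)
  qed
  ultimately have z: "(LBINT \<xi>. w \<xi> * \<Psi> \<xi>) = 0" by simp
  have "cx ((nrm w)^2) = (LBINT \<xi>. w \<xi> * cnj (w \<xi>))"
   unfolding nrm_square by (subst integral_complex_of_real[symmetric]) (simp add: complex_norm_square del: of_real_power)
  also have "\<dots> = (LBINT \<xi>. w \<xi> * (cnj (w \<xi>) - \<Psi> \<xi>))"
   using z integrable_mult_sqi[OF w sqi_cnj[OF w]] integrable_mult_sqi[OF w Cc_sqi[OF \<Psi>(1)]]
   by (simp add: right_diff_distrib)
  finally have "(nrm w)^2 = cmod (LBINT \<xi>. w \<xi> * (cnj (w \<xi>) - \<Psi> \<xi>))"
   by (metis norm_of_real abs_power2)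
  also have "\<dots> \<le> nrm w * nrm (\<lambda>\<xi>. cnj (w \<xi>) - \<Psi> \<xi>)"
   by (intro norm_integral_mult_le w sqi_diff sqi_cnj Cc_sqi \<Psi>)
  also have "\<dots> \<le> nrm w * e" using \<Psi>(2) by (intro mult_left_mono) auto
  finally have "nrm w * nrm w \<le> nrm w * e" by (simp add: power2_eq_square)
  then show ?thesis using e nrm_nonneg[of lborel w] by (cases "nrm w = 0") (auto simp: mult_le_cancel_left)
 qed
 then have "nrm w = 0" using field_le_epsilon[of "nrm w" 0] nrm_nonneg[of lborel w] by (intro antisym) auto
 then show ?thesis using nrm_eq_0[OF w] by simp
qed

text \<open>Cauchy-Schwarz in \<open>r\<close> with weight \<open>\<beta>\<close>: the square of the
  integral of \<open>|Z|\<close> is at most the integral of \<open>\<beta>\<close> times that of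
  \<open>|Z|^2 / \<beta>\<close>, and the latter integrates over \<open>y\<close> to at most the
  integral of \<open>\<beta>\<close> again. Integrability in \<open>r\<close> for almost every
  \<open>y\<close> comes out on the way.\<close>

lemma Minkowski_integral:
 fixes Z :: "real \<Rightarrow> 'a::euclidean_space \<Rightarrow> complex" and \<beta> :: "real \<Rightarrow> real"
 assumes Z [measurable]: "(\<lambda>(r, y). Z r y) \<in> borel_measurable (lborel \<Otimes>\<^sub>M lborel)"
  and \<beta> [measurable]: "\<beta> \<in> borel_measurable borel" and pos: "\<And>r. r \<in> {a..b} \<Longrightarrow> 0 < \<beta> r"
  and J: "(NN r. indicator {a..b} r * ennreal (\<beta> r)) \<le> ennreal J" "0 \<le> J"
  and bd: "\<And>r. r \<in> {a..b} \<Longrightarrow> (NN y. ennreal ((cmod (Z r y))^2)) \<le> ennreal ((\<beta> r)^2)"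
 shows "AE y in lborel. integrable lborel (\<lambda>r. indicator {a..b} r *\<^sub>R Z r y)"
  and "sqi (\<lambda>y. LBINT r. indicator {a..b} r *\<^sub>R Z r y)"
  and "nrm (\<lambda>y. LBINT r. indicator {a..b} r *\<^sub>R Z r y) \<le> J"
proof -
 define S where "S y = (NN r. indicator {a..b} r * ennreal (cmod (Z r y)))" for y
 define U where "U y = (NN r. indicator {a..b} r * (ennreal ((cmod (Z r y))^2) / ennreal (\<beta> r)))" for y
 have Zm [measurable]: "(\<lambda>z. Z (f1 z) (f2 z)) \<in> borel_measurable M"
  if [measurable]: "f1 \<in> borel_measurable M" "f2 \<in> borel_measurable M" for f1 f2 and M :: "'z measure"
 proof -
  have "(\<lambda>z. (f1 z, f2 z)) \<in> M \<rightarrow>\<^sub>M lborel \<Otimes>\<^sub>M lborel" by measurable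
  from measurable_compose[OF this Z] show ?thesis by simp
 qed
 have [measurable]: "S \<in> borel_measurable borel" "U \<in> borel_measurable borel"
  unfolding S_def[abs_def] U_def[abs_def] by measurable
 have SU: "(S y)^2 \<le> ennreal J * U y" for y
 proof -
  have pt: "indicator {a..b} r * ennreal (cmod (Z r y)) = (indicator {a..b} r * ennreal (sqrt (\<beta> r))) * (indicator {a..b} r * ennreal (cmod (Z r y) / sqrt (\<beta> r)))" for r
  proof (cases "r \<in> {a..b}")
   case True
   then have "0 < sqrt (\<beta> r)" using pos by simp
   then have "ennreal (sqrt (\<beta> r)) * ennreal (cmod (Z r y) / sqrt (\<beta> r)) = ennreal (cmod (Z r y))"
    by (subst ennreal_mult[symmetric]) auto
   then show ?thesis using True by simp
  qed simp
  have "S y = (NN r. (indicator {a..b} r * ennreal (sqrt (\<beta> r))) * (indicator {a..b} r * ennreal (cmod (Z r y) / sqrt (\<beta> r))))"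
   unfolding S_def by (intro nn_integral_cong pt)
  then have "(S y)^2 \<le> (NN r. (indicator {a..b} r * ennreal (sqrt (\<beta> r)))^2) * (NN r. (indicator {a..b} r * ennreal (cmod (Z r y) / sqrt (\<beta> r)))^2)"
   by (simp only:) (intro Cauchy_Schwarz_nn_integral; measurable)
  also have "(NN r. (indicator {a..b} r * ennreal (sqrt (\<beta> r)))^2) = (NN r. indicator {a..b} r * ennreal (\<beta> r))"
   by (intro nn_integral_cong) (use pos in \<open>auto simp: indicator_def ennreal_power less_imp_le\<close>)
  also have "(NN r. (indicator {a..b} r * ennreal (cmod (Z r y) / sqrt (\<beta> r)))^2) = U y"
   unfolding U_def
   by (intro nn_integral_cong) (use pos in \<open>auto simp: indicator_def ennreal_power power_divide divide_ennreal less_imp_le\<close>)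
  also have "(NN r. indicator {a..b} r * ennreal (\<beta> r)) * U y \<le> ennreal J * U y"
   by (intro mult_right_mono J) simp
  finally show ?thesis .
 qed
 have "(NN y. U y) = (NN r. \<integral>\<^sup>+y. indicator {a..b} r * (ennreal ((cmod (Z r y))^2) / ennreal (\<beta> r)) \<partial>lborel)"
  unfolding U_def by (rule lborel_pair.Fubini') measurable
 also have "\<dots> \<le> (NN r. indicator {a..b} r * ennreal (\<beta> r))"
 proof (rule nn_integral_mono)
  fix r
  show "(NN y. indicator {a..b} r * (ennreal ((cmod (Z r y))^2) / ennreal (\<beta> r))) \<le> indicator {a..b} r * ennreal (\<beta> r)"
  proof (cases "r \<in> {a..b}")
   case True
   have "(NN y. ennreal ((cmod (Z r y))^2) / ennreal (\<beta> r)) = (NN y. ennreal ((cmod (Z r y))^2)) / ennreal (\<beta> r)"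
    by (rule nn_integral_divide) measurable
   also have "\<dots> \<le> ennreal ((\<beta> r)^2) / ennreal (\<beta> r)" by (intro divide_right_mono_ennreal bd True)
   also have "\<dots> = ennreal (\<beta> r)" using pos[OF True] by (simp add: divide_ennreal power2_eq_square)
   finally show ?thesis using True by simp
  qed simp
 qed
 also have "\<dots> \<le> ennreal J" by (rule J)
 finally have UJ: "(NN y. U y) \<le> ennreal J" .
 have "(NN y. U y) \<noteq> \<infinity>" using UJ by (auto simp: top_unique)
 then have "AE y in lborel. U y \<noteq> \<infinity>" by (intro nn_integral_PInf_AE) auto
 then show ae: "AE y in lborel. integrable lborel (\<lambda>r. indicator {a..b} r *\<^sub>R Z r y)"
 proof eventually_elim
  case (elim y)
  have "(S y)^2 < \<infinity>" using SU[of y] elim by (auto simp: ennreal_mult_less_top less_top intro: le_less_trans)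
  then have "S y < \<infinity>" by (cases "S y") (auto simp: power2_eq_square)
  moreover have "(NN r. ennreal (norm (indicator {a..b} r *\<^sub>R Z r y))) = S y"
   unfolding S_def by (intro nn_integral_cong) (auto simp: indicator_def)
  ultimately show ?case unfolding integrable_iff_bounded by simp
 qed
 let ?I = "\<lambda>y. LBINT r. indicator {a..b} r *\<^sub>R Z r y"
 have Im [measurable]: "?I \<in> borel_measurable borel"
  by (rule lborel.borel_measurable_lebesgue_integral) measurable
 have IS: "ennreal ((cmod (?I y))^2) \<le> ennreal J * U y" for y
 proof -
  have "ennreal (cmod (?I y)) \<le> (NN r. ennreal (cmod (indicator {a..b} r *\<^sub>R Z r y)))" by (rule norm_integral_le_nn_integral)
  also have "\<dots> = S y" unfolding S_def by (intro nn_integral_cong) (auto simp: indicator_def)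
  finally have "(ennreal (cmod (?I y)))^2 \<le> (S y)^2" by (intro power_mono) auto
  then show ?thesis using SU[of y] by (simp add: ennreal_power)
 qed
 have "(NN y. ennreal ((cmod (?I y))^2)) \<le> (NN y. ennreal J * U y)"
  by (intro nn_integral_mono IS)
 also have "\<dots> = ennreal J * (NN y. U y)" by (rule nn_integral_cmult) measurable
 also have "\<dots> \<le> ennreal J * ennreal J" by (intro mult_left_mono UJ) simp
 also have "\<dots> = ennreal (J^2)" using J(2) by (simp add: ennreal_mult power2_eq_square)
 finally have le: "(NN y. ennreal ((cmod (?I y))^2)) \<le> ennreal (J^2)" .
 then show s: "sqi ?I" unfolding sqi_iff_nn_integral using Im by (auto intro: le_less_trans)
 show "nrm ?I \<le> J" using le J(2) unfolding nn_integral_sqi[OF s] by (simp add: power2_le_iff_abs_le)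
qed

section \<open>The flow on the frequency side\<close>

lemma mpow_transpose: "mpow (transpose A) k = transpose (mpow A k)"
proof (induction k)
 case (Suc k)
 have "mpow (transpose A) (Suc k) = transpose A ** transpose (mpow A k)" by (simp add: mpow_Suc Suc)
 also have "\<dots> = transpose (mpow A k ** A)" by (simp add: matrix_transpose_mul)
 finally show ?case by (simp only: mpow_Suc2)
qed simp

lemma expm_transpose: "expm (transpose A) t = transpose (expm A t)"
proof -
 have "expm (transpose A) t $ i $ j = expm A t $ j $ i" for i j
  using expm_entry_sums[of "transpose A" i j t] expm_entry_sums[of A j i t]
  unfolding mpow_transpose by (simp add: transpose_def sums_unique2)
 then show ?thesis by (simp add: vec_eq_iff transpose_def)
qed

locale frac_OU =
 fixes Q B :: "real^'n^'n" and s :: real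
 assumes posdef: "symmetric_posdef Q" and s: "s > 1 / 2"
begin

definition flow :: "real \<Rightarrow> real^'n \<Rightarrow> real^'n" where
 "flow r z = expm (transpose B) r *v z"

text \<open>The semigroup without diffusion, on the frequency side: transport along
  \<open>flow\<close>, with the factor contributed by the change of volume.\<close>

definition push :: "real \<Rightarrow> (real^'n \<Rightarrow> complex) \<Rightarrow> real^'n \<Rightarrow> complex" where
 "push r h z = cx (exp (- (r * trace B))) * h (flow (- r) z)"

definition sym :: "real^'n \<Rightarrow> real" where
 "sym z = ((Q *v z) \<bullet> z) powr s"

lemma flow_add: "flow (a + b) z = flow a (flow b z)"
 by (simp add: flow_def expm_vector_add)

lemma flow_0 [simp]: "flow 0 z = z"
 by (simp add: flow_def)

lemma flow_inverse [simp]: "flow (- r) (flow r z) = z" "flow r (flow (- r) z) = z"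
 by (simp_all add: flow_def)

lemma continuous_on_flow:
 "continuous_on S f \<Longrightarrow> continuous_on S g \<Longrightarrow> continuous_on S (\<lambda>z. flow (f z) (g z))"
 unfolding flow_def by (rule continuous_on_expm_vector)

lemma measurable_flow [measurable]:
 "f \<in> borel_measurable M \<Longrightarrow> g \<in> borel_measurable M \<Longrightarrow> (\<lambda>z. flow (f z) (g z)) \<in> borel_measurable M"
 unfolding flow_def by (rule measurable_expm_vector)

lemma flow_bound:
 obtains C where "C \<ge> 1" "\<And>t x. \<bar>t\<bar> \<le> T \<Longrightarrow> norm (flow t x) \<le> C * norm x"
 using expm_vector_bound[of T "transpose B"] unfolding flow_def by metis

lemma lborel_distr_flow: "density (distr lborel borel (flow r)) (\<lambda>_. ennreal (exp (r * trace B))) = lborel"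
proof -
 have "trace (transpose B) = trace B" by (simp add: trace_def transpose_def)
 then show ?thesis using lborel_distr_expm[of "transpose B" r] unfolding flow_def[abs_def] by simp
qed

lemma flow_borel [measurable]: "flow r \<in> borel_measurable borel"
 using measurable_flow[of "\<lambda>_. r" borel "\<lambda>x. x"] by simp

lemma push_measurable [measurable]:
 assumes [measurable]: "h \<in> borel_measurable borel" "f \<in> borel_measurable M" "g \<in> borel_measurable M"
 shows "(\<lambda>z. push (f z) h (g z)) \<in> borel_measurable M"
 unfolding push_def by measurable

lemma push_sqi:
 assumes h: "sqi h" shows "sqi (push r h)"
 unfolding push_def[abs_def] by (intro sqi_scale sqi_lborel_scaling[OF lborel_distr_flow _ _ h]) simp_all

lemma push_nrm_square:
 assumes h: "sqi h"
 shows "(nrm (push r h))^2 = exp (- (r * trace B)) * (nrm h)^2"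
proof -
 define c where "c = exp (- (r * trace B))"
 have "(nrm h)^2 = c * (nrm (\<lambda>x. h (flow (- r) x)))^2"
  using nrm_lborel_scaling[OF lborel_distr_flow _ _ h, of "- r"] by (simp add: c_def)
 moreover have "nrm (push r h) = c * nrm (\<lambda>x. h (flow (- r) x))"
  unfolding push_def[abs_def] nrm_scale by (simp add: c_def)
 ultimately show ?thesis unfolding c_def[symmetric] by (simp add: power2_eq_square)
qed

lemma push_nrm:
 assumes h: "sqi h"
 shows "nrm (push r h) = exp (- (r * trace B) / 2) * nrm h"
proof -
 have "(nrm (push r h))^2 = (exp (- (r * trace B) / 2) * nrm h)^2"
  unfolding push_nrm_square[OF h] power_mult_distrib by (simp add: power2_eq_square flip: exp_add)
 then show ?thesis by (rule power2_eq_imp_eq) simp_all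
qed

lemma integral_push:
 assumes [measurable]: "h \<in> borel_measurable borel" "q \<in> borel_measurable borel"
 shows "(LBINT z. h z * q (flow r z)) = (LBINT z. push r h z * q z)"
proof -
 have "(LBINT z. h z * q (flow r z)) = exp (- (r * trace B)) *\<^sub>R (LBINT z. h (flow (- r) z) * q (flow r (flow (- r) z)))"
  using integral_lborel_scaling[OF lborel_distr_flow, of "- r" "\<lambda>z. h z * q (flow r z)"] by simp
 also have "\<dots> = (LBINT z. push r h z * q z)"
  unfolding push_def by (simp add: scaleR_conv_of_real mult.assoc)
 finally show ?thesis .
qed

lemma sym_measurable [measurable]: "sym \<in> borel_measurable borel"
 unfolding sym_def[abs_def] by measurable

lemma quad_nonneg: "0 \<le> (Q *v z) \<bullet> z"
 using posdef by (cases "z = 0") (auto simp: symmetric_posdef_def less_imp_le)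

lemma sym_continuous: "continuous_on UNIV sym"
 unfolding sym_def[abs_def] using s quad_nonneg
 by (intro continuous_on_powr' continuous_intros linear_continuous_on matrix_vector_mul_bounded_linear) auto

lemma sym_nonneg [simp]: "0 \<le> sym z"
 by (simp add: sym_def)

lemma sym_bounds:
 obtains c C where "0 < c" "0 < C" "\<And>z. c * norm z powr (2 * s) \<le> sym z" "\<And>z. sym z \<le> C * norm z powr (2 * s)"
proof -
 obtain m where m: "m > 0" "\<And>x. m * (norm x)^2 \<le> (Q *v x) \<bullet> x" using posdef_lower_bound[OF posdef] by blast
 obtain K where K: "K > 0" "\<And>x. norm (Q *v x) \<le> norm x * K"
  using bounded_linear.pos_bounded[OF matrix_vector_mul_bounded_linear[of Q]] by blast
 have p: "((norm z)^2) powr s = norm z powr (2 * s)" for z :: "real^'n"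
  by (cases "z = 0") (simp_all add: powr_powr flip: powr_numeral)
 show ?thesis
 proof (rule that[of "m powr s" "K powr s"])
  fix z :: "real^'n"
  have "(m * (norm z)^2) powr s \<le> sym z" unfolding sym_def using m s by (intro powr_mono2) auto
  then show "m powr s * norm z powr (2 * s) \<le> sym z" using m(1) by (simp add: powr_mult p)
  have "(Q *v z) \<bullet> z \<le> norm (Q *v z) * norm z" by (rule norm_cauchy_schwarz)
  also have "\<dots> \<le> norm z * K * norm z" by (intro mult_right_mono K) simp
  finally have "sym z \<le> (K * (norm z)^2) powr s"
   unfolding sym_def using quad_nonneg s by (intro powr_mono2) (auto simp: power2_eq_square mult_ac)
  then show "sym z \<le> K powr s * norm z powr (2 * s)" using K(1) by (simp add: powr_mult p)
 qed (use m K in auto)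
qed

text \<open>The exponent is an integer, to be matched with the decay of test transforms.\<close>

lemma sym_le_weight:
 obtains C p where "0 < C" "\<And>z. sym z \<le> C * (1 + norm z) ^ p"
proof -
 obtain C where C: "0 < C" "\<And>z. sym z \<le> C * norm z powr (2 * s)" using sym_bounds by metis
 define p where "p = nat \<lceil>2 * s\<rceil>"
 have p: "2 * s \<le> real p" unfolding p_def by linarith
 show ?thesis
 proof (rule that[OF C(1), of p])
  fix z :: "real^'n"
  have pos: "0 < 1 + norm z" by (simp add: add_pos_nonneg)
  have "norm z powr (2 * s) \<le> (1 + norm z) powr (2 * s)" using s by (intro powr_mono2) auto
  also have "\<dots> \<le> (1 + norm z) powr (real p)" using p by (intro powr_mono) auto
  also have "\<dots> = (1 + norm z) ^ p" using pos by (simp add: powr_realpow)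
  finally show "sym z \<le> C * (1 + norm z) ^ p" using C by (meson mult_left_mono order_trans less_imp_le)
 qed
qed

section \<open>Transport of test functions\<close>

text \<open>The motion of test functions dual to \<open>push\<close>: the transform of
  \<open>drag r p\<close> is that of \<open>p\<close> read along \<open>flow\<close>.\<close>

definition drag :: "real \<Rightarrow> (real^'n \<Rightarrow> complex) \<Rightarrow> real^'n \<Rightarrow> complex" where
 "drag r p x = cx (exp (- (r * trace B))) * p (expm B (- r) *v x)"

text \<open>The generator of \<open>drag\<close>. It is \<open>- div (p B y)\<close>, the formal
  adjoint of the drift.\<close>

definition adv :: "(real^'n \<Rightarrow> complex) \<Rightarrow> real^'n \<Rightarrow> complex" where
 "adv p y = - (cx (trace B) * p y + (\<Sum>i\<in>UNIV. cx ((B *v y) $ i) * partial_deriv i p y))"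

lemma drag_test: "p \<in> test_functions \<Longrightarrow> drag r p \<in> test_functions"
proof -
 assume "p \<in> test_functions"
 moreover have "expm B r ** expm B (- r) = mat 1" using expm_minus[of B "- r"] by simp
 ultimately have "(\<lambda>x. p (expm B (- r) *v x)) \<in> test_functions" by (rule test_linear)
 then show ?thesis unfolding drag_def[abs_def] by (rule test_mult) (rule C_k_const)
qed

lemma adv_Cc:
 assumes p: "p \<in> test_functions" shows "Cc (adv p)"
proof -
 have S: "Cc (\<lambda>y. \<Sum>i\<in>I. cx ((B *v y) $ i) * partial_deriv i p y)" if "finite I" for I
  using that
 proof induction
  case (insert i I)
  have "Cc (\<lambda>y. cx ((B *v y) $ i) * partial_deriv i p y)"
   by (intro Cc_mult test_Cc test_partial p continuous_intros linear_continuous_on matrix_vector_mul_bounded_linear)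
  from Cc_add[OF this insert.IH] show ?case using insert by simp
 qed (simp add: Cc_def)
 have "Cc (\<lambda>y. cx (trace B) * p y)" by (intro Cc_mult test_Cc p continuous_intros)
 from Cc_mult[OF Cc_add[OF this S[OF finite]] continuous_on_const[of _ "- 1"]]
 show ?thesis by (simp add: adv_def[abs_def])
qed

lemma drag_derivative:
 assumes p: "p \<in> test_functions"
 shows "((\<lambda>r. drag r p x) has_vector_derivative drag r (adv p) x) (at r)"
proof -
 have D: "(p has_derivative frechet_derivative p (at y)) (at y)" for y
  using C_k_has_derivative[OF test_C_k[OF p]] .
 have L: "frechet_derivative p (at y) v = (\<Sum>i\<in>UNIV. cx (v $ i) * partial_deriv i p y)" for y v
  unfolding partial_deriv_def by (rule linear_expand_axis[OF has_derivative_linear[OF D]])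
 have "((\<lambda>r. expm B (- r) *v x) has_vector_derivative (- 1) *\<^sub>R (B *v (expm B (- r) *v x))) (at r)"
 proof -
  have "(uminus has_vector_derivative - 1) (at r)"
   using has_real_derivative_iff_has_vector_derivative[of uminus "- 1" "at r"] by (auto intro!: derivative_eq_intros)
  from vector_diff_chain_at[OF this DERIV_expm_vector] show ?thesis by (simp only: o_def)
 qed
 then have "((\<lambda>r. expm B (- r) *v x) has_derivative (\<lambda>h. h *\<^sub>R ((- 1) *\<^sub>R (B *v (expm B (- r) *v x))))) (at r)"
  by (simp only: has_vector_derivative_def)
 from has_derivative_compose[OF this D]
 have "((\<lambda>r. p (expm B (- r) *v x)) has_derivative
   (\<lambda>h. frechet_derivative p (at (expm B (- r) *v x)) (h *\<^sub>R ((- 1) *\<^sub>R (B *v (expm B (- r) *v x)))))) (at r)" .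
 moreover have "frechet_derivative p (at y) (h *\<^sub>R ((- 1) *\<^sub>R v)) = h *\<^sub>R (- frechet_derivative p (at y) v)" for y h v
  using has_derivative_linear[OF D[of y]] by (simp add: linear_cmul linear_neg)
 ultimately have 1: "((\<lambda>r. p (expm B (- r) *v x)) has_vector_derivative
   - frechet_derivative p (at (expm B (- r) *v x)) (B *v (expm B (- r) *v x))) (at r)"
  by (simp add: has_vector_derivative_def)
 have 2: "((\<lambda>r. cx (exp (- (r * trace B)))) has_vector_derivative cx (- trace B * exp (- (r * trace B)))) (at r)"
  by (intro has_vector_derivative_of_real) (auto intro!: derivative_eq_intros simp flip: has_real_derivative_iff_has_vector_derivative)
 show ?thesis
  using has_vector_derivative_mult[OF 2 1] unfolding drag_def adv_def L by (simp add: algebra_simps)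
qed

text \<open>\<open>B\<close> commutes with its exponential, so \<open>drag\<close> commutes with its
  generator. The derivative in \<open>r\<close> of \<open>drag r p\<close> thereby becomes exactly
  the integrand of \<open>drift\<close> tested with \<open>drag r p\<close>.\<close>

lemma drag_adv:
 assumes p: "p \<in> test_functions"
 shows "drag r (adv p) x = (\<Sum>i\<in>UNIV. \<Sum>j\<in>UNIV. cx (B $ i $ j) *
  (- partial_deriv i (\<lambda>y. cx (y $ j) * drag r p y) x))"
proof -
 define q where "q = drag r p"
 have qt: "q \<in> test_functions" unfolding q_def by (rule drag_test[OF p])
 have D: "(f has_derivative frechet_derivative f (at y)) (at y)" if "f \<in> test_functions" for f :: "real^'n \<Rightarrow> complex" and y
  using C_k_has_derivative[OF test_C_k[OF that]] .
 have L: "frechet_derivative f (at y) v = (\<Sum>i\<in>UNIV. cx (v $ i) * partial_deriv i f y)"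
  if "f \<in> test_functions" for f :: "real^'n \<Rightarrow> complex" and y v
  unfolding partial_deriv_def by (rule linear_expand_axis[OF has_derivative_linear[OF D[OF that]]])
 have "((\<lambda>y. cx (exp (- (r * trace B))) * p (expm B (- r) *v y)) has_derivative
   (\<lambda>h. cx (exp (- (r * trace B))) * frechet_derivative p (at (expm B (- r) *v x)) (expm B (- r) *v h))) (at x)"
  by (intro has_derivative_mult_right has_derivative_compose[OF _ D[OF p]] bounded_linear_imp_has_derivative matrix_vector_mul_bounded_linear)
 then have "(q has_derivative
   (\<lambda>h. cx (exp (- (r * trace B))) * frechet_derivative p (at (expm B (- r) *v x)) (expm B (- r) *v h))) (at x)"
  by (simp add: q_def drag_def[abs_def])
 from frechet_derivative_at[OF this]
 have "frechet_derivative q (at x) (B *v x) = cx (exp (- (r * trace B))) * frechet_derivative p (at (expm B (- r) *v x)) (expm B (- r) *v (B *v x))"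
  by metis
 also have "expm B (- r) *v (B *v x) = B *v (expm B (- r) *v x)"
  by (simp add: matrix_vector_mul_assoc expm_commute)
 finally have dB: "frechet_derivative q (at x) (B *v x) = cx (exp (- (r * trace B))) *
   (\<Sum>i\<in>UNIV. cx ((B *v (expm B (- r) *v x)) $ i) * partial_deriv i p (expm B (- r) *v x))"
  by (simp add: L[OF p])
 have lhs: "drag r (adv p) x = - (cx (trace B) * q x + frechet_derivative q (at x) (B *v x))"
  unfolding dB by (simp add: drag_def adv_def q_def algebra_simps)
 have pd: "partial_deriv i (\<lambda>y. cx (y $ j) * q y) x = (if i = j then q x else 0) + cx (x $ j) * partial_deriv i q x" for i j
 proof -
  have "((\<lambda>y. cx (y $ j) * q y) has_derivative
    (\<lambda>h. cx (x $ j) * frechet_derivative q (at x) h + cx (h $ j) * q x)) (at x)"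
   by (intro has_derivative_mult D[OF qt] bounded_linear_imp_has_derivative bounded_linear_compose[OF bounded_linear_of_real bounded_linear_vec_nth])
  from partial_deriv_eq[OF this] show ?thesis by (simp add: partial_deriv_def axis_def)
 qed
 have "(\<Sum>i\<in>UNIV. \<Sum>j\<in>UNIV. cx (B $ i $ j) * (- partial_deriv i (\<lambda>y. cx (y $ j) * q y) x))
   = - ((\<Sum>i\<in>UNIV. \<Sum>j\<in>UNIV. cx (B $ i $ j) * (if i = j then q x else 0))
     + (\<Sum>i\<in>UNIV. \<Sum>j\<in>UNIV. cx (B $ i $ j) * (cx (x $ j) * partial_deriv i q x)))"
  unfolding pd by (simp only: mult_minus_right sum_negf distrib_left sum.distrib)
 also have "(\<Sum>i\<in>UNIV. \<Sum>j\<in>UNIV. cx (B $ i $ j) * (if i = j then q x else 0)) = cx (trace B) * q x"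
  by (simp add: if_distrib trace_def sum_distrib_right cong: if_cong)
 also have "(\<Sum>i\<in>UNIV. \<Sum>j\<in>UNIV. cx (B $ i $ j) * (cx (x $ j) * partial_deriv i q x)) = frechet_derivative q (at x) (B *v x)"
  unfolding L[OF qt] by (simp add: matrix_vector_mult_def sum_distrib_right mult.assoc)
 finally show ?thesis unfolding lhs q_def by simp
qed

text \<open>The factor in \<open>drag\<close> cancels the Jacobian, and moving
  \<open>expm B r\<close> across the inner product transposes it into \<open>flow r\<close>.\<close>

lemma fourier_drag:
 assumes p: "p \<in> test_functions"
 shows "fourier (drag r p) (- z) = fourier p (- flow r z)"
proof -
 have [measurable]: "p \<in> borel_measurable borel" "drag r p \<in> borel_measurable borel"
  using p drag_test by (auto intro: Cc_borel test_Cc)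
 have "fourier (drag r p) (- z) = (LBINT x. drag r p x * ekern x (- z))" by (rule fourier_lborel) measurable
 also have "\<dots> = exp (r * trace B) *\<^sub>R (LBINT x. drag r p (expm B r *v x) * ekern (expm B r *v x) (- z))"
  by (rule integral_lborel_scaling[OF lborel_distr_expm]) simp_all
 also have "\<dots> = (LBINT x. exp (r * trace B) *\<^sub>R (drag r p (expm B r *v x) * ekern (expm B r *v x) (- z)))" by simp
 also have "\<dots> = (LBINT x. p x * ekern x (- flow r z))"
 proof (intro Bochner_Integration.integral_cong refl)
  fix x
  have "(expm B r *v x) \<bullet> z = x \<bullet> flow r z"
   by (metis dot_lmul_matrix expm_transpose flow_def inner_commute transpose_matrix_vector)
  then show "exp (r * trace B) *\<^sub>R (drag r p (expm B r *v x) * ekern (expm B r *v x) (- z)) = p x * ekern x (- flow r z)"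
   by (simp add: drag_def scaleR_conv_of_real exp_minus)
 qed
 also have "\<dots> = fourier p (- flow r z)" by (rule fourier_lborel[symmetric]) measurable
 finally show ?thesis .
qed

end

section \<open>The transport equation in integrated form\<close>

lemma nn_integral_square_le:
 assumes "sqi_on M h" "f \<in> borel_measurable M" "\<And>x. cmod (f x) \<le> c * cmod (h x)" "0 \<le> c" "c * nrm_on M h \<le> K"
 shows "(\<integral>\<^sup>+x. ennreal ((cmod (f x))^2) \<partial>M) \<le> ennreal (K^2)"
proof -
 have h: "sqi_on M (\<lambda>x. cx c * h x)" by (rule sqi_scale[OF assms(1)])
 have le: "cmod (f x) \<le> cmod (cx c * h x)" for x using assms(3)[of x] assms(4) by (simp add: norm_mult)
 then have f: "sqi_on M f" by (intro sqi_dominated[OF h assms(2)]) simp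
 have "nrm_on M f \<le> nrm_on M (\<lambda>x. cx c * h x)" using le by (intro nrm_mono[OF h assms(2)]) simp
 also have "\<dots> \<le> K" using assms(4,5) by (simp add: nrm_scale)
 finally have "(nrm_on M f)^2 \<le> K^2" by (intro power_mono) simp_all
 then show ?thesis unfolding nn_integral_sqi[OF f] by (simp add: ennreal_leI)
qed

text \<open>Cauchy-Schwarz in \<open>y\<close> and the bounded interval of \<open>r\<close> make
  \<open>Z r y * w y\<close> integrable on the product, although \<open>Z r\<close> and
  \<open>w\<close> are only square integrable.\<close>

lemma Fubini_sqi:
 fixes Z :: "real \<Rightarrow> 'a::euclidean_space \<Rightarrow> complex"
 assumes Z [measurable]: "(\<lambda>(r, y). Z r y) \<in> borel_measurable (lborel \<Otimes>\<^sub>M lborel)"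
  and bd: "\<And>r. r \<in> {a..b} \<Longrightarrow> (NN y. ennreal ((cmod (Z r y))^2)) \<le> ennreal (K^2)"
  and K: "0 \<le> K" and w: "sqi w"
 shows "(LBINT y. (LBINT r. indicator {a..b} r *\<^sub>R Z r y) * w y) = (LBINT r. indicator {a..b} r *\<^sub>R (LBINT y. Z r y * w y))"
proof -
 have [measurable]: "w \<in> borel_measurable borel" using w by (simp add: sqi_on_def)
 have Zs: "sqi (Z r)" "nrm (Z r) \<le> K" if t: "r \<in> {a..b}" for r
 proof -
  have "(\<lambda>y. (r, y)) \<in> lborel \<rightarrow>\<^sub>M lborel \<Otimes>\<^sub>M lborel" by measurable
  from measurable_compose[OF this Z] have "Z r \<in> borel_measurable lborel" by simp
  then show s: "sqi (Z r)" using bd[OF t] unfolding sqi_iff_nn_integral by (auto intro: le_less_trans)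
  have "(nrm (Z r))^2 \<le> K^2" using bd[OF t] unfolding nn_integral_sqi[OF s] by simp
  then show "nrm (Z r) \<le> K" using K by (rule power2_le_imp_le)
 qed
 define F where "F = (\<lambda>(r, y). indicator {a..b} r *\<^sub>R (Z r y * w y))"
 have Fm [measurable]: "F \<in> borel_measurable (lborel \<Otimes>\<^sub>M lborel)" unfolding F_def by measurable
 have "(\<integral>\<^sup>+z. ennreal (norm (F z)) \<partial>(lborel \<Otimes>\<^sub>M lborel)) = (NN r. \<integral>\<^sup>+y. ennreal (norm (F (r, y))) \<partial>lborel)"
  by (rule lborel.nn_integral_fst[symmetric]) measurable
 also have "\<dots> \<le> (NN r. ennreal (K * nrm w) * indicator {a..b} r)"
 proof (rule nn_integral_mono)
  fix r
  show "(NN y. ennreal (norm (F (r, y)))) \<le> ennreal (K * nrm w) * indicator {a..b} r"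
  proof (cases "r \<in> {a..b}")
   case True
   note Z' = Zs[OF True]
   have "(NN y. ennreal (norm (F (r, y)))) = (NN y. ennreal (cmod (Z r y * w y)))"
    using True by (simp add: F_def)
   also have "\<dots> = ennreal (LBINT y. cmod (Z r y * w y))"
    by (rule nn_integral_eq_integral[OF integrable_norm[OF integrable_mult_sqi[OF Z'(1) w]]]) simp
   also have "\<dots> \<le> ennreal (nrm (Z r) * nrm w)"
    using Cauchy_Schwarz_nrm[OF Z'(1) w] by (intro ennreal_leI) (simp add: norm_mult)
   also have "\<dots> \<le> ennreal (K * nrm w)" using Z'(2) by (intro ennreal_leI mult_right_mono) simp_all
   finally show ?thesis using True by simp
  qed (simp add: F_def)
 qed
 also have "\<dots> = ennreal (K * nrm w) * emeasure lborel {a..b}" by (rule nn_integral_cmult_indicator) simp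
 also have "\<dots> < \<infinity>" by (cases "a \<le> b") (simp_all add: ennreal_mult_less_top)
 finally have Fi: "integrable (lborel \<Otimes>\<^sub>M lborel) F" unfolding integrable_iff_bounded using Fm by simp
 have "(LBINT y. LBINT r. F (r, y)) = (LBINT r. LBINT y. F (r, y))"
  using lborel_pair.Fubini_integral[of "\<lambda>r y. F (r, y)"] Fi by (simp add: case_prod_unfold)
 moreover have "(LBINT r. F (r, y)) = (LBINT r. indicator {a..b} r *\<^sub>R Z r y) * w y" for y
  unfolding F_def by (simp flip: integral_mult_left_zero)
 moreover have "(LBINT y. F (r, y)) = indicator {a..b} r *\<^sub>R (LBINT y. Z r y * w y)" for r
  unfolding F_def by simp
 ultimately show ?thesis by simp
qed

lemma test_transform_weight_sqi:
 fixes q :: "real^'n \<Rightarrow> complex"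
 assumes q: "q \<in> test_functions"
 shows "sqi (\<lambda>z. cx ((1 + norm z) ^ p) * fourier q (- z))"
proof -
 have [measurable]: "q \<in> borel_measurable borel" by (rule Cc_borel[OF test_Cc[OF q]])
 obtain C where C: "C > 0" "\<And>z. cmod (fourier q z) * (1 + norm z) ^ (p + 2 * CARD('n)) \<le> C"
  using fourier_decay[OF q] by metis
 have pos: "0 < (1 + norm z) ^ m" for z :: "real^'n" and m by (intro zero_less_power) (auto intro: add_pos_nonneg)
 show ?thesis
 proof (rule sqi_dominated[OF sqi_scale[OF weight_sqi[OF order_refl], of "cx C"]])
  show "AE z in lborel. cmod (cx ((1 + norm z) ^ p) * fourier q (- z)) \<le> cmod (cx C * cx (1 / (1 + norm z) ^ (2 * CARD('n))))"
  proof (rule AE_I2)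
   fix z :: "real^'n"
   have "(1 + norm z) ^ p * cmod (fourier q (- z)) * (1 + norm z) ^ (2 * CARD('n)) \<le> C"
    using C(2)[of "- z"] by (simp only: power_add norm_minus_cancel mult_ac)
   then have "(1 + norm z) ^ p * cmod (fourier q (- z)) \<le> C * (1 / (1 + norm z) ^ (2 * CARD('n)))"
    by (simp only: times_divide_eq_right mult_1_right pos_le_divide_eq[OF pos])
   then show "cmod (cx ((1 + norm z) ^ p) * fourier q (- z)) \<le> cmod (cx C * cx (1 / (1 + norm z) ^ (2 * CARD('n))))"
    using C(1) unfolding norm_mult norm_of_real by (simp add: abs_mult)
  qed
 qed simp
qed

lemma test_transform_sqi:
 fixes p :: "real^'n \<Rightarrow> complex"
 assumes "p \<in> test_functions" shows "sqi (\<lambda>z. fourier p (- z))"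
 using test_transform_weight_sqi[OF assms, of 0] by simp

section \<open>The weak equation tested along the flow\<close>

context frac_OU
begin

lemma drag_sqi:
 assumes q: "sqi q"
 shows "sqi (drag r q)" "nrm (drag r q) = exp (- (r * trace B) / 2) * nrm q"
proof -
 have m: "(*v) (expm B t) \<in> borel_measurable borel" for t
  using measurable_expm_vector[of "\<lambda>_. t" borel "\<lambda>x. x" B] by simp
 show "sqi (drag r q)"
  unfolding drag_def[abs_def] by (intro sqi_scale sqi_lborel_scaling[OF lborel_distr_expm m _ q]) simp
 define c where "c = exp (- (r * trace B))"
 have "(nrm q)^2 = c * (nrm (\<lambda>x. q (expm B (- r) *v x)))^2"
  using nrm_lborel_scaling[OF lborel_distr_expm m _ q, of "- r"] by (simp add: c_def)
 moreover have "nrm (drag r q) = c * nrm (\<lambda>x. q (expm B (- r) *v x))"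
  unfolding drag_def[abs_def] nrm_scale by (simp add: c_def)
 ultimately have "(nrm (drag r q))^2 = c * (nrm q)^2" by (simp add: power2_eq_square)
 also have "\<dots> = (exp (- (r * trace B) / 2) * nrm q)^2"
  unfolding power_mult_distrib c_def by (simp add: power2_eq_square flip: exp_add)
 finally show "nrm (drag r q) = exp (- (r * trace B) / 2) * nrm q" by (rule power2_eq_imp_eq) simp_all
qed

lemma drag_measurable [measurable]:
 assumes [measurable]: "h \<in> borel_measurable borel" "f \<in> borel_measurable M" "g \<in> borel_measurable M"
 shows "(\<lambda>z. drag (f z) h (g z)) \<in> borel_measurable M"
 unfolding drag_def by measurable

lemma exp_growth: "r \<in> {0..t} \<Longrightarrow> exp (- (r * trace B) / 2) \<le> exp (t * \<bar>trace B\<bar>)"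
proof -
 assume t: "r \<in> {0..t}"
 have "- (r * trace B) / 2 \<le> r * \<bar>trace B\<bar>"
 proof -
  have "r * (- trace B) \<le> r * \<bar>trace B\<bar>" using t by (intro mult_left_mono) auto
  moreover have "0 \<le> r * \<bar>trace B\<bar>" using t by simp
  ultimately show ?thesis by simp
 qed
 also have "\<dots> \<le> t * \<bar>trace B\<bar>" using t by (intro mult_right_mono) auto
 finally show ?thesis by simp
qed

text \<open>The fundamental theorem of calculus in \<open>r\<close>, under the integral in
  \<open>x\<close>.\<close>

lemma integral_drag:
 assumes p: "p \<in> test_functions" and u: "sqi u" and t: "0 \<le> t"
 shows "(LBINT x. u x * drag t p x) - (LBINT x. u x * p x) = (LBINT r. indicator {0..t} r *\<^sub>R (LBINT x. u x * drag r (adv p) x))"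
proof -
 note C = adv_Cc[OF p]
 have [measurable]: "adv p \<in> borel_measurable borel" using C by (rule Cc_borel)
 define K where "K = exp (t * \<bar>trace B\<bar>) * nrm (adv p)"
 have "(LBINT r. indicator {0..t} r *\<^sub>R (LBINT x. drag r (adv p) x * u x)) = (LBINT x. (LBINT r. indicator {0..t} r *\<^sub>R drag r (adv p) x) * u x)"
 proof (rule Fubini_sqi[symmetric, where K = K, OF _ _ _ u])
  show "(\<lambda>(r, y). drag r (adv p) y) \<in> borel_measurable (lborel \<Otimes>\<^sub>M lborel)" by measurable
  show "0 \<le> K" by (simp add: K_def)
  fix r assume "r \<in> {0..t}"
  then have "nrm (drag r (adv p)) \<le> K"
   unfolding K_def drag_sqi(2)[OF Cc_sqi[OF C]] by (intro mult_right_mono exp_growth) simp_all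
  then show "(NN y. ennreal ((cmod (drag r (adv p) y))^2)) \<le> ennreal (K^2)"
   by (intro nn_integral_square_le[OF drag_sqi(1)[OF Cc_sqi[OF C]], where c = 1]) simp_all
 qed
 moreover have "(LBINT r. indicator {0..t} r *\<^sub>R drag r (adv p) x) = drag t p x - drag 0 p x" for x
 proof (rule integral_FTC_Icc)
  show "0 \<le> t" by (rule t)
  show "((\<lambda>r. drag r p x) has_vector_derivative drag r (adv p) x) (at r within {0..t})" for r
   by (rule has_vector_derivative_at_within[OF drag_derivative[OF p]])
  have "continuous_on {0..t} (\<lambda>r. adv p (expm B (- r) *v x))"
   by (rule continuous_on_compose2[OF Cc_continuous[OF C]]) (auto intro!: continuous_on_expm_vector continuous_intros)
  then show "continuous_on {0..t} (\<lambda>r. drag r (adv p) x)"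
   unfolding drag_def by (intro continuous_intros)
 qed
 moreover have "drag 0 p x = p x" for x by (simp add: drag_def)
 moreover have "integrable lborel (\<lambda>x. u x * drag t p x)" "integrable lborel (\<lambda>x. u x * p x)"
  by (intro integrable_mult_sqi u Cc_sqi test_Cc drag_test p)+
 ultimately show ?thesis by (simp add: mult.commute[of _ "u _"] right_diff_distrib)
qed

text \<open>Conjugating the test function by the flow removes the drift.\<close>

lemma transport_identity:
 assumes ug: "FT u g" and fk: "FT f k" and t: "0 \<le> t"
  and weak: "\<And>q. q \<in> test_functions \<Longrightarrow> (LBINT x. f x * q x) =
    - (LBINT z. cx (sym z) * g z * fourier q (- z)) / cx ((2 * pi) ^ CARD('n))
    + (\<Sum>i\<in>UNIV. \<Sum>j\<in>UNIV. cx (B $ i $ j) * (- (LBINT x. u x * partial_deriv i (\<lambda>y. cx (y $ j) * q y) x)))"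
 defines "m \<equiv> \<lambda>z. k z + cx (sym z) * g z"
 shows "AE z in lborel. integrable lborel (\<lambda>r. indicator {0..t} r *\<^sub>R push r m z)"
  and "AE z in lborel. push t g z - g z = (LBINT r. indicator {0..t} r *\<^sub>R push r m z)"
proof -
 note sq = FT_sqi[OF ug] FT_sqi[OF fk]
 have [measurable]: "g \<in> borel_measurable borel" "k \<in> borel_measurable borel" "u \<in> borel_measurable borel" using sq by (simp_all add: sqi_on_def)
 have mm [measurable]: "m \<in> borel_measurable borel" unfolding m_def by measurable
 have pos: "0 < (1 + norm z) ^ j" for z :: "real^'n" and j by (intro zero_less_power) (auto intro: add_pos_nonneg)
 obtain C0 p where C0: "0 < C0" "\<And>z. sym z \<le> C0 * (1 + norm z) ^ p" using sym_le_weight by metis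
 obtain Cf where Cf: "Cf \<ge> 1" "\<And>t' x. \<bar>t'\<bar> \<le> t \<Longrightarrow> norm (flow t' x) \<le> Cf * norm x" using flow_bound by metis
 define M0 where "M0 z = cx (cmod (k z) + C0 * cmod (g z))" for z
 have M0: "sqi M0"
 proof -
  have "sqi (\<lambda>z. cx (cmod (h z)))" if "sqi h" for h :: "real^'n \<Rightarrow> complex"
  proof -
   have [measurable]: "h \<in> borel_measurable borel" using that by (simp add: sqi_on_def)
   show ?thesis by (rule sqi_dominated[OF that]) simp_all
  qed
  from sqi_add[OF this[OF sq(4)] sqi_scale[OF this[OF sq(2)], of "cx C0"]]
  show ?thesis by (simp add: M0_def[abs_def])
 qed
 have mM: "cmod (m z) \<le> (1 + norm z) ^ p * cmod (M0 z)" for z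
 proof -
  have "cmod (m z) \<le> cmod (k z) + sym z * cmod (g z)"
   unfolding m_def by (rule order_trans[OF norm_triangle_ineq]) (simp add: norm_mult)
  also have "sym z * cmod (g z) \<le> (C0 * (1 + norm z) ^ p) * cmod (g z)" by (intro mult_right_mono C0) simp
  also have "cmod (k z) \<le> (1 + norm z) ^ p * cmod (k z)"
   using mult_right_mono[OF one_le_power[of "1 + norm z" p], of "cmod (k z)"] by simp
  finally have "cmod (m z) \<le> (1 + norm z) ^ p * (cmod (k z) + C0 * cmod (g z))" by (simp add: algebra_simps)
  moreover have "cmod (M0 z) = cmod (k z) + C0 * cmod (g z)"
   unfolding M0_def norm_of_real using C0(1) by (intro abs_of_nonneg) simp
  ultimately show ?thesis by simp
 qed
 \<comment> \<open>\<open>m\<close> contains the unbounded symbol and need not be square integrable.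
   Divided by the weight, its transports are, uniformly for \<open>r\<close> in
   \<open>[0, t]\<close>, because the flow increases \<open>1 + norm\<close> by at most the factor
   \<open>Cf\<close>.\<close>
 define Z where "Z r \<eta> = cx (1 / (1 + norm \<eta>) ^ p) * push r m \<eta>" for r \<eta>
 have ZM: "cmod (Z r \<eta>) \<le> Cf ^ p * cmod (push r M0 \<eta>)" if r: "r \<in> {0..t}" for r \<eta>
 proof -
  let ?y = "flow (- r) \<eta>"
  have "norm ?y \<le> Cf * norm \<eta>" using r by (intro Cf) auto
  then have "1 + norm ?y \<le> Cf * (1 + norm \<eta>)" using Cf(1) by (simp add: distrib_left)
  then have "(1 + norm ?y) ^ p \<le> Cf ^ p * (1 + norm \<eta>) ^ p"
   unfolding power_mult_distrib[symmetric] by (intro power_mono) auto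
  then have "(1 + norm ?y) ^ p * cmod (M0 ?y) \<le> Cf ^ p * (1 + norm \<eta>) ^ p * cmod (M0 ?y)" by (intro mult_right_mono) auto
  then have "cmod (m ?y) \<le> (Cf ^ p * cmod (M0 ?y)) * (1 + norm \<eta>) ^ p" using mM[of ?y] by (simp add: mult_ac)
  then have "1 / (1 + norm \<eta>) ^ p * cmod (m ?y) \<le> Cf ^ p * cmod (M0 ?y)"
   using pos_divide_le_eq[OF pos] by simp
  from mult_left_mono[OF this, of "exp (- (r * trace B))"]
  show ?thesis unfolding Z_def push_def norm_mult norm_of_real using pos[of \<eta> p] by (simp add: mult_ac)
 qed
 \<comment> \<open>The \<open>+ 1\<close> keeps the bound positive, as
   \<open>Minkowski_integral\<close> divides by it.\<close>
 define K where "K = Cf ^ p * (exp (t * \<bar>trace B\<bar>) * nrm M0) + 1"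
 have K: "K > 0" using Cf(1) by (auto simp: K_def intro!: add_nonneg_pos mult_nonneg_nonneg)
 have Zm: "(\<lambda>(r, \<eta>). Z r \<eta>) \<in> borel_measurable (lborel \<Otimes>\<^sub>M lborel)" unfolding Z_def by measurable
 have Zbd: "(NN \<eta>. ennreal ((cmod (Z r \<eta>))^2)) \<le> ennreal (K^2)" if r: "r \<in> {0..t}" for r
 proof (rule nn_integral_square_le[OF push_sqi[OF M0]])
  show "Z r \<in> borel_measurable lborel" unfolding Z_def[abs_def] by measurable
  show "cmod (Z r \<eta>) \<le> Cf ^ p * cmod (push r M0 \<eta>)" for \<eta> by (rule ZM[OF r])
  show "0 \<le> Cf ^ p" using Cf(1) by simp
  have "Cf ^ p * nrm (push r M0) \<le> Cf ^ p * (exp (t * \<bar>trace B\<bar>) * nrm M0)"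
   unfolding push_nrm[OF M0] using Cf(1) by (intro mult_left_mono mult_right_mono exp_growth r) auto
  then show "Cf ^ p * nrm (push r M0) \<le> K" by (simp add: K_def)
 qed
 have J: "(NN r. indicator {0..t} r * ennreal K) \<le> ennreal (t * K)"
  using t K by (simp add: nn_integral_multc ennreal_mult)
 have Kt: "0 \<le> t * K" using t K by simp
 have Mink: "AE \<eta> in lborel. integrable lborel (\<lambda>r. indicator {0..t} r *\<^sub>R Z r \<eta>)"
  "sqi (\<lambda>\<eta>. LBINT r. indicator {0..t} r *\<^sub>R Z r \<eta>)"
 proof -
  note M = Minkowski_integral[where \<beta> = "\<lambda>_. K", OF Zm borel_measurable_const K J Kt]
  show "AE \<eta> in lborel. integrable lborel (\<lambda>r. indicator {0..t} r *\<^sub>R Z r \<eta>)" by (rule M(1)) (rule Zbd)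
  show "sqi (\<lambda>\<eta>. LBINT r. indicator {0..t} r *\<^sub>R Z r \<eta>)" by (rule M(2)) (rule Zbd)
 qed
 have pushZ: "push r m \<eta> = cx ((1 + norm \<eta>) ^ p) * Z r \<eta>" for r \<eta>
 proof -
  have "cx ((1 + norm \<eta>) ^ p) * cx (1 / (1 + norm \<eta>) ^ p) = 1"
   using pos[of \<eta> p] by (simp only: of_real_mult[symmetric] times_divide_eq_right mult_1_right divide_self[OF less_imp_neq[THEN not_sym]] of_real_1)
  then show ?thesis unfolding Z_def by (metis mult.assoc mult_1)
 qed
 show "AE z in lborel. integrable lborel (\<lambda>r. indicator {0..t} r *\<^sub>R push r m z)"
  using Mink(1)
 proof eventually_elim
  case (elim z)
  from integrable_mult_right[OF this, of "cx ((1 + norm z) ^ p)"]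
  show ?case unfolding pushZ by (simp only: mult_scaleR_right)
 qed
 define IZ where "IZ \<eta> = (LBINT r. indicator {0..t} r *\<^sub>R Z r \<eta>)" for \<eta>
 have IZ: "sqi IZ" unfolding IZ_def[abs_def] by (rule Mink(2))
 have pushIZ: "(LBINT r. indicator {0..t} r *\<^sub>R push r m z) = cx ((1 + norm z) ^ p) * IZ z" for z
  unfolding IZ_def pushZ integral_mult_right_zero[symmetric] by (simp only: mult_scaleR_right)
 define D where "D z = push t g z - g z" for z
 have D: "sqi D" unfolding D_def[abs_def] by (intro sqi_diff push_sqi sq)
 \<comment> \<open>The defect of the claimed identity, divided by the weight: it is square
   integrable, and it vanishes once its weighted form pairs to zero with all test
   transforms.\<close>
 define w where "w z = cx (1 / (1 + norm z) ^ p) * D z - IZ z" for z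
 have Dw: "sqi (\<lambda>z. cx (1 / (1 + norm z) ^ p) * D z)"
 proof (rule sqi_dominated[OF D])
  show "AE z in lborel. cmod (cx (1 / (1 + norm z) ^ p) * D z) \<le> cmod (D z)"
  proof (rule AE_I2)
   fix z :: "real^'n"
   have "1 \<le> (1 + norm z) ^ p" by (rule one_le_power) simp
   then have "1 / (1 + norm z) ^ p \<le> 1" by (simp only: pos_divide_le_eq[OF pos])
   moreover have "0 \<le> 1 / (1 + norm z) ^ p" using pos[of z p] by simp
   ultimately show "cmod (cx (1 / (1 + norm z) ^ p) * D z) \<le> cmod (D z)"
    unfolding norm_mult norm_of_real by (intro mult_left_le_one_le) auto
  qed
 qed (use D in measurable)
 have w: "sqi w" unfolding w_def[abs_def] by (intro sqi_diff Dw IZ)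
 have wexp: "cx ((1 + norm z) ^ p) * w z = D z - cx ((1 + norm z) ^ p) * IZ z" for z
 proof -
  have "cx ((1 + norm z) ^ p) * cx (1 / (1 + norm z) ^ p) = 1"
   using pos[of z p] by (simp only: of_real_mult[symmetric] times_divide_eq_right mult_1_right divide_self[OF less_imp_neq[THEN not_sym]] of_real_1)
  then show ?thesis unfolding w_def right_diff_distrib by (metis mult.assoc mult_1)
 qed
 have "AE z in lborel. w z = 0"
 proof (rule test_transforms_total[OF w, of p])
  fix q :: "real^'n \<Rightarrow> complex" assume q: "q \<in> test_functions"
  define c where "c = cx ((2 * pi) ^ CARD('n))"
  have c: "c \<noteq> 0" by (simp add: c_def)
  have [measurable]: "q \<in> borel_measurable borel" by (rule Cc_borel[OF test_Cc[OF q]])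
  let ?W = "\<lambda>z. cx ((1 + norm z) ^ p) * fourier q (- z)"
  have Par: "c * (LBINT x. h x * \<psi> x) = (LBINT z. h' z * fourier \<psi> (- z))"
   if "FT h h'" "\<psi> \<in> test_functions" for h h' \<psi> :: "real^'n \<Rightarrow> complex"
   using Parseval[OF that(1) Cc_integrable[OF test_Cc[OF that(2)]] Cc_sqi[OF test_Cc[OF that(2)]]] by (simp add: c_def)
  \<comment> \<open>The weak equation tested with \<open>drag r q\<close>. The diffusion term
    cancels against the symbol part of \<open>m\<close>, and the drift term is, by
    \<open>drag_adv\<close>, the pairing of \<open>u\<close> with the derivative in \<open>r\<close>
    of \<open>drag r q\<close>.\<close>
  have gen: "(LBINT z. push r m z * fourier q (- z)) = c * (LBINT x. u x * drag r (adv q) x)" for r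
  proof -
   note \<psi> = drag_test[OF q, of r]
   define W where "W z = fourier (drag r q) (- z)" for z
   have [measurable]: "drag r q \<in> borel_measurable borel" by (rule Cc_borel[OF test_Cc[OF \<psi>]])
   have Wm [measurable]: "W \<in> borel_measurable borel" unfolding W_def[abs_def] by measurable
   have i1: "integrable lborel (\<lambda>z. k z * W z)"
    unfolding W_def by (intro integrable_mult_sqi sq test_transform_sqi \<psi>)
   have "sqi (\<lambda>z. cx (sym z) * W z)"
   proof (rule sqi_dominated[OF sqi_scale[OF test_transform_weight_sqi[OF \<psi>, of p], of "cx C0"]])
    show "AE z in lborel. cmod (cx (sym z) * W z) \<le> cmod (cx C0 * (cx ((1 + norm z) ^ p) * fourier (drag r q) (- z)))"
    proof (rule AE_I2)
     fix z :: "real^'n"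
     have "sym z * cmod (W z) \<le> C0 * (1 + norm z) ^ p * cmod (W z)" by (intro mult_right_mono C0) simp
     then show "cmod (cx (sym z) * W z) \<le> cmod (cx C0 * (cx ((1 + norm z) ^ p) * fourier (drag r q) (- z)))"
      unfolding norm_mult norm_of_real W_def[symmetric] using C0(1) abs_of_pos[OF pos[of z p]] by simp
    qed
   qed measurable
   from integrable_mult_sqi[OF sq(2) this]
   have i2: "integrable lborel (\<lambda>z. cx (sym z) * g z * W z)" by (simp add: mult_ac)
   have "(LBINT z. push r m z * fourier q (- z)) = (LBINT z. m z * fourier q (- flow r z))"
    by (rule integral_push[symmetric]) measurable
   also have "\<dots> = (LBINT z. m z * W z)" by (simp add: W_def fourier_drag[OF q])
   also have "\<dots> = (LBINT z. k z * W z) + (LBINT z. cx (sym z) * g z * W z)"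
    unfolding m_def distrib_right by (rule Bochner_Integration.integral_add[OF i1 i2])
   also have "(LBINT z. k z * W z) = c * (LBINT x. f x * drag r q x)"
    unfolding W_def by (rule Par[OF fk \<psi>, symmetric])
   also have "\<dots> + (LBINT z. cx (sym z) * g z * W z) =
     c * (\<Sum>i\<in>UNIV. \<Sum>j\<in>UNIV. cx (B $ i $ j) * (- (LBINT x. u x * partial_deriv i (\<lambda>y. cx (y $ j) * drag r q y) x)))"
   proof -
    have "c * (- X / c + S) + X = c * S" for X S using c by (simp add: field_simps)
    then show ?thesis unfolding weak[OF \<psi>] W_def[symmetric] c_def[symmetric] .
   qed
   also have "(\<Sum>i\<in>UNIV. \<Sum>j\<in>UNIV. cx (B $ i $ j) * (- (LBINT x. u x * partial_deriv i (\<lambda>y. cx (y $ j) * drag r q y) x)))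
     = (LBINT x. u x * drag r (adv q) x)"
   proof -
    have ii: "integrable lborel (\<lambda>x. u x * partial_deriv i (\<lambda>y. cx (y $ j) * drag r q y) x)" for i j
     by (intro integrable_mult_sqi sq Cc_sqi test_Cc test_partial test_mult \<psi> C_k_component)
    have "(LBINT x. u x * drag r (adv q) x) = (LBINT x. (\<Sum>i\<in>UNIV. \<Sum>j\<in>UNIV. - cx (B $ i $ j) * (u x * partial_deriv i (\<lambda>y. cx (y $ j) * drag r q y) x)))"
     unfolding drag_adv[OF q] sum_distrib_left by (simp add: mult_ac)
    also have "\<dots> = (\<Sum>i\<in>UNIV. \<Sum>j\<in>UNIV. LBINT x. - cx (B $ i $ j) * (u x * partial_deriv i (\<lambda>y. cx (y $ j) * drag r q y) x))"
     by (subst Bochner_Integration.integral_sum, (intro Bochner_Integration.integrable_sum integrable_mult_right ii)[1], intro sum.cong refl Bochner_Integration.integral_sum integrable_mult_right ii)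
    also have "\<dots> = (\<Sum>i\<in>UNIV. \<Sum>j\<in>UNIV. cx (B $ i $ j) * (- (LBINT x. u x * partial_deriv i (\<lambda>y. cx (y $ j) * drag r q y) x)))"
     unfolding integral_mult_right_zero by simp
    finally show ?thesis ..
   qed
   finally show ?thesis .
  qed
  have Ws: "sqi ?W" by (rule test_transform_weight_sqi[OF q])
  \<comment> \<open>Integrated over \<open>r\<close>, that pairing reduces to its end values by
    \<open>integral_drag\<close>; on the frequency side these are the pairings of
    \<open>push t g\<close> and \<open>g\<close>.\<close>
  have "(LBINT z. IZ z * ?W z) = (LBINT r. indicator {0..t} r *\<^sub>R (LBINT z. Z r z * ?W z))"
   unfolding IZ_def by (rule Fubini_sqi[OF Zm Zbd less_imp_le[OF K] Ws])
  also have "(\<lambda>r. LBINT z. Z r z * ?W z) = (\<lambda>r. c * (LBINT x. u x * drag r (adv q) x))"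
   unfolding gen[symmetric] pushZ by (simp only: mult_ac)
  also have "(LBINT r. indicator {0..t} r *\<^sub>R (c * (LBINT x. u x * drag r (adv q) x))) = c * (LBINT r. indicator {0..t} r *\<^sub>R (LBINT x. u x * drag r (adv q) x))"
   by (simp only: mult_scaleR_right[symmetric] integral_mult_right_zero)
  also have "\<dots> = c * (LBINT x. u x * drag t q x) - c * (LBINT x. u x * q x)"
   unfolding integral_drag[OF q sq(1) t, symmetric] by (rule right_diff_distrib)
  also have "\<dots> = (LBINT z. g z * fourier q (- flow t z)) - (LBINT z. g z * fourier q (- z))"
   unfolding Par[OF ug drag_test[OF q]] Par[OF ug q] fourier_drag[OF q] by (rule refl)
  also have "(LBINT z. g z * fourier q (- flow t z)) = (LBINT z. push t g z * fourier q (- z))"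
   by (rule integral_push) measurable
  also have "\<dots> - (LBINT z. g z * fourier q (- z)) = (LBINT z. D z * fourier q (- z))"
   unfolding D_def left_diff_distrib
   by (intro Bochner_Integration.integral_diff[symmetric] integrable_mult_sqi push_sqi sq test_transform_sqi q)
  finally have eq: "(LBINT z. IZ z * ?W z) = (LBINT z. D z * fourier q (- z))" .
  have "(LBINT z. cx ((1 + norm z) ^ p) * w z * fourier q (- z)) = (LBINT z. D z * fourier q (- z) - IZ z * ?W z)"
   unfolding wexp by (intro Bochner_Integration.integral_cong refl) (simp add: algebra_simps)
  also have "\<dots> = (LBINT z. D z * fourier q (- z)) - (LBINT z. IZ z * ?W z)"
   by (intro Bochner_Integration.integral_diff integrable_mult_sqi D IZ Ws test_transform_sqi q)
  finally show "(LBINT z. cx ((1 + norm z) ^ p) * w z * fourier q (- z)) = 0" unfolding eq by simp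
 qed
 then show "AE z in lborel. push t g z - g z = (LBINT r. indicator {0..t} r *\<^sub>R push r m z)"
 proof eventually_elim
  case (elim z)
  then show ?case using wexp[of z] unfolding pushIZ D_def by simp
 qed
qed

end

section \<open>Integrating factor and Duhamel formula\<close>

text \<open>Variation of constants for the primitive of \<open>\<mu>\<close> with initial value
  \<open>a0\<close>, where the equation holds almost everywhere only. The primitive is merely
  absolutely continuous, so the product rule with \<open>E\<close> is replaced by Fubini's theorem
  on the triangle \<open>r \<le> b\<close>.\<close>

lemma integrating_factor:
 fixes \<mu> k :: "real \<Rightarrow> complex" and q E :: "real \<Rightarrow> real" and a0 :: complex
 assumes t: "0 \<le> t" and q: "continuous_on {0..t} q"
  and E: "\<And>r. r \<in> {0..t} \<Longrightarrow> (E has_real_derivative - (q r * E r)) (at r within {0..t})" "E 0 = 1"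
  and \<mu>: "integrable lborel (\<lambda>r. indicator {0..t} r *\<^sub>R \<mu> r)" and \<mu>m [measurable]: "\<mu> \<in> borel_measurable borel"
  and ae: "AE r in lborel. r \<in> {0..t} \<longrightarrow> \<mu> r = k r + cx (q r) * (a0 + (LBINT b. indicator {0..r} b *\<^sub>R \<mu> b))"
  and km [measurable]: "k \<in> borel_measurable borel"
 shows "integrable lborel (\<lambda>r. indicator {0..t} r *\<^sub>R (cx (E r) * k r))"
  and "cx (E t) * (a0 + (LBINT b. indicator {0..t} b *\<^sub>R \<mu> b)) - a0 = (LBINT r. indicator {0..t} r *\<^sub>R (cx (E r) * k r))"
proof -
 define P where "P r = (LBINT b. indicator {0..r} b *\<^sub>R \<mu> b)" for r
 define Y where "Y r = indicator {0..t} r * (q r * E r)" for r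
 have Ec: "continuous_on {0..t} E" using E(1) by (rule DERIV_continuous_on)
 have qE: "continuous_on {0..t} (\<lambda>r. q r * E r)" by (intro continuous_intros q Ec)
 have Ym [measurable]: "Y \<in> borel_measurable borel" and Yi: "integrable lborel Y"
  using borel_measurable_continuous_on_indicator[OF _ qE] borel_integrable_compact[OF _ qE] by (auto simp: Y_def[abs_def])
 define \<mu>' where "\<mu>' r = indicator {0..t} r *\<^sub>R \<mu> r" for r
 have \<mu>'m [measurable]: "\<mu>' \<in> borel_measurable borel" unfolding \<mu>'_def[abs_def] by measurable
 have \<mu>'i: "integrable lborel \<mu>'" using \<mu> by (simp add: \<mu>'_def[abs_def])
 \<comment> \<open>Integration over \<open>b\<close> yields the increments \<open>E r - E t\<close>,
   integration over \<open>r\<close> the primitive of \<open>\<mu>\<close>.\<close>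
 define F where "F = (\<lambda>(r, b). (if r \<le> b then \<mu>' r * cx (Y b) else 0))"
 have Fm [measurable]: "F \<in> borel_measurable (lborel \<Otimes>\<^sub>M lborel)" unfolding F_def by measurable
 have Fi: "integrable (lborel \<Otimes>\<^sub>M lborel) F"
 proof (rule integrable_pair_dominated[OF integrable_norm[OF \<mu>'i] integrable_norm[OF Yi] Fm])
  show "cmod (F (r, b)) \<le> norm (\<mu>' r) * norm (Y b)" for r b by (simp add: F_def norm_mult)
 qed
 have Yint: "(LBINT b. indicator {r..t} b *\<^sub>R (q b * E b)) = E r - E t" if r: "r \<in> {0..t}" for r
 proof -
  have "(LBINT b. indicator {r..t} b *\<^sub>R (q b * E b)) = (- E t) - (- E r)"
  proof (rule integral_FTC_Icc)
   show "r \<le> t" using r by simp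
   show "continuous_on {r..t} (\<lambda>b. q b * E b)" using r by (intro continuous_on_subset[OF qE]) auto
   fix b assume "r \<le> b" "b \<le> t"
   then have "(E has_real_derivative - (q b * E b)) (at b within {r..t})"
    using r by (intro DERIV_subset[OF E(1)]) auto
   from DERIV_minus[OF this]
   show "((\<lambda>b. - E b) has_vector_derivative q b * E b) (at b within {r..t})"
    by (simp add: has_real_derivative_iff_has_vector_derivative)
  qed
  then show ?thesis by simp
 qed
 have in1: "(LBINT b. F (r, b)) = \<mu>' r * cx (E r - E t)" for r
 proof (cases "r \<in> {0..t}")
  case True
  have "(LBINT b. F (r, b)) = (LBINT b. \<mu>' r * cx (indicator {r..t} b *\<^sub>R (q b * E b)))"
   using True by (intro Bochner_Integration.integral_cong refl) (auto simp: F_def Y_def indicator_def)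
  also have "\<dots> = \<mu>' r * cx (LBINT b. indicator {r..t} b *\<^sub>R (q b * E b))"
   by (simp only: integral_mult_right_zero integral_complex_of_real)
  finally show ?thesis unfolding Yint[OF True] .
 qed (simp add: F_def \<mu>'_def if_distrib cong: if_cong)
 have in2: "(LBINT r. F (r, b)) = cx (Y b) * P b" for b
 proof (cases "b \<in> {0..t}")
  case True
  have "(LBINT r. F (r, b)) = (LBINT r. cx (Y b) * (indicator {0..b} r *\<^sub>R \<mu> r))"
   using True by (intro Bochner_Integration.integral_cong refl) (auto simp: F_def \<mu>'_def indicator_def)
  then show ?thesis by (simp only: integral_mult_right_zero P_def)
 next
  case False
  then have "Y b = 0" by (auto simp: Y_def indicator_def)
  then show ?thesis by (simp add: F_def cong: if_cong)
 qed
 have i2: "integrable lborel (\<lambda>b. cx (Y b) * P b)"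
  using lborel_pair.integrable_snd[of "\<lambda>r b. F (r, b)"] Fi by (simp add: in2)
 have i1: "integrable lborel (\<lambda>r. \<mu>' r * cx (E r - E t))"
  using lborel_pair.integrable_fst'[OF Fi] by (simp add: in1)
 have eq: "(LBINT r. \<mu>' r * cx (E r - E t)) = (LBINT b. cx (Y b) * P b)"
  using lborel_pair.Fubini_integral[of "\<lambda>r b. F (r, b)"] Fi by (simp add: in1 in2)
 have i3: "integrable lborel (\<lambda>r. \<mu>' r * cx (E t))" "integrable lborel (\<lambda>r. cx (Y r) * a0)"
  using \<mu>'i Yi by auto
 have int: "integrable lborel (\<lambda>r. \<mu>' r * cx (E r - E t) + \<mu>' r * cx (E t) - cx (Y r) * a0 - cx (Y r) * P r)"
  by (intro Bochner_Integration.integrable_diff Bochner_Integration.integrable_add i1 i2 i3)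
 have EM [measurable]: "(\<lambda>r. indicator {0..t} r *\<^sub>R E r) \<in> borel_measurable borel"
  using borel_measurable_continuous_on_indicator[OF _ Ec] by simp
 have km: "(\<lambda>r. indicator {0..t} r *\<^sub>R (cx (E r) * k r)) \<in> borel_measurable lborel"
 proof -
  have "(\<lambda>r. cx (indicator {0..t} r *\<^sub>R E r) * k r) \<in> borel_measurable lborel" by measurable
  then show ?thesis by (simp add: scaleR_conv_of_real mult.assoc)
 qed
 have ae': "AE r in lborel. \<mu>' r * cx (E r - E t) + \<mu>' r * cx (E t) - cx (Y r) * a0 - cx (Y r) * P r = indicator {0..t} r *\<^sub>R (cx (E r) * k r)"
  using ae
 proof eventually_elim
  case (elim r)
  then show ?case by (cases "r \<in> {0..t}") (simp_all add: \<mu>'_def Y_def P_def algebra_simps)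
 qed
 show "integrable lborel (\<lambda>r. indicator {0..t} r *\<^sub>R (cx (E r) * k r))"
  by (rule integrable_cong_AE_imp[OF int km]) (use ae' in eventually_elim, simp)
 have "(LBINT r. indicator {0..t} r *\<^sub>R (cx (E r) * k r)) = (LBINT r. \<mu>' r * cx (E r - E t) + \<mu>' r * cx (E t) - cx (Y r) * a0 - cx (Y r) * P r)"
  by (rule integral_cong_AE[OF km borel_measurable_integrable[OF int]]) (use ae' in eventually_elim, simp)
 also have "\<dots> = (LBINT r. \<mu>' r) * cx (E t) - cx (LBINT r. Y r) * a0"
  using i1 i2 i3 by (simp add: eq del: of_real_diff)
 also have "(LBINT r. Y r) = 1 - E t" using Yint[of 0] t E(2) by (simp add: Y_def)
 also have "(LBINT r. \<mu>' r) = (LBINT b. indicator {0..t} b *\<^sub>R \<mu> b)" by (simp add: \<mu>'_def)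
 finally show "cx (E t) * (a0 + (LBINT b. indicator {0..t} b *\<^sub>R \<mu> b)) - a0 = (LBINT r. indicator {0..t} r *\<^sub>R (cx (E r) * k r))"
  by (simp add: algebra_simps)
qed

context frac_OU
begin

section \<open>The evolution of transforms\<close>

definition decay :: "real \<Rightarrow> real^'n \<Rightarrow> real" where
 "decay t z = exp (- (LBINT r:{0..t}. sym (flow (- r) z)))"

text \<open>The right-hand side of the formula in \<open>OU_semigroup\<close>, as a map on the
  transform of the initial datum.\<close>

definition evo :: "real \<Rightarrow> (real^'n \<Rightarrow> complex) \<Rightarrow> real^'n \<Rightarrow> complex" where
 "evo t h z = cx (decay t z) * push t h z"

lemma sym_flow_continuous: "continuous_on S (\<lambda>r. sym (flow (- r) z))"
 by (rule continuous_on_compose2[OF sym_continuous]) (auto intro!: continuous_on_flow continuous_intros)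

lemma sym_flow_integrable: "set_integrable lborel {a..b} (\<lambda>r. sym (flow (- r) z))"
 by (rule borel_integrable_atLeastAtMost'[OF sym_flow_continuous])

lemma decay_0 [simp]: "decay 0 z = 1"
proof -
 have "AE r in lborel. indicator {0..0} r *\<^sub>R sym (flow (- r) z) = (0::real)"
  using AE_lborel_singleton[of 0] by eventually_elim (simp add: indicator_def)
 then have "(LBINT r:{0..0}. sym (flow (- r) z)) = 0"
  unfolding set_lebesgue_integral_def by (rule integral_eq_zero_AE)
 then show ?thesis by (simp add: decay_def)
qed

lemma decay_DERIV:
 assumes "r \<in> {0..t}"
 shows "((\<lambda>r. decay r z) has_real_derivative - (sym (flow (- r) z) * decay r z)) (at r within {0..t})"
proof -
 have eq: "(LBINT r:{0..t}. sym (flow (- r) z)) = integral {0..t} (\<lambda>r. sym (flow (- r) z))" for t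
  by (rule set_borel_integral_eq_integral[OF sym_flow_integrable])
 have "((\<lambda>r. integral {0..r} (\<lambda>r. sym (flow (- r) z))) has_real_derivative sym (flow (- r) z)) (at r within {0..t})"
  using integral_has_vector_derivative[OF sym_flow_continuous assms] by (simp add: has_real_derivative_iff_has_vector_derivative)
 then show ?thesis unfolding decay_def eq by (auto intro!: derivative_eq_intros)
qed

text \<open>\<open>decay_DERIV\<close> is one-sided at the end of the interval; the composition with
  \<open>\<bar>r\<bar>\<close> moves \<open>0\<close> into an open interval.\<close>

lemma decay_continuous: "continuous_on {0..} (\<lambda>r. decay r z)"
proof -
 have "isCont (\<lambda>r. decay (\<bar>r\<bar>) z) x" for x
 proof -
  have "continuous_on {0..\<bar>x\<bar> + 1} (\<lambda>r. decay r z)"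
   by (rule DERIV_continuous_on[OF decay_DERIV])
  then have "continuous_on {-\<bar>x\<bar> - 1<..<\<bar>x\<bar> + 1} (\<lambda>r. decay \<bar>r\<bar> z)"
   by (rule continuous_on_compose2) (auto intro!: continuous_intros)
  moreover have "x \<in> {-\<bar>x\<bar> - 1<..<\<bar>x\<bar> + 1}" by auto
  ultimately show ?thesis by (simp only: continuous_on_eq_continuous_at[OF open_greaterThanLessThan])
 qed
 then have "continuous_on {0..} (\<lambda>r. decay (\<bar>r\<bar>) z)" by (intro continuous_at_imp_continuous_on) blast
 then show ?thesis by (rule continuous_on_eq) simp
qed

lemma decay_pos: "0 < decay t z"
 by (simp add: decay_def)

lemma decay_le_1: "decay t z \<le> 1"
 by (simp add: decay_def set_lebesgue_integral_def)

lemma decay_measurable [measurable]: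
 assumes [measurable]: "f \<in> borel_measurable M" "g \<in> borel_measurable M"
 shows "(\<lambda>z. decay (f z) (g z)) \<in> borel_measurable M"
proof -
 have "(\<lambda>z. LBINT r. (if 0 \<le> r \<and> r \<le> f z then sym (flow (- r) (g z)) else 0)) \<in> borel_measurable M"
  by (rule lborel.borel_measurable_lebesgue_integral) measurable
 moreover have "(LBINT r. (if 0 \<le> r \<and> r \<le> f z then sym (flow (- r) (g z)) else 0)) = (LBINT r:{0..f z}. sym (flow (- r) (g z)))" for z
  unfolding set_lebesgue_integral_def by (intro Bochner_Integration.integral_cong) (auto simp: indicator_def)
 ultimately show ?thesis unfolding decay_def by simp
qed

lemma evo_measurable [measurable]:
 assumes [measurable]: "h \<in> borel_measurable borel" "f \<in> borel_measurable M" "g \<in> borel_measurable M"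
 shows "(\<lambda>z. evo (f z) h (g z)) \<in> borel_measurable M"
 unfolding evo_def by measurable

lemma evo_le_push: "cmod (evo t h z) \<le> cmod (push t h z)"
 unfolding evo_def norm_mult norm_of_real using decay_pos[of t z] decay_le_1[of t z] by (intro mult_left_le_one_le) auto

lemma evo_sqi:
 assumes h: "sqi h" shows "sqi (evo t h)"
proof -
 have [measurable]: "h \<in> borel_measurable borel" using h by (simp add: sqi_on_def)
 show ?thesis by (rule sqi_dominated[OF push_sqi[OF h, of t]]) (simp_all add: evo_le_push)
qed

lemma evo_nrm_le:
 assumes h: "sqi h" and t: "t \<in> {0..T}"
 shows "nrm (evo t h) \<le> exp (T * \<bar>trace B\<bar>) * nrm h"
proof -
 have "nrm (evo t h) \<le> nrm (push t h)"
  using evo_sqi[OF h, of t] by (intro nrm_mono[OF push_sqi[OF h]]) (auto simp: evo_le_push sqi_on_def)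
 also have "\<dots> \<le> exp (T * \<bar>trace B\<bar>) * nrm h"
  unfolding push_nrm[OF h] by (intro mult_right_mono exp_growth t) simp
 finally show ?thesis .
qed

lemma evo_diff: "evo t (\<lambda>z. f z - g z) z = evo t f z - evo t g z"
 by (simp add: evo_def push_def algebra_simps)

lemma evo_0 [simp]: "evo 0 h = h"
 by (simp add: fun_eq_iff evo_def push_def)

text \<open>The condition of \<open>is_OU_image\<close> for Borel functions, with \<open>g\<close>
  in place of \<open>fourier_L2 u\<close>.\<close>

definition weak_image :: "(real^'n \<Rightarrow> complex) \<Rightarrow> (real^'n \<Rightarrow> complex) \<Rightarrow> (real^'n \<Rightarrow> complex) \<Rightarrow> bool" where
 "weak_image u g f \<longleftrightarrow> (\<forall>p\<in>test_functions. (LBINT x. f x * p x) =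
    - (LBINT z. cx (sym z) * g z * fourier p (- z)) / cx ((2 * pi) ^ CARD('n))
    + (\<Sum>i\<in>UNIV. \<Sum>j\<in>UNIV. cx (B $ i $ j) * (- (LBINT x. u x * partial_deriv i (\<lambda>y. cx (y $ j) * p y) x))))"

text \<open>For fixed \<open>y\<close> the integrated transport equation is a linear equation in
  \<open>r\<close> for \<open>push r g y\<close>: its source is \<open>push r k y\<close>, its
  coefficient the symbol along the characteristic that ends at \<open>y\<close>, and
  \<open>decay\<close> is the integrating factor.\<close>

lemma Duhamel:
 assumes ug: "FT u g" and fk: "FT f k" and t: "0 \<le> t" and weak: "weak_image u g f"
 shows "AE y in lborel. integrable lborel (\<lambda>r. indicator {0..t} r *\<^sub>R evo r k y) \<and>
  evo t g y - g y = (LBINT r. indicator {0..t} r *\<^sub>R evo r k y)"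
proof -
 have [measurable]: "g \<in> borel_measurable borel" "k \<in> borel_measurable borel"
  using FT_sqi[OF ug] FT_sqi[OF fk] by (simp_all add: sqi_on_def)
 define m where "m = (\<lambda>y. k y + cx (sym y) * g y)"
 have [measurable]: "m \<in> borel_measurable borel" unfolding m_def by measurable
 have tr: "AE y in lborel. integrable lborel (\<lambda>b. indicator {0..r} b *\<^sub>R push b m y)"
  "AE y in lborel. push r g y - g y = (LBINT b. indicator {0..r} b *\<^sub>R push b m y)" if r: "0 \<le> r" for r
  unfolding m_def
  by (rule transport_identity(1)[OF ug fk r], rule weak[unfolded weak_image_def, rule_format], assumption)
    (rule transport_identity(2)[OF ug fk r], rule weak[unfolded weak_image_def, rule_format], assumption)
 define R where "R r y = (LBINT b. indicator {0..r} b *\<^sub>R push b m y)" for r y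
 have Rm [measurable]: "(\<lambda>z. R (fst z) (snd z)) \<in> borel_measurable (lborel \<Otimes>\<^sub>M lborel)"
 proof -
  have "(\<lambda>z. LBINT b. (if 0 \<le> b \<and> b \<le> fst z then push b m (snd z) else 0)) \<in> borel_measurable (lborel \<Otimes>\<^sub>M lborel)"
   by (rule lborel.borel_measurable_lebesgue_integral) measurable
  moreover have "(LBINT b. (if 0 \<le> b \<and> b \<le> fst z then push b m (snd z) else 0)) = R (fst z) (snd z)" for z
   unfolding R_def by (intro Bochner_Integration.integral_cong) (auto simp: indicator_def)
  ultimately show ?thesis by simp
 qed
 \<comment> \<open>The exceptional set of \<open>y\<close> depends on \<open>r\<close>. Joint
   measurability allows the quantifiers to be exchanged: for almost every \<open>y\<close> the
   identity holds for almost every \<open>r\<close>, which is what \<open>integrating_factor\<close>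
   asks for.\<close>
 have "AE r in lborel. AE y in lborel. r \<in> {0..t} \<longrightarrow> push r g y - g y = R r y"
 proof (rule AE_I2)
  fix r :: real
  show "AE y in lborel. r \<in> {0..t} \<longrightarrow> push r g y - g y = R r y"
  proof (cases "0 \<le> r")
   case True
   show ?thesis using tr(2)[OF True] by eventually_elim (simp add: R_def)
  qed simp
 qed
 moreover have "{z \<in> space (lborel \<Otimes>\<^sub>M lborel). fst z \<in> {0..t} \<longrightarrow> push (fst z) g (snd z) - g (snd z) = R (fst z) (snd z)} \<in> sets (lborel \<Otimes>\<^sub>M (lborel :: (real^'n) measure))"
  by measurable
 ultimately have "AE y in lborel. AE r in lborel. r \<in> {0..t} \<longrightarrow> push r g y - g y = R r y"
  using lborel_pair.AE_commute[of "\<lambda>r y. r \<in> {0..t} \<longrightarrow> push r g y - g y = R r y"] by blast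
 with tr(1)[OF t] tr(2)[OF t] show ?thesis
 proof eventually_elim
  case (elim y)
  have 1: "AE r in lborel. r \<in> {0..t} \<longrightarrow> push r m y = push r k y + cx (sym (flow (- r) y)) * (g y + (LBINT b. indicator {0..r} b *\<^sub>R push b m y))"
   using elim(3)
  proof eventually_elim
   case (elim r)
   show ?case
   proof
    assume "r \<in> {0..t}"
    with elim have "g y + R r y = push r g y" by (simp add: algebra_simps)
    then show "push r m y = push r k y + cx (sym (flow (- r) y)) * (g y + (LBINT b. indicator {0..r} b *\<^sub>R push b m y))"
     unfolding R_def[symmetric] by (simp add: m_def push_def algebra_simps)
   qed
  qed
  have mk: "(\<lambda>r. push r m y) \<in> borel_measurable borel" "(\<lambda>r. push r k y) \<in> borel_measurable borel" by measurable
  note IF = integrating_factor[OF t sym_flow_continuous decay_DERIV decay_0 elim(1) mk(1) 1 mk(2)]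
  have "g y + (LBINT r. indicator {0..t} r *\<^sub>R push r m y) = push t g y" unfolding elim(2)[symmetric] by simp
  with IF show ?case by (simp add: evo_def)
 qed
qed

lemma Duhamel_increment:
 assumes ug: "FT u g" and fk: "FT f k" and ab: "0 \<le> a" "a \<le> b" and weak: "weak_image u g f"
 shows "AE z in lborel. integrable lborel (\<lambda>r. indicator {a..b} r *\<^sub>R evo r k z) \<and>
  evo b g z - evo a g z = (LBINT r. indicator {a..b} r *\<^sub>R evo r k z)"
proof -
 have [measurable]: "k \<in> borel_measurable borel" using FT_sqi[OF fk] by (simp add: sqi_on_def)
 have b: "0 \<le> b" using ab by simp
 from Duhamel[OF ug fk ab(1) weak] Duhamel[OF ug fk b weak] show ?thesis
 proof eventually_elim
  case (elim z)
  have ae: "AE r in lborel. indicator {0..b} r *\<^sub>R evo r k z - indicator {0..a} r *\<^sub>R evo r k z = indicator {a..b} r *\<^sub>R evo r k z"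
  proof (rule AE_mp[OF AE_lborel_singleton[of a]], rule AE_I2, rule impI)
   fix r :: real assume "r \<noteq> a"
   then show "indicator {0..b} r *\<^sub>R evo r k z - indicator {0..a} r *\<^sub>R evo r k z = indicator {a..b} r *\<^sub>R evo r k z"
    using ab by (auto simp: indicator_def)
  qed
  have i: "integrable lborel (\<lambda>r. indicator {0..b} r *\<^sub>R evo r k z - indicator {0..a} r *\<^sub>R evo r k z)"
   using elim by (intro Bochner_Integration.integrable_diff) auto
  have m: "(\<lambda>r. indicator {a..b} r *\<^sub>R evo r k z) \<in> borel_measurable lborel" by measurable
  have "integrable lborel (\<lambda>r. indicator {a..b} r *\<^sub>R evo r k z)" by (rule integrable_cong_AE_imp[OF i m]) (use ae in eventually_elim, simp)
  moreover have "(LBINT r. indicator {0..b} r *\<^sub>R evo r k z - indicator {0..a} r *\<^sub>R evo r k z) = (LBINT r. indicator {a..b} r *\<^sub>R evo r k z)"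
   by (rule integral_cong_AE[OF borel_measurable_integrable[OF i] m ae])
  moreover have "(LBINT r. indicator {0..b} r *\<^sub>R evo r k z - indicator {0..a} r *\<^sub>R evo r k z) = (evo b g z - g z) - (evo a g z - g z)"
   using elim by (subst Bochner_Integration.integral_diff) auto
  ultimately show ?case by simp
 qed
qed

section \<open>Strong continuity and differentiability\<close>

text \<open>For bounded times the supports stay in one ball, so pointwise continuity and dominated
  convergence suffice.\<close>

lemma evo_Cc_tendsto:
 assumes \<Phi>: "Cc \<Phi>" and X: "\<And>i. 0 \<le> X i" "X \<longlonglongrightarrow> t"
 shows "(\<lambda>i. nrm (\<lambda>z. evo (X i) \<Phi> z - evo t \<Phi> z)) \<longlonglongrightarrow> 0"
proof -
 have [measurable]: "\<Phi> \<in> borel_measurable borel" by (rule Cc_borel[OF \<Phi>])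
 have t0: "0 \<le> t" using X by (intro LIMSEQ_le_const) auto
 obtain T where T: "\<And>i. X i \<le> T" "t \<le> T"
 proof -
  have "Bseq X" using X(2) by (intro convergent_imp_Bseq) (auto simp: convergent_def)
  then obtain K where K: "\<And>i. norm (X i) \<le> K" by (auto simp: Bseq_def)
  then show ?thesis using that[of "max K t"] abs_le_D1 by (metis max.coboundedI1 max.cobounded2 real_norm_def)
 qed
 obtain Bd R where Bd: "0 < Bd" "0 < R" "\<And>x. cmod (\<Phi> x) \<le> Bd * indicator (cball 0 R) x" using Cc_bounded[OF \<Phi>] by blast
 obtain Cf where Cf: "Cf \<ge> 1" "\<And>t' x. \<bar>t'\<bar> \<le> T \<Longrightarrow> norm (flow t' x) \<le> Cf * norm x" using flow_bound by metis
 define Bd' where "Bd' = exp (T * \<bar>trace B\<bar>) * Bd"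
 have bd: "cmod (evo r \<Phi> z) \<le> Bd' * indicator (cball 0 (Cf * R)) z" if r: "0 \<le> r" "r \<le> T" for r z
 proof -
  have e: "exp (- (r * trace B)) \<le> exp (T * \<bar>trace B\<bar>)"
  proof -
   have "r * (- trace B) \<le> r * \<bar>trace B\<bar>" using r by (intro mult_left_mono) auto
   also have "\<dots> \<le> T * \<bar>trace B\<bar>" using r by (intro mult_right_mono) auto
   finally show ?thesis by simp
  qed
  have "cmod (evo r \<Phi> z) \<le> exp (- (r * trace B)) * cmod (\<Phi> (flow (- r) z))"
   using evo_le_push[of r \<Phi> z] by (simp add: push_def norm_mult)
  also have "\<dots> \<le> exp (T * \<bar>trace B\<bar>) * (Bd * indicator (cball 0 R) (flow (- r) z))"
   by (intro mult_mono e Bd) auto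
  also have "\<dots> \<le> Bd' * indicator (cball 0 (Cf * R)) z"
  proof (cases "norm (flow (- r) z) \<le> R")
   case True
   have "norm (flow r (flow (- r) z)) \<le> Cf * norm (flow (- r) z)" using r by (intro Cf) auto
   also have "\<dots> \<le> Cf * R" using True Cf(1) by (intro mult_left_mono) auto
   finally show ?thesis using True by (simp add: Bd'_def)
  qed (use Bd(1) in \<open>simp add: Bd'_def\<close>)
  finally show ?thesis .
 qed
 have "(\<lambda>i. LBINT z. (cmod (evo (X i) \<Phi> z - evo t \<Phi> z))^2) \<longlonglongrightarrow> (LINT z|(lborel :: (real^'n) measure). 0)"
 proof (rule integral_dominated_convergence[where w = "\<lambda>z. (2 * Bd')^2 * indicator (cball 0 (Cf * R)) z"])
  show "integrable lborel (\<lambda>z::real^'n. (2 * Bd')^2 * indicator (cball 0 (Cf * R)) z :: real)"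
   by (intro integrable_mult_right integrable_indicator_cball)
  show "AE z in lborel. (\<lambda>i. (cmod (evo (X i) \<Phi> z - evo t \<Phi> z))^2) \<longlonglongrightarrow> 0"
  proof (rule AE_I2)
   fix z
   have "continuous_on {0..} (\<lambda>r. \<Phi> (flow (- r) z))"
    by (rule continuous_on_compose2[OF Cc_continuous[OF \<Phi>]]) (auto intro!: continuous_on_flow continuous_intros)
   then have "continuous_on {0..} (\<lambda>r. evo r \<Phi> z)"
    unfolding evo_def push_def by (intro continuous_intros decay_continuous)
   then have "(\<lambda>i. evo (X i) \<Phi> z) \<longlonglongrightarrow> evo t \<Phi> z"
    by (rule continuous_on_tendsto_compose[OF _ X(2)]) (use t0 X in auto)
   then have "(\<lambda>i. (cmod (evo (X i) \<Phi> z - evo t \<Phi> z))^2) \<longlonglongrightarrow> (cmod (evo t \<Phi> z - evo t \<Phi> z))^2"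
    by (intro tendsto_intros)
   then show "(\<lambda>i. (cmod (evo (X i) \<Phi> z - evo t \<Phi> z))^2) \<longlonglongrightarrow> 0" by simp
  qed
  show "AE z in lborel. norm ((cmod (evo (X i) \<Phi> z - evo t \<Phi> z))^2) \<le> (2 * Bd')^2 * indicator (cball 0 (Cf * R)) z" for i
  proof (rule AE_I2)
   fix z :: "real^'n"
   have "cmod (evo (X i) \<Phi> z - evo t \<Phi> z) \<le> Bd' * indicator (cball 0 (Cf * R)) z + Bd' * indicator (cball 0 (Cf * R)) z"
    by (rule order_trans[OF norm_triangle_ineq4 add_mono[OF bd bd]]) (use X T t0 in auto)
   then have "(cmod (evo (X i) \<Phi> z - evo t \<Phi> z))^2 \<le> (2 * Bd' * indicator (cball 0 (Cf * R)) z)^2"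
    by (intro power_mono) auto
   then show "norm ((cmod (evo (X i) \<Phi> z - evo t \<Phi> z))^2) \<le> (2 * Bd')^2 * indicator (cball 0 (Cf * R)) z"
    by (cases "norm z \<le> Cf * R") (simp_all add: power_mult_distrib)
  qed
 qed measurable
 then have "(\<lambda>i. sqrt (LBINT z. (cmod (evo (X i) \<Phi> z - evo t \<Phi> z))^2)) \<longlonglongrightarrow> sqrt 0"
  by (intro tendsto_real_sqrt) simp
 then show ?thesis by (simp add: nrm_on_def)
qed

text \<open>Density of continuous functions of compact support, and the bound
  \<open>evo_nrm_le\<close>, which is uniform for bounded times.\<close>

lemma evo_strongly_continuous:
 assumes h: "sqi h" and t: "0 \<le> t"
 shows "((\<lambda>q. nrm (\<lambda>z. evo q h z - evo t h z)) \<longlongrightarrow> 0) (at t within {0..})"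
 unfolding tendsto_at_iff_sequentially
proof (intro allI impI)
 fix X :: "nat \<Rightarrow> real" assume X: "\<forall>i. X i \<in> {0..} - {t}" "X \<longlonglongrightarrow> t"
 have X0: "0 \<le> X i" for i using X(1) by auto
 obtain T where T: "\<And>i. X i \<le> T" "t \<le> T"
 proof -
  have "Bseq X" using X(2) by (intro convergent_imp_Bseq) (auto simp: convergent_def)
  then obtain K where K: "\<And>i. norm (X i) \<le> K" by (auto simp: Bseq_def)
  then show ?thesis using that[of "max K t"] abs_le_D1 by (metis max.coboundedI1 max.cobounded2 real_norm_def)
 qed
 define c where "c = exp (T * \<bar>trace B\<bar>)"
 have c: "c > 0" by (simp add: c_def)
 have "(\<lambda>i. nrm (\<lambda>z. evo (X i) h z - evo t h z)) \<longlonglongrightarrow> 0"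
 proof (rule LIMSEQ_I)
  fix r :: real assume r: "0 < r"
  define e where "e = r / (3 * c)"
  have e: "e > 0" using r c by (simp add: e_def)
  obtain \<Phi> where \<Phi>: "Cc \<Phi>" "nrm (\<lambda>z. h z - \<Phi> z) < e" using Cc_dense[OF h e] by blast
  note \<Phi>s = Cc_sqi[OF \<Phi>(1)]
  have ap: "nrm (\<lambda>z. evo q h z - evo q \<Phi> z) \<le> r / 3" if "0 \<le> q" "q \<le> T" for q
  proof -
   have "nrm (evo q (\<lambda>z. h z - \<Phi> z)) \<le> c * nrm (\<lambda>z. h z - \<Phi> z)"
    unfolding c_def using that by (intro evo_nrm_le sqi_diff h \<Phi>s) auto
   also have "\<dots> \<le> c * e" using \<Phi>(2) c by (intro mult_left_mono) auto
   also have "\<dots> = r / 3" using c by (simp add: e_def)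
   finally have "nrm (evo q (\<lambda>z. h z - \<Phi> z)) \<le> r / 3" .
   moreover have "evo q (\<lambda>z. h z - \<Phi> z) = (\<lambda>z. evo q h z - evo q \<Phi> z)" by (simp add: fun_eq_iff evo_diff)
   ultimately show ?thesis by (simp only:)
  qed
  obtain N where N: "\<And>i. i \<ge> N \<Longrightarrow> nrm (\<lambda>z. evo (X i) \<Phi> z - evo t \<Phi> z) < r / 3"
   using LIMSEQ_D[OF evo_Cc_tendsto[OF \<Phi>(1) X0 X(2)], of "r / 3"] r by auto
  show "\<exists>N. \<forall>i\<ge>N. norm (nrm (\<lambda>z. evo (X i) h z - evo t h z) - 0) < r"
  proof (intro exI allI impI)
   fix i assume i: "i \<ge> N"
   note s = evo_sqi[OF h] evo_sqi[OF \<Phi>s]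
   have "nrm (\<lambda>z. evo (X i) h z - evo t h z) \<le> nrm (\<lambda>z. evo (X i) h z - evo (X i) \<Phi> z) + nrm (\<lambda>z. evo (X i) \<Phi> z - evo t h z)"
    by (intro nrm_diff_triangle s)
   also have "nrm (\<lambda>z. evo (X i) \<Phi> z - evo t h z) \<le> nrm (\<lambda>z. evo (X i) \<Phi> z - evo t \<Phi> z) + nrm (\<lambda>z. evo t \<Phi> z - evo t h z)"
    by (intro nrm_diff_triangle s)
   also have "nrm (\<lambda>z. evo t \<Phi> z - evo t h z) = nrm (\<lambda>z. evo t h z - evo t \<Phi> z)" by (rule nrm_minus_commute)
   finally show "norm (nrm (\<lambda>z. evo (X i) h z - evo t h z) - 0) < r"
    using N[OF i] ap[OF X0 T(1), of i] ap[OF t T(2)] by simp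
  qed
 qed
 then show "((\<lambda>q. nrm (\<lambda>z. evo q h z - evo t h z)) \<circ> X) \<longlonglongrightarrow> 0" by (simp add: o_def)
qed

text \<open>By Duhamel the difference quotient minus \<open>evo t k\<close> is the mean of
  \<open>evo q k - evo t k\<close> over the times \<open>q\<close> between \<open>t\<close> and
  \<open>t + h\<close>, and strong continuity makes this mean small.\<close>

lemma evo_difference_quotient:
 assumes ug: "FT u g" and fk: "FT f k" and weak: "weak_image u g f" and t: "0 < t"
 shows "((\<lambda>h. nrm (\<lambda>z. (evo (t + h) g z - evo t g z) / cx h - evo t k z)) \<longlongrightarrow> 0) (at 0)"
proof (rule tendstoI)
 fix r :: real assume r: "0 < r"
 note gs = FT_sqi(2)[OF ug] and ks = FT_sqi(2)[OF fk]
 have km [measurable]: "k \<in> borel_measurable borel" "g \<in> borel_measurable borel" using ks gs by (simp_all add: sqi_on_def)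
 define e where "e = r / 2"
 have e: "0 < e" using r by (simp add: e_def)
 have "eventually (\<lambda>q. nrm (\<lambda>z. evo q k z - evo t k z) < e) (at t within {0..})"
  using tendstoD[OF evo_strongly_continuous[OF ks] e, of t] t by simp
 then obtain d where d: "d > 0" "\<And>q. 0 \<le> q \<Longrightarrow> q \<noteq> t \<Longrightarrow> \<bar>q - t\<bar> < d \<Longrightarrow> nrm (\<lambda>z. evo q k z - evo t k z) < e"
  unfolding eventually_at by (auto simp: dist_real_def)
 have d': "nrm (\<lambda>z. evo q k z - evo t k z) \<le> e" if "0 \<le> q" "\<bar>q - t\<bar> < d" for q
  using d(2)[of q] that e by (cases "q = t") (auto simp: nrm_on_def)
 \<comment> \<open>Stated for two times \<open>a < b\<close> near \<open>t\<close>, so that both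
   signs of \<open>h\<close> are covered.\<close>
 have inc: "nrm (\<lambda>z. (evo b g z - evo a g z) / cx (b - a) - evo t k z) \<le> e"
  if ab: "0 \<le> a" "a < b" "t - d < a" "b < t + d" for a b
 proof -
  define Z where "Z q z = evo q k z - evo t k z" for q z
  have Zm: "(\<lambda>(q, z). Z q z) \<in> borel_measurable (lborel \<Otimes>\<^sub>M lborel)" unfolding Z_def by measurable
  have J: "(NN q. indicator {a..b} q * ennreal e) \<le> ennreal (e * (b - a))" "0 \<le> e * (b - a)"
  proof -
   have "(NN q. ennreal e * indicator {a..b} q) = ennreal e * emeasure lborel {a..b}"
    by (rule nn_integral_cmult_indicator) simp
   also have "\<dots> = ennreal (e * (b - a))" using e ab by (simp add: ennreal_mult)
   finally show "(NN q. indicator {a..b} q * ennreal e) \<le> ennreal (e * (b - a))"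
    by (simp only: mult.commute[of "indicator _ _" "ennreal e"] order_refl)
   show "0 \<le> e * (b - a)" using e ab by simp
  qed
  have Zbd: "(NN z. ennreal ((cmod (Z q z))^2)) \<le> ennreal (e^2)" if "q \<in> {a..b}" for q
  proof (rule nn_integral_square_le[where c = 1])
   show Zs: "sqi (Z q)" unfolding Z_def[abs_def] by (intro sqi_diff evo_sqi ks)
   show "Z q \<in> borel_measurable lborel" using Zs by (simp add: sqi_on_def)
   show "1 * nrm (Z q) \<le> e" unfolding Z_def[abs_def] using d'[of q] that ab by auto
  qed simp_all
  note M = Minkowski_integral[where \<beta> = "\<lambda>_. e", OF Zm borel_measurable_const e J]
  define I where "I z = (LBINT q. indicator {a..b} q *\<^sub>R Z q z)" for z
  have I: "sqi I" unfolding I_def[abs_def] by (rule M(2)) (rule Zbd)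
  have I': "nrm I \<le> e * (b - a)" unfolding I_def[abs_def] by (rule M(3)) (rule Zbd)
  have ae: "AE z in lborel. (evo b g z - evo a g z) / cx (b - a) - evo t k z = cx (1 / (b - a)) * I z"
   using Duhamel_increment[OF ug fk ab(1) less_imp_le[OF ab(2)] weak]
  proof eventually_elim
   case (elim z)
   have c: "integrable lborel (\<lambda>q. indicator {a..b} q *\<^sub>R evo t k z)"
    using ab by (intro integrable_scaleR_left) (simp add: integrable_indicator_iff)
   have "I z = (LBINT q. indicator {a..b} q *\<^sub>R evo q k z) - (LBINT q. indicator {a..b} q *\<^sub>R evo t k z)"
    unfolding I_def Z_def scaleR_diff_right using elim c by (intro Bochner_Integration.integral_diff) auto
   also have "(LBINT q. indicator {a..b} q *\<^sub>R evo t k z) = cx (b - a) * evo t k z"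
    using ab by (simp add: scaleR_conv_of_real)
   finally have "I z = (evo b g z - evo a g z) - cx (b - a) * evo t k z" using elim by simp
   moreover have "cx (b - a) \<noteq> 0" using ab by (simp only: of_real_eq_0_iff)
   ultimately show ?case by (simp add: field_simps del: of_real_diff)
  qed
  have "nrm (\<lambda>z. (evo b g z - evo a g z) / cx (b - a) - evo t k z) = nrm (\<lambda>z. cx (1 / (b - a)) * I z)"
   using I by (intro nrm_cong_AE ae) (auto simp: sqi_on_def)
  also have "\<dots> = 1 / (b - a) * nrm I" unfolding nrm_scale norm_of_real using ab by simp
  also have "\<dots> \<le> 1 / (b - a) * (e * (b - a))" using ab by (intro mult_left_mono I') auto
  also have "\<dots> = e" using ab by simp
  finally show ?thesis .
 qed
 show "eventually (\<lambda>h. dist (nrm (\<lambda>z. (evo (t + h) g z - evo t g z) / cx h - evo t k z)) 0 < r) (at 0)"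
  unfolding eventually_at
 proof (intro exI conjI ballI impI)
  show "0 < min d t" using d t by simp
  fix h :: real assume h: "h \<noteq> 0 \<and> dist h 0 < min d t"
  have "nrm (\<lambda>z. (evo (t + h) g z - evo t g z) / cx h - evo t k z) \<le> e"
  proof (cases "h > 0")
   case True then show ?thesis using inc[of t "t + h"] h t d by (simp add: dist_real_def)
  next
   case False
   have "(evo t g z - evo (t + h) g z) / cx (t - (t + h)) = (evo (t + h) g z - evo t g z) / cx h" for z
    using h by (simp add: field_simps)
   then show ?thesis using inc[of "t + h" t] h False d by (simp add: dist_real_def)
  qed
  then show "dist (nrm (\<lambda>z. (evo (t + h) g z - evo t g z) / cx h - evo t k z)) 0 < r"
   using r by (simp add: dist_real_def e_def)
 qed
qed

end

section \<open>Observation of band-limited functions\<close>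

text \<open>Inversion in explicit form: for integrable \<open>L\<close> the preimage is, up to a
  constant, the continuous function \<open>fourier L (- x)\<close>, the one that the spectral
  inequality speaks of.\<close>

lemma FT_band_limited:
 fixes L :: "real^'n \<Rightarrow> complex"
 assumes L: "integrable lborel L" "sqi L"
 shows "FT (\<lambda>x. cx (1 / (2 * pi) ^ CARD('n)) * fourier L (- x)) L"
proof -
 have [measurable]: "L \<in> borel_measurable borel" using L by (simp add: sqi_on_def)
 have c: "integrable lborel (\<lambda>x. cnj (L x))" "sqi (\<lambda>x. cnj (L x))" using L by (auto intro: sqi_cnj)
 have "cnj (fourier (\<lambda>x. cnj (L x)) x) = fourier L (- x)" for x
 proof -
  have "fourier (\<lambda>x. cnj (L x)) x = (LBINT y. cnj (L y) * ekern y x)" by (rule fourier_lborel) measurable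
  then have "cnj (fourier (\<lambda>x. cnj (L x)) x) = (LBINT y. cnj (cnj (L y) * ekern y x))"
   by (simp only: Bochner_Integration.integral_cnj)
  also have "\<dots> = (LBINT y. L y * ekern y (- x))" by (simp add: exp_cnj)
  also have "\<dots> = fourier L (- x)" by (rule fourier_lborel[symmetric]) measurable
  finally show ?thesis .
 qed
 with FT_cnj[OF FT_L1[OF c]] have "FT (\<lambda>x. fourier L (- x)) (\<lambda>z. (2 * pi) ^ CARD('n) * L z)" by simp
 from FT_scale[OF this, of "cx (1 / (2 * pi) ^ CARD('n))"] show ?thesis by simp
qed

text \<open>The spectral inequality is applied to the part of \<open>v\<close> with frequencies up
  to \<open>k\<close>. The rest has norm at most that of its transform and enters twice, as an error
  on \<open>W\<close> and as an error on the whole space.\<close>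

lemma band_limited_observation:
 fixes W :: "(real^'n) set" and a :: "real^'n" and l :: real
 assumes W: "W \<in> sets borel" and a: "\<And>i. 0 < a $ i" and l: "0 < l" "l \<le> 1"
  and thick: "\<And>x. ennreal (l * (\<Prod>i\<in>UNIV. a $ i)) \<le> (NN y. indicator (cbox 0 a) y * indicator W (x + y))"
 obtains C where "C > 0"
  "\<And>k v G. 0 \<le> k \<Longrightarrow> FT v G \<Longrightarrow> nrm v \<le> C * exp (C * k) *
    (nrm (\<lambda>x. indicator W x * v x) + nrm (\<lambda>z. indicator {z. k < norm z} z * G z))"
proof -
 obtain C where C: "C > 0" "\<And>k g. 0 \<le> k \<Longrightarrow> sqi g \<Longrightarrow> (\<And>z. k < norm z \<Longrightarrow> g z = 0) \<Longrightarrow>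
   (nrm (fourier g))^2 \<le> C * exp (C * k) * (nrm (\<lambda>x. indicator W x * fourier g (- x)))^2"
  by (rule spectral_inequality[OF W a l thick]) blast
 define p where "p = (2 * pi) ^ CARD('n)"
 have p: "1 \<le> p" unfolding p_def using pi_gt3 by (intro one_le_power) simp
 show ?thesis
 \<comment> \<open>\<open>sqrt C\<close> comes from the root of the inequality between squares,
   \<open>1\<close> from the high-frequency part of \<open>v\<close>, and \<open>C\<close> dominates
   the exponent.\<close>
 proof (rule that[of "sqrt C + 1 + C"])
  show "0 < sqrt C + 1 + C" using C(1) by (intro add_pos_pos) auto
  fix k :: real and v G :: "real^'n \<Rightarrow> complex" assume k: "0 \<le> k" and vG: "FT v G"
  have G: "sqi G" and v: "sqi v" using FT_sqi[OF vG] by auto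
  have Gm [measurable]: "G \<in> borel_measurable borel" using G by (simp add: sqi_on_def)
  define L where "L = trunc k G"
  have L: "sqi L" "integrable lborel L" unfolding L_def by (intro sqi_trunc integrable_trunc G)+
  have [measurable]: "L \<in> borel_measurable borel" using L by (simp add: sqi_on_def)
  have L0: "L z = 0" if "k < norm z" for z using that by (simp add: L_def trunc_def)
  define f where "f x = cx (1 / p) * fourier L (- x)" for x
  have fL: "FT f L" using FT_band_limited[OF L(2,1)] by (simp add: f_def[abs_def] p_def)
  have f: "sqi f" using FT_sqi[OF fL] by auto
  define D where "D = sqrt C * exp (C * k / 2)"
  have D: "0 \<le> D" using C(1) by (simp add: D_def)
  have D2: "D^2 = C * exp (C * k)"
   unfolding D_def power_mult_distrib using C(1) by (simp add: power2_eq_square flip: exp_add)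
  have cp: "cmod (cx (1 / p)) = 1 / p" unfolding norm_of_real using p by simp
  have "(nrm (fourier L))^2 \<le> (D * nrm (\<lambda>x. indicator W x * fourier L (- x)))^2"
   unfolding power_mult_distrib D2 by (rule C(2)[OF k L(1) L0])
  then have le: "nrm (fourier L) \<le> D * nrm (\<lambda>x. indicator W x * fourier L (- x))"
   by (rule power2_le_imp_le) (use D in simp)
  have "nrm f = 1 / p * nrm (fourier L)"
   unfolding f_def[abs_def] nrm_scale cp nrm_reflect[OF Plancherel_L1(1)[OF L(2,1)]] by (rule refl)
  also have "\<dots> \<le> 1 / p * (D * nrm (\<lambda>x. indicator W x * fourier L (- x)))" using p by (intro mult_left_mono le) simp
  also have "\<dots> = D * nrm (\<lambda>x. indicator W x * f x)"
  proof -
   have "(\<lambda>x. indicator W x * f x) = (\<lambda>x. cx (1 / p) * (indicator W x * fourier L (- x)))" by (simp add: f_def fun_eq_iff)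
   then have "nrm (\<lambda>x. indicator W x * f x) = 1 / p * nrm (\<lambda>x. indicator W x * fourier L (- x))"
    by (simp only: nrm_scale cp)
   then show ?thesis by simp
  qed
  finally have nf: "nrm f \<le> D * nrm (\<lambda>x. indicator W x * f x)" .
  define \<omega> where "\<omega> = nrm (\<lambda>x. indicator W x * v x)"
  define d where "d = nrm (\<lambda>z. indicator {z. k < norm z} z * G z)"
  have "nrm (\<lambda>z. G z - L z) = sqrt p * nrm (\<lambda>x. v x - f x)"
   unfolding p_def by (rule Plancherel[OF FT_diff[OF vG fL]])
  moreover have "(\<lambda>z. G z - L z) = (\<lambda>z. indicator {z. k < norm z} z * G z)"
   by (auto simp: L_def trunc_def indicator_def fun_eq_iff)
  ultimately have "d = sqrt p * nrm (\<lambda>x. v x - f x)" by (simp add: d_def)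
  moreover have "1 * nrm (\<lambda>x. v x - f x) \<le> sqrt p * nrm (\<lambda>x. v x - f x)"
   using p by (intro mult_right_mono) auto
  ultimately have vf: "nrm (\<lambda>x. v x - f x) \<le> d" by simp
  have Wl: "W \<in> sets lborel" using W by simp
  have "nrm (\<lambda>x. indicator W x * f x) \<le> nrm (\<lambda>x. indicator W x * v x) + nrm (\<lambda>x. indicator W x * f x - indicator W x * v x)"
   by (intro nrm_triangle_sub sqi_indicator f v Wl)
  also have "nrm (\<lambda>x. indicator W x * f x - indicator W x * v x) = nrm (\<lambda>x. indicator W x * (v x - f x))"
   by (subst nrm_minus_commute) (simp add: right_diff_distrib)
  also have "\<dots> \<le> nrm (\<lambda>x. v x - f x)"
   using sqi_indicator[OF sqi_diff[OF v f] Wl] by (intro nrm_mono sqi_diff v f) (auto simp: sqi_on_def norm_mult indicator_def)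
  finally have Wf: "nrm (\<lambda>x. indicator W x * f x) \<le> \<omega> + d" using vf by (simp add: \<omega>_def)
  have "nrm v \<le> nrm f + nrm (\<lambda>x. v x - f x)" by (rule nrm_triangle_sub[OF v f])
  also have "\<dots> \<le> D * (\<omega> + d) + d" using nf mult_left_mono[OF Wf D] vf by linarith
  also have "\<dots> \<le> (D + 1) * (\<omega> + d)" by (simp add: distrib_left distrib_right \<omega>_def)
  also have "\<dots> \<le> ((sqrt C + 1 + C) * exp ((sqrt C + 1 + C) * k)) * (\<omega> + d)"
  proof (rule mult_right_mono)
   have "C * k / 2 \<le> (sqrt C + 1 + C) * k" using C(1) k by (simp add: distrib_right add_nonneg_nonneg)
   then have e: "exp (C * k / 2) \<le> exp ((sqrt C + 1 + C) * k)" by simp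
   have e1: "1 \<le> exp ((sqrt C + 1 + C) * k)" using C(1) k by simp
   have "D + 1 \<le> sqrt C * exp ((sqrt C + 1 + C) * k) + 1 * exp ((sqrt C + 1 + C) * k)"
    unfolding D_def using e e1 C(1) by (intro add_mono mult_left_mono) auto
   also have "\<dots> \<le> (sqrt C + 1 + C) * exp ((sqrt C + 1 + C) * k)" using C(1) by (simp add: distrib_right)
   finally show "D + 1 \<le> (sqrt C + 1 + C) * exp ((sqrt C + 1 + C) * k)" .
   show "0 \<le> \<omega> + d" by (simp add: \<omega>_def d_def)
  qed
  finally show "nrm v \<le> (sqrt C + 1 + C) * exp ((sqrt C + 1 + C) * k) *
    (nrm (\<lambda>x. indicator W x * v x) + nrm (\<lambda>z. indicator {z. k < norm z} z * G z))"
   by (simp add: \<omega>_def d_def)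
 qed
qed

section \<open>Low and high frequencies\<close>

lemma exp_minus_le_inverse: "0 < x \<Longrightarrow> exp (- x) \<le> 1 / (x::real)"
proof -
 assume "0 < x"
 moreover have "x \<le> exp x" using exp_ge_add_one_self[of x] by linarith
 ultimately show ?thesis by (simp add: exp_minus field_simps)
qed

context frac_OU
begin

text \<open>For bounded times the norm of a frequency stays comparable along the flow, so the symbol
  is at least a multiple of \<open>norm z powr (2 * s)\<close> on the whole characteristic.\<close>

lemma decay_upper:
 fixes T :: real
 obtains c where "c > 0" "\<And>t z. t \<in> {0..T} \<Longrightarrow> decay t z \<le> exp (- (c * t * norm z powr (2 * s)))"
proof -
 obtain c0 where c0: "0 < c0" "\<And>z. c0 * norm z powr (2 * s) \<le> sym z" using sym_bounds by metis
 obtain Cf where Cf: "Cf \<ge> 1" "\<And>t' x. \<bar>t'\<bar> \<le> T \<Longrightarrow> norm (flow t' x) \<le> Cf * norm x" using flow_bound by metis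
 define c where "c = c0 / Cf powr (2 * s)"
 show ?thesis
 proof (rule that[of c])
  show "0 < c" using c0 Cf by (simp add: c_def)
  fix t :: real and z :: "real^'n" assume t: "t \<in> {0..T}"
  have "(LBINT r:{0..t}. c * norm z powr (2 * s)) \<le> (LBINT r:{0..t}. sym (flow (- r) z))"
  proof (rule set_integral_mono)
   show "set_integrable lborel {0..t} (\<lambda>r. c * norm z powr (2 * s))"
    by (rule borel_integrable_atLeastAtMost') (intro continuous_intros)
   fix r assume r: "r \<in> {0..t}"
   have "norm (flow r (flow (- r) z)) \<le> Cf * norm (flow (- r) z)" using r t by (intro Cf) auto
   then have "norm z / Cf \<le> norm (flow (- r) z)" using Cf(1) by (simp add: field_simps)
   then have "(norm z / Cf) powr (2 * s) \<le> norm (flow (- r) z) powr (2 * s)" using s Cf(1) by (intro powr_mono2) auto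
   then have "c0 * (norm z / Cf) powr (2 * s) \<le> sym (flow (- r) z)"
    using c0 mult_left_mono[of _ _ c0] by (meson less_imp_le order_trans)
   then show "c * norm z powr (2 * s) \<le> sym (flow (- r) z)" using Cf(1) by (simp add: c_def powr_divide)
  qed (rule sym_flow_integrable)
  moreover have "(LBINT r:{0..t}. c * norm z powr (2 * s)) = c * t * norm z powr (2 * s)"
  proof -
   have "(LBINT r:{0..t}. d) = t * d" for d :: real using t by (simp add: set_lebesgue_integral_def)
   from this[of "c * norm z powr (2 * s)"] show ?thesis by (simp only: mult_ac)
  qed
  ultimately have "c * t * norm z powr (2 * s) \<le> (LBINT r:{0..t}. sym (flow (- r) z))" by (simp only:)
  then show "decay t z \<le> exp (- (c * t * norm z powr (2 * s)))" unfolding decay_def by (simp only: exp_le_cancel_iff neg_le_iff_le)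
 qed
qed

text \<open>The bound is expressed at the foot \<open>flow (- t) z\<close> of the characteristic,
  where \<open>push\<close> evaluates the initial datum; a datum cut off at \<open>K\<close> then
  has its damping bounded below on the whole transported support.\<close>

lemma decay_lower:
 fixes T :: real
 assumes T: "0 \<le> T"
 obtains C where "C \<ge> 0" "\<And>t z. t \<in> {0..T} \<Longrightarrow> exp (- (C * norm (flow (- t) z) powr (2 * s))) \<le> decay t z"
proof -
 obtain C0 where C0: "0 < C0" "\<And>z. sym z \<le> C0 * norm z powr (2 * s)" using sym_bounds by metis
 obtain Cf where Cf: "Cf \<ge> 1" "\<And>t' x. \<bar>t'\<bar> \<le> T \<Longrightarrow> norm (flow t' x) \<le> Cf * norm x" using flow_bound by metis
 define C where "C = C0 * Cf powr (2 * s)"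
 have C: "0 \<le> C" using C0 by (simp add: C_def)
 show ?thesis
 proof (rule that[of "T * C"])
  show "0 \<le> T * C" using T C by simp
  fix t :: real and z :: "real^'n" assume t: "t \<in> {0..T}"
  define y where "y = flow (- t) z"
  have "(LBINT r:{0..t}. sym (flow (- r) z)) \<le> (LBINT r:{0..t}. C * norm y powr (2 * s))"
  proof (rule set_integral_mono)
   show "set_integrable lborel {0..t} (\<lambda>r. C * norm y powr (2 * s))"
    by (rule borel_integrable_atLeastAtMost') (intro continuous_intros)
   fix r assume r: "r \<in> {0..t}"
   have "flow (- r) z = flow (t - r) y" unfolding y_def flow_add[symmetric] by simp
   also have "norm \<dots> \<le> Cf * norm y" using r t by (intro Cf) auto
   finally have "norm (flow (- r) z) powr (2 * s) \<le> (Cf * norm y) powr (2 * s)" using s by (intro powr_mono2) auto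
   then have "C0 * norm (flow (- r) z) powr (2 * s) \<le> C0 * (Cf * norm y) powr (2 * s)" using C0(1) by (intro mult_left_mono) auto
   then show "sym (flow (- r) z) \<le> C * norm y powr (2 * s)"
    using C0(2)[of "flow (- r) z"] Cf(1) by (simp add: C_def powr_mult mult.assoc)
  qed (rule sym_flow_integrable)
  also have "\<dots> = t * (C * norm y powr (2 * s))" using t by (simp add: set_lebesgue_integral_def)
  also have "\<dots> \<le> T * (C * norm y powr (2 * s))" using t C by (intro mult_right_mono) auto
  finally show "exp (- (T * C * norm (flow (- t) z) powr (2 * s))) \<le> decay t z" by (simp add: decay_def y_def mult.assoc)
 qed
qed

lemma evo_tail:
 fixes T :: real
 obtains c where "c > 0" "\<And>t h K. t \<in> {0..T} \<Longrightarrow> sqi h \<Longrightarrow> 0 \<le> K \<Longrightarrow>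
  sqi (\<lambda>z. indicator {z. K < norm z} z * evo t h z) \<and>
  nrm (\<lambda>z. indicator {z. K < norm z} z * evo t h z) \<le> exp (- (c * t * K powr (2 * s))) * (exp (T * \<bar>trace B\<bar>) * nrm h)"
proof -
 obtain c where c: "c > 0" "\<And>t z. t \<in> {0..T} \<Longrightarrow> decay t z \<le> exp (- (c * t * norm z powr (2 * s)))" by (rule decay_upper) blast
 show ?thesis
 proof (rule that[OF c(1)])
  fix t :: real and h :: "real^'n \<Rightarrow> complex" and K :: real assume t: "t \<in> {0..T}" and h: "sqi h" and K: "(0::real) \<le> K"
  define e where "e = exp (- (c * t * K powr (2 * s)))"
  have S: "sqi (\<lambda>z. indicator {z. K < norm z} z * evo t h z)"
   by (intro sqi_indicator evo_sqi h) measurable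
  have le: "cmod (indicator {z. K < norm z} z * evo t h z) \<le> cmod (cx e * push t h z)" for z
  proof (cases "K < norm z")
   case True
   have "K powr (2 * s) \<le> norm z powr (2 * s)" using True K s by (intro powr_mono2) auto
   then have "c * t * K powr (2 * s) \<le> c * t * norm z powr (2 * s)" using c(1) t by (intro mult_left_mono) auto
   then have "decay t z \<le> e" using c(2)[OF t, of z] unfolding e_def by (meson exp_le_cancel_iff neg_le_iff_le order_trans)
   then have "decay t z * cmod (push t h z) \<le> e * cmod (push t h z)" by (intro mult_right_mono) auto
   then show ?thesis using True decay_pos[of t z] by (simp add: evo_def norm_mult e_def)
  qed simp
  have "nrm (\<lambda>z. indicator {z. K < norm z} z * evo t h z) \<le> nrm (\<lambda>z. cx e * push t h z)"
   using S le by (intro nrm_mono sqi_scale push_sqi h) (auto simp: sqi_on_def)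
  also have "\<dots> = e * (exp (- (t * trace B) / 2) * nrm h)" unfolding nrm_scale push_nrm[OF h] by (simp add: e_def)
  also have "\<dots> \<le> e * (exp (T * \<bar>trace B\<bar>) * nrm h)"
   by (intro mult_left_mono mult_right_mono exp_growth t) (simp_all add: e_def)
  finally show "sqi (\<lambda>z. indicator {z. K < norm z} z * evo t h z) \<and>
    nrm (\<lambda>z. indicator {z. K < norm z} z * evo t h z) \<le> exp (- (c * t * K powr (2 * s))) * (exp (T * \<bar>trace B\<bar>) * nrm h)"
   using S by (simp add: e_def)
 qed
qed

text \<open>By Duhamel's formula \<open>g\<close> is \<open>evo T g\<close> minus the integral of \<open>evo r k\<close> over \<open>[0, T]\<close>, and both terms are damped at high frequency.\<close>

lemma high_frequency:
 fixes T :: real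
 assumes T: "0 < T"
 obtains C where "C > 0" "\<And>u g f k A K. FT u g \<Longrightarrow> FT f k \<Longrightarrow> weak_image u g f \<Longrightarrow> 0 < A \<Longrightarrow> nrm g \<le> A \<Longrightarrow> nrm k \<le> A \<Longrightarrow>
  0 < K \<Longrightarrow> nrm (\<lambda>z. indicator {z. K < norm z} z * g z) \<le> C * A / K powr (2 * s)"
proof -
 obtain c where c: "c > 0" "\<And>t h K. t \<in> {0..T} \<Longrightarrow> sqi h \<Longrightarrow> 0 \<le> K \<Longrightarrow>
  sqi (\<lambda>z. indicator {z. K < norm z} z * evo t h z) \<and>
  nrm (\<lambda>z. indicator {z. K < norm z} z * evo t h z) \<le> exp (- (c * t * K powr (2 * s))) * (exp (T * \<bar>trace B\<bar>) * nrm h)"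
  by (rule evo_tail) blast
 define E where "E = exp (T * \<bar>trace B\<bar>)"
 have E: "E > 0" by (simp add: E_def)
 show ?thesis
 proof (rule that[of "E / (c * T) + E / c"])
  show "0 < E / (c * T) + E / c" using E c(1) T by (intro add_pos_pos) auto
  fix u g f k :: "real^'n \<Rightarrow> complex" and A K :: real
  assume ug: "FT u g" and fk: "FT f k" and weak: "weak_image u g f" and A: "0 < A" and gA: "nrm g \<le> A" and kA: "nrm k \<le> A" and K: "0 < K"
  note gs = FT_sqi(2)[OF ug] and ks = FT_sqi(2)[OF fk]
  have [measurable]: "g \<in> borel_measurable borel" "k \<in> borel_measurable borel" using gs ks by (simp_all add: sqi_on_def)
  define Y where "Y = K powr (2 * s)"
  have Y: "Y > 0" using K by (simp add: Y_def)
  let ?\<chi> = "indicator {z::real^'n. K < norm z} :: real^'n \<Rightarrow> complex"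
  define Z where "Z r z = ?\<chi> z * evo r k z" for r z
  define \<beta> where "\<beta> r = E * A * exp (- (c * Y * r))" for r
  have \<beta>m: "\<beta> \<in> borel_measurable borel" unfolding \<beta>_def[abs_def] by measurable
  have \<beta>: "0 < \<beta> r" for r using E A by (simp add: \<beta>_def)
  have Zm: "(\<lambda>(r, z). Z r z) \<in> borel_measurable (lborel \<Otimes>\<^sub>M lborel)" unfolding Z_def by measurable
  have Zbd: "(NN z. ennreal ((cmod (Z r z))^2)) \<le> ennreal ((\<beta> r)^2)" if r: "r \<in> {0..T}" for r
  proof (rule nn_integral_square_le[where c = 1])
   note ct = c(2)[OF r ks less_imp_le[OF K]]
   show "sqi (Z r)" unfolding Z_def[abs_def] using ct by blast
   then show "Z r \<in> borel_measurable lborel" by (simp add: sqi_on_def)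
   have "nrm (Z r) \<le> exp (- (c * r * Y)) * (E * nrm k)" unfolding Z_def[abs_def] Y_def E_def using ct by blast
   also have "\<dots> \<le> exp (- (c * r * Y)) * (E * A)" using kA E by (intro mult_left_mono) auto
   finally show "1 * nrm (Z r) \<le> \<beta> r" by (simp add: \<beta>_def mult_ac)
  qed simp_all
  \<comment> \<open>The integral of \<open>exp (- (c * Y * r))\<close> over \<open>r\<close> is at
    most \<open>1 / (c * Y)\<close>: here the full power \<open>K powr (2 * s)\<close> is gained.
    The boundary term \<open>evo T g\<close> is later brought to the same order by
    \<open>exp_minus_le_inverse\<close>.\<close>
  have J: "(NN r. indicator {0..T} r * ennreal (\<beta> r)) \<le> ennreal (E * A / (c * Y))"
  proof -
   have "(NN r. ennreal (\<beta> r) * indicator {0..T} r) = ennreal ((- (E * A / (c * Y)) * exp (- (c * Y * T))) - (- (E * A / (c * Y)) * exp (- (c * Y * 0))))"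
   proof (rule nn_integral_FTC_Icc[OF \<beta>m])
    fix r :: real
    show "((\<lambda>r. - (E * A / (c * Y)) * exp (- (c * Y * r))) has_real_derivative \<beta> r) (at r)"
     using c(1) Y by (auto intro!: derivative_eq_intros simp: \<beta>_def)
    show "0 \<le> \<beta> r" using \<beta>[of r] by simp
   qed (use T in simp)
   also have "\<dots> \<le> ennreal (E * A / (c * Y))" using E A c(1) Y by (intro ennreal_leI) simp
   finally show ?thesis by (simp only: mult.commute[of "ennreal _" "indicator _ _"])
  qed
  have J0: "0 \<le> E * A / (c * Y)" using E A c(1) Y by simp
  note M = Minkowski_integral[OF Zm \<beta>m \<beta> J J0]
  define I where "I z = (LBINT r. indicator {0..T} r *\<^sub>R Z r z)" for z
  have I: "sqi I" unfolding I_def[abs_def] by (rule M(2)) (rule Zbd)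
  have I': "nrm I \<le> E * A / (c * Y)" unfolding I_def[abs_def] by (rule M(3)) (rule Zbd)
  have TT: "T \<in> {0..T}" using T by simp
  note cT = c(2)[OF TT gs less_imp_le[OF K]]
  have ae: "AE z in lborel. ?\<chi> z * g z = ?\<chi> z * evo T g z - I z"
   using Duhamel[OF ug fk less_imp_le[OF T] weak]
  proof eventually_elim
   case (elim z)
   have "I z = ?\<chi> z * (LBINT r. indicator {0..T} r *\<^sub>R evo r k z)"
    unfolding I_def Z_def integral_mult_right_zero[symmetric] by (simp only: mult_scaleR_right)
   also have "\<dots> = ?\<chi> z * (evo T g z - g z)" using elim by simp
   finally show ?case by (simp add: algebra_simps)
  qed
  have Im [measurable]: "I \<in> borel_measurable borel" using I by (simp add: sqi_on_def)
  have "nrm (\<lambda>z. ?\<chi> z * g z) = nrm (\<lambda>z. ?\<chi> z * evo T g z - I z)"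
   by (rule nrm_cong_AE[OF _ _ ae]) measurable
  also have "\<dots> \<le> nrm (\<lambda>z. ?\<chi> z * evo T g z) + nrm (\<lambda>z. - I z)"
   using nrm_triangle[of lborel "\<lambda>z. ?\<chi> z * evo T g z" "\<lambda>z. - I z"] cT sqi_uminus[OF I] by simp
  also have "nrm (\<lambda>z. ?\<chi> z * evo T g z) \<le> exp (- (c * T * Y)) * (E * nrm g)"
   using cT unfolding Y_def E_def by blast
  also have "\<dots> \<le> 1 / (c * T * Y) * (E * A)"
   using E gA c(1) T Y by (intro mult_mono exp_minus_le_inverse mult_left_mono) auto
  finally have "nrm (\<lambda>z. ?\<chi> z * g z) \<le> 1 / (c * T * Y) * (E * A) + E * A / (c * Y)" using I' by simp
  also have "\<dots> = (E / (c * T) + E / c) * A / Y" using c(1) T Y by (simp add: field_simps)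
  finally show "nrm (\<lambda>z. ?\<chi> z * g z) \<le> (E / (c * T) + E / c) * A / K powr (2 * s)" by (simp add: Y_def)
 qed
qed

text \<open>Cutting the datum before the transport makes \<open>decay\<close> bounded below where
  the transported function lives, so the damping is undone at the cost
  \<open>exp (C * K powr (2 * s))\<close>.\<close>

lemma low_frequency:
 fixes T :: real
 assumes T: "0 \<le> T"
 obtains C where "C \<ge> 0" "\<And>t g K. t \<in> {0..T} \<Longrightarrow> sqi g \<Longrightarrow> 0 \<le> K \<Longrightarrow>
  nrm (\<lambda>z. indicator {z. norm z \<le> K} z * g z) \<le> exp (T * \<bar>trace B\<bar>) * exp (C * K powr (2 * s)) * nrm (evo t g)"
proof -
 obtain C where C: "C \<ge> 0" "\<And>t z. t \<in> {0..T} \<Longrightarrow> exp (- (C * norm (flow (- t) z) powr (2 * s))) \<le> decay t z" by (rule decay_lower[OF T]) blast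
 show ?thesis
 proof (rule that[OF C(1)])
  fix t :: real and g :: "real^'n \<Rightarrow> complex" and K :: real assume t: "t \<in> {0..T}" and g: "sqi g" and K: "(0::real) \<le> K"
  define h where "h z = indicator {z. norm z \<le> K} z * g z" for z
  have h: "sqi h" unfolding h_def[abs_def] by (intro sqi_indicator g) measurable
  define e where "e = exp (C * K powr (2 * s))"
  have e: "e > 0" by (simp add: e_def)
  have le: "cmod (push t h z) \<le> cmod (cx e * evo t g z)" for z
  proof (cases "norm (flow (- t) z) \<le> K")
   case True
   have "norm (flow (- t) z) powr (2 * s) \<le> K powr (2 * s)" using True s by (intro powr_mono2) auto
   then have "C * norm (flow (- t) z) powr (2 * s) \<le> C * K powr (2 * s)" using C(1) by (intro mult_left_mono)
   then have "exp (- (C * K powr (2 * s))) \<le> decay t z" using C(2)[OF t, of z] by (meson exp_le_cancel_iff neg_le_iff_le order_trans)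
   then have "e * exp (- (C * K powr (2 * s))) \<le> e * decay t z" using e by (intro mult_left_mono) auto
   then have "1 \<le> e * decay t z" by (simp add: e_def flip: exp_add)
   then have "1 * cmod (push t g z) \<le> e * decay t z * cmod (push t g z)" by (intro mult_right_mono) auto
   moreover have "push t h z = push t g z" using True by (simp add: push_def h_def)
   ultimately show ?thesis using e decay_pos[of t z] by (simp add: evo_def norm_mult mult.assoc)
  qed (simp add: push_def h_def)
  have "nrm (push t h) \<le> nrm (\<lambda>z. cx e * evo t g z)"
   using push_sqi[OF h, of t] le by (intro nrm_mono sqi_scale evo_sqi g) (auto simp: sqi_on_def)
  also have "\<dots> = e * nrm (evo t g)" unfolding nrm_scale using e by simp
  finally have 1: "nrm (push t h) \<le> e * nrm (evo t g)" .
  have "nrm h = exp (t * trace B / 2) * nrm (push t h)"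
   unfolding push_nrm[OF h] by (simp flip: mult.assoc exp_add)
  also have "\<dots> \<le> exp (T * \<bar>trace B\<bar>) * (e * nrm (evo t g))"
  proof (intro mult_mono 1)
   have "t * trace B \<le> t * \<bar>trace B\<bar>" using t by (intro mult_left_mono) auto
   moreover have "t * \<bar>trace B\<bar> \<le> T * \<bar>trace B\<bar>" using t by (intro mult_right_mono) auto
   moreover have "0 \<le> T * \<bar>trace B\<bar>" using T by simp
   ultimately show "exp (t * trace B / 2) \<le> exp (T * \<bar>trace B\<bar>)" unfolding exp_le_cancel_iff by linarith
  qed auto
  finally show "nrm (\<lambda>z. indicator {z. norm z \<le> K} z * g z) \<le> exp (T * \<bar>trace B\<bar>) * exp (C * K powr (2 * s)) * nrm (evo t g)"
   by (simp add: h_def[abs_def] e_def mult.assoc)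
 qed
qed

text \<open>This is where \<open>s > 1 / 2\<close> enters: the dissipation \<open>(A K) powr (2 s)\<close> at frequency \<open>A K\<close> beats
 both the cost \<open>A K\<close> of observing frequencies below \<open>A K\<close> and the cost \<open>K powr (2 s)\<close> of going back in
 time on frequencies below \<open>K\<close>.\<close>

lemma large_cutoff:
 fixes b C1 C2 :: real
 assumes b: "b > 0" and C: "0 \<le> C1" "0 \<le> C2"
 obtains A where "A \<ge> 1" "C1 + C2 * A + 1 \<le> b * A powr (2 * s)"
proof -
 define D where "D = C1 + C2 + 1"
 \<comment> \<open>The second argument of \<open>max\<close> solves
   \<open>b * A powr (2 * s - 1) = D\<close>, which is possible because
   \<open>2 * s - 1 > 0\<close>.\<close>
 define A where "A = max 1 ((D / b) powr (1 / (2 * s - 1)))"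
 have D: "D > 0" using C by (simp add: D_def)
 have A: "A \<ge> 1" by (simp add: A_def)
 have "D / b = ((D / b) powr (1 / (2 * s - 1))) powr (2 * s - 1)" using s D b by (simp add: powr_powr)
 also have "\<dots> \<le> A powr (2 * s - 1)" using s by (intro powr_mono2) (auto simp: A_def)
 finally have "D \<le> b * A powr (2 * s - 1)" using b by (simp add: field_simps)
 then have "D * A \<le> b * A powr (2 * s - 1) * A" using A by (intro mult_right_mono) auto
 also have "\<dots> = b * A powr (2 * s)" using A powr_add[of A "2 * s - 1" 1] by simp
 finally have "D * A \<le> b * A powr (2 * s)" .
 moreover have "C1 * 1 \<le> C1 * A" using A C by (intro mult_left_mono) auto
 ultimately have "C1 + C2 * A + 1 \<le> b * A powr (2 * s)" using A by (simp add: D_def distrib_right)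
 with A show ?thesis by (rule that)
qed

text \<open>The cut is at \<open>K = X powr (1 / (2 * s))\<close>, and the tail beyond it is of
  order \<open>1 / X\<close>. Below it, going back from time \<open>t\<close> costs
  \<open>exp (C2 * X)\<close> and observing costs \<open>exp (C5 * A * X)\<close>. Both multiply the
  error \<open>d\<close> from frequencies above \<open>A * K\<close>, of which the choice of
  \<open>A\<close> leaves only \<open>exp (- X)\<close>. The constants are uniform in
  \<open>t\<close>, which is selected later from the observation.\<close>

theorem interpolated_observability:
 fixes W :: "(real^'n) set" and a :: "real^'n" and l T M :: real
 assumes W: "W \<in> sets borel" and a: "\<And>i. 0 < a $ i" and l: "0 < l" "l \<le> 1"
  and thick: "\<And>x. ennreal (l * (\<Prod>i\<in>UNIV. a $ i)) \<le> (NN y. indicator (cbox 0 a) y * indicator W (x + y))"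
  and T: "T > 0" and M: "M > 0"
 obtains C C' where "C > 0" "C' > 0" "\<And>u g f k t v X. FT u g \<Longrightarrow> FT f k \<Longrightarrow> weak_image u g f \<Longrightarrow> nrm u \<le> M \<Longrightarrow> nrm f \<le> M \<Longrightarrow>
   T / 2 \<le> t \<Longrightarrow> t \<le> T \<Longrightarrow> FT v (evo t g) \<Longrightarrow> 1 \<le> X \<Longrightarrow>
   nrm u \<le> C / X + C * exp (C' * X) * nrm (\<lambda>x. indicator W x * v x)"
proof -
 obtain C5 where C5: "C5 > 0" "\<And>k v G. 0 \<le> k \<Longrightarrow> FT v G \<Longrightarrow> nrm v \<le> C5 * exp (C5 * k) *
    (nrm (\<lambda>x. indicator W x * v x) + nrm (\<lambda>z. indicator {z. k < norm z} z * G z))"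
  by (rule band_limited_observation[OF W a l thick]) blast
 obtain C2 where C2: "C2 \<ge> 0" "\<And>t g K. t \<in> {0..T} \<Longrightarrow> sqi g \<Longrightarrow> 0 \<le> K \<Longrightarrow>
  nrm (\<lambda>z. indicator {z. norm z \<le> K} z * g z) \<le> exp (T * \<bar>trace B\<bar>) * exp (C2 * K powr (2 * s)) * nrm (evo t g)"
  by (rule low_frequency[OF less_imp_le[OF T]]) blast
 obtain C3 where C3: "C3 > 0" "\<And>u g f k A K. FT u g \<Longrightarrow> FT f k \<Longrightarrow> weak_image u g f \<Longrightarrow> 0 < A \<Longrightarrow> nrm g \<le> A \<Longrightarrow> nrm k \<le> A \<Longrightarrow>
  0 < K \<Longrightarrow> nrm (\<lambda>z. indicator {z. K < norm z} z * g z) \<le> C3 * A / K powr (2 * s)"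
  by (rule high_frequency[OF T]) blast
 obtain c where c: "c > 0" "\<And>t h K. t \<in> {0..T} \<Longrightarrow> sqi h \<Longrightarrow> 0 \<le> K \<Longrightarrow>
  sqi (\<lambda>z. indicator {z. K < norm z} z * evo t h z) \<and>
  nrm (\<lambda>z. indicator {z. K < norm z} z * evo t h z) \<le> exp (- (c * t * K powr (2 * s))) * (exp (T * \<bar>trace B\<bar>) * nrm h)"
  by (rule evo_tail) blast
 define E where "E = exp (T * \<bar>trace B\<bar>)"
 have E: "E > 0" by (simp add: E_def)
 define p where "p = sqrt ((2 * pi) ^ CARD('n))"
 have "1 \<le> (2 * pi) ^ CARD('n)" using pi_gt3 by (intro one_le_power) simp
 then have p: "1 \<le> p" by (simp add: p_def)
 \<comment> \<open>\<open>c * T / 2\<close> is the damping available at times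
   \<open>t \<ge> T / 2\<close>, \<open>C2\<close> the cost of going back, and \<open>C5 * A\<close>
   that of observing up to frequency \<open>A * K\<close>. The extra \<open>1\<close> is what
   remains as \<open>exp (- X)\<close>.\<close>
 obtain A where A: "A \<ge> 1" "C2 + C5 * A + 1 \<le> (c * T / 2) * A powr (2 * s)"
  by (rule large_cutoff[of "c * T / 2" C2 C5]) (use c(1) T C2(1) C5(1) in auto)
 define D where "D = E * p * C5"
 have D: "D > 0" using E p C5(1) by (simp add: D_def)
 define C where "C = D + D * (E * p * M) + C3 * (p * M)"
 have terms: "0 \<le> D * (E * p * M)" "0 \<le> C3 * (p * M)" using D E p M C3(1) by auto
 show ?thesis
 proof (rule that[of C "C2 + C5 * A"])
  show "0 < C" using D terms unfolding C_def by linarith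
  show "0 < C2 + C5 * A" using C2(1) C5(1) A(1) by (intro add_nonneg_pos mult_pos_pos) auto
  fix u g f k v :: "real^'n \<Rightarrow> complex" and t X :: real
  assume ug: "FT u g" and fk: "FT f k" and weak: "weak_image u g f" and uM: "nrm u \<le> M" and fM: "nrm f \<le> M"
   and t: "T / 2 \<le> t" "t \<le> T" and v: "FT v (evo t g)" and X: "1 \<le> X"
  note gs = FT_sqi(2)[OF ug]
  have t': "t \<in> {0..T}" using t T by simp
  define \<omega> where "\<omega> = nrm (\<lambda>x. indicator W x * v x)"
  have \<omega>: "0 \<le> \<omega>" by (simp add: \<omega>_def)
  have gu: "nrm g = p * nrm u" and kf: "nrm k = p * nrm f"
   and ev: "nrm (evo t g) = p * nrm v"
   unfolding p_def by (rule Plancherel[OF ug] Plancherel[OF fk] Plancherel[OF v])+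
  have gM: "nrm g \<le> p * M" "nrm k \<le> p * M" unfolding gu kf using uM fM p by (auto intro: mult_left_mono)
  define K where "K = X powr (1 / (2 * s))"
  have K: "1 \<le> K" unfolding K_def using X s by (intro ge_one_powr_ge_zero) auto
  have KX: "K powr (2 * s) = X" unfolding K_def using X s by (simp add: powr_powr)
  \<comment> \<open>As \<open>2 * s \<ge> 1\<close>, the observation cost, exponential in
    \<open>A * K\<close>, is at most exponential in \<open>A * X\<close>.\<close>
  have KleX: "K \<le> X"
  proof -
   have "K \<le> X powr 1" unfolding K_def using X s by (intro powr_mono) (auto simp: field_simps)
   then show ?thesis using X by simp
  qed
  have hi: "nrm (\<lambda>z. indicator {z. K < norm z} z * g z) \<le> C3 * (p * M) / X"
   using C3(2)[OF ug fk weak _ gM, of K] K p M by (simp add: KX)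
  define d where "d = nrm (\<lambda>z. indicator {z. A * K < norm z} z * evo t g z)"
  have AK: "0 \<le> A * K" using A K by simp
  have d: "d \<le> exp (- ((C2 + C5 * A + 1) * X)) * (E * p * M)"
  proof -
   have "d \<le> exp (- (c * t * (A * K) powr (2 * s))) * (E * nrm g)"
    unfolding d_def E_def using c(2)[OF t' gs AK] by blast
   also have "\<dots> \<le> exp (- ((C2 + C5 * A + 1) * X)) * (E * (p * M))"
   proof (intro mult_mono)
    have "(C2 + C5 * A + 1) * X \<le> (c * T / 2) * A powr (2 * s) * X" using X by (intro mult_right_mono A) auto
    also have "\<dots> = c * (T / 2) * (A * K) powr (2 * s)" using A(1) K by (simp add: powr_mult KX)
    also have "\<dots> \<le> c * t * (A * K) powr (2 * s)" using c(1) t by (intro mult_right_mono mult_left_mono) auto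
    finally show "exp (- (c * t * (A * K) powr (2 * s))) \<le> exp (- ((C2 + C5 * A + 1) * X))" by simp
   qed (use E gM in auto)
   finally show ?thesis by (simp add: mult.assoc)
  qed
  have "nrm v \<le> C5 * exp (C5 * (A * K)) * (\<omega> + d)" unfolding \<omega>_def d_def by (rule C5(2)[OF AK v])
  also have "\<dots> \<le> C5 * exp (C5 * A * X) * (\<omega> + d)"
  proof (intro mult_right_mono mult_left_mono)
   have "C5 * A * K \<le> C5 * A * X" using KleX C5(1) A(1) by (intro mult_left_mono) auto
   then show "exp (C5 * (A * K)) \<le> exp (C5 * A * X)" by (simp add: mult.assoc)
   show "0 \<le> \<omega> + d" by (simp add: \<omega>_def d_def)
  qed (use C5 in auto)
  finally have nv: "nrm v \<le> C5 * exp (C5 * A * X) * (\<omega> + d)" .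
  have "nrm (\<lambda>z. indicator {z. norm z \<le> K} z * g z) \<le> E * exp (C2 * X) * (p * nrm v)"
   using C2(2)[OF t' gs, of K] K unfolding E_def KX ev by simp
  also have "\<dots> \<le> E * exp (C2 * X) * (p * (C5 * exp (C5 * A * X) * (\<omega> + d)))"
   using E p nv by (intro mult_left_mono) auto
  also have "\<dots> = D * (exp ((C2 + C5 * A) * X) * \<omega> + exp ((C2 + C5 * A) * X) * d)"
   by (simp add: D_def distrib_right distrib_left exp_add mult_ac)
  also have "exp ((C2 + C5 * A) * X) * d \<le> exp ((C2 + C5 * A) * X) * (exp (- ((C2 + C5 * A + 1) * X)) * (E * p * M))"
   using d by (intro mult_left_mono) auto
  also have "exp ((C2 + C5 * A) * X) * (exp (- ((C2 + C5 * A + 1) * X)) * (E * p * M)) = exp (- X) * (E * p * M)"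
  proof -
   have "exp ((C2 + C5 * A) * X) * exp (- ((C2 + C5 * A + 1) * X)) = exp (- X)"
    unfolding exp_add[symmetric] by (simp add: algebra_simps)
   then show ?thesis by (metis mult.assoc)
  qed
  also have "exp (- X) * (E * p * M) \<le> 1 / X * (E * p * M)" using X E p M by (intro mult_right_mono exp_minus_le_inverse) auto
  finally have lo: "nrm (\<lambda>z. indicator {z. norm z \<le> K} z * g z) \<le> D * (exp ((C2 + C5 * A) * X) * \<omega> + 1 / X * (E * p * M))"
   using D by simp
  have "nrm g = nrm (\<lambda>z. indicator {z. norm z \<le> K} z * g z + indicator {z. K < norm z} z * g z)"
   by (intro arg_cong[where f = "nrm"]) (auto simp: fun_eq_iff indicator_def)
  also have "\<dots> \<le> nrm (\<lambda>z. indicator {z. norm z \<le> K} z * g z) + nrm (\<lambda>z. indicator {z. K < norm z} z * g z)"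
   by (intro nrm_triangle sqi_indicator gs) measurable
  also have "\<dots> \<le> D * (exp ((C2 + C5 * A) * X) * \<omega> + 1 / X * (E * p * M)) + C3 * (p * M) / X" using lo hi by (rule add_mono)
  also have "\<dots> = (D * (E * p * M) + C3 * (p * M)) / X + D * exp ((C2 + C5 * A) * X) * \<omega>"
   by (simp add: distrib_left add_divide_distrib)
  also have "\<dots> \<le> C / X + C * exp ((C2 + C5 * A) * X) * \<omega>"
   using X D terms \<omega> by (intro add_mono divide_right_mono mult_right_mono) (auto simp: C_def)
  finally have "nrm g \<le> C / X + C * exp ((C2 + C5 * A) * X) * \<omega>" .
  moreover have "1 * nrm u \<le> nrm g" unfolding gu using p by (intro mult_right_mono) auto
  ultimately show "nrm u \<le> C / X + C * exp ((C2 + C5 * A) * X) * nrm (\<lambda>x. indicator W x * v x)"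
   by (simp add: \<omega>_def)
 qed
qed

end

text \<open>The choice \<open>X = - ln h / (2 * C')\<close> turns \<open>exp (C' * X) * h\<close>
  into the square root of \<open>h\<close>, which is at most \<open>2 / (- ln h)\<close>. The
  threshold \<open>exp (- (2 * C'))\<close> guarantees \<open>X \<ge> 1\<close>. For
  \<open>h = 0\<close> arbitrarily large \<open>X\<close> force \<open>n \<le> 0\<close>.\<close>

lemma logarithmic_optimization:
 fixes C C' :: real
 assumes C: "C > 0" "C' > 0"
 obtains C2 d where "C2 > 0" "0 < d" "d < 1"
  "\<And>n h. 0 \<le> h \<Longrightarrow> h \<le> d \<Longrightarrow> (\<And>X. 1 \<le> X \<Longrightarrow> n \<le> C / X + C * exp (C' * X) * h) \<Longrightarrow> n \<le> (if h = 0 then 0 else - C2 / ln h)"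
proof -
 show ?thesis
 proof (rule that[of "2 * C * C' + 2 * C" "exp (- (2 * C'))"])
  show "0 < 2 * C * C' + 2 * C" using C by (intro add_pos_pos) auto
  show "exp (- (2 * C')) < 1" using C by simp
  fix n h :: real assume h: "0 \<le> h" "h \<le> exp (- (2 * C'))" and n: "\<And>X. 1 \<le> X \<Longrightarrow> n \<le> C / X + C * exp (C' * X) * h"
  show "n \<le> (if h = 0 then 0 else - (2 * C * C' + 2 * C) / ln h)"
  proof (cases "h = 0")
   case True
   have "n \<le> 0"
   proof (rule ccontr)
    assume "\<not> n \<le> 0"
    then have n0: "n > 0" by simp
    define X where "X = max 1 (2 * C / n)"
    have X: "X \<ge> 1" "2 * C / n \<le> X" by (simp_all add: X_def)
    then have "C / X \<le> n / 2" using n0 by (simp add: field_simps)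
    moreover have "n \<le> C / X" using n[OF X(1)] True by simp
    ultimately show False using n0 by linarith
   qed
   then show ?thesis using True by simp
  next
   case False
   then have h0: "h > 0" using h by simp
   define L where "L = - ln h"
   have "ln h \<le> - (2 * C')" using h h0 by (metis ln_exp ln_le_cancel_iff exp_gt_zero)
   then have L: "2 * C' \<le> L" by (simp add: L_def)
   have L0: "L > 0" using L C by simp
   have hL: "h = exp (- L)" using h0 by (simp add: L_def)
   have X: "1 \<le> L / (2 * C')" using L C by (simp add: field_simps)
   have "n \<le> C / (L / (2 * C')) + C * exp (C' * (L / (2 * C'))) * h" by (rule n[OF X])
   also have "exp (C' * (L / (2 * C'))) = exp (L / 2)" using C by simp
   also have "C * exp (L / 2) * h = C * exp (- (L / 2))" unfolding hL by (simp add: mult.assoc flip: exp_add)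
   also have "\<dots> \<le> C * (1 / (L / 2))" using L0 C by (intro mult_left_mono exp_minus_le_inverse) auto
   finally have "n \<le> C / (L / (2 * C')) + C * (1 / (L / 2))" by simp
   also have "\<dots> = (2 * C * C' + 2 * C) / L" using L0 C by (simp add: field_simps)
   also have "\<dots> = - (2 * C * C' + 2 * C) / ln h" unfolding L_def by (simp only: minus_divide_left minus_divide_right)
   finally show ?thesis using False by (simp only: if_False)
  qed
 qed simp
qed

section \<open>Borel representatives\<close>

text \<open>\<open>f\<close> matters on \<open>S\<close> only and is measurable for the completed
  measure; \<open>h\<close> is a Borel function on the whole space that agrees with it on
  \<open>S\<close> and is \<open>0\<close> outside, up to a null set. Norms over \<open>S\<close>
  thereby become norms over the whole space.\<close>

definition represents :: "(real^'n) set \<Rightarrow> (real^'n \<Rightarrow> complex) \<Rightarrow> (real^'n \<Rightarrow> complex) \<Rightarrow> bool" where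
 "represents S f h \<longleftrightarrow> (\<lambda>x. indicator S x *\<^sub>R f x) \<in> borel_measurable lebesgue \<and> h \<in> borel_measurable borel \<and>
   (AE x in lborel. indicator S x *\<^sub>R f x = h x)"

lemma representsD:
 assumes "represents S f h"
 shows "(\<lambda>x. indicator S x *\<^sub>R f x) \<in> borel_measurable lebesgue" "h \<in> borel_measurable borel"
  "AE x in lborel. indicator S x *\<^sub>R f x = h x"
 using assms by (auto simp: represents_def)

lemma represents_exists:
 assumes "(\<lambda>x. indicator S x *\<^sub>R f x) \<in> borel_measurable lebesgue"
 obtains h where "represents S f h"
proof -
 have RI: "(\<lambda>x. Re (indicator S x *\<^sub>R f x)) \<in> borel_measurable lebesgue" "(\<lambda>x. Im (indicator S x *\<^sub>R f x)) \<in> borel_measurable lebesgue"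
  using assms by measurable
 obtain p where p: "p \<in> borel_measurable lborel" "AE x in lborel. Re (indicator S x *\<^sub>R f x) = p x"
  using completion_ex_borel_measurable_real[OF RI(1)] by blast
 obtain q where q: "q \<in> borel_measurable lborel" "AE x in lborel. Im (indicator S x *\<^sub>R f x) = q x"
  using completion_ex_borel_measurable_real[OF RI(2)] by blast
 have "(\<lambda>x. Complex (p x) (q x)) \<in> borel_measurable borel"
  using p(1) q(1) by (simp add: borel_measurable_complex_iff)
 moreover have "AE x in lborel. indicator S x *\<^sub>R f x = Complex (p x) (q x)"
  using p(2) q(2) by eventually_elim (simp add: complex_eq_iff)
 ultimately show ?thesis using assms that unfolding represents_def by blast
qed

lemma represents_norm:
 assumes r: "represents S f h"
 shows "L2_norm_on S f = nrm h" "f \<in> L2 S \<longleftrightarrow> sqi h"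
proof -
 note R = representsD[OF r]
 have hm [measurable]: "h \<in> borel_measurable borel" by (rule R(2))
 have eq: "indicator S x *\<^sub>R (norm (f x))^2 = (norm (indicator S x *\<^sub>R f x))^2" for x by (simp add: indicator_def)
 have m: "(\<lambda>x. (norm (indicator S x *\<^sub>R f x))^2) \<in> borel_measurable lebesgue" using R(1) by measurable
 have hl: "(\<lambda>x. (norm (h x))^2) \<in> borel_measurable lebesgue" by (rule measurable_completion) measurable
 have ae: "AE x in lebesgue. (norm (indicator S x *\<^sub>R f x))^2 = (norm (h x))^2"
  by (rule AE_completion) (use R(3) in eventually_elim, simp)
 have "(LINT x|lebesgue. (norm (indicator S x *\<^sub>R f x))^2) = (LINT x|lebesgue. (norm (h x))^2)"
  by (rule integral_cong_AE[OF m hl ae])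
 also have "\<dots> = (LBINT x. (norm (h x))^2)" by (rule integral_completion) measurable
 finally show "L2_norm_on S f = nrm h"
  unfolding L2_norm_on_def set_lebesgue_integral_def eq nrm_on_def by simp
 have "integrable lebesgue (\<lambda>x. (norm (indicator S x *\<^sub>R f x))^2) \<longleftrightarrow> integrable lebesgue (\<lambda>x. (norm (h x))^2)"
  by (rule integrable_cong_AE[OF m hl ae])
 also have "\<dots> \<longleftrightarrow> integrable lborel (\<lambda>x. (norm (h x))^2)" by (rule integrable_completion) measurable
 finally have iff: "integrable lebesgue (\<lambda>x. (norm (indicator S x *\<^sub>R f x))^2) \<longleftrightarrow> integrable lborel (\<lambda>x. (norm (h x))^2)" .
 have hm': "h \<in> borel_measurable lborel" using hm by simp
 show "f \<in> L2 S \<longleftrightarrow> sqi h"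
  unfolding L2_def sqi_on_def set_borel_measurable_def set_integrable_def eq mem_Collect_eq using iff R(1) hm' by blast
qed

lemma represents_UNIV_self:
 assumes h: "h \<in> borel_measurable borel" shows "represents UNIV h h"
proof -
 have "h \<in> borel_measurable lebesgue" by (rule measurable_completion) (simp add: h)
 with h show ?thesis by (simp add: represents_def)
qed

lemma represents_L2:
 assumes "f \<in> L2 S" obtains h where "represents S f h" "sqi h"
proof -
 have "(\<lambda>x. indicator S x *\<^sub>R f x) \<in> borel_measurable lebesgue" using assms by (simp add: L2_def set_borel_measurable_def)
 then obtain h where "represents S f h" by (rule represents_exists)
 with assms show ?thesis using represents_norm(2) that by blast
qed

lemma represents_cong:
 assumes "represents S f h" "AE x in lborel. h x = h' x" "h' \<in> borel_measurable borel"
 shows "represents S f h'"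
proof -
 have "AE x in lborel. indicator S x *\<^sub>R f x = h' x"
  using representsD(3)[OF assms(1)] assms(2) by eventually_elim simp
 with representsD(1)[OF assms(1)] assms(3) show ?thesis by (simp only: represents_def simp_thms)
qed

lemma represents_quotient:
 assumes "represents S f h" "represents S f' h'"
 shows "represents S (\<lambda>x. (f x - f' x) / c) (\<lambda>x. (h x - h' x) / c)"
proof -
 note R = representsD[OF assms(1)] representsD[OF assms(2)]
 have eq: "indicator S x *\<^sub>R ((f x - f' x) / c) = (indicator S x *\<^sub>R f x - indicator S x *\<^sub>R f' x) / c" for x
  by (simp add: indicator_def)
 show ?thesis unfolding represents_def eq
  by (intro conjI borel_measurable_divide borel_measurable_diff R borel_measurable_const)
    (use R(3,6) in eventually_elim, simp)
qed

lemma represents_restrict: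
 assumes r: "represents UNIV f h" and \<omega>: "\<omega> \<in> sets lebesgue" and W: "W \<in> sets borel" "AE x in lborel. x \<in> \<omega> \<longleftrightarrow> x \<in> W"
 shows "represents \<omega> f (\<lambda>x. indicator W x * h x)"
proof -
 note R = representsD[OF r]
 have "f \<in> borel_measurable lebesgue" using R(1) by simp
 then have "(\<lambda>x. indicator \<omega> x *\<^sub>R f x) \<in> borel_measurable lebesgue" using \<omega> by measurable
 moreover have "(\<lambda>x. indicator W x * h x) \<in> borel_measurable borel" using R(2) W(1) by measurable
 moreover have "AE x in lborel. indicator \<omega> x *\<^sub>R f x = indicator W x * h x"
  using R(3) W(2) by eventually_elim (auto simp: indicator_def)
 ultimately show ?thesis by (simp add: represents_def)
qed

text \<open>The representation is asked for only eventually: difference quotients involve the times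
  \<open>t + h\<close>, which are nonnegative for small \<open>h\<close> only.\<close>

lemma represents_tendsto:
 assumes ev: "eventually (\<lambda>a. represents S (f a) (h a) \<and> sqi (h a)) F"
  and g: "represents S g p" "sqi p"
 shows "tendsto_L2 S f g F \<longleftrightarrow> ((\<lambda>a. nrm (\<lambda>x. h a x - p x)) \<longlongrightarrow> 0) F"
proof -
 have eq: "(\<integral>\<^sup>+x\<in>S. ennreal ((norm (f a x - g x))^2) \<partial>lebesgue) = ennreal ((nrm (\<lambda>x. h a x - p x))^2)"
  if a: "represents S (f a) (h a)" "sqi (h a)" for a
 proof -
  have "(\<integral>\<^sup>+x\<in>S. ennreal ((norm (f a x - g x))^2) \<partial>lebesgue) = (\<integral>\<^sup>+x\<in>S. ennreal ((norm (f a x - g x))^2) \<partial>lborel)"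
   by (rule nn_integral_completion)
  also have "\<dots> = (NN x. ennreal ((norm (h a x - p x))^2))"
  proof (rule nn_integral_cong_AE)
   show "AE x in lborel. ennreal ((norm (f a x - g x))^2) * indicator S x = ennreal ((norm (h a x - p x))^2)"
    using representsD(3)[OF a(1)] representsD(3)[OF g(1)]
   proof eventually_elim
    case (elim x)
    show ?case unfolding elim[symmetric] by (simp add: indicator_def)
   qed
  qed
  also have "\<dots> = ennreal ((nrm (\<lambda>x. h a x - p x))^2)" by (rule nn_integral_sqi[OF sqi_diff[OF a(2) g(2)]])
  finally show ?thesis .
 qed
 have "tendsto_L2 S f g F \<longleftrightarrow> ((\<lambda>a. ennreal ((nrm (\<lambda>x. h a x - p x))^2)) \<longlongrightarrow> ennreal 0) F"
  unfolding tendsto_L2_def ennreal_0 by (rule tendsto_cong) (use ev eq in \<open>auto elim!: eventually_mono\<close>)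
 also have "\<dots> \<longleftrightarrow> ((\<lambda>a. (nrm (\<lambda>x. h a x - p x))^2) \<longlongrightarrow> 0) F"
  by (rule tendsto_ennreal_iff) simp_all
 also have "\<dots> \<longleftrightarrow> ((\<lambda>a. nrm (\<lambda>x. h a x - p x)) \<longlongrightarrow> 0) F"
 proof
  assume "((\<lambda>a. (nrm (\<lambda>x. h a x - p x))^2) \<longlongrightarrow> 0) F"
  from tendsto_real_sqrt[OF this] show "((\<lambda>a. nrm (\<lambda>x. h a x - p x)) \<longlongrightarrow> 0) F" by simp
 next
  assume "((\<lambda>a. nrm (\<lambda>x. h a x - p x)) \<longlongrightarrow> 0) F"
  from tendsto_power[OF this, of 2] show "((\<lambda>a. (nrm (\<lambda>x. h a x - p x))^2) \<longlongrightarrow> 0) F" by simp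
 qed
 finally show ?thesis .
qed

text \<open>Limits in \<open>L2\<close> along a proper filter are unique up to null sets. Whatever
  \<open>SOME\<close> selects therefore shares the Borel representative of any limit
  \<open>P\<close> already known.\<close>

lemma represents_SOME_limit:
 assumes ev: "eventually (\<lambda>a. represents S (f a) (h a) \<and> sqi (h a)) F" and F: "F \<noteq> bot"
  and P: "represents S P p" "sqi p" and lim: "((\<lambda>a. nrm (\<lambda>x. h a x - p x)) \<longlongrightarrow> 0) F"
 shows "represents S (SOME v. v \<in> L2 S \<and> tendsto_L2 S f v F) p"
proof -
 define v where "v = (SOME v. v \<in> L2 S \<and> tendsto_L2 S f v F)"
 have "P \<in> L2 S \<and> tendsto_L2 S f P F" using represents_tendsto[OF ev P] lim represents_norm(2)[OF P(1)] P(2) by blast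
 then have "v \<in> L2 S \<and> tendsto_L2 S f v F" unfolding v_def by (rule someI[where P = "\<lambda>v. v \<in> L2 S \<and> tendsto_L2 S f v F"])
 then have v: "v \<in> L2 S" "tendsto_L2 S f v F" by auto
 obtain q where q: "represents S v q" "sqi q" using represents_L2[OF v(1)] .
 have lq: "((\<lambda>a. nrm (\<lambda>x. h a x - q x)) \<longlongrightarrow> 0) F" using represents_tendsto[OF ev q] v(2) by blast
 have "nrm (\<lambda>x. q x - p x) \<le> 0 + 0"
 proof (rule tendsto_lowerbound[OF tendsto_add[OF lq lim] _ F])
  show "eventually (\<lambda>a. nrm (\<lambda>x. q x - p x) \<le> nrm (\<lambda>x. h a x - q x) + nrm (\<lambda>x. h a x - p x)) F"
   using ev
  proof eventually_elim
   case (elim a)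
   then show ?case using nrm_diff_triangle[OF q(2) _ P(2), of "h a"] nrm_minus_commute[of lborel q "h a"] by auto
  qed
 qed
 then have "nrm (\<lambda>x. q x - p x) = 0" using nrm_nonneg[of lborel "\<lambda>x. q x - p x"] by linarith
 then have "AE x in lborel. q x = p x" using nrm_eq_0[OF sqi_diff[OF q(2) P(2)]] by simp
 then show ?thesis using represents_cong[OF q(1)] P(2) unfolding v_def[symmetric] by (simp add: sqi_on_def)
qed

text \<open>Values on null sets do not affect integrals, so the truncations of \<open>u\<close> and
  of \<open>u'\<close> have equal transforms at every point.\<close>

lemma fourier_L2_represents:
 fixes u u' g :: "real^'n \<Rightarrow> complex"
 assumes u: "represents UNIV u u'" and ug: "FT u' g"
 shows "represents UNIV (fourier_L2 u) g"
proof -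
 note us = FT_sqi(1)[OF ug] and gs = FT_sqi(2)[OF ug]
 have um [measurable]: "u' \<in> borel_measurable borel" using us by (simp add: sqi_on_def)
 have ul: "u \<in> borel_measurable lebesgue" using representsD(1)[OF u] by simp
 have tm [measurable]: "trunc R u' \<in> borel_measurable borel" for R using sqi_trunc[OF us, of R] by (simp add: sqi_on_def)
 have eq: "fourier (\<lambda>x. indicator (cball 0 R) x * u x) = fourier (trunc R u')" for R
 proof
  fix z :: "real^'n"
  have b: "(\<lambda>x::real^'n. indicator (cball 0 R) x :: complex) \<in> borel_measurable lebesgue"
   by (rule measurable_completion) (intro borel_measurable_indicator, simp)
  have b2: "(\<lambda>x. ekern x z) \<in> borel_measurable lebesgue"
   by (rule measurable_completion) measurable
  have m2: "(\<lambda>x. trunc R u' x * ekern x z) \<in> borel_measurable lebesgue" by (rule measurable_completion) measurable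
  show "fourier (\<lambda>x. indicator (cball 0 R) x * u x) z = fourier (trunc R u') z"
   unfolding fourier_def
  proof (rule integral_cong_AE[OF _ m2])
   show "(\<lambda>x. indicator (cball 0 R) x * u x * ekern x z) \<in> borel_measurable lebesgue"
    by (intro borel_measurable_times b b2 ul)
   show "AE x in lebesgue. indicator (cball 0 R) x * u x * ekern x z = trunc R u' x * ekern x z"
    by (rule AE_completion) (use representsD(3)[OF u] in eventually_elim, simp add: trunc_def)
  qed
 qed
 show ?thesis unfolding fourier_L2_def
 proof (rule represents_SOME_limit[where h = "\<lambda>R. fourier (trunc R u')" and P = g])
  show "eventually (\<lambda>R. represents UNIV (fourier (\<lambda>x. indicator (cball 0 R) x * u x)) (fourier (trunc R u')) \<and> sqi (fourier (trunc R u'))) at_top"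
   unfolding eq by (intro always_eventually allI conjI represents_UNIV_self Plancherel_L1(1) integrable_trunc sqi_trunc us) measurable
  show "represents UNIV g g" using gs by (intro represents_UNIV_self) (simp add: sqi_on_def)
  show "((\<lambda>R. nrm (\<lambda>z. fourier (trunc R u') z - g z)) \<longlongrightarrow> 0) at_top" using ug by (simp add: FT_def)
 qed (use gs in simp_all)
qed

lemma represents_integral:
 fixes u u' q :: "real^'n \<Rightarrow> complex"
 assumes u: "represents UNIV u u'" and q: "q \<in> borel_measurable borel"
 shows "(LINT x|lebesgue. u x * q x) = (LBINT x. u' x * q x)"
proof -
 have um [measurable]: "u' \<in> borel_measurable borel" by (rule representsD(2)[OF u])
 have m: "(\<lambda>x. u' x * q x) \<in> borel_measurable lborel" using q by measurable
 have "(LINT x|lebesgue. u x * q x) = (LINT x|lebesgue. u' x * q x)"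
 proof (rule integral_cong_AE[OF _ measurable_completion[OF m]])
  have "u \<in> borel_measurable lebesgue" using representsD(1)[OF u] by simp
  then show "(\<lambda>x. u x * q x) \<in> borel_measurable lebesgue"
   using measurable_completion[of q lborel borel] q by (intro borel_measurable_times) simp_all
  show "AE x in lebesgue. u x * q x = u' x * q x"
   by (rule AE_completion) (use representsD(3)[OF u] in eventually_elim, simp)
 qed
 also have "\<dots> = (LBINT x. u' x * q x)" by (rule integral_completion[OF m])
 finally show ?thesis .
qed

section \<open>Identification of the operator, the semigroup and the time derivative\<close>

context frac_OU
begin

lemma OU_image_weak:
 assumes u: "represents UNIV u u'" and ug: "FT u' g" and f: "represents UNIV f f'" and im: "is_OU_image Q B s u f"
 shows "weak_image u' g f'"
 unfolding weak_image_def
proof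
 fix p :: "real^'n \<Rightarrow> complex" assume p: "p \<in> test_functions"
 have pm [measurable]: "p \<in> borel_measurable borel" by (rule Cc_borel[OF test_Cc[OF p]])
 have 1: "(LINT x|lebesgue. f x * p x) = (LBINT x. f' x * p x)" by (rule represents_integral[OF f pm])
 have m: "(\<lambda>z. cx (sym z) * fourier p (- z)) \<in> borel_measurable borel" by measurable
 have "(LINT z|lebesgue. cx (((Q *v z) \<bullet> z) powr s) * fourier_L2 u z * fourier p (- z))
   = (LINT z|lebesgue. fourier_L2 u z * (cx (sym z) * fourier p (- z)))"
  by (simp add: sym_def mult_ac)
 also have "\<dots> = (LBINT z. g z * (cx (sym z) * fourier p (- z)))"
  by (rule represents_integral[OF fourier_L2_represents[OF u ug] m])
 finally have 2: "(LINT z|lebesgue. cx (((Q *v z) \<bullet> z) powr s) * fourier_L2 u z * fourier p (- z))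
   = (LBINT z. cx (sym z) * g z * fourier p (- z))" by (simp add: mult_ac)
 have 3: "(LINT x|lebesgue. u x * partial_deriv i (\<lambda>y. cx (y $ j) * p y) x) = (LBINT x. u' x * partial_deriv i (\<lambda>y. cx (y $ j) * p y) x)" for i j
  by (intro represents_integral[OF u] Cc_borel test_Cc test_partial test_mult p C_k_component)
 have "(LINT x|lebesgue. f x * p x) = - frac_diffusion Q s u p + drift B u p" using im p by (simp add: is_OU_image_def)
 then show "(LBINT x. f' x * p x) =
    - (LBINT z. cx (sym z) * g z * fourier p (- z)) / cx ((2 * pi) ^ CARD('n))
    + (\<Sum>i\<in>UNIV. \<Sum>j\<in>UNIV. cx (B $ i $ j) * (- (LBINT x. u' x * partial_deriv i (\<lambda>y. cx (y $ j) * p y) x)))"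
  unfolding 1 frac_diffusion_def drift_def 2 3 by simp
qed

text \<open>A function with transform \<open>evo t g\<close> exists by \<open>FT_surj\<close>, so
  the choice by \<open>SOME\<close> is from a nonempty class, and the prescribed transform
  determines it up to a null set.\<close>

lemma OU_semigroup_represents:
 assumes u: "represents UNIV u0 u'" and ug: "FT u' g" and t: "0 \<le> t"
 shows "\<exists>v. FT v (evo t g) \<and> represents UNIV (OU_semigroup Q B s t u0) v"
proof -
 note gs = FT_sqi(2)[OF ug]
 have gm [measurable]: "g \<in> borel_measurable borel" using gs by (simp add: sqi_on_def)
 note eg = evo_sqi[OF gs, of t]
 have egm: "evo t g \<in> borel_measurable borel" using eg by (simp add: sqi_on_def)
 define R where "R z = cx (exp (- trace B * t) *
     exp (- (LBINT r:{0..t}.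
       norm (matrix_sqrt Q *v (matrix_exp (- r *\<^sub>R transpose B) *v z)) powr (2 * s))))
    * fourier_L2 u0 (matrix_exp (- t *\<^sub>R transpose B) *v z)" for z
 have R: "AE z in lborel. R z = evo t g z"
 proof -
  have "AE z in lborel. fourier_L2 u0 z = g z" using representsD(3)[OF fourier_L2_represents[OF u ug]] by simp
  then have "AE z in lborel. fourier_L2 u0 (flow (- t) z) = g (flow (- t) z)"
   by (rule AE_lborel_scaling[OF lborel_distr_flow flow_borel exp_gt_zero])
  then show ?thesis
  proof eventually_elim
   case (elim z)
   have fl: "matrix_exp (- r *\<^sub>R transpose B) *v z = flow (- r) z" for r by (simp add: flow_def expm_def)
   have "norm (matrix_sqrt Q *v x) powr (2 * s) = sym x" for x
   proof -
    have "sym x = ((norm (matrix_sqrt Q *v x))^2) powr s" unfolding sym_def matrix_sqrt_norm[OF posdef] by (rule refl)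
    also have "\<dots> = norm (matrix_sqrt Q *v x) powr (2 * s)"
     by (cases "matrix_sqrt Q *v x = 0") (simp_all add: powr_powr flip: powr_numeral)
    finally show ?thesis by simp
   qed
   then show ?case unfolding R_def fl elim by (simp add: evo_def push_def decay_def mult_ac)
  qed
 qed
 define v where "v = OU_semigroup Q B s t u0"
 have "\<exists>v. v \<in> L2 UNIV \<and> (AE z in lebesgue. fourier_L2 v z = R z)"
 proof -
  obtain w where w: "FT w (evo t g)" using FT_surj[OF eg] by blast
  have wr: "represents UNIV w w" using FT_sqi(1)[OF w] by (intro represents_UNIV_self) (simp add: sqi_on_def)
  have "AE z in lborel. fourier_L2 w z = evo t g z" using representsD(3)[OF fourier_L2_represents[OF wr w]] by simp
  with R have "AE z in lborel. fourier_L2 w z = R z" by eventually_elim simp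
  then have "AE z in lebesgue. fourier_L2 w z = R z" by (rule AE_completion)
  moreover have "w \<in> L2 UNIV" using represents_norm(2)[OF wr] FT_sqi(1)[OF w] by simp
  ultimately show ?thesis by blast
 qed
 from someI_ex[OF this] have v: "v \<in> L2 UNIV" "AE z in lebesgue. fourier_L2 v z = R z"
  unfolding v_def OU_semigroup_def R_def by auto
 obtain v' where v': "represents UNIV v v'" "sqi v'" using represents_L2[OF v(1)] .
 obtain g' where g': "FT v' g'" using FT_exists[OF v'(2)] by blast
 have "AE z in lborel. g' z = evo t g z"
  using representsD(3)[OF fourier_L2_represents[OF v'(1) g']] v(2)[unfolded AE_completion_iff] R by eventually_elim simp
 then have "FT v' (evo t g)" by (intro FT_cong[OF g' _ _ _ egm]) (use v'(2) in \<open>auto simp: sqi_on_def\<close>)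
 with v'(1) show ?thesis unfolding v_def by blast
qed

text \<open>Plancherel bounds the change of the observed norm by that of \<open>evo\<close>.
  Continuity in time is what makes the integrand of \<open>H1_norm\<close> integrable.\<close>

lemma nrm_FT_evo_continuous:
 assumes v: "\<And>t. 0 \<le> t \<Longrightarrow> FT (v t) (evo t g)" and W: "W \<in> sets borel"
 shows "continuous_on {0..} (\<lambda>t. nrm (\<lambda>x. indicator W x * v t x))"
proof -
 have gs: "sqi g" using FT_sqi(2)[OF v[of 0]] by simp
 have Wl: "W \<in> sets lborel" using W by simp
 have "((\<lambda>r. nrm (\<lambda>x. indicator W x * v r x)) \<longlongrightarrow> nrm (\<lambda>x. indicator W x * v t x)) (at t within {0..})"
  if t: "t \<in> {0..}" for t
 proof -
  have t0: "0 \<le> t" using t by simp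
  have "((\<lambda>r. nrm (\<lambda>x. indicator W x * v r x) - nrm (\<lambda>x. indicator W x * v t x)) \<longlongrightarrow> 0) (at t within {0..})"
  proof (rule Lim_null_comparison[OF _ evo_strongly_continuous[OF gs t0]])
   show "eventually (\<lambda>r. norm (nrm (\<lambda>x. indicator W x * v r x) - nrm (\<lambda>x. indicator W x * v t x)) \<le> nrm (\<lambda>z. evo r g z - evo t g z)) (at t within {0..})"
    unfolding eventually_at_topological
   proof (intro exI[of _ UNIV] conjI ballI impI)
    fix r assume "r \<in> {0::real..}"
    then have r: "0 \<le> r" by simp
    note sq = FT_sqi(1)[OF v[OF r]] FT_sqi(1)[OF v[OF t0]]
    have "norm (nrm (\<lambda>x. indicator W x * v r x) - nrm (\<lambda>x. indicator W x * v t x)) \<le> nrm (\<lambda>x. indicator W x * v r x - indicator W x * v t x)"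
     unfolding real_norm_def by (intro nrm_abs_diff sqi_indicator sq Wl)
    also have "\<dots> \<le> nrm (\<lambda>x. v r x - v t x)"
     using sqi_diff[OF sqi_indicator[OF sq(1) Wl] sqi_indicator[OF sq(2) Wl]]
     by (intro nrm_mono sqi_diff sq) (auto simp: sqi_on_def indicator_def)
    also have "\<dots> \<le> nrm (\<lambda>z. evo r g z - evo t g z)"
    proof -
     have "1 \<le> sqrt ((2 * pi) ^ CARD('n))"
      using pi_gt3 unfolding real_sqrt_ge_1_iff by (intro one_le_power) simp
     then have "1 * nrm (\<lambda>x. v r x - v t x) \<le> sqrt ((2 * pi) ^ CARD('n)) * nrm (\<lambda>x. v r x - v t x)"
      by (intro mult_right_mono) simp_all
     then show ?thesis unfolding Plancherel[OF FT_diff[OF v[OF r] v[OF t0]]] by simp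
    qed
    finally show "norm (nrm (\<lambda>x. indicator W x * v r x) - nrm (\<lambda>x. indicator W x * v t x)) \<le> nrm (\<lambda>z. evo r g z - evo t g z)" .
   qed auto
  qed
  then show ?thesis by (simp only: LIM_zero_iff)
 qed
 then show ?thesis by (simp add: continuous_on_def)
qed

text \<open>On the frequency side the difference quotients converge to \<open>evo t k\<close> by
  \<open>evo_difference_quotient\<close>. Passing to the space side and restricting to
  \<open>W\<close> do not increase distances, so \<open>w\<close> is the limit that
  \<open>SOME\<close> must select up to null sets.\<close>

lemma time_deriv_represents:
 assumes u: "represents UNIV u0 u'" and ug: "FT u' g" and fk: "FT f' k" and weak: "weak_image u' g f'"
  and v: "\<And>t. 0 \<le> t \<Longrightarrow> FT (v t) (evo t g) \<and> represents UNIV (OU_semigroup Q B s t u0) (v t)"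
  and w: "FT w (evo t k)" and t: "0 < t"
  and \<omega>: "\<omega> \<in> sets lebesgue" and W: "W \<in> sets borel" "AE x in lborel. x \<in> \<omega> \<longleftrightarrow> x \<in> W"
 shows "represents \<omega> (L2_time_deriv \<omega> (\<lambda>t. OU_semigroup Q B s t u0) t) (\<lambda>x. indicator W x * w x)"
 unfolding L2_time_deriv_def
proof (rule represents_SOME_limit[where P = w and h = "\<lambda>h x. (indicator W x * v (t + h) x - indicator W x * v t x) / cx h"])
 have Wl: "W \<in> sets lborel" using W by simp
 note ws = FT_sqi(1)[OF w]
 have near: "eventually (\<lambda>h. 0 \<le> t + h \<and> h \<noteq> 0) (at (0::real))"
  unfolding eventually_at using t by (intro exI[of _ t]) (auto simp: dist_real_def)
 have quot: "sqi (\<lambda>x. (a x - b x) / c)" if "sqi a" "sqi b" for a b :: "real^'n \<Rightarrow> complex" and c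
  using sqi_scale[OF sqi_diff[OF that], of "1 / c"] by simp
 show "eventually (\<lambda>h. represents \<omega> (\<lambda>x. (OU_semigroup Q B s (t + h) u0 x - OU_semigroup Q B s t u0 x) / cx h)
     (\<lambda>x. (indicator W x * v (t + h) x - indicator W x * v t x) / cx h) \<and>
    sqi (\<lambda>x. (indicator W x * v (t + h) x - indicator W x * v t x) / cx h)) (at 0)"
  using near
 proof eventually_elim
  case (elim h)
  have 1: "0 \<le> t + h" "0 \<le> t" using elim t by auto
  show ?case
   using v[OF 1(1)] v[OF 1(2)]
   by (intro conjI represents_quotient represents_restrict \<omega> W quot sqi_indicator Wl) (auto dest: FT_sqi)
 qed
 have "represents UNIV w w" using ws by (intro represents_UNIV_self) (simp add: sqi_on_def)
 then show "represents \<omega> w (\<lambda>x. indicator W x * w x)" by (rule represents_restrict[OF _ \<omega> W])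
 show "sqi (\<lambda>x. indicator W x * w x)" by (intro sqi_indicator ws Wl)
 show "((\<lambda>h. nrm (\<lambda>x. (indicator W x * v (t + h) x - indicator W x * v t x) / cx h - indicator W x * w x)) \<longlongrightarrow> 0) (at 0)"
 proof (rule Lim_null_comparison[OF _ evo_difference_quotient[OF ug fk weak t]])
  show "eventually (\<lambda>h. norm (nrm (\<lambda>x. (indicator W x * v (t + h) x - indicator W x * v t x) / cx h - indicator W x * w x))
    \<le> nrm (\<lambda>z. (evo (t + h) g z - evo t g z) / cx h - evo t k z)) (at 0)"
   using near
  proof eventually_elim
   case (elim h)
   have 1: "0 \<le> t + h" "0 \<le> t" using elim t by auto
   have F: "FT (v (t + h)) (evo (t + h) g)" "FT (v t) (evo t g)" using v[OF 1(1)] v[OF 1(2)] by auto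
   have D: "FT (\<lambda>x. (v (t + h) x - v t x) / cx h - w x) (\<lambda>z. (evo (t + h) g z - evo t g z) / cx h - evo t k z)"
    using FT_diff[OF FT_scale[OF FT_diff[OF F], of "1 / cx h"] w] by simp
   have eq: "(indicator W x * v (t + h) x - indicator W x * v t x) / cx h - indicator W x * w x = indicator W x * ((v (t + h) x - v t x) / cx h - w x)" for x
    by (simp add: indicator_def)
   have "nrm (\<lambda>x. indicator W x * ((v (t + h) x - v t x) / cx h - w x)) \<le> nrm (\<lambda>x. (v (t + h) x - v t x) / cx h - w x)"
    using sqi_indicator[OF FT_sqi(1)[OF D] Wl] by (intro nrm_mono FT_sqi(1)[OF D]) (auto simp: sqi_on_def indicator_def)
   also have "\<dots> \<le> sqrt ((2 * pi) ^ CARD('n)) * nrm (\<lambda>x. (v (t + h) x - v t x) / cx h - w x)"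
   proof -
    have "1 \<le> sqrt ((2 * pi) ^ CARD('n))"
      using pi_gt3 unfolding real_sqrt_ge_1_iff by (intro one_le_power) simp
    then have "1 * nrm (\<lambda>x. (v (t + h) x - v t x) / cx h - w x) \<le> sqrt ((2 * pi) ^ CARD('n)) * nrm (\<lambda>x. (v (t + h) x - v t x) / cx h - w x)"
     by (intro mult_right_mono) simp_all
    then show ?thesis by simp
   qed
   also have "\<dots> = nrm (\<lambda>z. (evo (t + h) g z - evo t g z) / cx h - evo t k z)" by (rule Plancherel[OF D, symmetric])
   finally show ?case unfolding eq by simp
  qed
 qed
qed simp

end

text \<open>\<open>t\<close> minimises \<open>N1\<close> on \<open>[T / 2, T]\<close>. Continuity is
  assumed for both terms because the integral of a sum that is not integrable would be
  \<open>0\<close> by default.\<close>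

lemma mean_value_lower_bound:
 fixes N1 N2 :: "real \<Rightarrow> real"
 assumes T: "0 < T" and c: "continuous_on {0..T} N1" "continuous_on {0..T} N2"
 obtains t where "T / 2 \<le> t" "t \<le> T" "T / 2 * (N1 t)^2 \<le> (LBINT t:{0<..<T}. (N1 t)^2 + (N2 t)^2)"
proof -
 have "continuous_on {T / 2..T} (\<lambda>t. (N1 t)^2)" using T by (intro continuous_intros continuous_on_subset[OF c(1)]) auto
 then obtain t where t: "t \<in> {T / 2..T}" "\<And>r. r \<in> {T / 2..T} \<Longrightarrow> (N1 t)^2 \<le> (N1 r)^2"
  using continuous_attains_inf[of "{T / 2..T}" "\<lambda>t. (N1 t)^2"] T by auto
 have i0: "set_integrable lborel {0..T} (\<lambda>t. (N1 t)^2 + (N2 t)^2)"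
  by (rule borel_integrable_atLeastAtMost') (intro continuous_intros c)
 have i1: "set_integrable lborel {0<..<T} (\<lambda>t. (N1 t)^2 + (N2 t)^2)" by (rule set_integrable_subset[OF i0]) auto
 have ic: "integrable lborel (\<lambda>r. indicator {T / 2<..<T} r *\<^sub>R (N1 t)^2)"
  using T by (intro integrable_scaleR_left) (simp add: integrable_indicator_iff)
 have "(LBINT r. indicator {T / 2<..<T} r *\<^sub>R (N1 t)^2) \<le> (LBINT r. indicator {0<..<T} r *\<^sub>R ((N1 r)^2 + (N2 r)^2))"
 proof (rule integral_mono[OF ic i1[unfolded set_integrable_def]])
  fix r
  show "indicator {T / 2<..<T} r *\<^sub>R (N1 t)^2 \<le> indicator {0<..<T} r *\<^sub>R ((N1 r)^2 + (N2 r)^2)"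
  proof (cases "r \<in> {T / 2<..<T}")
   case True
   then have "(N1 t)^2 \<le> (N1 r)^2 + (N2 r)^2" using t(2)[of r] by (simp add: add_increasing2)
   then show ?thesis using True T by simp
  qed simp
 qed
 moreover have "(LBINT r. indicator {T / 2<..<T} r *\<^sub>R (N1 t)^2) = T / 2 * (N1 t)^2"
  using T by simp
 ultimately show ?thesis using t(1) that[of t] by (simp add: set_lebesgue_integral_def)
qed

text \<open>The indicator of \<open>\<omega>\<close> equals a Borel function \<open>p\<close> almost
  everywhere, and the level set of \<open>p\<close> at \<open>1\<close> serves as \<open>W\<close>.
  The thickness condition is rewritten as a nonnegative integral over a fixed box, the form that
  translations and Fubini's theorem handle.\<close>

lemma thick_Borel:
 fixes \<omega> :: "(real^'n) set"
 assumes "thick \<omega>"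
 obtains W l and a :: "real^'n" where "W \<in> sets borel" "AE x in lborel. x \<in> \<omega> \<longleftrightarrow> x \<in> W" "\<And>i. 0 < a $ i" "0 < l" "l \<le> 1"
  "\<And>x. ennreal (l * (\<Prod>i\<in>UNIV. a $ i)) \<le> (NN y. indicator (cbox 0 a) y * indicator W (x + y))"
proof -
 obtain l a where \<omega>: "\<omega> \<in> sets lebesgue" and l: "0 < l" "l \<le> 1" and a: "\<And>i. 0 < a $ i"
  and m: "\<And>x. l * (\<Prod>i\<in>UNIV. a $ i) \<le> measure lebesgue (\<omega> \<inter> (+) x ` cbox 0 a)"
  using assms unfolding thick_def by blast
 have "(indicator \<omega> :: real^'n \<Rightarrow> real) \<in> borel_measurable lebesgue" using \<omega> by simp
 then obtain p where p: "p \<in> borel_measurable lborel" "AE x in lborel. (indicator \<omega> x :: real) = p x"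
  using completion_ex_borel_measurable_real by blast
 define W where "W = {x. p x = 1}"
 have W: "W \<in> sets borel" unfolding W_def using p(1) by simp
 have ae: "AE x in lborel. x \<in> \<omega> \<longleftrightarrow> x \<in> W" using p(2) by eventually_elim (auto simp: W_def indicator_def split: if_splits)
 show ?thesis
 proof (rule that[OF W ae a l])
  fix x :: "real^'n"
  define F where "F z = indicator (cbox 0 a) (z - x) * (indicator W z :: ennreal)" for z
  have Fm: "F \<in> borel_measurable borel" unfolding F_def[abs_def] using W by measurable
  have "ennreal (l * (\<Prod>i\<in>UNIV. a $ i)) \<le> ennreal (measure lebesgue (\<omega> \<inter> (+) x ` cbox 0 a))" by (intro ennreal_leI m)
  \<comment> \<open>An infinite measure is read as \<open>0\<close> by \<open>measure\<close>, so
    the inequality holds without an argument for finiteness.\<close>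
  also have "\<dots> \<le> emeasure lebesgue (\<omega> \<inter> (+) x ` cbox 0 a)" by (simp add: measure_def ennreal_enn2real_if)
  also have "\<dots> = (\<integral>\<^sup>+z. indicator (\<omega> \<inter> (+) x ` cbox 0 a) z \<partial>lebesgue)"
  proof -
   have "(+) x ` cbox 0 a = cbox x (x + a)" using cbox_translation[of x 0 a] by simp
   then have "(+) x ` cbox 0 a \<in> sets lebesgue" by simp
   then show ?thesis using \<omega> by (intro nn_integral_indicator[symmetric]) auto
  qed
  also have "\<dots> = (NN z. indicator (\<omega> \<inter> (+) x ` cbox 0 a) z)" by (rule nn_integral_completion)
  also have "\<dots> = (NN z. F z)"
  proof (rule nn_integral_cong_AE)
   show "AE z in lborel. indicator (\<omega> \<inter> (+) x ` cbox 0 a) z = F z"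
    using ae
   proof eventually_elim
    case (elim z)
    have "z \<in> (+) x ` cbox 0 a \<longleftrightarrow> z - x \<in> cbox 0 a" by (force simp: image_iff)
    with elim show ?case by (auto simp: F_def indicator_def)
   qed
  qed
  also have "\<dots> = (NN y. F (x + y))" by (rule nn_integral_lborel_translation[OF Fm, symmetric])
  finally show "ennreal (l * (\<Prod>i\<in>UNIV. a $ i)) \<le> (NN y. indicator (cbox 0 a) y * indicator W (x + y))" by (simp add: F_def)
 qed
qed

theorem theorem4p2:
 fixes Q B :: "real^'n^'n" and s T M :: real and \<omega> :: "(real^'n) set"
 assumes "symmetric_posdef Q" and "B \<noteq> 0" and "T > 0" and "M > 0"
  and "s > 1 / 2" and "thick \<omega>"
 shows "\<exists>C C1 \<delta>. C > 0 \<and> C1 > 0 \<and> \<delta> > 0 \<and> C1 * \<delta> < 1 \<and>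
  (\<forall>u0 \<in> OU_domain Q B s. OU_graph_norm Q B s u0 \<le> M \<longrightarrow>
   (let h = H1_norm T \<omega> (\<lambda>t. OU_semigroup Q B s t u0) in
    h \<le> \<delta> \<longrightarrow>
    L2_norm_on UNIV u0 \<le> (if h = 0 then 0 else - C / ln (C1 * h))))"
proof -
 interpret frac_OU Q B s by unfold_locales (use assms in auto)
 note T = \<open>T > 0\<close> and M = \<open>M > 0\<close>
 have \<omega>: "\<omega> \<in> sets lebesgue" using \<open>thick \<omega>\<close> by (simp add: thick_def)
 obtain W l a where W: "W \<in> sets borel" "AE x in lborel. x \<in> \<omega> \<longleftrightarrow> x \<in> W" and al: "\<And>i. 0 < a $ i" "0 < l" "l \<le> 1"
  and th: "\<And>x. ennreal (l * (\<Prod>i\<in>UNIV. a $ i)) \<le> (NN y. indicator (cbox 0 a) y * indicator W (x + y))"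
  by (rule thick_Borel[OF \<open>thick \<omega>\<close>]) blast
 obtain C C' where C: "C > 0" "C' > 0" "\<And>u g f k t v X. FT u g \<Longrightarrow> FT f k \<Longrightarrow> weak_image u g f \<Longrightarrow> nrm u \<le> M \<Longrightarrow> nrm f \<le> M \<Longrightarrow>
   T / 2 \<le> t \<Longrightarrow> t \<le> T \<Longrightarrow> FT v (evo t g) \<Longrightarrow> 1 \<le> X \<Longrightarrow>
   nrm u \<le> C / X + C * exp (C' * X) * nrm (\<lambda>x. indicator W x * v x)"
  by (rule interpolated_observability[OF W(1) al th T M]) blast
 \<comment> \<open>The mean value argument gives \<open>T / 2 * (N1 t)^2 \<le> h^2\<close>, that is
   \<open>N1 t \<le> r * h\<close>.\<close>
 define r where "r = sqrt (2 / T)"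
 have r: "r > 0" using T by (simp add: r_def)
 have Cr: "C + C * r > 0" using C(1) r by (simp add: add_pos_pos)
 obtain C2 \<delta> where C2: "C2 > 0" "0 < \<delta>" "\<delta> < 1"
  "\<And>n h. 0 \<le> h \<Longrightarrow> h \<le> \<delta> \<Longrightarrow> (\<And>X. 1 \<le> X \<Longrightarrow> n \<le> (C + C * r) / X + (C + C * r) * exp (C' * X) * h) \<Longrightarrow> n \<le> (if h = 0 then 0 else - C2 / ln h)"
  using logarithmic_optimization[OF Cr C(2)] by metis
 have main: "L2_norm_on UNIV u0 \<le> (if h = 0 then 0 else - C2 / ln h)"
  if u0: "u0 \<in> OU_domain Q B s" and gn: "OU_graph_norm Q B s u0 \<le> M"
   and h: "h = H1_norm T \<omega> (\<lambda>t. OU_semigroup Q B s t u0)" and h\<delta>: "h \<le> \<delta>" for u0 h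
 proof -
  define f where "f = OU_op Q B s u0"
  have "\<exists>f. is_OU_image Q B s u0 f" using u0 by (simp add: OU_domain_def)
  then have im: "is_OU_image Q B s u0 f" unfolding f_def OU_op_def by (rule someI_ex)
  have uL: "u0 \<in> L2 UNIV" and fL: "f \<in> L2 UNIV" using u0 im by (auto simp: OU_domain_def is_OU_image_def)
  obtain u' where u': "represents UNIV u0 u'" "sqi u'" using represents_L2[OF uL] .
  obtain f' where f': "represents UNIV f f'" "sqi f'" using represents_L2[OF fL] .
  obtain g where g: "FT u' g" using FT_exists[OF u'(2)] by blast
  obtain k where k: "FT f' k" using FT_exists[OF f'(2)] by blast
  have weak: "weak_image u' g f'" by (rule OU_image_weak[OF u'(1) g f'(1) im])
  have un: "L2_norm_on UNIV u0 = nrm u'" and fn: "L2_norm_on UNIV f = nrm f'"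
   by (rule represents_norm(1)[OF u'(1)] represents_norm(1)[OF f'(1)])+
  have sum: "nrm u' + nrm f' \<le> M" using gn unfolding OU_graph_norm_def f_def[symmetric] un fn .
  have uM: "nrm u' \<le> M" using sum nrm_nonneg[of lborel f'] by linarith
  have fM: "nrm f' \<le> M" using sum nrm_nonneg[of lborel u'] by linarith
  obtain v where v: "\<And>t. 0 \<le> t \<Longrightarrow> FT (v t) (evo t g) \<and> represents UNIV (OU_semigroup Q B s t u0) (v t)"
   using OU_semigroup_represents[OF u'(1) g] by metis
  obtain w where w: "\<And>t. FT (w t) (evo t k)"
   using FT_surj[OF evo_sqi[OF FT_sqi(2)[OF k]]] by metis
  define N1 where "N1 t = nrm (\<lambda>x. indicator W x * v t x)" for t
  define N2 where "N2 t = nrm (\<lambda>x. indicator W x * w t x)" for t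
  have c1: "continuous_on {0..T} N1"
  proof (rule continuous_on_subset)
   show "continuous_on {0..} N1" unfolding N1_def[abs_def] by (rule nrm_FT_evo_continuous[OF _ W(1)]) (use v in blast)
  qed auto
  have c2: "continuous_on {0..T} N2"
  proof (rule continuous_on_subset)
   show "continuous_on {0..} N2" unfolding N2_def[abs_def] by (rule nrm_FT_evo_continuous[OF w W(1)])
  qed auto
  obtain t where t: "T / 2 \<le> t" "t \<le> T" "T / 2 * (N1 t)^2 \<le> (LBINT t:{0<..<T}. (N1 t)^2 + (N2 t)^2)"
   by (rule mean_value_lower_bound[OF T c1 c2]) blast
  \<comment> \<open>The functions chosen by \<open>SOME\<close> disappear here. The open interval
    matters: at \<open>t = 0\<close> the two-sided difference quotient would involve negative
    times.\<close>
  have "(LBINT t:{0<..<T}. (L2_norm_on \<omega> (OU_semigroup Q B s t u0))^2 + (L2_norm_on \<omega> (L2_time_deriv \<omega> (\<lambda>t. OU_semigroup Q B s t u0) t))^2)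
    = (LBINT t:{0<..<T}. (N1 t)^2 + (N2 t)^2)"
  proof (rule set_lebesgue_integral_cong, simp, intro allI impI)
   fix t assume t: "t \<in> {0<..<T}"
   have "represents \<omega> (OU_semigroup Q B s t u0) (\<lambda>x. indicator W x * v t x)"
    using v[of t] t by (intro represents_restrict \<omega> W) auto
   from represents_norm(1)[OF this] represents_norm(1)[OF time_deriv_represents[OF u'(1) g k weak v w _ \<omega> W, of t]] t
   show "(L2_norm_on \<omega> (OU_semigroup Q B s t u0))^2 + (L2_norm_on \<omega> (L2_time_deriv \<omega> (\<lambda>t. OU_semigroup Q B s t u0) t))^2 = (N1 t)^2 + (N2 t)^2"
    by (simp add: N1_def N2_def)
  qed
  then have hs: "h = sqrt (LBINT t:{0<..<T}. (N1 t)^2 + (N2 t)^2)" unfolding h H1_norm_def by (rule arg_cong)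
  have I0: "0 \<le> (LBINT t:{0<..<T}. (N1 t)^2 + (N2 t)^2)"
   by (rule order_trans[OF _ t(3)]) (use T in simp)
  have h0: "0 \<le> h" unfolding hs using I0 by simp
  have "T / 2 * (N1 t)^2 \<le> h^2" using t(3) I0 by (simp add: hs)
  then have "(N1 t)^2 \<le> 2 / T * h^2" using T by (simp add: field_simps)
  also have "2 / T * h^2 = (r * h)^2" using T by (simp add: r_def power_mult_distrib)
  finally have N1h: "N1 t \<le> r * h" by (rule power2_le_imp_le) (use r h0 in simp)
  have vt: "FT (v t) (evo t g)" using v[of t] t(1) T by simp
  show ?thesis unfolding un
  proof (rule C2(4)[OF h0 h\<delta>])
   fix X :: real assume X: "1 \<le> X"
   have "nrm u' \<le> C / X + C * exp (C' * X) * N1 t"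
    unfolding N1_def by (rule C(3)[OF g k weak uM fM t(1,2) vt X])
   also have "\<dots> \<le> (C + C * r) / X + C * exp (C' * X) * (r * h)"
    using C(1) r X N1h by (intro add_mono divide_right_mono mult_left_mono) auto
   also have "C * exp (C' * X) * (r * h) \<le> (C + C * r) * exp (C' * X) * h"
   proof -
    have "(C * r) * (exp (C' * X) * h) \<le> (C + C * r) * (exp (C' * X) * h)" using C(1) h0 by (intro mult_right_mono) auto
    then show ?thesis by (simp only: mult_ac)
   qed
   finally show "nrm u' \<le> (C + C * r) / X + (C + C * r) * exp (C' * X) * h" by simp
  qed
 qed
 \<comment> \<open>The threshold \<open>\<delta>\<close> is already below \<open>1\<close> and the
   logarithm is that of \<open>h\<close> itself, so \<open>C1 = 1\<close>.\<close>
 show ?thesis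
  using C2(1-3) main unfolding Let_def by (intro exI[of _ C2] exI[of _ 1] exI[of _ \<delta>]) simp
qed

end
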